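(* For any $0<c_0<1$ there exists a constant $c_1>0$, depending only on $c_0$, such that the following holds. Let $n\ge1$ and $r\ge2$ be integers, and let $Q$ be the transition matrix of the simple random walk on an $r$-regular digraph $G=(V,E)$ with $V=[n]=\{1,\dots,n\}$. Let $\sigma$ be a uniformly distributed random permutation in $\mathbb S_n$ with permutation matrix $M$, and let $P=MQ$, with eigenvalues $1=\lambda_1\ge|\lambda_2|\ge\cdots\ge|\lambda_n|$. Then, with $\rho=1/\sqrt r$ and $d=r^2$, $$\mathbb P\big(|\lambda_2|\ge(1+\varepsilon)\rho\big)\le n^{-c_0},\qquad\text{where }\varepsilon=c_1\frac{\log d}{\sqrt{\log n}}.$$
   Context: A digraph $G=(V,E)$ has vertex set $V$ and a set of oriented edges $E\subset V\times V$ (loops allowed, no multiple edges). It is $r$-regular if every vertex has exactly $r$ incoming and exactly $r$ outgoing edges. The transition matrix of the simple random walk is $Q_{xy}=\frac1r$ if $(x,y)\in E$ and $0$ otherwise. The permutation matrix of $\sigma$ is $M_{xy}=1$ if $\sigma(x)=y$ and $0$ otherwise. Eigenvalues are complex, counted with algebraic multiplicity, and ordered by non-increasing modulus. *)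

theory Defs
  imports
    "HOL-Probability.Probability"
    "HOL-Combinatorics.Permutations"
    "Jordan_Normal_Form.Char_Poly"
    "Graph_Theory.Pair_Digraph"
begin

text \<open>
  The type \<open>pair_pre_digraph\<close> represents arcs as a set of ordered pairs, so loops are
  allowed and parallel arcs are not.
\<close>

definition regular_digraph :: "nat \<Rightarrow> 'a pair_pre_digraph \<Rightarrow> bool" where
  "regular_digraph r G \<longleftrightarrow> pair_fin_digraph G \<and>
     (\<forall>v \<in> pverts G. in_degree (with_proj G) v = r \<and> out_degree (with_proj G) v = r)"

text \<open>
  Vertices and permuted points are \<open>1, \<dots>, n\<close>, whereas the rows and columns of a
  matrix are indexed by \<open>0, \<dots>, n - 1\<close>; hence the shifts by \<open>Suc\<close>.
\<close>

definition transition_mat :: "nat \<Rightarrow> nat \<Rightarrow> nat pair_pre_digraph \<Rightarrow> complex mat" where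
  "transition_mat n r G =
     mat n n (\<lambda>(x, y). if (Suc x, Suc y) \<in> parcs G then 1 / of_nat r else 0)"

definition permutation_mat :: "nat \<Rightarrow> (nat \<Rightarrow> nat) \<Rightarrow> complex mat" where
  "permutation_mat n \<sigma> = mat n n (\<lambda>(x, y). if \<sigma> (Suc x) = Suc y then 1 else 0)"

text \<open>
  The order among eigenvalues of equal modulus is left unspecified; the modulus of the
  \<open>k\<close>-th eigenvalue does not depend on it.
\<close>

definition ordered_eigenvalues :: "complex mat \<Rightarrow> complex list" where
  "ordered_eigenvalues A =
     (SOME zs. mset zs = proots (char_poly A) \<and> sorted_wrt (\<lambda>z w. cmod z \<ge> cmod w) zs)"

definition nth_eigenvalue :: "complex mat \<Rightarrow> nat \<Rightarrow> complex" where
  "nth_eigenvalue A k = ordered_eigenvalues A ! (k - 1)"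

lemma ordered_eigenvalues:
  "mset (ordered_eigenvalues A) = proots (char_poly A)"
  "sorted_wrt (\<lambda>z w. cmod z \<ge> cmod w) (ordered_eigenvalues A)"
proof -
  obtain xs where xs: "mset xs = proots (char_poly A)"
    using ex_mset by blast
  define zs where "zs = sort_key (\<lambda>z. - cmod z) xs"
  have "sorted (map (\<lambda>z. - cmod z) zs)"
    by (simp add: zs_def)
  then have "sorted_wrt (\<lambda>z w. cmod z \<ge> cmod w) zs"
    by (simp add: sorted_wrt_map)
  moreover have "mset zs = proots (char_poly A)"
    by (simp add: zs_def xs)
  ultimately have "\<exists>zs. mset zs = proots (char_poly A) \<and>
      sorted_wrt (\<lambda>z w. cmod z \<ge> cmod w) zs"
    by blast
  from someI_ex[OF this, folded ordered_eigenvalues_def]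
  show "mset (ordered_eigenvalues A) = proots (char_poly A)"
    and "sorted_wrt (\<lambda>z w. cmod z \<ge> cmod w) (ordered_eigenvalues A)"
    by auto
qed

end

theory Submission
  imports Defs "HOL-Real_Asymp.Real_Asymp"
begin

text \<open>
  Let \<open>B = P - J / n\<close> with \<open>J\<close> the all-ones matrix. Passing from \<open>P\<close> to \<open>B\<close> replaces one
  eigenvalue \<open>1\<close> by \<open>0\<close>, so \<open>|\<lambda>\<^sub>2|\<close> is at most the spectral radius of \<open>B\<close>. Split
  \<open>B\<^sup>l = Y + Z\<close>, where \<open>Y\<close> collects the tame paths, those which at most once leave a vertex
  already visited by another way than after the first visit. The sum of the absolute weights
  of the other paths is small on average, since each of them closes two independent cycles.
  The trace of \<open>(Y\<^sup>T Y)\<^sup>m\<close> is expanded over closed walks made of \<open>2 m\<close> blocks.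

  For one such walk the average over the permutation is a sum over injections of a product of
  factors with mean zero; hence a point visited only once must be merged with another one. Each
  way of merging, together with the set of moves at which \<open>1 / n\<close> is used in place of the
  transition probability (the jumps), gives a graph. Its homomorphisms into \<open>G\<close> number at most
  \<open>n\<close> to the number of components times \<open>r\<close> to the number of the remaining nodes. The excess, a
  cyclomatic number, thus costs a factor \<open>r / n\<close> per unit, whereas a tame walk is determined by
  few exceptional times once the excess is given. With \<open>l\<close> of order \<open>log n / log r\<close> and \<open>m\<close> of
  order \<open>sqrt (log n)\<close> this suffices for \<open>r \<le> exp (sqrt (log n))\<close>. For larger \<open>r\<close> the factor
  \<open>1 + \<epsilon>\<close> is bounded below by a large constant, and \<open>m = 1\<close>, \<open>l\<close> of order \<open>log n\<close>, all paths
  counted as tame and cruder counts of the walks are enough.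
\<close>

section \<open>Components of a graph and homomorphisms\<close>

text \<open>The trace bound costs a factor n^(1 / (2 m l)) per step. For \<open>l\<close> of order
  log n / log r and \<open>m\<close> of order sqrt (log n) this is 1 + O(log r / sqrt (log n)), the
  origin of \<open>\<epsilon>\<close>. The obstacle to a growing \<open>m\<close> is that the mean
  of a high moment can be ruined by permutations of probability about 1 / n which create two cycles
  close together; therefore the wild paths are removed before moments are taken. If r^l is at most
  n^a, their own mean has order 1 / n up to n^(O(a)), and relative to the l-th power of
  \<open>\<rho>\<close> it must stay below the required probability: this fixes
  \<open>a = (1 - c\<^sub>0) / 8\<close>. From above, \<open>m\<close> is limited by the description
  of the walks: a unit of excess costs N^(O(m)) codes, to be less than n / r, and the subsets stored
  for the blocks cost exp (O(m^2)). The square root in \<open>\<rho>\<close> reflects the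
  cancellation: an image contributes only if it serves two moves, so it is freely chosen for at most
  half of them. For the remaining, bounded \<open>n\<close> the threshold exceeds 1 and hence every
  eigenvalue.\<close>

definition edge_comp :: "('a \<times> 'a) set \<Rightarrow> 'a \<Rightarrow> 'a set" where
  "edge_comp H u = (H \<union> H\<inverse>)\<^sup>* `` {u}"

text \<open>Components are taken in the whole type, so a node without edges is a component of its
  own; only those meeting \<open>N\<close> are counted.\<close>

definition ncomp :: "'a set \<Rightarrow> ('a \<times> 'a) set \<Rightarrow> nat" where
  "ncomp N H = card (edge_comp H ` N)"

lemma edge_comp_refl [simp]: "u \<in> edge_comp H u"
  by (simp add: edge_comp_def)

lemma edge_comp_eqI: "w \<in> edge_comp H u \<Longrightarrow> edge_comp H u = edge_comp H w"
proof -
  assume "w \<in> edge_comp H u"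
  hence 1: "(u, w) \<in> (H \<union> H\<inverse>)\<^sup>*" by (simp add: edge_comp_def)
  have "sym (H \<union> H\<inverse>)" by (auto simp: sym_def)
  hence "sym ((H \<union> H\<inverse>)\<^sup>*)" by (rule sym_rtrancl)
  with 1 have 2: "(w, u) \<in> (H \<union> H\<inverse>)\<^sup>*" by (meson symD)
  show ?thesis
    unfolding edge_comp_def using rtrancl_trans[OF 1] rtrancl_trans[OF 2] by auto
qed

lemma edge_comp_eq_iff: "edge_comp H u = edge_comp H w \<longleftrightarrow> w \<in> edge_comp H u"
  by (metis edge_comp_eqI edge_comp_refl)

lemma edge_comp_edge: "(u, w) \<in> H \<Longrightarrow> edge_comp H u = edge_comp H w"
  by (rule edge_comp_eqI) (auto simp: edge_comp_def)

lemma edge_comp_mono: "H \<subseteq> H' \<Longrightarrow> edge_comp H u \<subseteq> edge_comp H' u"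
  unfolding edge_comp_def by (intro Image_mono rtrancl_mono) auto

lemma edge_comp_eq_mono: "H \<subseteq> H' \<Longrightarrow> edge_comp H u = edge_comp H w \<Longrightarrow> edge_comp H' u = edge_comp H' w"
  using edge_comp_mono edge_comp_eq_iff by (metis subsetD)

lemma edge_comp_closed:
  assumes "w \<in> edge_comp H u" "u \<in> C" "\<And>x y. (x, y) \<in> H \<Longrightarrow> x \<in> C \<longleftrightarrow> y \<in> C"
  shows "w \<in> C"
proof -
  have "(u, w) \<in> (H \<union> H\<inverse>)\<^sup>*" using assms by (simp add: edge_comp_def)
  thus ?thesis
    by (induction rule: rtrancl_induct) (use assms in auto)
qed

lemma edge_comp_isolated:
  assumes "\<And>x y. (x, y) \<in> H \<Longrightarrow> x \<noteq> u \<and> y \<noteq> u"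
  shows "edge_comp H u = {u}"
  using edge_comp_closed[of _ H u "{u}"] assms by (auto simp: set_eq_iff)

lemma edge_comp_insert:
  "edge_comp (insert (a, b) H) u =
     (if edge_comp H u = edge_comp H a \<or> edge_comp H u = edge_comp H b then edge_comp H a \<union> edge_comp H b else edge_comp H u)"
proof -
  let ?H = "insert (a, b) H"
  have le: "edge_comp ?H u \<subseteq> (if edge_comp H u = edge_comp H a \<or> edge_comp H u = edge_comp H b
      then edge_comp H a \<union> edge_comp H b else edge_comp H u)" (is "_ \<subseteq> ?C")
  proof
    fix w assume w: "w \<in> edge_comp ?H u"
    show "w \<in> ?C"
    proof (rule edge_comp_closed[OF w])
      show "u \<in> ?C" by (metis UnI1 UnI2 edge_comp_refl)
    next
      fix x y assume "(x, y) \<in> ?H"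
      hence "x = a \<and> y = b \<or> edge_comp H x = edge_comp H y" using edge_comp_edge by fastforce
      thus "x \<in> ?C \<longleftrightarrow> y \<in> ?C"
        by (metis (no_types, lifting) UnCI Un_iff edge_comp_eq_iff)
    qed
  qed
  have sub: "edge_comp H x \<subseteq> edge_comp ?H x" for x by (rule edge_comp_mono) auto
  have ab: "edge_comp ?H a = edge_comp ?H b" by (rule edge_comp_edge) auto
  have ge: "?C \<subseteq> edge_comp ?H u"
  proof (cases "edge_comp H u = edge_comp H a \<or> edge_comp H u = edge_comp H b")
    case True
    hence "edge_comp ?H u = edge_comp ?H a"
      using ab edge_comp_eq_mono[of H ?H] by (metis subset_insertI)
    with True show ?thesis using sub[of a] sub[of b] ab by auto
  next
    case False thus ?thesis using sub by auto
  qed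
  from le ge show ?thesis by (rule subset_antisym)
qed

text \<open>Only the components of \<open>a\<close> and \<open>b\<close> change, and their union was
  not a component before, so two are replaced by one.\<close>

lemma ncomp_insert:
  assumes fin: "finite N" and a: "a \<in> N" and b: "b \<in> N" and ne: "edge_comp H a \<noteq> edge_comp H b"
  shows "ncomp N H = Suc (ncomp N (insert (a, b) H))"
proof -
  let ?A = "edge_comp H ` N" and ?a = "edge_comp H a" and ?b = "edge_comp H b"
  have eq: "edge_comp (insert (a, b) H) ` N = insert (?a \<union> ?b) (?A - {?a, ?b})"
  proof (intro equalityI subsetI)
    fix C assume "C \<in> edge_comp (insert (a, b) H) ` N"
    thus "C \<in> insert (?a \<union> ?b) (?A - {?a, ?b})"
      by (auto simp: edge_comp_insert split: if_splits)
  next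
    fix C assume C: "C \<in> insert (?a \<union> ?b) (?A - {?a, ?b})"
    show "C \<in> edge_comp (insert (a, b) H) ` N"
    proof (cases "C = ?a \<union> ?b")
      case True
      hence "C = edge_comp (insert (a, b) H) a" by (simp add: edge_comp_insert)
      thus ?thesis using a by auto
    next
      case False
      then obtain u where u: "u \<in> N" "C = edge_comp H u" "C \<noteq> ?a" "C \<noteq> ?b" using C by auto
      hence "C = edge_comp (insert (a, b) H) u" by (simp add: edge_comp_insert)
      thus ?thesis using u by auto
    qed
  qed
  have notin: "?a \<union> ?b \<notin> ?A - {?a, ?b}"
  proof
    assume "?a \<union> ?b \<in> ?A - {?a, ?b}"
    then obtain u where "?a \<union> ?b = edge_comp H u" by auto
    hence "a \<in> edge_comp H u" "b \<in> edge_comp H u" using edge_comp_refl by (metis UnI1 UnI2)+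
    hence "edge_comp H u = ?a" "edge_comp H u = ?b" using edge_comp_eqI by metis+
    thus False using ne by simp
  qed
  have "card (?A - {?a, ?b}) = card ?A - card {?a, ?b}"
    using a b fin by (intro card_Diff_subset) auto
  moreover have "card {?a, ?b} = 2" using ne by simp
  moreover have "card {?a, ?b} \<le> card ?A" using a b fin by (intro card_mono) auto
  ultimately show ?thesis
    unfolding ncomp_def eq using notin fin by (simp add: card_insert_if)
qed

lemma ncomp_insert_same:
  assumes "edge_comp H a = edge_comp H b"
  shows "ncomp N (insert (a, b) H) = ncomp N H"
proof -
  have "edge_comp (insert (a, b) H) u = edge_comp H u" for u
    using assms by (auto simp: edge_comp_insert)
  thus ?thesis by (simp add: ncomp_def)
qed

lemma ncomp_insert_le: "finite N \<Longrightarrow> a \<in> N \<Longrightarrow> b \<in> N \<Longrightarrow>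
    ncomp N H \<le> Suc (ncomp N (insert (a, b) H))"
  using ncomp_insert ncomp_insert_same by (metis le_Suc_eq order_refl)

lemma ncomp_Un_le:
  assumes "finite N" "finite D" "D \<subseteq> N \<times> N"
  shows "ncomp N H \<le> ncomp N (H \<union> D) + card D"
  using assms(2,3)
proof (induction D rule: finite_induct)
  case (insert e D)
  obtain a b where e: "e = (a, b)" by force
  have "ncomp N (H \<union> D) \<le> Suc (ncomp N (insert (a, b) (H \<union> D)))"
    by (rule ncomp_insert_le) (use insert e assms in auto)
  with insert e show ?case by simp
qed simp

lemma ncomp_le_card: "finite N \<Longrightarrow> ncomp N H \<le> card N"
  unfolding ncomp_def by (rule card_image_le)

lemma ncomp_empty: "ncomp N {} = card N"
proof -
  have "edge_comp {} u = {u}" for u :: 'a by (rule edge_comp_isolated) auto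
  thus ?thesis unfolding ncomp_def by (simp add: card_image)
qed

text \<open>A value taken once uses one element, any other value at least two, all of them
  colliding. So twice the number of values is at most the number of colliding elements plus twice
  the number of the others. This turns a count of classes into a bound for the elements that share a
  class.\<close>

lemma card_colliding_le:
  assumes "finite X"
  shows "card {x \<in> X. \<exists>x' \<in> X. x' \<noteq> x \<and> c x' = c x} + 2 * card (c ` X) \<le> 2 * card X"
proof -
  define S where "S = {x \<in> X. \<exists>x' \<in> X. x' \<noteq> x \<and> c x' = c x}"
  have fin: "finite S" "finite (X - S)" using assms by (auto simp: S_def)
  have "card (c ` X) \<le> card (c ` S) + card (c ` (X - S))"
    by (rule order_trans[OF card_mono card_Un_le])
      (use assms in \<open>auto simp: S_def\<close>)
  moreover have "card (c ` (X - S)) \<le> card (X - S)" using fin by (intro card_image_le)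
  moreover have "card X = card S + card (X - S)"
  proof -
    have "card (S \<union> (X - S)) = card S + card (X - S)" using fin by (intro card_Un_disjoint) auto
    moreover have "S \<union> (X - S) = X" by (auto simp: S_def)
    ultimately show ?thesis by simp
  qed
  moreover have "2 * card (c ` S) \<le> card S"
  proof -
    have "2 * card (c ` S) = (\<Sum>y\<in>c ` S. 2)" by simp
    also have "\<dots> \<le> (\<Sum>y\<in>c ` S. card {x \<in> S. c x = y})"
    proof (rule sum_mono)
      fix y assume "y \<in> c ` S"
      then obtain x x' where x: "x \<in> S" "x' \<in> X" "x' \<noteq> x" "c x' = c x" "y = c x"
        by (auto simp: S_def)
      hence "x' \<in> S" by (auto simp: S_def)
      hence "{x, x'} \<subseteq> {x \<in> S. c x = y}" using x by auto
      hence "card {x, x'} \<le> card {x \<in> S. c x = y}" using fin by (intro card_mono) auto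
      thus "2 \<le> card {x \<in> S. c x = y}" using x by simp
    qed
    also have "\<dots> = card S"
    proof -
      have "(\<Sum>y\<in>c ` S. \<Sum>x | x \<in> S \<and> c x = y. (1::nat)) = (\<Sum>x\<in>S. 1)"
        by (rule sum.image_gen[symmetric]) (rule fin)
      thus ?thesis by simp
    qed
    finally show ?thesis .
  qed
  ultimately show ?thesis unfolding S_def by linarith
qed

text \<open>The nodes are placed one by one, next to a node already placed as long as that is
  possible. Such a node has at most \<open>r\<close> choices; otherwise a new component is opened,
  at the cost of \<open>card V\<close>.\<close>

lemma card_hom_le:
  fixes E :: "('b \<times> 'b) set" and H :: "('a \<times> 'a) set"
  assumes N: "finite N" "H \<subseteq> N \<times> N" and V: "finite V"
    and out: "\<And>y. y \<in> V \<Longrightarrow> card {x \<in> V. (y, x) \<in> E} \<le> r"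
    and inn: "\<And>x. x \<in> V \<Longrightarrow> card {y \<in> V. (y, x) \<in> E} \<le> r"
  shows "card {\<phi> \<in> N \<rightarrow>\<^sub>E V. \<forall>(a, b)\<in>H. (\<phi> a, \<phi> b) \<in> E}
     \<le> card V ^ ncomp N H * r ^ (card N - ncomp N H)"
proof -
  define M where "M S = {\<phi> \<in> S \<rightarrow>\<^sub>E V. \<forall>(a, b)\<in>H. a \<in> S \<longrightarrow> b \<in> S \<longrightarrow> (\<phi> a, \<phi> b) \<in> E}" for S
  define k where "k S = card (edge_comp H ` S)" for S :: "'a set"
  \<comment> \<open>The bound for the nodes placed so far. It is kept along a suitable order only: a
    set that leaves gaps in a component need not satisfy it.\<close>
  define P where "P S \<longleftrightarrow> S \<subseteq> N \<and> card (M S) \<le> card V ^ k S * r ^ (card S - k S)" for S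
  have finM: "finite (M S)" if "S \<subseteq> N" for S
  proof -
    have "finite (S \<rightarrow>\<^sub>E V)" using that N V by (intro finite_PiE) (auto intro: finite_subset)
    thus ?thesis unfolding M_def by simp
  qed
  have step: "card (M (insert v S)) \<le> card (M S) * c"
    if S: "S \<subseteq> N" "v \<in> N" "v \<notin> S"
      and c: "\<And>\<phi>. \<phi> \<in> M S \<Longrightarrow> \<exists>B. finite B \<and> card B \<le> c \<and>
          (\<forall>\<phi>'\<in>M (insert v S). restrict \<phi>' S = \<phi> \<longrightarrow> \<phi>' v \<in> B)" for v S c
  proof -
    from c obtain B where B: "\<And>\<phi>. \<phi> \<in> M S \<Longrightarrow> finite (B \<phi>) \<and> card (B \<phi>) \<le> c \<and>
          (\<forall>\<phi>'\<in>M (insert v S). restrict \<phi>' S = \<phi> \<longrightarrow> \<phi>' v \<in> B \<phi>)" by metis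
    have inM: "restrict \<phi>' S \<in> M S" if "\<phi>' \<in> M (insert v S)" for \<phi>'
      using that by (auto simp: M_def)
    have "card (M (insert v S)) \<le> card (Sigma (M S) B)"
    proof (rule card_inj_on_le[where f = "\<lambda>\<phi>'. (restrict \<phi>' S, \<phi>' v)"])
      show "inj_on (\<lambda>\<phi>'. (restrict \<phi>' S, \<phi>' v)) (M (insert v S))"
      proof (rule inj_onI)
        fix f g assume fg: "f \<in> M (insert v S)" "g \<in> M (insert v S)"
          "(restrict f S, f v) = (restrict g S, g v)"
        show "f = g"
        proof (rule PiE_ext)
          show "f \<in> insert v S \<rightarrow>\<^sub>E V" "g \<in> insert v S \<rightarrow>\<^sub>E V" using fg by (auto simp: M_def)
          fix x assume "x \<in> insert v S"
          thus "f x = g x" using fg(3) by (metis insertE prod.inject restrict_apply')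
        qed
      qed
      show "(\<lambda>\<phi>'. (restrict \<phi>' S, \<phi>' v)) ` M (insert v S) \<subseteq> Sigma (M S) B"
        using inM B by auto
      show "finite (Sigma (M S) B)" using finM[OF S(1)] B by (intro finite_SigmaI) auto
    qed
    also have "\<dots> = (\<Sum>\<phi>\<in>M S. card (B \<phi>))" using finM[OF S(1)] B by (intro card_SigmaI) auto
    also have "\<dots> \<le> (\<Sum>\<phi>\<in>M S. c)" using B by (intro sum_mono) auto
    finally show ?thesis by simp
  qed
  have ext: "\<exists>v\<in>N - S. P (insert v S)" if S: "P S" "S \<noteq> N" for S
  proof -
    have SN: "S \<subseteq> N" and cS: "card (M S) \<le> card V ^ k S * r ^ (card S - k S)"
      using S by (auto simp: P_def)
    have finS: "finite S" using SN N finite_subset by auto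
    have kle: "k S \<le> card S" unfolding k_def by (rule card_image_le[OF finS])
    show ?thesis
    proof (cases "\<exists>v\<in>N - S. \<exists>s\<in>S. (s, v) \<in> H \<or> (v, s) \<in> H")
      case True
      then obtain v s where v: "v \<in> N - S" "s \<in> S" "(s, v) \<in> H \<or> (v, s) \<in> H" by blast
      hence same: "edge_comp H v = edge_comp H s" using edge_comp_edge by metis
      hence keq: "k (insert v S) = k S" unfolding k_def using v by (simp add: insert_absorb)
      have "card (M (insert v S)) \<le> card (M S) * r"
      proof (rule step[OF SN])
        fix \<phi> assume \<phi>: "\<phi> \<in> M S"
        hence s: "\<phi> s \<in> V" using v by (auto simp: M_def)
        show "\<exists>B. finite B \<and> card B \<le> r \<and>
            (\<forall>\<phi>'\<in>M (insert v S). restrict \<phi>' S = \<phi> \<longrightarrow> \<phi>' v \<in> B)"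
        proof (cases "(s, v) \<in> H")
          case True
          show ?thesis
          proof (intro exI[of _ "{x \<in> V. (\<phi> s, x) \<in> E}"] conjI ballI impI)
            fix \<phi>' assume a: "\<phi>' \<in> M (insert v S)" "restrict \<phi>' S = \<phi>"
            hence "\<phi>' s = \<phi> s" using v by auto
            thus "\<phi>' v \<in> {x \<in> V. (\<phi> s, x) \<in> E}" using a True v by (fastforce simp: M_def)
          qed (use V out s in auto)
        next
          case False
          hence vs: "(v, s) \<in> H" using v by auto
          show ?thesis
          proof (intro exI[of _ "{x \<in> V. (x, \<phi> s) \<in> E}"] conjI ballI impI)
            fix \<phi>' assume a: "\<phi>' \<in> M (insert v S)" "restrict \<phi>' S = \<phi>"
            hence "\<phi>' s = \<phi> s" using v by auto
            thus "\<phi>' v \<in> {x \<in> V. (x, \<phi> s) \<in> E}" using a vs v by (fastforce simp: M_def)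
          qed (use V inn s in auto)
        qed
      qed (use v in auto)
      also have "\<dots> \<le> card V ^ k S * r ^ (card S - k S) * r" using cS by simp
      also have "\<dots> = card V ^ k (insert v S) * r ^ (card (insert v S) - k (insert v S))"
        using v finS kle keq by (simp add: Suc_diff_le mult.assoc mult.commute)
      finally show ?thesis using v SN by (auto simp: P_def)
    next
      case False
      obtain v where v: "v \<in> N - S" using S SN by auto
      have nin: "edge_comp H v \<notin> edge_comp H ` S"
      proof
        assume "edge_comp H v \<in> edge_comp H ` S"
        then obtain s where s: "s \<in> S" "v \<in> edge_comp H s" using edge_comp_eq_iff by (metis imageE)
        \<comment> \<open>No edge leaves \<open>S\<close>, so a component meeting \<open>S\<close>
          lies inside it.\<close>
        have "v \<in> S"
          by (rule edge_comp_closed[OF s(2) s(1)]) (use False N(2) in auto)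
        thus False using v by auto
      qed
      have keq: "k (insert v S) = Suc (k S)" unfolding k_def using nin finS by simp
      have "card (M (insert v S)) \<le> card (M S) * card V"
        by (rule step[OF SN]) (use v V in \<open>auto intro!: exI[of _ V] simp: M_def\<close>)
      also have "\<dots> \<le> card V ^ k S * r ^ (card S - k S) * card V" using cS by simp
      also have "\<dots> = card V ^ k (insert v S) * r ^ (card (insert v S) - k (insert v S))"
        using v finS kle keq by (simp add: mult.assoc mult.commute)
      finally show ?thesis using v SN by (auto simp: P_def)
    qed
  qed
  have "\<exists>S. P S \<and> card S = i" if "i \<le> card N" for i
    using that
  proof (induction i)
    case 0
    have "P {}" by (auto simp: P_def M_def k_def)
    thus ?case by (intro exI[of _ "{}"]) auto
  next
    case (Suc i)
    then obtain S where S: "P S" "card S = i" by auto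
    hence "S \<noteq> N" using Suc by auto
    with ext S obtain v where v: "v \<in> N - S" "P (insert v S)" by blast
    have "finite S" using S N by (auto simp: P_def intro: finite_subset)
    thus ?case using v S by (intro exI[of _ "insert v S"]) auto
  qed
  from this[of "card N"] obtain S where S: "P S" "card S = card N" by auto
  hence "S = N" using N by (simp add: P_def card_subset_eq)
  with S have "card (M N) \<le> card V ^ ncomp N H * r ^ (card N - ncomp N H)"
    by (simp add: P_def k_def ncomp_def)
  moreover have "M N = {\<phi> \<in> N \<rightarrow>\<^sub>E V. \<forall>(a, b)\<in>H. (\<phi> a, \<phi> b) \<in> E}"
    using N(2) by (auto simp: M_def)
  ultimately show ?thesis by simp
qed

section \<open>Sums over injections of products with vanishing means\<close>

definition injections :: "'i set \<Rightarrow> 'b set \<Rightarrow> ('i \<Rightarrow> 'b) set" where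
  "injections X V = {y \<in> X \<rightarrow>\<^sub>E V. inj_on y X}"

lemma finite_injections [simp]: "finite X \<Longrightarrow> finite V \<Longrightarrow> finite (injections X V)"
  by (auto simp: injections_def intro: finite_subset[OF _ finite_PiE[of X "\<lambda>_. V"]])

text \<open>An idempotent map encodes a partition with a representative in each class. Points
  outside \<open>S\<close> represent themselves, and no point of \<open>S\<close> is alone in its
  class.\<close>

definition mergings :: "'i set \<Rightarrow> 'i set \<Rightarrow> ('i \<Rightarrow> 'i) set" where
  "mergings X S = {p \<in> X \<rightarrow>\<^sub>E X. (\<forall>x\<in>X. p (p x) = p x) \<and> (\<forall>x\<in>X - S. p x = x) \<and>
     (\<forall>s\<in>S. \<exists>x\<in>X. x \<noteq> s \<and> p x = p s)}"

lemma finite_mergings [simp]: "finite X \<Longrightarrow> finite (mergings X S)"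
  by (auto simp: mergings_def intro: finite_subset[OF _ finite_PiE[of X "\<lambda>_. X"]])

lemma sum_injections_insert:
  assumes X: "finite X" "s \<notin> X" and V: "finite V"
  shows "(\<Sum>y\<in>injections (insert s X) V. F (y(s := undefined)) (y s)) =
         (\<Sum>y\<in>injections X V. \<Sum>b\<in>V - y ` X. (F y b :: real))"
proof -
  have "(\<Sum>y\<in>injections X V. \<Sum>b\<in>V - y ` X. F y b) =
      (\<Sum>(y, b)\<in>Sigma (injections X V) (\<lambda>y. V - y ` X). F y b)"
    using X V by (subst sum.Sigma) auto
  also have "\<dots> = (\<Sum>y\<in>injections (insert s X) V. F (y(s := undefined)) (y s))"
  proof (rule sum.reindex_bij_witness[of _ "\<lambda>y. (y(s := undefined), y s)" "\<lambda>(y, b). y(s := b)"])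
    fix yb assume yb: "yb \<in> Sigma (injections X V) (\<lambda>y. V - y ` X)"
    obtain y b where 1: "yb = (y, b)" by force
    have y: "y \<in> X \<rightarrow>\<^sub>E V" "inj_on y X" "b \<in> V" "b \<notin> y ` X"
      using yb 1 by (auto simp: injections_def)
    have ys: "y s = undefined" using y X by (auto simp: PiE_def extensional_def)
    show "(\<lambda>y. (y(s := undefined), y s)) ((\<lambda>(y, b). y(s := b)) yb) = yb"
      using 1 ys by auto
    have "inj_on (y(s := b)) (insert s X)"
      using y X by (auto simp: inj_on_def)
    moreover have "y(s := b) \<in> insert s X \<rightarrow>\<^sub>E V"
      using y by (auto simp: PiE_def extensional_def Pi_def)
    ultimately show "(\<lambda>(y, b). y(s := b)) yb \<in> injections (insert s X) V"
      using 1 by (simp add: injections_def)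
    show "F ((case yb of (y, b) \<Rightarrow> y(s := b))(s := undefined)) ((case yb of (y, b) \<Rightarrow> y(s := b)) s)
      = (case yb of (y, b) \<Rightarrow> F y b)"
      using 1 fun_upd_triv[of y s] ys by simp
  next
    fix y assume y: "y \<in> injections (insert s X) V"
    have "y(s := undefined) \<in> X \<rightarrow>\<^sub>E V"
      using y X by (auto simp: injections_def PiE_def extensional_def)
    moreover have "inj_on (y(s := undefined)) X"
      using y X by (auto simp: injections_def inj_on_def)
    moreover have "y s \<in> V - (y(s := undefined)) ` X"
      using y X by (auto simp: injections_def inj_on_def split: if_splits)
    ultimately show "(y(s := undefined), y s) \<in> Sigma (injections X V) (\<lambda>y. V - y ` X)"
      by (auto simp: injections_def)
  qed auto
  finally show ?thesis by simp
qed

lemma prod_merge: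
  assumes "finite X" "x0 \<in> X"
  shows "(\<Prod>x\<in>X. f x (z x) * (if x = x0 then g (z x) else 1)) = (\<Prod>x\<in>X. f x (z x)) * (g (z x0) :: real)"
  using assms by (simp add: prod.distrib prod.delta)

text \<open>
  A point \<open>s\<close> of \<open>S\<close> ranges over the complement of the other values; as \<open>f s\<close> has mean zero this
  is minus the sum over these values, so \<open>s\<close> is glued to some other point. Eliminating the points
  of \<open>S\<close> one by one leaves sums over all functions.
\<close>

lemma sum_injections_le:
  fixes f :: "'i \<Rightarrow> 'b \<Rightarrow> real"
  assumes "finite X" "finite V" "S \<subseteq> X" "\<And>s. s \<in> S \<Longrightarrow> (\<Sum>b\<in>V. f s b) = 0"
  shows "\<bar>\<Sum>y\<in>injections X V. \<Prod>x\<in>X. f x (y x)\<bar>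
    \<le> (\<Sum>p\<in>mergings X S. \<Sum>y\<in>p ` X \<rightarrow>\<^sub>E V. \<Prod>x\<in>X. \<bar>f x (y (p x))\<bar>)"
  using assms
proof (induction "card X" arbitrary: X S f rule: less_induct)
  case less
  note X = less.prems(1) and V = less.prems(2) and S = less.prems(3) and z = less.prems(4)
  show ?case
  proof (cases "S = {}")
    case True
    define p where "p = restrict id X"
    have p: "p \<in> mergings X S" using True by (auto simp: mergings_def p_def)
    have pX: "p ` X = X" by (auto simp: p_def)
    have "\<bar>\<Sum>y\<in>injections X V. \<Prod>x\<in>X. f x (y x)\<bar> \<le> (\<Sum>y\<in>injections X V. \<Prod>x\<in>X. \<bar>f x (y x)\<bar>)"
      by (rule order_trans[OF sum_abs]) (simp add: abs_prod)
    also have "\<dots> \<le> (\<Sum>y\<in>X \<rightarrow>\<^sub>E V. \<Prod>x\<in>X. \<bar>f x (y x)\<bar>)"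
      using X V by (intro sum_mono2 prod_nonneg finite_PiE) (auto simp: injections_def)
    also have "\<dots> = (\<Sum>y\<in>p ` X \<rightarrow>\<^sub>E V. \<Prod>x\<in>X. \<bar>f x (y (p x))\<bar>)"
      unfolding pX by (intro sum.cong prod.cong) (auto simp: p_def)
    also have "\<dots> \<le> (\<Sum>p\<in>mergings X S. \<Sum>y\<in>p ` X \<rightarrow>\<^sub>E V. \<Prod>x\<in>X. \<bar>f x (y (p x))\<bar>)"
      using p X by (intro member_le_sum[where f = "\<lambda>p. \<Sum>y\<in>p ` X \<rightarrow>\<^sub>E V. \<Prod>x\<in>X. \<bar>f x (y (p x))\<bar>"])
        (auto intro!: sum_nonneg prod_nonneg)
    finally show ?thesis .
  next
    case False
    then obtain s where s: "s \<in> S" by auto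
    define X' where "X' = X - {s}"
    have X': "X = insert s X'" "s \<notin> X'" "finite X'" using s S X by (auto simp: X'_def)
    \<comment> \<open>Gluing \<open>s\<close> to \<open>x'\<close> multiplies the factor of
      \<open>x'\<close> by that of \<open>s\<close>. The product need not have mean zero, so
      \<open>x'\<close> leaves the set together with \<open>s\<close>; in return every later merging
      fixes \<open>x'\<close>.\<close>
    define f' where "f' x' x b = f x b * (if x = x' then f s b else 1)" for x' x b
    define S' where "S' x' = S - {s, x'}" for x'
    let ?R = "\<lambda>X f p. \<Sum>y\<in>p ` X \<rightarrow>\<^sub>E V. \<Prod>x\<in>X. \<bar>f x (y (p x))\<bar> :: real"
    have "(\<Sum>y\<in>injections X V. \<Prod>x\<in>X. f x (y x)) =
        (\<Sum>y\<in>injections (insert s X') V. (\<lambda>y b. f s b * (\<Prod>x\<in>X'. f x (y x))) (y(s := undefined)) (y s))"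
      unfolding X'(1) using X' by (intro sum.cong refl) (auto intro!: prod.cong)
    also have "\<dots> = (\<Sum>y\<in>injections X' V. \<Sum>b\<in>V - y ` X'. f s b * (\<Prod>x\<in>X'. f x (y x)))"
      by (rule sum_injections_insert[OF X'(3,2) V])
    also have "\<dots> = (\<Sum>y\<in>injections X' V. - (\<Sum>x'\<in>X'. \<Prod>x\<in>X'. f' x' x (y x)))"
    proof (rule sum.cong[OF refl])
      fix y assume y: "y \<in> injections X' V"
      hence sub: "y ` X' \<subseteq> V" and inj: "inj_on y X'" by (auto simp: injections_def)
      have "(\<Sum>b\<in>V. f s b) = (\<Sum>b\<in>V - y ` X'. f s b) + (\<Sum>b\<in>y ` X'. f s b)"
        using sub V by (rule sum.subset_diff)
      hence "(\<Sum>b\<in>V - y ` X'. f s b) = - (\<Sum>b\<in>y ` X'. f s b)" using z[OF s] by simp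
      also have "(\<Sum>b\<in>y ` X'. f s b) = (\<Sum>x'\<in>X'. f s (y x'))"
        using inj by (subst sum.reindex) auto
      finally have "(\<Sum>b\<in>V - y ` X'. f s b * (\<Prod>x\<in>X'. f x (y x))) =
          - (\<Sum>x'\<in>X'. f s (y x')) * (\<Prod>x\<in>X'. f x (y x))"
        by (simp add: sum_distrib_right[symmetric])
      also have "\<dots> = - (\<Sum>x'\<in>X'. \<Prod>x\<in>X'. f' x' x (y x))"
        unfolding f'_def using X'(3) by (simp add: prod_merge sum_distrib_left sum_distrib_right mult.commute)
      finally show "(\<Sum>b\<in>V - y ` X'. f s b * (\<Prod>x\<in>X'. f x (y x))) =
          - (\<Sum>x'\<in>X'. \<Prod>x\<in>X'. f' x' x (y x))" .
    qed
    finally have eq: "(\<Sum>y\<in>injections X V. \<Prod>x\<in>X. f x (y x)) =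
        - (\<Sum>x'\<in>X'. \<Sum>y\<in>injections X' V. \<Prod>x\<in>X'. f' x' x (y x))"
      by (simp add: sum_negf sum.swap[of _ "X'"])
    have IH: "\<bar>\<Sum>y\<in>injections X' V. \<Prod>x\<in>X'. f' x' x (y x)\<bar> \<le>
        (\<Sum>p\<in>mergings X' (S' x'). ?R X' (f' x') p)" if "x' \<in> X'" for x'
    proof (rule less.hyps)
      show "card X' < card X" using X' by simp
      show "S' x' \<subseteq> X'" using S by (auto simp: S'_def X'_def)
      fix t assume t: "t \<in> S' x'"
      hence "f' x' t = f t" by (auto simp: f'_def S'_def)
      thus "(\<Sum>b\<in>V. f' x' t b) = 0" using z[of t] t by (auto simp: S'_def)
    qed (use X' V in auto)
    have R: "?R X' (f' x') p = ?R X f (p(s := x'))" if x': "x' \<in> X'" and p: "p \<in> mergings X' (S' x')"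
      for x' p
    proof -
      have px: "p x' = x'" using p x' by (auto simp: mergings_def S'_def)
      have im: "p(s := x') ` X = p ` X'"
      proof -
        have "x' \<in> p ` X'" using px x' by (metis image_eqI)
        moreover have "p(s := x') ` X = insert x' (p ` X')"
          unfolding X'(1) using X'(2) by auto
        ultimately show ?thesis by auto
      qed
      have "(\<Prod>x\<in>X'. \<bar>f' x' x (y (p x))\<bar>) = (\<Prod>x\<in>X. \<bar>f x (y ((p(s := x')) x))\<bar>)" for y
      proof -
        have "(\<Prod>x\<in>X'. \<bar>f' x' x (y (p x))\<bar>) =
            (\<Prod>x\<in>X'. \<bar>f x (y (p x))\<bar> * (if x = x' then \<bar>f s (y (p x))\<bar> else 1))"
          by (intro prod.cong) (auto simp: f'_def abs_mult)
        also have "\<dots> = (\<Prod>x\<in>X'. \<bar>f x (y (p x))\<bar>) * \<bar>f s (y (p x'))\<bar>"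
          using X'(3) x' by (simp add: prod.distrib prod.delta)
        also have "\<dots> = (\<Prod>x\<in>X'. \<bar>f x (y ((p(s := x')) x))\<bar>) * \<bar>f s (y x')\<bar>"
          using X'(2) px by (intro arg_cong2[where f = "(*)"] prod.cong) auto
        also have "\<dots> = (\<Prod>x\<in>X. \<bar>f x (y ((p(s := x')) x))\<bar>)"
          unfolding X'(1) using X'(2,3) by simp
        finally show ?thesis .
      qed
      thus ?thesis unfolding im by simp
    qed
    have mem: "p(s := x') \<in> mergings X S" if x': "x' \<in> X'" and p: "p \<in> mergings X' (S' x')" for x' p
    proof -
      have pp: "p \<in> X' \<rightarrow>\<^sub>E X'" "\<And>x. x \<in> X' \<Longrightarrow> p (p x) = p x"
        "\<And>x. x \<in> X' - S' x' \<Longrightarrow> p x = x"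
        "\<And>t. t \<in> S' x' \<Longrightarrow> \<exists>x\<in>X'. x \<noteq> t \<and> p x = p t"
        using p by (auto simp: mergings_def)
      have px: "p x' = x'" using pp(3) x' by (auto simp: S'_def)
      have ps: "p x \<noteq> s" if "x \<in> X'" for x using pp(1) that X'(2) by (metis PiE_mem)
      show ?thesis
        unfolding mergings_def
      proof (intro CollectI conjI ballI)
        show "p(s := x') \<in> X \<rightarrow>\<^sub>E X" using pp(1) x' unfolding X'(1) by (auto simp: PiE_def extensional_def Pi_def)
      next
        fix x assume "x \<in> X"
        thus "(p(s := x')) ((p(s := x')) x) = (p(s := x')) x"
          using pp(2) px ps x' X' by (auto simp: X'(1))
      next
        fix x assume "x \<in> X - S"
        thus "(p(s := x')) x = x" using pp(3) s by (auto simp: X'_def S'_def)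
      next
        fix t assume t: "t \<in> S"
        consider "t = s" | "t = x'" "t \<noteq> s" | "t \<in> S' x'" using t by (auto simp: S'_def)
        thus "\<exists>x\<in>X. x \<noteq> t \<and> (p(s := x')) x = (p(s := x')) t"
        proof cases
          case 1
          thus ?thesis using x' px X' by (intro bexI[of _ x']) auto
        next
          case 2
          thus ?thesis using x' px X' by (intro bexI[of _ s]) auto
        next
          case 3
          then obtain x where "x \<in> X'" "x \<noteq> t" "p x = p t" using pp(4) by blast
          thus ?thesis using 3 X' by (intro bexI[of _ x]) (auto simp: S'_def)
        qed
      qed
    qed
    \<comment> \<open>\<open>x'\<close> is recovered as the value at \<open>s\<close>, where the
      smaller map is \<open>undefined\<close>; so no merging is produced twice.\<close>
    have inj: "inj_on (\<lambda>(x', p). p(s := x')) (Sigma X' (\<lambda>x'. mergings X' (S' x')))"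
    proof (rule inj_onI, clarify)
      fix x1 p1 x2 p2
      assume h: "x1 \<in> X'" "p1 \<in> mergings X' (S' x1)" "x2 \<in> X'" "p2 \<in> mergings X' (S' x2)"
        "p1(s := x1) = p2(s := x2)"
      have 1: "x1 = x2" using h(5) by (metis fun_upd_same)
      have "p1 s = undefined" "p2 s = undefined"
        using h X'(2) by (auto simp: mergings_def PiE_def extensional_def)
      hence "p1 = p2" using h(5) by (metis fun_upd_triv fun_upd_upd)
      with 1 show "x1 = x2 \<and> p1 = p2" by simp
    qed
    have "\<bar>\<Sum>y\<in>injections X V. \<Prod>x\<in>X. f x (y x)\<bar> \<le>
        (\<Sum>x'\<in>X'. \<bar>\<Sum>y\<in>injections X' V. \<Prod>x\<in>X'. f' x' x (y x)\<bar>)"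
      unfolding eq abs_minus_cancel by (rule sum_abs)
    also have "\<dots> \<le> (\<Sum>x'\<in>X'. \<Sum>p\<in>mergings X' (S' x'). ?R X' (f' x') p)"
      by (intro sum_mono IH)
    also have "\<dots> = (\<Sum>x'\<in>X'. \<Sum>p\<in>mergings X' (S' x'). ?R X f (p(s := x')))"
      by (intro sum.cong refl R)
    also have "\<dots> = (\<Sum>(x', p)\<in>Sigma X' (\<lambda>x'. mergings X' (S' x')). ?R X f (p(s := x')))"
      using X'(3) by (subst sum.Sigma) auto
    also have "\<dots> = (\<Sum>p\<in>(\<lambda>(x', p). p(s := x')) ` (Sigma X' (\<lambda>x'. mergings X' (S' x'))). ?R X f p)"
      by (subst sum.reindex[OF inj]) (simp add: case_prod_unfold o_def)
    also have "\<dots> \<le> (\<Sum>p\<in>mergings X S. ?R X f p)"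
      using mem X by (intro sum_mono2) (auto intro!: sum_nonneg prod_nonneg)
    finally show ?thesis .
  qed
qed

section \<open>A uniform permutation seen at a few points\<close>

lemma permutation_extending:
  assumes "finite V" "y \<in> injections I V" "y' \<in> injections I V"
  shows "\<exists>\<tau>. \<tau> permutes V \<and> (\<forall>i\<in>I. \<tau> (y i) = y' i)"
proof -
  have y: "y ` I \<subseteq> V" "inj_on y I" "y' ` I \<subseteq> V" "inj_on y' I"
    using assms by (auto simp: injections_def)
  have "card (V - y ` I) = card (V - y' ` I)"
    using y assms(1) by (simp add: card_Diff_subset finite_subset card_image)
  then obtain h where h: "bij_betw h (V - y ` I) (V - y' ` I)"
    using assms(1) finite_same_card_bij by (metis finite_Diff)
  define g where "g b = (if b \<in> y ` I then y' (inv_into I y b) else h b)" for b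
  have 1: "bij_betw g (y ` I) (y' ` I)"
  proof -
    have "bij_betw (y' \<circ> inv_into I y) (y ` I) (y' ` I)"
      by (rule bij_betw_trans[OF bij_betw_inv_into[OF inj_on_imp_bij_betw[OF y(2)]]
            inj_on_imp_bij_betw[OF y(4)]])
    thus ?thesis by (rule bij_betw_cong[THEN iffD1, rotated]) (auto simp: g_def)
  qed
  have 2: "bij_betw g (V - y ` I) (V - y' ` I)"
    using h by (rule bij_betw_cong[THEN iffD1, rotated]) (auto simp: g_def)
  have "bij_betw g (y ` I \<union> (V - y ` I)) (y' ` I \<union> (V - y' ` I))"
    by (rule bij_betw_combine[OF 1 2]) auto
  hence 3: "bij_betw g V V" using y by (simp add: Un_absorb1)
  define \<tau> where "\<tau> b = (if b \<in> V then g b else b)" for b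
  have "bij_betw \<tau> V V" using 3 by (rule bij_betw_cong[THEN iffD1, rotated]) (auto simp: \<tau>_def)
  hence "\<tau> permutes V" by (rule bij_imp_permutes) (auto simp: \<tau>_def)
  moreover have "\<tau> (y i) = y' i" if "i \<in> I" for i
    using that y by (auto simp: \<tau>_def g_def)
  ultimately show ?thesis by blast
qed

text \<open>Composition with a permutation carrying \<open>y\<close> to \<open>y'\<close> embeds the
  fibre over \<open>y\<close> into the fibre over \<open>y'\<close>. All fibres have the same size,
  so a uniform permutation restricts to a uniform injection.\<close>

lemma sum_permutes_eq:
  fixes g :: "('i \<Rightarrow> 'b) \<Rightarrow> real"
  assumes V: "finite V" and w: "w \<in> I \<rightarrow> V" "inj_on w I" and I: "finite I"
  shows "(\<Sum>\<sigma> | \<sigma> permutes V. g (restrict (\<sigma> \<circ> w) I)) * card (injections I V) =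
         fact (card V) * (\<Sum>y\<in>injections I V. g y)"
proof -
  let ?Per = "{\<sigma>. \<sigma> permutes V}"
  define \<Phi> where "\<Phi> \<sigma> = restrict (\<sigma> \<circ> w) I" for \<sigma> :: "'b \<Rightarrow> 'b"
  have fin: "finite ?Per" using V by (rule finite_permutations)
  have \<Phi>: "\<Phi> \<sigma> \<in> injections I V" if "\<sigma> permutes V" for \<sigma>
    using that w permutes_in_image[OF that] permutes_inj[OF that]
    by (auto simp: \<Phi>_def injections_def inj_on_def Pi_def dest: injD)
  define c where "c y = card {\<sigma> \<in> ?Per. \<Phi> \<sigma> = y}" for y
  have le: "c y \<le> c y'" if yy: "y \<in> injections I V" "y' \<in> injections I V" for y y'
  proof -
    obtain \<tau> where \<tau>: "\<tau> permutes V" "\<forall>i\<in>I. \<tau> (y i) = y' i"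
      using permutation_extending[OF V yy] by blast
    show ?thesis
      unfolding c_def
    proof (rule card_inj_on_le[where f = "\<lambda>\<sigma>. \<tau> \<circ> \<sigma>"])
      show "inj_on (\<lambda>\<sigma>. \<tau> \<circ> \<sigma>) {\<sigma> \<in> ?Per. \<Phi> \<sigma> = y}"
        using permutes_inj[OF \<tau>(1)] by (auto simp: inj_on_def fun_eq_iff dest: injD)
      show "(\<lambda>\<sigma>. \<tau> \<circ> \<sigma>) ` {\<sigma> \<in> ?Per. \<Phi> \<sigma> = y} \<subseteq> {\<sigma> \<in> ?Per. \<Phi> \<sigma> = y'}"
      proof safe
        fix \<sigma> assume s: "\<sigma> permutes V" "y = \<Phi> \<sigma>"
        show "(\<tau> \<circ> \<sigma>) permutes V" by (rule permutes_compose[OF s(1) \<tau>(1)])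
        show "\<Phi> (\<tau> \<circ> \<sigma>) = y'"
        proof
          fix i show "\<Phi> (\<tau> \<circ> \<sigma>) i = y' i"
            using \<tau>(2) s yy(2) by (cases "i \<in> I") (auto simp: \<Phi>_def injections_def PiE_def extensional_def)
        qed
      qed
    qed (use fin in auto)
  qed
  have eq: "c y = c y'" if "y \<in> injections I V" "y' \<in> injections I V" for y y'
    using le that by (meson order_antisym)
  \<comment> \<open>Used twice: for \<open>g\<close>, and for the constant 1, where it counts all
    permutations.\<close>
  have "(\<Sum>\<sigma>\<in>?Per. h (\<Phi> \<sigma>)) = (\<Sum>y\<in>injections I V. real (c y) * h y)" for h :: "_ \<Rightarrow> real"
  proof -
    have "(\<Sum>\<sigma>\<in>?Per. h (\<Phi> \<sigma>)) = (\<Sum>y\<in>injections I V. \<Sum>\<sigma> | \<sigma> \<in> ?Per \<and> \<Phi> \<sigma> = y. h (\<Phi> \<sigma>))"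
      using fin I V \<Phi> by (intro sum.group[symmetric]) auto
    also have "\<dots> = (\<Sum>y\<in>injections I V. real (c y) * h y)"
      by (intro sum.cong refl) (simp add: c_def)
    finally show ?thesis .
  qed
  note S = this
  have "(\<Sum>\<sigma>\<in>?Per. g (\<Phi> \<sigma>)) * card (injections I V) =
      (\<Sum>y\<in>injections I V. \<Sum>y'\<in>injections I V. real (c y) * g y)"
    unfolding S by (simp add: sum_distrib_left sum_distrib_right mult_ac)
  also have "\<dots> = (\<Sum>y\<in>injections I V. \<Sum>y'\<in>injections I V. real (c y') * g y)"
    using eq by (intro sum.cong refl) (metis)
  also have "\<dots> = (\<Sum>y'\<in>injections I V. real (c y') * 1) * (\<Sum>y\<in>injections I V. g y)"
    by (simp add: sum_distrib_left sum_distrib_right)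
  also have "(\<Sum>y'\<in>injections I V. real (c y') * 1) = fact (card V)"
    unfolding S[symmetric] using card_permutations[OF refl V] by simp
  finally show ?thesis by (simp add: \<Phi>_def restrict_def)
qed

text \<open>Each of the \<open>v\<close> factors of the falling factorial is at least
  \<open>n (1 - v / n)\<close>, and Bernoulli's inequality with \<open>2 v^2 \<le> n\<close> leaves
  one half.\<close>

lemma card_injections_ge:
  assumes "finite I" "finite V" "2 * card I ^ 2 \<le> card V"
  shows "real (card V) ^ card I \<le> 2 * real (card (injections I V))"
proof (cases "card V = 0")
  case True
  hence "card I = 0" using assms(3) by simp
  hence "injections I V = {\<lambda>_. undefined}" using assms(1) by (auto simp: injections_def)
  thus ?thesis using \<open>card I = 0\<close> by simp
next
  case False
  let ?n = "card V" and ?v = "card I"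
  have vn: "?v \<le> ?n" using assms(3) by (cases "?v") (auto simp: power2_eq_square)
  have "card (injections I V) = prod ((-) ?n) {0..<?v}"
    using card_inj_on_subset_funcset[OF assms(1,2) order_refl] by (simp add: injections_def)
  hence "real (card (injections I V)) = (\<Prod>i\<in>{0..<?v}. real (?n - i))" by simp
  also have "\<dots> \<ge> (\<Prod>i\<in>{0..<?v}. real ?n * (1 - ?v / ?n))"
  proof (rule prod_mono)
    fix i assume "i \<in> {0..<?v}"
    thus "0 \<le> real ?n * (1 - real ?v / real ?n) \<and> real ?n * (1 - real ?v / real ?n) \<le> real (?n - i)"
      using vn False by (auto simp: field_simps of_nat_diff)
  qed
  also have "(\<Prod>i\<in>{0..<?v}. real ?n * (1 - ?v / ?n)) = real ?n ^ ?v * (1 + - (?v / ?n)) ^ ?v"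
    by (simp add: power_mult_distrib)
  also have "real ?n ^ ?v * (1 + - (?v / ?n)) ^ ?v \<ge> real ?n ^ ?v * (1 / 2)"
  proof (intro mult_left_mono)
    have "1 / 2 \<le> 1 + real ?v * (- (real ?v / real ?n))"
    proof -
      have "2 * real ?v ^ 2 \<le> real ?n" using assms(3) by (metis of_nat_le_iff of_nat_mult of_nat_numeral of_nat_power)
      thus ?thesis using False by (simp add: field_simps power2_eq_square)
    qed
    also have "\<dots> \<le> (1 + - (real ?v / real ?n)) ^ ?v"
      using vn False by (intro Bernoulli_inequality) (simp add: field_simps)
    finally show "1 / 2 \<le> (1 + - (real ?v / real ?n)) ^ ?v" .
  qed simp
  finally show ?thesis by simp
qed

section \<open>Patterns of walks\<close>

text \<open>A normal form for the coincidences of a walk: two walks have the same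
  \<open>first_index\<close> iff the same pairs of times below \<open>N\<close> coincide.\<close>

definition first_index :: "nat \<Rightarrow> (nat \<Rightarrow> 'a) \<Rightarrow> nat \<Rightarrow> nat" where
  "first_index N W = restrict (\<lambda>\<theta>. LEAST \<theta>'. W \<theta>' = W \<theta>) {..<N}"

lemma first_index_le: "\<theta> < N \<Longrightarrow> first_index N W \<theta> \<le> \<theta>"
  by (simp add: first_index_def Least_le)

lemma first_index_apply: "\<theta> < N \<Longrightarrow> W (first_index N W \<theta>) = W \<theta>"
  unfolding first_index_def by (simp, rule LeastI, rule refl)

lemma first_index_eq_iff:
  assumes "\<theta> < N" "\<theta>' < N"
  shows "first_index N W \<theta> = first_index N W \<theta>' \<longleftrightarrow> W \<theta> = W \<theta>'"
proof
  assume e: "first_index N W \<theta> = first_index N W \<theta>'"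
  have "W \<theta> = W (first_index N W \<theta>)" by (rule first_index_apply[OF assms(1), symmetric])
  also have "\<dots> = W \<theta>'" unfolding e by (rule first_index_apply[OF assms(2)])
  finally show "W \<theta> = W \<theta>'" .
next
  assume "W \<theta> = W \<theta>'"
  thus "first_index N W \<theta> = first_index N W \<theta>'" using assms by (simp add: first_index_def)
qed

lemma first_index_less: "\<theta> < N \<Longrightarrow> first_index N W \<theta> < N"
  using first_index_le le_less_trans by blast

lemma first_index_idem:
  assumes "\<theta> < N"
  shows "first_index N W (first_index N W \<theta>) = first_index N W \<theta>"
  by (rule first_index_eq_iff[THEN iffD2, OF first_index_less[OF assms] assms first_index_apply[OF assms]])

lemma first_index_PiE: "first_index N W \<in> {..<N} \<rightarrow>\<^sub>E {..<N}"
proof (rule PiE_I)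
  fix \<theta> assume "\<theta> \<in> {..<N}"
  thus "first_index N W \<theta> \<in> {..<N}" using first_index_less[of \<theta> N W] by simp
qed (simp add: first_index_def)

text \<open>
  A walk visits the points \<open>W \<theta>\<close>; the indices in \<open>T\<close> are those from which it moves on, first
  to the image under the permutation and then along an edge to \<open>W (Suc \<theta>)\<close>. In the
  graph of a pattern, \<open>Inl\<close> marks the points \<open>W \<theta>\<close>, \<open>Inr\<close> their images, and
  \<open>J\<close> is the set of moves which do not follow an edge.
\<close>

definition pattern_nodes :: "nat \<Rightarrow> nat set \<Rightarrow> (nat \<Rightarrow> nat) \<Rightarrow> (nat \<Rightarrow> nat) \<Rightarrow> (nat + nat) set" where
  "pattern_nodes N T f p = Inl ` f ` {..<N} \<union> Inr ` p ` f ` T"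

definition pattern_edges ::
    "nat set \<Rightarrow> (nat \<Rightarrow> nat) \<Rightarrow> (nat \<Rightarrow> nat) \<Rightarrow> nat set \<Rightarrow> ((nat + nat) \<times> (nat + nat)) set" where
  "pattern_edges T f p J = (\<lambda>\<theta>. (Inr (p (f \<theta>)), Inl (f (Suc \<theta>)))) ` (T - J)"

abbreviation pattern_ncomp where
  "pattern_ncomp N T f p J \<equiv> ncomp (pattern_nodes N T f p) (pattern_edges T f p J)"

lemma finite_pattern_nodes [simp]: "finite T \<Longrightarrow> finite (pattern_nodes N T f p)"
  by (simp add: pattern_nodes_def)

lemma card_pattern_nodes:
  "finite T \<Longrightarrow> card (pattern_nodes N T f p) = card (f ` {..<N}) + card (p ` f ` T)"
  unfolding pattern_nodes_def
  by (subst card_Un_disjoint) (auto simp: card_image)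

lemma pattern_edges_subset:
  "(\<And>\<theta>. \<theta> \<in> T \<Longrightarrow> Suc \<theta> < N) \<Longrightarrow>
    pattern_edges T f p J \<subseteq> pattern_nodes N T f p \<times> pattern_nodes N T f p"
  by (fastforce simp: pattern_edges_def pattern_nodes_def)

section \<open>Averages over the permutation, pattern by pattern\<close>

locale regular_graph =
  fixes V :: "'a set" and E :: "('a \<times> 'a) set" and r :: nat
  assumes finV: "finite V" and neV: "V \<noteq> {}" and r_pos: "r > 0"
    and out: "\<And>y. y \<in> V \<Longrightarrow> card {x \<in> V. (y, x) \<in> E} = r"
    and inn: "\<And>x. x \<in> V \<Longrightarrow> card {y \<in> V. (y, x) \<in> E} = r"
begin

abbreviation n :: nat where "n \<equiv> card V"

lemma n_pos: "n > 0" using finV neV by (simp add: card_gt_0_iff)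

lemma r_le_n: "r \<le> n"
proof -
  obtain y where "y \<in> V" using neV by blast
  hence "r = card {x \<in> V. (y, x) \<in> E}" using out by simp
  also have "\<dots> \<le> n" using finV by (intro card_mono) auto
  finally show ?thesis .
qed

definition q :: "'a \<Rightarrow> 'a \<Rightarrow> real" where "q y x = (if (y, x) \<in> E then 1 / r else 0)"

text \<open>The kernel of \<open>Q - J / n\<close>. Its first argument receives the random image,
  and summing over it gives zero: this is the mean zero of the factors.\<close>

definition qc :: "'a \<Rightarrow> 'a \<Rightarrow> real" where "qc y x = q y x - 1 / n"

lemma q_nonneg: "q y x \<ge> 0" by (simp add: q_def)

lemma sum_q_row: "y \<in> V \<Longrightarrow> (\<Sum>x\<in>V. q y x) = 1"
  using out[of y] r_pos finV by (simp add: q_def sum.If_cases Int_def)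

lemma sum_q_col: "x \<in> V \<Longrightarrow> (\<Sum>y\<in>V. q y x) = 1"
  using inn[of x] r_pos finV by (simp add: q_def sum.If_cases Int_def)

lemma sum_qc_col: "x \<in> V \<Longrightarrow> (\<Sum>y\<in>V. qc y x) = 0"
  using n_pos by (simp add: qc_def sum_subtractf sum_q_col)

lemma abs_qc_le: "\<bar>qc y x\<bar> \<le> q y x + 1 / n"
  using q_nonneg[of y x] by (simp add: qc_def abs_le_iff)

definition avg :: "(('a \<Rightarrow> 'a) \<Rightarrow> real) \<Rightarrow> real" where
  "avg h = (\<Sum>\<sigma> | \<sigma> permutes V. h \<sigma>) / fact n"

lemma finite_perms: "finite {\<sigma>. \<sigma> permutes V}" by (rule finite_permutations[OF finV])

lemma avg_sum: "avg (\<lambda>\<sigma>. \<Sum>i\<in>A. h i \<sigma>) = (\<Sum>i\<in>A. avg (h i))"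
  unfolding avg_def by (subst sum.swap) (simp add: sum_divide_distrib)

lemma markov:
  assumes "\<And>\<sigma>. \<sigma> permutes V \<Longrightarrow> 0 \<le> h \<sigma>" "a > 0"
  shows "card {\<sigma>. \<sigma> permutes V \<and> h \<sigma> \<ge> a} / fact n \<le> avg h / a"
proof -
  have "a * card {\<sigma>. \<sigma> permutes V \<and> h \<sigma> \<ge> a} = (\<Sum>\<sigma> | \<sigma> permutes V \<and> h \<sigma> \<ge> a. a)" by simp
  also have "\<dots> \<le> (\<Sum>\<sigma> | \<sigma> permutes V \<and> h \<sigma> \<ge> a. h \<sigma>)" by (intro sum_mono) auto
  also have "\<dots> \<le> (\<Sum>\<sigma> | \<sigma> permutes V. h \<sigma>)"
    using assms finite_perms by (intro sum_mono2) auto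
  finally show ?thesis using assms(2) by (simp add: avg_def field_simps)
qed

text \<open>The numerator bounds the homomorphisms of the pattern graph. The denominator has the
  order of the number of injections of the sources, a factor \<open>r\<close> for each move along an
  edge and a factor \<open>n\<close> for each jump.\<close>

definition weight :: "nat \<Rightarrow> nat set \<Rightarrow> (nat \<Rightarrow> nat) \<Rightarrow> (nat \<Rightarrow> nat) \<Rightarrow> nat set \<Rightarrow> real" where
  "weight N T f p J =
     real n ^ pattern_ncomp N T f p J * real r ^ (card (pattern_nodes N T f p) - pattern_ncomp N T f p J)
     / (real n ^ card (f ` T) * real r ^ card (T - J) * real n ^ card J)"

text \<open>A walk with pattern \<open>f\<close> is determined by its values at the representatives.
  So a walk together with the images \<open>y\<close> is a homomorphism of the pattern graph into
  \<open>E\<close>, and distinct pairs give distinct homomorphisms.\<close>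

lemma count_embeddings:
  assumes T: "finite T" "T \<subseteq> {..<N}" "\<And>\<theta>. \<theta> \<in> T \<Longrightarrow> Suc \<theta> < N"
    and \<W>: "\<W> \<subseteq> {..<N} \<rightarrow>\<^sub>E V"
  shows "(\<Sum>W | W \<in> \<W> \<and> first_index N W = f. \<Sum>y\<in>p ` f ` T \<rightarrow>\<^sub>E V.
            of_bool (\<forall>\<theta>\<in>T - J. (y (p (f \<theta>)), W (Suc \<theta>)) \<in> E))
      \<le> real n ^ pattern_ncomp N T f p J *
        real r ^ (card (pattern_nodes N T f p) - pattern_ncomp N T f p J)"
    (is "?L \<le> _")
proof -
  let ?N = "pattern_nodes N T f p" and ?H = "pattern_edges T f p J"
  let ?Ws = "{W. W \<in> \<W> \<and> first_index N W = f}" and ?Y = "p ` f ` T \<rightarrow>\<^sub>E V"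
  let ?P = "\<lambda>W y. \<forall>\<theta>\<in>T - J. (y (p (f \<theta>)), W (Suc \<theta>)) \<in> E"
  let ?S = "{\<phi> \<in> ?N \<rightarrow>\<^sub>E V. \<forall>(a, b)\<in>?H. (\<phi> a, \<phi> b) \<in> E}"
  have finY: "finite ?Y" using T finV by (intro finite_PiE) auto
  have finW: "finite ?Ws" using \<W> finV by (auto intro: finite_subset[OF _ finite_PiE[of "{..<N}" "\<lambda>_. V"]])
  have "?L = (\<Sum>W\<in>?Ws. real (card {y \<in> ?Y. ?P W y}))"
    using finY by (intro sum.cong refl) (simp add: of_bool_def sum.If_cases Int_def)
  also have "\<dots> = real (card (Sigma ?Ws (\<lambda>W. {y \<in> ?Y. ?P W y})))"
    using finY finW by (subst card_SigmaI) auto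
  also have "\<dots> \<le> real (card ?S)"
  proof (intro of_nat_mono)
    define \<Psi> where "\<Psi> = (\<lambda>(W :: nat \<Rightarrow> 'a, y). restrict (\<lambda>u. case u of Inl i \<Rightarrow> W i | Inr k \<Rightarrow> y k) ?N)"
    show "card (Sigma ?Ws (\<lambda>W. {y \<in> ?Y. ?P W y})) \<le> card ?S"
    proof (rule card_inj_on_le[where f = \<Psi>])
      show "inj_on \<Psi> (Sigma ?Ws (\<lambda>W. {y \<in> ?Y. ?P W y}))"
      proof (rule inj_onI)
        fix a b assume a: "a \<in> Sigma ?Ws (\<lambda>W. {y \<in> ?Y. ?P W y})"
          and b: "b \<in> Sigma ?Ws (\<lambda>W. {y \<in> ?Y. ?P W y})" and eq: "\<Psi> a = \<Psi> b"
        obtain W y where aW: "a = (W, y)" by force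
        obtain W' y' where bW: "b = (W', y')" by force
        have W: "W \<in> {..<N} \<rightarrow>\<^sub>E V" "first_index N W = f" "y \<in> ?Y" using a aW \<W> by auto
        have W': "W' \<in> {..<N} \<rightarrow>\<^sub>E V" "first_index N W' = f" "y' \<in> ?Y" using b bW \<W> by auto
        have e: "\<Psi> a u = \<Psi> b u" for u using eq by simp
        have "W \<theta> = W' \<theta>" if "\<theta> < N" for \<theta>
        proof -
          have "Inl (f \<theta>) \<in> ?N" using that by (auto simp: pattern_nodes_def)
          hence "W (f \<theta>) = W' (f \<theta>)" using e[of "Inl (f \<theta>)"] by (simp add: \<Psi>_def aW bW)
          thus ?thesis
            using first_index_apply[OF that, of W] first_index_apply[OF that, of W'] W(2) W'(2) by simp
        qed
        hence 1: "W = W'" using W(1) W'(1) by (intro PiE_ext[OF W(1) W'(1)]) auto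
        have "y k = y' k" if "k \<in> p ` f ` T" for k
        proof -
          have "Inr k \<in> ?N" using that by (auto simp: pattern_nodes_def)
          thus ?thesis using e[of "Inr k"] by (simp add: \<Psi>_def aW bW)
        qed
        hence 2: "y = y'" by (intro PiE_ext[OF W(3) W'(3)]) auto
        show "a = b" using 1 2 aW bW by simp
      qed
      show "\<Psi> ` Sigma ?Ws (\<lambda>W. {y \<in> ?Y. ?P W y}) \<subseteq> ?S"
      proof (rule image_subsetI)
        fix z assume z: "z \<in> Sigma ?Ws (\<lambda>W. {y \<in> ?Y. ?P W y})"
        obtain W y where zW: "z = (W, y)" by force
        have W: "W \<in> \<W>" "f = first_index N W" and y: "y \<in> ?Y" and P: "?P W y"
          using z zW by auto
        have W': "W \<in> {..<N} \<rightarrow>\<^sub>E V" using W \<W> by auto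
        have A: "\<Psi> (W, y) \<in> ?N \<rightarrow>\<^sub>E V"
        proof (rule PiE_I)
          fix u assume u: "u \<in> ?N"
          show "\<Psi> (W, y) u \<in> V"
          proof (cases u)
            case (Inl i)
            hence "i < N" using u W first_index_less by (auto simp: pattern_nodes_def)
            thus ?thesis using u Inl W' by (auto simp: \<Psi>_def)
          next
            case (Inr k)
            hence "k \<in> p ` f ` T" using u by (auto simp: pattern_nodes_def)
            thus ?thesis using u Inr y by (auto simp: \<Psi>_def)
          qed
        qed (simp add: \<Psi>_def)
        have B: "(\<Psi> (W, y) a, \<Psi> (W, y) b) \<in> E" if "(a, b) \<in> ?H" for a b
        proof -
        from that
        obtain \<theta> where \<theta>: "\<theta> \<in> T - J" "a = Inr (p (f \<theta>))" "b = Inl (f (Suc \<theta>))"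
          by (auto simp: pattern_edges_def)
        have N: "a \<in> ?N" "b \<in> ?N" using \<theta> T(3) by (auto simp: pattern_nodes_def)
        have "W (f (Suc \<theta>)) = W (Suc \<theta>)"
          using \<theta> first_index_apply[OF T(3), of \<theta> W] W by simp
        moreover have "(y (p (f \<theta>)), W (Suc \<theta>)) \<in> E" using P \<theta>(1) by blast
        ultimately show ?thesis
          using N \<theta> by (simp add: \<Psi>_def)
        qed
        show "\<Psi> z \<in> ?S" unfolding zW using A B by blast
      qed
      show "finite ?S" using T finV
        by (intro finite_subset[OF _ finite_PiE[of ?N "\<lambda>_. V"]]) auto
    qed
  qed
  also have "card ?S \<le> n ^ ncomp ?N ?H * r ^ (card ?N - ncomp ?N ?H)"
    by (rule card_hom_le) (use T finV out inn pattern_edges_subset[of T N] in auto)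
  finally show ?thesis by simp
qed

text \<open>The kernel \<open>q'\<close> is left open, subject to domination by
  \<open>q + 1 / n\<close>. It will be \<open>qc\<close>, with \<open>S\<close> the points where the
  mean vanishes, and also the absolute value of \<open>qc\<close>, with \<open>S\<close>
  empty.\<close>

lemma avg_walk_le:
  fixes q' :: "'a \<Rightarrow> 'a \<Rightarrow> real"
  assumes T: "T \<subseteq> {..<N}" "\<And>\<theta>. \<theta> \<in> T \<Longrightarrow> Suc \<theta> < N"
    and W: "W \<in> {..<N} \<rightarrow>\<^sub>E V" and f: "f = first_index N W"
    and q': "\<And>y x. y \<in> V \<Longrightarrow> x \<in> V \<Longrightarrow> \<bar>q' y x\<bar> \<le> q y x + 1 / n"
    and S: "S \<subseteq> f ` T"
    and zero: "\<And>s. s \<in> S \<Longrightarrow> (\<Sum>y\<in>V. \<Prod>\<theta> | \<theta> \<in> T \<and> f \<theta> = s. q' y (W (Suc \<theta>))) = 0"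
    and N: "2 * N ^ 2 \<le> n"
  shows "\<bar>avg (\<lambda>\<sigma>. \<Prod>\<theta>\<in>T. q' (\<sigma> (W \<theta>)) (W (Suc \<theta>)))\<bar> \<le>
    2 / real n ^ card (f ` T) * (\<Sum>p\<in>mergings (f ` T) S. \<Sum>y\<in>p ` f ` T \<rightarrow>\<^sub>E V. \<Sum>J\<in>Pow T.
       of_bool (\<forall>\<theta>\<in>T - J. (y (p (f \<theta>)), W (Suc \<theta>)) \<in> E) / (real r ^ card (T - J) * real n ^ card J))"
proof -
  define I where "I = f ` T"
  have finT: "finite T" using T(1) finite_subset by blast
  hence finI: "finite I" by (simp add: I_def)
  define g where "g i y = (\<Prod>\<theta> | \<theta> \<in> T \<and> f \<theta> = i. q' y (W (Suc \<theta>)))" for i y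
  have less: "\<theta> \<in> T \<Longrightarrow> \<theta> < N" for \<theta> using T(1) by auto
  have Wf: "W (f \<theta>) = W \<theta>" if "\<theta> \<in> T" for \<theta>
    unfolding f by (rule first_index_apply[OF less[OF that]])
  have prod_eq: "(\<Prod>\<theta>\<in>T. q' (z (f \<theta>)) (W (Suc \<theta>))) = (\<Prod>i\<in>I. g i (z i))" for z
    unfolding g_def I_def by (subst prod.image_gen[OF finT, of _ f]) (auto intro!: prod.cong)
  have WI: "W \<in> I \<rightarrow> V"
  proof
    fix i assume "i \<in> I"
    then obtain \<theta> where "\<theta> \<in> T" "i = f \<theta>" by (auto simp: I_def)
    thus "W i \<in> V" using PiE_mem[OF W, of \<theta>] less Wf by simp
  qed
  have injW: "inj_on W I"
  proof (rule inj_onI)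
    fix i j assume "i \<in> I" "j \<in> I" and ij: "W i = W j"
    then obtain a b where ab: "a \<in> T" "b \<in> T" "i = f a" "j = f b" by (auto simp: I_def)
    hence "W a = W b" using ij Wf by metis
    thus "i = j" using ab f first_index_eq_iff[of a N b W] less by simp
  qed
  have eq1: "(\<Prod>\<theta>\<in>T. q' (\<sigma> (W \<theta>)) (W (Suc \<theta>))) = (\<Prod>i\<in>I. g i (restrict (\<sigma> \<circ> W) I i))" for \<sigma>
  proof -
    have "(\<Prod>\<theta>\<in>T. q' (\<sigma> (W \<theta>)) (W (Suc \<theta>))) = (\<Prod>\<theta>\<in>T. q' (\<sigma> (W (f \<theta>))) (W (Suc \<theta>)))"
      using Wf by (intro prod.cong) auto
    also have "\<dots> = (\<Prod>i\<in>I. g i (\<sigma> (W i)))" by (rule prod_eq)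
    finally show ?thesis by simp
  qed
  have cI: "card I \<le> N" unfolding I_def
    using finT T(1) card_image_le card_mono by (metis card_lessThan finite_lessThan order_trans)
  have "2 * card I ^ 2 \<le> n" using N power_mono[OF cI, of 2] by linarith
  hence inj_ge: "real n ^ card I \<le> 2 * real (card (injections I V))"
    by (rule card_injections_ge[OF finI finV])
  have npos: "real n ^ card I > 0" using n_pos by simp
  hence inj_pos: "real (card (injections I V)) > 0" using inj_ge by linarith
  have "avg (\<lambda>\<sigma>. \<Prod>\<theta>\<in>T. q' (\<sigma> (W \<theta>)) (W (Suc \<theta>))) =
      (\<Sum>\<sigma> | \<sigma> permutes V. (\<Prod>i\<in>I. g i (restrict (\<sigma> \<circ> W) I i))) / fact n"
    unfolding avg_def eq1 ..
  also have "\<dots> = (\<Sum>y\<in>injections I V. \<Prod>i\<in>I. g i (y i)) / card (injections I V)"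
    using sum_permutes_eq[OF finV WI injW finI, of "\<lambda>y. \<Prod>i\<in>I. g i (y i)"] inj_pos
    by (simp add: field_simps)
  finally have "\<bar>avg (\<lambda>\<sigma>. \<Prod>\<theta>\<in>T. q' (\<sigma> (W \<theta>)) (W (Suc \<theta>)))\<bar> =
      \<bar>\<Sum>y\<in>injections I V. \<Prod>i\<in>I. g i (y i)\<bar> / card (injections I V)"
    by simp
  also have "\<dots> \<le> \<bar>\<Sum>y\<in>injections I V. \<Prod>i\<in>I. g i (y i)\<bar> * (2 / real n ^ card I)"
  proof -
    have "1 / real (card (injections I V)) \<le> 2 / real n ^ card I"
      using frac_le[of 2 2 "real n ^ card I" "2 * real (card (injections I V))"] inj_ge npos by simp
    from mult_left_mono[OF this, of "\<bar>\<Sum>y\<in>injections I V. \<Prod>i\<in>I. g i (y i)\<bar>"] show ?thesis by simp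
  qed
  also have "\<dots> \<le> (\<Sum>p\<in>mergings I S. \<Sum>y\<in>p ` I \<rightarrow>\<^sub>E V. \<Prod>i\<in>I. \<bar>g i (y (p i))\<bar>) * (2 / real n ^ card I)"
    using S zero finI finV by (intro mult_right_mono sum_injections_le) (auto simp: I_def g_def)
  also have "(\<Sum>p\<in>mergings I S. \<Sum>y\<in>p ` I \<rightarrow>\<^sub>E V. \<Prod>i\<in>I. \<bar>g i (y (p i))\<bar>) \<le>
      (\<Sum>p\<in>mergings I S. \<Sum>y\<in>p ` I \<rightarrow>\<^sub>E V. \<Sum>J\<in>Pow T.
       of_bool (\<forall>\<theta>\<in>T - J. (y (p (f \<theta>)), W (Suc \<theta>)) \<in> E) / (real r ^ card (T - J) * real n ^ card J))"
  proof (intro sum_mono)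
    fix p y assume p: "p \<in> mergings I S" and y: "y \<in> p ` I \<rightarrow>\<^sub>E V"
    have "(\<Prod>i\<in>I. \<bar>g i (y (p i))\<bar>) = \<bar>\<Prod>\<theta>\<in>T. q' (y (p (f \<theta>))) (W (Suc \<theta>))\<bar>"
      using prod_eq[of "\<lambda>i. y (p i)"] by (simp add: abs_prod)
    also have "\<dots> \<le> (\<Prod>\<theta>\<in>T. 1 / n + q (y (p (f \<theta>))) (W (Suc \<theta>)))"
      unfolding abs_prod
    proof (rule prod_mono)
      fix \<theta> assume \<theta>: "\<theta> \<in> T"
      have "y (p (f \<theta>)) \<in> V" "W (Suc \<theta>) \<in> V"
        using y \<theta> T(2) W by (auto simp: I_def PiE_def Pi_def)
      hence "\<bar>q' (y (p (f \<theta>))) (W (Suc \<theta>))\<bar> \<le> q (y (p (f \<theta>))) (W (Suc \<theta>)) + 1 / n"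
        by (rule q')
      thus "0 \<le> \<bar>q' (y (p (f \<theta>))) (W (Suc \<theta>))\<bar> \<and>
          \<bar>q' (y (p (f \<theta>))) (W (Suc \<theta>))\<bar> \<le> 1 / n + q (y (p (f \<theta>))) (W (Suc \<theta>))"
        by (simp add: add.commute)
    qed
    also have "\<dots> = (\<Sum>J\<in>Pow T. (\<Prod>\<theta>\<in>J. 1 / n) * (\<Prod>\<theta>\<in>T - J. q (y (p (f \<theta>))) (W (Suc \<theta>))))"
      by (rule prod_add[OF finT])
    also have "\<dots> = (\<Sum>J\<in>Pow T. of_bool (\<forall>\<theta>\<in>T - J. (y (p (f \<theta>)), W (Suc \<theta>)) \<in> E) /
        (real r ^ card (T - J) * real n ^ card J))"
    proof (rule sum.cong[OF refl])
      fix J assume "J \<in> Pow T"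
      have fTJ: "finite (T - J)" using finT by simp
      have "(\<Prod>\<theta>\<in>T - J. q (y (p (f \<theta>))) (W (Suc \<theta>))) =
          of_bool (\<forall>\<theta>\<in>T - J. (y (p (f \<theta>)), W (Suc \<theta>)) \<in> E) / real r ^ card (T - J)"
      proof (cases "\<forall>\<theta>\<in>T - J. (y (p (f \<theta>)), W (Suc \<theta>)) \<in> E")
        case True
        hence "(\<Prod>\<theta>\<in>T - J. q (y (p (f \<theta>))) (W (Suc \<theta>))) = (\<Prod>\<theta>\<in>T - J. 1 / real r)"
          by (intro prod.cong) (auto simp: q_def)
        thus ?thesis using True by (simp add: power_divide)
      next
        case False
        hence "(\<Prod>\<theta>\<in>T - J. q (y (p (f \<theta>))) (W (Suc \<theta>))) = 0"
          using fTJ by (auto simp: prod_zero_iff q_def)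
        thus ?thesis using False by simp
      qed
      thus "(\<Prod>\<theta>\<in>J. 1 / n) * (\<Prod>\<theta>\<in>T - J. q (y (p (f \<theta>))) (W (Suc \<theta>))) =
          of_bool (\<forall>\<theta>\<in>T - J. (y (p (f \<theta>)), W (Suc \<theta>)) \<in> E) / (real r ^ card (T - J) * real n ^ card J)"
        by (simp add: power_divide)
    qed
    finally show "(\<Prod>i\<in>I. \<bar>g i (y (p i))\<bar>) \<le> \<dots>" .
  qed
  finally show ?thesis
    using npos unfolding I_def by (simp add: mult.commute divide_right_mono)
qed

text \<open>Walks are grouped by their pattern. Within a group the mergings are the same, so the sum
  over the walks can be moved inside, where \<open>count_embeddings\<close> applies.\<close>

lemma sum_avg_walk_le:
  fixes q' :: "'a \<Rightarrow> 'a \<Rightarrow> real" and S :: "(nat \<Rightarrow> nat) \<Rightarrow> nat set"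
  assumes T: "T \<subseteq> {..<N}" "\<And>\<theta>. \<theta> \<in> T \<Longrightarrow> Suc \<theta> < N"
    and \<W>: "\<W> \<subseteq> {..<N} \<rightarrow>\<^sub>E V"
    and q': "\<And>y x. y \<in> V \<Longrightarrow> x \<in> V \<Longrightarrow> \<bar>q' y x\<bar> \<le> q y x + 1 / n"
    and S: "\<And>f. S f \<subseteq> f ` T"
    and zero: "\<And>W s. W \<in> \<W> \<Longrightarrow> s \<in> S (first_index N W) \<Longrightarrow>
        (\<Sum>y\<in>V. \<Prod>\<theta> | \<theta> \<in> T \<and> first_index N W \<theta> = s. q' y (W (Suc \<theta>))) = 0"
    and N: "2 * N ^ 2 \<le> n"
  shows "(\<Sum>W\<in>\<W>. \<bar>avg (\<lambda>\<sigma>. \<Prod>\<theta>\<in>T. q' (\<sigma> (W \<theta>)) (W (Suc \<theta>)))\<bar>) \<le>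
     2 * (\<Sum>f\<in>first_index N ` \<W>. \<Sum>p\<in>mergings (f ` T) (S f). \<Sum>J\<in>Pow T. weight N T f p J)"
proof -
  have finT: "finite T" using T(1) finite_subset by blast
  have finW: "finite \<W>" using \<W> finV by (auto intro: finite_subset[OF _ finite_PiE[of "{..<N}" "\<lambda>_. V"]])
  define h where "h f W p y J = (of_bool (\<forall>\<theta>\<in>T - J. (y (p (f \<theta>)), W (Suc \<theta>)) \<in> E) /
     (real r ^ card (T - J) * real n ^ card J) :: real)"
    for f p :: "nat \<Rightarrow> nat" and W y :: "nat \<Rightarrow> 'a" and J
  have "(\<Sum>W\<in>\<W>. \<bar>avg (\<lambda>\<sigma>. \<Prod>\<theta>\<in>T. q' (\<sigma> (W \<theta>)) (W (Suc \<theta>)))\<bar>) =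
      (\<Sum>f\<in>first_index N ` \<W>. \<Sum>W | W \<in> \<W> \<and> first_index N W = f.
        \<bar>avg (\<lambda>\<sigma>. \<Prod>\<theta>\<in>T. q' (\<sigma> (W \<theta>)) (W (Suc \<theta>)))\<bar>)"
    by (rule sum.image_gen[OF finW])
  also have "\<dots> \<le> (\<Sum>f\<in>first_index N ` \<W>. \<Sum>W | W \<in> \<W> \<and> first_index N W = f.
      2 / real n ^ card (f ` T) * (\<Sum>p\<in>mergings (f ` T) (S f). \<Sum>y\<in>p ` f ` T \<rightarrow>\<^sub>E V. \<Sum>J\<in>Pow T. h f W p y J))"
    unfolding h_def using \<W> zero
    by (intro sum_mono avg_walk_le[OF T _ _ q' S _ N]) (auto)
  also have "\<dots> = (\<Sum>f\<in>first_index N ` \<W>. 2 / real n ^ card (f ` T) *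
      (\<Sum>p\<in>mergings (f ` T) (S f). \<Sum>J\<in>Pow T. \<Sum>W | W \<in> \<W> \<and> first_index N W = f.
         \<Sum>y\<in>p ` f ` T \<rightarrow>\<^sub>E V. h f W p y J))"
  proof (intro sum.cong refl)
    fix f
    let ?A = "{W. W \<in> \<W> \<and> first_index N W = f}" and ?B = "mergings (f ` T) (S f)"
    have "(\<Sum>W\<in>?A. \<Sum>p\<in>?B. \<Sum>y\<in>p ` f ` T \<rightarrow>\<^sub>E V. \<Sum>J\<in>Pow T. h f W p y J) =
        (\<Sum>W\<in>?A. \<Sum>p\<in>?B. \<Sum>J\<in>Pow T. \<Sum>y\<in>p ` f ` T \<rightarrow>\<^sub>E V. h f W p y J)"
      by (intro sum.cong refl sum.swap)
    also have "\<dots> = (\<Sum>p\<in>?B. \<Sum>W\<in>?A. \<Sum>J\<in>Pow T. \<Sum>y\<in>p ` f ` T \<rightarrow>\<^sub>E V. h f W p y J)"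
      by (rule sum.swap)
    also have "\<dots> = (\<Sum>p\<in>?B. \<Sum>J\<in>Pow T. \<Sum>W\<in>?A. \<Sum>y\<in>p ` f ` T \<rightarrow>\<^sub>E V. h f W p y J)"
      by (intro sum.cong refl sum.swap)
    finally show "(\<Sum>W\<in>?A. 2 / real n ^ card (f ` T) *
        (\<Sum>p\<in>?B. \<Sum>y\<in>p ` f ` T \<rightarrow>\<^sub>E V. \<Sum>J\<in>Pow T. h f W p y J)) =
      2 / real n ^ card (f ` T) *
        (\<Sum>p\<in>?B. \<Sum>J\<in>Pow T. \<Sum>W\<in>?A. \<Sum>y\<in>p ` f ` T \<rightarrow>\<^sub>E V. h f W p y J)"
      by (simp only: sum_distrib_left[symmetric])
  qed
  also have "\<dots> \<le> (\<Sum>f\<in>first_index N ` \<W>. 2 / real n ^ card (f ` T) *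
      (\<Sum>p\<in>mergings (f ` T) (S f). \<Sum>J\<in>Pow T.
        real n ^ pattern_ncomp N T f p J *
        real r ^ (card (pattern_nodes N T f p) - pattern_ncomp N T f p J) /
        (real r ^ card (T - J) * real n ^ card J)))"
    unfolding h_def sum_divide_distrib[symmetric]
    by (intro sum_mono mult_left_mono divide_right_mono count_embeddings finT T \<W>) auto
  also have "\<dots> = 2 * (\<Sum>f\<in>first_index N ` \<W>. \<Sum>p\<in>mergings (f ` T) (S f). \<Sum>J\<in>Pow T. weight N T f p J)"
    unfolding weight_def by (simp add: sum_distrib_left mult.assoc)
  finally show ?thesis .
qed

end

section \<open>The excess of a pattern\<close>

text \<open>\<open>connected\<close> says that the times, linked by moves and by visits to a common
  point, do not split. It is the reason why only one factor \<open>n\<close> survives in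
  \<open>weight_eq\<close>.\<close>

locale walk_pattern =
  fixes N :: nat and T :: "nat set" and f p :: "nat \<Rightarrow> nat" and J :: "nat set"
  assumes T_sub: "T \<subseteq> {..<N}" and T_Suc: "\<And>\<theta>. \<theta> \<in> T \<Longrightarrow> Suc \<theta> < N"
    and N_pos: "N > 0"
    and f_le: "\<And>\<theta>. \<theta> < N \<Longrightarrow> f \<theta> \<le> \<theta>"
    and f_idem: "\<And>\<theta>. \<theta> < N \<Longrightarrow> f (f \<theta>) = f \<theta>"
    and p_mem: "\<And>i. i \<in> f ` T \<Longrightarrow> p i \<in> f ` T"
    and J_sub: "J \<subseteq> T"
    and connected: "\<And>C. C \<subseteq> {..<N} \<Longrightarrow> C \<noteq> {} \<Longrightarrow> (\<And>\<theta>. \<theta> \<in> T \<Longrightarrow> \<theta> \<in> C \<longleftrightarrow> Suc \<theta> \<in> C) \<Longrightarrow>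
      (\<And>\<theta> \<theta>'. \<theta> < N \<Longrightarrow> \<theta>' < N \<Longrightarrow> f \<theta> = f \<theta>' \<Longrightarrow> \<theta> \<in> C \<longleftrightarrow> \<theta>' \<in> C) \<Longrightarrow> C = {..<N}"
begin

definition "points = f ` {..<N}"
definition "sources = f ` T"
definition "images = p ` f ` T"

definition px :: "nat \<Rightarrow> nat + nat" where "px \<theta> = Inl (f \<theta>)"
definition py :: "nat \<Rightarrow> nat + nat" where "py \<theta> = Inr (p (f \<theta>))"

abbreviation "nodes \<equiv> pattern_nodes N T f p"
abbreviation "edges \<equiv> pattern_edges T f p J"
abbreviation "cc \<equiv> ncomp nodes edges"
abbreviation cl :: "nat + nat \<Rightarrow> (nat + nat) set" where "cl \<equiv> edge_comp edges"

text \<open>Contract every component to a vertex. A source joins the component of its point to that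
  of its image; a jump joins the component of the image to that of the arrival. This graph is
  connected, with \<open>cc\<close> vertices and \<open>card sources + card J\<close> edges, so the
  excess counts its independent cycles.\<close>

definition excess :: nat where "excess = card sources + 1 + card J - cc"

lemma finT [simp]: "finite T" using T_sub finite_subset by blast
lemma finJ [simp]: "finite J" using J_sub finT finite_subset by blast
lemma fin_points [simp]: "finite points" by (simp add: points_def)
lemma fin_sources [simp]: "finite sources" by (simp add: sources_def)
lemma fin_images [simp]: "finite images" by (simp add: images_def)
lemma T_less: "\<theta> \<in> T \<Longrightarrow> \<theta> < N" using T_sub by auto
lemma f_less: "\<theta> < N \<Longrightarrow> f \<theta> < N" using f_le le_less_trans by blast

lemma cl_move: "\<theta> \<in> T \<Longrightarrow> \<theta> \<notin> J \<Longrightarrow> cl (py \<theta>) = cl (px (Suc \<theta>))"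
  by (rule edge_comp_edge) (auto simp: pattern_edges_def py_def px_def)

definition cls :: "nat set \<Rightarrow> (nat + nat) set set" where
  "cls D = (\<lambda>\<theta>. cl (px \<theta>)) ` D \<union> (\<lambda>\<theta>. cl (py \<theta>)) ` (D \<inter> T)"

definition inner_jumps :: "nat set \<Rightarrow> nat set" where
  "inner_jumps D = {\<theta> \<in> J. \<theta> \<in> D \<and> Suc \<theta> \<in> D}"

lemma fin_inner_jumps [simp]: "finite (inner_jumps D)"
  by (auto simp: inner_jumps_def)

lemma cls_all: "card (cls {..<N}) = cc"
proof -
  have "cls {..<N} = cl ` nodes"
    using T_sub by (auto simp: cls_def pattern_nodes_def px_def py_def Int_absorb1 image_image image_Un)
  thus ?thesis by (simp add: ncomp_def)
qed

text \<open>By connectedness some time outside \<open>D\<close> is linked to \<open>D\<close> by a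
  move in either direction or by a common point. It brings at most as many new components as new
  sources and new inner jumps, so edges minus vertices of the contracted graph does not
  drop.\<close>

lemma grow_step:
  assumes D: "D \<subseteq> {..<N}" "D \<noteq> {}" "D \<noteq> {..<N}"
  shows "\<exists>\<theta>'\<in>{..<N} - D. card (cls (insert \<theta>' D)) + (card (f ` (D \<inter> T)) + card (inner_jumps D))
      \<le> card (cls D) + (card (f ` (insert \<theta>' D \<inter> T)) + card (inner_jumps (insert \<theta>' D)))"
proof -
  have finD: "finite D" using D(1) finite_subset by blast
  have fincls: "finite (cls D)" using finD by (simp add: cls_def)
  have key: ?thesis
    if \<theta>': "\<theta>' < N" "\<theta>' \<notin> D"
      and le: "of_bool (cl (px \<theta>') \<notin> cls D) + of_bool (\<theta>' \<in> T \<and> cl (py \<theta>') \<notin> cls D) \<le>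
         of_bool (\<theta>' \<in> T \<and> f \<theta>' \<notin> f ` (D \<inter> T)) +
         (of_bool (\<exists>\<theta>. \<theta> \<in> inner_jumps (insert \<theta>' D) \<and> \<theta> \<notin> inner_jumps D) :: nat)" for \<theta>'
  proof -
    have "cls (insert \<theta>' D) = insert (cl (px \<theta>')) ((if \<theta>' \<in> T then {cl (py \<theta>')} else {}) \<union> cls D)"
      by (auto simp: cls_def)
    hence 1: "card (cls (insert \<theta>' D)) \<le> of_bool (cl (px \<theta>') \<notin> cls D) +
        (of_bool (\<theta>' \<in> T \<and> cl (py \<theta>') \<notin> cls D) + card (cls D))"
      using fincls by (auto simp: card_insert_if)
    have 2: "card (f ` (insert \<theta>' D \<inter> T)) = of_bool (\<theta>' \<in> T \<and> f \<theta>' \<notin> f ` (D \<inter> T)) + card (f ` (D \<inter> T))"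
      using finD by (cases "\<theta>' \<in> T") (auto simp: card_insert_if)
    have 3: "of_bool (\<exists>\<theta>. \<theta> \<in> inner_jumps (insert \<theta>' D) \<and> \<theta> \<notin> inner_jumps D) + card (inner_jumps D)
        \<le> card (inner_jumps (insert \<theta>' D))"
    proof -
      have sub: "inner_jumps D \<subseteq> inner_jumps (insert \<theta>' D)" by (auto simp: inner_jumps_def)
      show ?thesis
      proof (cases "\<exists>\<theta>. \<theta> \<in> inner_jumps (insert \<theta>' D) \<and> \<theta> \<notin> inner_jumps D")
        case True
        hence "inner_jumps D \<subset> inner_jumps (insert \<theta>' D)" using sub by blast
        hence "card (inner_jumps D) < card (inner_jumps (insert \<theta>' D))" by (intro psubset_card_mono) auto
        thus ?thesis by simp
      next
        case False
        have "card (inner_jumps D) \<le> card (inner_jumps (insert \<theta>' D))" using sub by (intro card_mono) auto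
        thus ?thesis by (simp only: of_bool_def False if_False add_0)
      qed
    qed
    show ?thesis
      using \<theta>' by (intro bexI[of _ \<theta>']) (use 1 2 3 le in linarith, simp)
  qed
  have old: "cl (px \<theta>') \<in> cls D \<and> cl (py \<theta>') \<in> cls D" if "f \<theta>' \<in> f ` (D \<inter> T)" for \<theta>'
    using that by (auto simp: cls_def px_def py_def)
  have "\<not> ((\<forall>\<theta>. \<theta> \<in> T \<longrightarrow> (\<theta> \<in> D \<longleftrightarrow> Suc \<theta> \<in> D)) \<and>
      (\<forall>\<theta> \<theta>'. \<theta> < N \<longrightarrow> \<theta>' < N \<longrightarrow> f \<theta> = f \<theta>' \<longrightarrow> (\<theta> \<in> D \<longleftrightarrow> \<theta>' \<in> D)))"
    using connected[of D] D by blast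
  then consider \<theta> where "\<theta> \<in> T" "\<theta> \<in> D" "Suc \<theta> \<notin> D" | \<theta> where "\<theta> \<in> T" "\<theta> \<notin> D" "Suc \<theta> \<in> D"
    | \<theta> \<theta>' where "\<theta> \<in> D" "\<theta>' \<notin> D" "\<theta>' < N" "f \<theta> = f \<theta>'" by metis
  thus ?thesis
  proof cases
    \<comment> \<open>Forward move: the component of the arrival can be new only after a jump, that
      of its image only with a new source.\<close>
    case 1
    have "\<theta> \<notin> J \<Longrightarrow> cl (px (Suc \<theta>)) \<in> cls D" using cl_move[of \<theta>] 1 by (auto simp: cls_def)
    moreover have "\<theta> \<in> J \<Longrightarrow> \<theta> \<in> inner_jumps (insert (Suc \<theta>) D) \<and> \<theta> \<notin> inner_jumps D"
      using 1 by (auto simp: inner_jumps_def)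
    ultimately have "of_bool (cl (px (Suc \<theta>)) \<notin> cls D) \<le>
       (of_bool (\<exists>\<theta>1. \<theta>1 \<in> inner_jumps (insert (Suc \<theta>) D) \<and> \<theta>1 \<notin> inner_jumps D) :: nat)"
      by (cases "\<theta> \<in> J") auto
    moreover have "of_bool (Suc \<theta> \<in> T \<and> cl (py (Suc \<theta>)) \<notin> cls D) \<le>
       (of_bool (Suc \<theta> \<in> T \<and> f (Suc \<theta>) \<notin> f ` (D \<inter> T)) :: nat)"
      using old[of "Suc \<theta>"] by (cases "f (Suc \<theta>) \<in> f ` (D \<inter> T)") auto
    ultimately show ?thesis
      by (intro key[of "Suc \<theta>"]) (use 1 T_Suc in blast, use 1 in blast, linarith)
  next
    \<comment> \<open>Backward move: with a new source, the source pays for the point and a jump, if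
      there is one, for the image.\<close>
    case 2
    have N: "\<theta> < N" using 2 T_less by auto
    show ?thesis
    proof (cases "f \<theta> \<in> f ` (D \<inter> T)")
      case True
      thus ?thesis using old[OF True] N 2 by (intro key[of \<theta>]) auto
    next
      case False
      have "\<theta> \<notin> J \<Longrightarrow> cl (py \<theta>) \<in> cls D" using cl_move[of \<theta>] 2 by (auto simp: cls_def)
      moreover have "\<theta> \<in> J \<Longrightarrow> \<theta> \<in> inner_jumps (insert \<theta> D) \<and> \<theta> \<notin> inner_jumps D"
        using 2 by (auto simp: inner_jumps_def)
      ultimately have "of_bool (\<theta> \<in> T \<and> cl (py \<theta>) \<notin> cls D) \<le>
         (of_bool (\<exists>\<theta>1. \<theta>1 \<in> inner_jumps (insert \<theta> D) \<and> \<theta>1 \<notin> inner_jumps D) :: nat)"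
        by (cases "\<theta> \<in> J") auto
      moreover have "of_bool (cl (px \<theta>) \<notin> cls D) \<le> (of_bool (\<theta> \<in> T \<and> f \<theta> \<notin> f ` (D \<inter> T)) :: nat)"
        using False 2 by auto
      ultimately show ?thesis
        by (intro key[of \<theta>]) (use N in blast, use 2 in blast, linarith)
    qed
  next
    case 3
    have x: "cl (px \<theta>') \<in> cls D" using 3 by (auto simp: cls_def px_def intro!: image_eqI[of _ _ \<theta>])
    have "of_bool (\<theta>' \<in> T \<and> cl (py \<theta>') \<notin> cls D) \<le>
       (of_bool (\<theta>' \<in> T \<and> f \<theta>' \<notin> f ` (D \<inter> T)) :: nat)"
      using old[of \<theta>'] by (cases "f \<theta>' \<in> f ` (D \<inter> T)") auto
    thus ?thesis using 3 x by (intro key[of \<theta>']) auto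
  qed
qed

text \<open>Iteration of \<open>grow_step\<close> up to the set of all times. For a stretch
  \<open>D\<close> of the walk it says that a connected part has at most as many independent cycles
  as the whole.\<close>

lemma grow:
  assumes "D \<subseteq> {..<N}" "D \<noteq> {}"
  shows "cc + (card (f ` (D \<inter> T)) + card (inner_jumps D)) \<le> card (cls D) + (card sources + card J)"
  using assms
proof (induction "card ({..<N} - D)" arbitrary: D rule: less_induct)
  case less
  show ?case
  proof (cases "D = {..<N}")
    case True
    have "inner_jumps {..<N} = J" using J_sub T_less T_Suc by (auto simp: inner_jumps_def)
    moreover have "{..<N} \<inter> T = T" using T_sub by auto
    ultimately show ?thesis using True by (simp add: cls_all sources_def)
  next
    case False
    then obtain \<theta>' where \<theta>': "\<theta>' \<in> {..<N} - D"
      "card (cls (insert \<theta>' D)) + (card (f ` (D \<inter> T)) + card (inner_jumps D))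
      \<le> card (cls D) + (card (f ` (insert \<theta>' D \<inter> T)) + card (inner_jumps (insert \<theta>' D)))"
      using grow_step less.prems by blast
    have "card ({..<N} - insert \<theta>' D) < card ({..<N} - D)"
      using \<theta>' by (intro psubset_card_mono) auto
    from less.hyps[OF this] less.prems \<theta>' show ?thesis by auto
  qed
qed

text \<open>\<open>grow\<close> from a single time; it makes the truncated subtraction in
  \<open>excess\<close> exact.\<close>

lemma cc_le: "cc \<le> card sources + 1 + card J"
proof -
  have "card (cls {0}) \<le> 1 + card (f ` ({0} \<inter> T))"
    by (cases "0 \<in> T") (auto simp: cls_def card_insert_if)
  thus ?thesis using grow[of "{0}"] N_pos by auto
qed

lemma excess_eq: "cc + excess = card sources + 1 + card J"
  using cc_le by (simp add: excess_def)

lemma card_nodes: "card nodes = card points + card images"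
  by (simp add: card_pattern_nodes points_def images_def)

lemma cc_le_nodes: "cc \<le> card nodes" by (simp add: ncomp_le_card)

text \<open>
  Times in \<open>{b..e}\<close> at which a point new to this stretch lies in a component already met there;
  each of them closes a cycle, hence the bound by the excess.
\<close>

definition revisits :: "nat \<Rightarrow> nat \<Rightarrow> nat set" where
  "revisits b e = {\<theta> \<in> {b..e}. (\<forall>s\<in>{b..<\<theta>}. f s \<noteq> f \<theta>) \<and> (\<exists>s\<in>{b..<\<theta>}. cl (px s) = cl (px \<theta>))}"

text \<open>\<open>grow\<close> for one stretch. An image not left by a jump lies in the component
  of the next point, and each revisit lets a new point share a component met earlier. As
  \<open>e\<close> is not a source, the stretch has at most one point more than sources.\<close>

lemma card_revisits_le:
  assumes "b \<le> e" "e < N" "{b..<e} \<subseteq> T" "e \<notin> T"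
  shows "card (revisits b e) \<le> excess"
proof -
  let ?D = "{b..e}"
  let ?R = "revisits b e"
  have fin: "finite ?R" by (simp add: revisits_def)
  have DT: "?D \<inter> T = {b..<e}" using assms by (auto simp: order.strict_iff_order)
  have ij: "inner_jumps ?D = J \<inter> {b..<e}" using assms J_sub by (auto simp: inner_jumps_def)
  have "cls ?D \<subseteq> (\<lambda>\<theta>. cl (px \<theta>)) ` ?D \<union> (\<lambda>\<theta>. cl (py \<theta>)) ` (J \<inter> {b..<e})"
  proof -
    have "cl (py \<theta>) \<in> (\<lambda>\<theta>. cl (px \<theta>)) ` ?D" if "\<theta> \<in> {b..<e}" "\<theta> \<notin> J" for \<theta>
      using cl_move[of \<theta>] that assms by (auto intro!: image_eqI[of _ _ "Suc \<theta>"])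
    thus ?thesis unfolding cls_def DT by blast
  qed
  hence "card (cls ?D) \<le> card ((\<lambda>\<theta>. cl (px \<theta>)) ` ?D \<union> (\<lambda>\<theta>. cl (py \<theta>)) ` (J \<inter> {b..<e}))"
    by (intro card_mono) auto
  also have "\<dots> \<le> card ((\<lambda>\<theta>. cl (px \<theta>)) ` ?D) + card (J \<inter> {b..<e})"
    by (rule order_trans[OF card_Un_le]) (simp add: card_image_le)
  finally have 1: "card (cls ?D) \<le> card ((\<lambda>\<theta>. cl (px \<theta>)) ` ?D) + card (J \<inter> {b..<e})" .
  have injR: "inj_on f ?R"
    by (rule inj_onI) (simp add: revisits_def, metis atLeastLessThan_iff nat_neq_iff)
  have "(\<lambda>\<theta>. cl (px \<theta>)) ` ?D \<subseteq> (\<lambda>i. cl (Inl i)) ` (f ` ?D - f ` ?R)"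
  proof (rule image_subsetI)
    fix \<theta> assume \<theta>: "\<theta> \<in> ?D"
    \<comment> \<open>The first time in a given component does not visit the point of a revisit. So
      the components are counted by the points which are not revisits.\<close>
    define \<mu> where "\<mu> = (LEAST \<mu>. \<mu> \<in> ?D \<and> cl (px \<mu>) = cl (px \<theta>))"
    have \<mu>: "\<mu> \<in> ?D" "cl (px \<mu>) = cl (px \<theta>)"
      using LeastI[of "\<lambda>\<mu>. \<mu> \<in> ?D \<and> cl (px \<mu>) = cl (px \<theta>)" \<theta>] \<theta> by (auto simp: \<mu>_def)
    have min: "\<mu> \<le> s" if "s \<in> ?D" "cl (px s) = cl (px \<theta>)" for s
      unfolding \<mu>_def using that by (intro Least_le) auto
    have "f \<mu> \<notin> f ` ?R"
    proof
      assume "f \<mu> \<in> f ` ?R"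
      then obtain \<rho> where \<rho>: "\<rho> \<in> ?R" "f \<mu> = f \<rho>" by auto
      then obtain s where s: "s \<in> {b..<\<rho>}" "cl (px s) = cl (px \<rho>)" and \<rho>D: "\<rho> \<in> ?D"
        and new: "\<forall>s\<in>{b..<\<rho>}. f s \<noteq> f \<rho>" by (auto simp: revisits_def)
      have "cl (px \<rho>) = cl (px \<theta>)" using \<rho> \<mu> by (simp add: px_def)
      hence "\<mu> \<le> s" using s \<rho>D by (intro min) auto
      hence "\<mu> \<in> {b..<\<rho>}" using s \<mu> by auto
      thus False using new \<rho> by auto
    qed
    hence "f \<mu> \<in> f ` ?D - f ` ?R" using \<mu>(1) by blast
    hence "cl (Inl (f \<mu>)) \<in> (\<lambda>i. cl (Inl i)) ` (f ` ?D - f ` ?R)" by (rule imageI)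
    thus "cl (px \<theta>) \<in> (\<lambda>i. cl (Inl i)) ` (f ` ?D - f ` ?R)"
      using \<mu>(2) by (simp add: px_def)
  qed
  hence "card ((\<lambda>\<theta>. cl (px \<theta>)) ` ?D) \<le> card (f ` ?D - f ` ?R)"
    by (meson card_image_le card_mono finite_Diff finite_atLeastAtMost finite_imageI order_trans)
  also have "\<dots> = card (f ` ?D) - card ?R"
    using injR fin by (subst card_Diff_subset) (auto simp: card_image revisits_def)
  finally have 2: "card ((\<lambda>\<theta>. cl (px \<theta>)) ` ?D) \<le> card (f ` ?D) - card ?R" .
  have 3: "card ?R \<le> card (f ` ?D)"
    using injR fin by (metis (no_types, lifting) card_image card_mono finite_atLeastAtMost finite_imageI
        image_mono mem_Collect_eq revisits_def subsetI)
  have "?D = insert e {b..<e}" using assms by auto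
  hence 4: "card (f ` ?D) \<le> card (f ` {b..<e}) + 1" by (simp add: card_insert_if)
  have "cc + (card (f ` {b..<e}) + card (J \<inter> {b..<e})) \<le> card (cls ?D) + (card sources + card J)"
  proof -
    have "?D \<subseteq> {..<N}" "?D \<noteq> {}" using assms by auto
    from grow[OF this] show ?thesis unfolding DT ij .
  qed
  hence "cc + card ?R \<le> card sources + 1 + card J" using 1 2 3 4 by linarith
  thus ?thesis using excess_eq by linarith
qed

definition "sharing = {i \<in> points. \<exists>i'\<in>points. i' \<noteq> i \<and> cl (Inl i') = cl (Inl i)}"

text \<open>Following an edge from an image leads to a point of the same component; the components
  without a point hold an image left by a jump, so \<open>J\<close> counts them.\<close>

lemma cc_le_points: "cc \<le> card ((\<lambda>i. cl (Inl i)) ` points) + card J"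
proof -
  have "cl ` nodes \<subseteq> (\<lambda>i. cl (Inl i)) ` points \<union> (\<lambda>\<theta>. cl (py \<theta>)) ` J"
  proof (rule image_subsetI)
    fix u assume "u \<in> nodes"
    then consider i where "i \<in> points" "u = Inl i" | \<theta> where "\<theta> \<in> T" "u = py \<theta>"
      by (auto simp: pattern_nodes_def points_def py_def)
    thus "cl u \<in> (\<lambda>i. cl (Inl i)) ` points \<union> (\<lambda>\<theta>. cl (py \<theta>)) ` J"
    proof cases
      case 2
      show ?thesis
      proof (cases "\<theta> \<in> J")
        case False
        hence "cl u = cl (Inl (f (Suc \<theta>)))" using 2 cl_move by (simp add: px_def)
        thus ?thesis using 2 T_Suc by (auto simp: points_def)
      qed (use 2 in auto)
    qed auto
  qed
  hence "cc \<le> card ((\<lambda>i. cl (Inl i)) ` points \<union> (\<lambda>\<theta>. cl (py \<theta>)) ` J)"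
    unfolding ncomp_def by (intro card_mono) auto
  also have "\<dots> \<le> card ((\<lambda>i. cl (Inl i)) ` points) + card J"
    by (rule order_trans[OF card_Un_le]) (simp add: card_image_le)
  finally show ?thesis .
qed

text \<open>\<open>cc_le_points\<close> shows that there are many classes of points when the excess
  is small; then \<open>card_colliding_le\<close> leaves few points that share one.\<close>

lemma card_sharing_le: "card sharing + 2 * card sources + 2 \<le> 2 * card points + 2 * excess"
  using card_colliding_le[OF fin_points, of "\<lambda>i. cl (Inl i)"] cc_le_points excess_eq
  unfolding sharing_def by linarith

text \<open>
  \<open>hist \<theta>\<close> consists of the edges used before time \<open>\<theta>\<close>, and \<open>linked \<theta>\<close> says that the edge of the
  move \<open>\<theta>\<close> closes a cycle with the earlier ones. The moves which are not linked form a forest.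
\<close>

definition hist :: "nat \<Rightarrow> ((nat + nat) \<times> (nat + nat)) set" where
  "hist \<theta> = (\<lambda>\<theta>'. (py \<theta>', px (Suc \<theta>'))) ` {\<theta>' \<in> T - J. Suc \<theta>' < \<theta>}"

definition linked :: "nat \<Rightarrow> bool" where
  "linked \<theta> \<longleftrightarrow> edge_comp (hist (Suc \<theta>)) (py \<theta>) = edge_comp (hist (Suc \<theta>)) (px (Suc \<theta>))"

lemma hist_mono: "\<theta> \<le> \<theta>' \<Longrightarrow> hist \<theta> \<subseteq> hist \<theta>'"
  by (auto simp: hist_def)

lemma hist_subset: "hist \<theta> \<subseteq> edges"
  by (auto simp: hist_def pattern_edges_def px_def py_def)

lemma hist_N: "hist N = edges"
  using T_Suc by (auto simp: hist_def pattern_edges_def px_def py_def)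

text \<open>\<open>hist k\<close> holds the moves arriving strictly before \<open>k\<close>; the
  move arriving at \<open>k\<close> itself enters with \<open>hist (Suc k)\<close>.\<close>

lemma hist_Suc: "hist (Suc k) = (if \<exists>\<theta>\<in>T - J. Suc \<theta> = k then insert (py (k - 1), px k) (hist k) else hist k)"
proof -
  have "{\<theta>' \<in> T - J. Suc \<theta>' < Suc k} = {\<theta>' \<in> T - J. Suc \<theta>' < k} \<union> {\<theta>' \<in> T - J. Suc \<theta>' = k}"
    by auto
  moreover have "{\<theta>' \<in> T - J. Suc \<theta>' = k} = (if \<exists>\<theta>\<in>T - J. Suc \<theta> = k then {k - 1} else {})"
    by auto
  moreover have "(\<exists>\<theta>\<in>T - J. Suc \<theta> = k) \<Longrightarrow> Suc (k - 1) = k" by auto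
  ultimately show ?thesis unfolding hist_def by (simp add: image_Un)
qed

text \<open>When the edges are added in the order of time, each move that is not linked lowers the
  number of components by one.\<close>

lemma cc_add_tree_le: "cc + card {\<theta> \<in> T - J. \<not> linked \<theta>} \<le> card nodes"
proof -
  have "ncomp nodes (hist k) + card {\<theta> \<in> T - J. \<not> linked \<theta> \<and> Suc \<theta> < k} \<le> card nodes" for k
  proof (induction k)
    case 0
    have "hist 0 = {}" by (simp add: hist_def)
    thus ?case by (simp add: ncomp_empty)
  next
    case (Suc k)
    show ?case
    proof (cases "\<exists>\<theta>\<in>T - J. Suc \<theta> = k")
      case False
      hence "{\<theta> \<in> T - J. \<not> linked \<theta> \<and> Suc \<theta> < Suc k} = {\<theta> \<in> T - J. \<not> linked \<theta> \<and> Suc \<theta> < k}"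
        by (auto simp: less_Suc_eq)
      moreover have "hist (Suc k) = hist k" using False by (subst hist_Suc) auto
      ultimately show ?thesis using Suc by simp
    next
      case True
      then obtain \<theta> where \<theta>: "\<theta> \<in> T - J" "Suc \<theta> = k" by auto
      have h: "hist (Suc k) = insert (py \<theta>, px (Suc \<theta>)) (hist k)" using True \<theta> by (subst hist_Suc) auto
      have mem: "py \<theta> \<in> nodes" "px (Suc \<theta>) \<in> nodes"
        using \<theta> T_Suc by (auto simp: pattern_nodes_def py_def px_def)
      have set: "{\<theta>' \<in> T - J. \<not> linked \<theta>' \<and> Suc \<theta>' < Suc k} =
         (if linked \<theta> then {} else {\<theta>}) \<union> {\<theta>' \<in> T - J. \<not> linked \<theta>' \<and> Suc \<theta>' < k}"
        using \<theta> by (auto simp: less_Suc_eq)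
      show ?thesis
      proof (cases "linked \<theta>")
        case True
        hence "ncomp nodes (hist (Suc k)) = ncomp nodes (hist k)"
          unfolding h using \<theta> by (intro ncomp_insert_same) (auto simp: linked_def)
        thus ?thesis using Suc set True by simp
      next
        case False
        hence "ncomp nodes (hist k) = Suc (ncomp nodes (hist (Suc k)))"
          unfolding h using \<theta> mem by (intro ncomp_insert) (auto simp: linked_def)
        moreover have "card {\<theta>' \<in> T - J. \<not> linked \<theta>' \<and> Suc \<theta>' < Suc k} =
            Suc (card {\<theta>' \<in> T - J. \<not> linked \<theta>' \<and> Suc \<theta>' < k})"
          unfolding set using False \<theta> by (simp add: card_insert_if)
        ultimately show ?thesis using Suc by simp
      qed
    qed
  qed
  from this[of N] have "cc + card {\<theta> \<in> T - J. \<not> linked \<theta> \<and> Suc \<theta> < N} \<le> card nodes"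
    by (simp add: hist_N)
  moreover have "{\<theta> \<in> T - J. \<not> linked \<theta> \<and> Suc \<theta> < N} = {\<theta> \<in> T - J. \<not> linked \<theta>}"
    using T_Suc by auto
  ultimately show ?thesis by simp
qed

section \<open>Merges and jumps are controlled by the excess\<close>

definition "starts = {\<theta>. \<theta> < N \<and> (\<forall>\<theta>'\<in>T. \<theta> \<noteq> Suc \<theta>')}"
text \<open>Two components are joined at an old point. Such an arrival is not predictable from the
  component of the image, so it has to be coded.\<close>

definition "merges = {\<theta> \<in> T - J. \<not> linked \<theta> \<and> f (Suc \<theta>) \<noteq> Suc \<theta>}"
definition "jumps_new = {\<theta> \<in> J. f (Suc \<theta>) = Suc \<theta>}"
definition "jumps_old = {\<theta> \<in> J. f (Suc \<theta>) \<noteq> Suc \<theta>}"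

lemma fin_defs [simp]: "finite starts" "finite merges" "finite jumps_new" "finite jumps_old"
  by (auto simp: starts_def merges_def jumps_new_def jumps_old_def)

lemma card_J: "card J = card jumps_new + card jumps_old"
proof -
  have "J = jumps_new \<union> jumps_old" by (auto simp: jumps_new_def jumps_old_def)
  moreover have "jumps_new \<inter> jumps_old = {}" by (auto simp: jumps_new_def jumps_old_def)
  ultimately show ?thesis by (metis card_Un_disjoint fin_defs(3,4))
qed

lemma points_eq: "points = {\<theta>. \<theta> < N \<and> f \<theta> = \<theta>}"
proof -
  have 1: "i < N \<and> f i = i" if i: "i \<in> points" for i
  proof -
    obtain \<theta> where "\<theta> < N" "i = f \<theta>" using i by (auto simp: points_def)
    thus ?thesis using f_less[of \<theta>] f_idem[of \<theta>] by simp
  qed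
  have 2: "i \<in> points" if "i < N" "f i = i" for i
    unfolding points_def by (rule image_eqI[of _ _ i]) (use that in auto)
  show ?thesis using 1 2 by blast
qed

lemma new_not_linked:
  assumes "\<theta> \<in> T - J" "f (Suc \<theta>) = Suc \<theta>"
  shows "\<not> linked \<theta>"
proof -
  have "edge_comp (hist (Suc \<theta>)) (px (Suc \<theta>)) = {px (Suc \<theta>)}"
  proof (rule edge_comp_isolated)
    fix x y assume "(x, y) \<in> hist (Suc \<theta>)"
    then obtain \<theta>' where \<theta>': "\<theta>' \<in> T" "Suc \<theta>' < Suc \<theta>" "x = py \<theta>'" "y = px (Suc \<theta>')"
      by (auto simp: hist_def)
    have "f (Suc \<theta>') < Suc \<theta>" using f_le[of "Suc \<theta>'"] \<theta>' T_Suc by force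
    thus "x \<noteq> px (Suc \<theta>) \<and> y \<noteq> px (Suc \<theta>)" using \<theta>' assms by (auto simp: py_def px_def)
  qed
  moreover have "py \<theta> \<in> edge_comp (hist (Suc \<theta>)) (py \<theta>)" "py \<theta> \<noteq> px (Suc \<theta>)"
    by (auto simp: py_def px_def)
  ultimately show ?thesis unfolding linked_def by (metis singletonD)
qed

text \<open>Every point is first met at a start, by an edge or by a jump, and the forest has to
  accommodate the edges to new points together with the merges. Eliminating \<open>cc\<close>
  through the excess bounds the unpredictable events.\<close>

lemma events_le: "card sources + 1 + card jumps_old + card merges \<le> excess + card (starts \<inter> points) + card images"
proof -
  let ?new = "{\<theta> \<in> T - J. f (Suc \<theta>) = Suc \<theta>}"
  have "points \<subseteq> (starts \<inter> points) \<union> Suc ` ?new \<union> Suc ` jumps_new"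
    by (auto simp: points_eq starts_def jumps_new_def)
  hence "card points \<le> card ((starts \<inter> points) \<union> Suc ` ?new \<union> Suc ` jumps_new)"
    by (intro card_mono) auto
  also have "\<dots> \<le> card (starts \<inter> points) + card ?new + card jumps_new"
    by (intro order_trans[OF card_Un_le] add_mono) (auto simp: card_image)
  finally have 1: "card points \<le> card (starts \<inter> points) + card ?new + card jumps_new" .
  have "?new \<union> merges \<subseteq> {\<theta> \<in> T - J. \<not> linked \<theta>}"
    using new_not_linked by (auto simp: merges_def)
  hence "card (?new \<union> merges) \<le> card {\<theta> \<in> T - J. \<not> linked \<theta>}"
    by (intro card_mono) auto
  moreover have "card (?new \<union> merges) = card ?new + card merges"
    by (intro card_Un_disjoint) (auto simp: merges_def)
  ultimately have "cc + card ?new + card merges \<le> card points + card images"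
    using cc_add_tree_le card_nodes by linarith
  thus ?thesis using 1 excess_eq card_J by linarith
qed

text \<open>By \<open>vis\<close> and \<open>tie\<close>, a new point reached by a jump is glued to
  another source or visited again. Until its next visit it is isolated in the history, since the
  jump contributed no edge; so this visit is a start, an old jump or a merge, all of which
  \<open>events_le\<close> controls.\<close>

lemma jumps_new_le:
  assumes vis: "\<And>i. i \<in> sources \<Longrightarrow>
      (\<exists>i'\<in>sources. i' \<noteq> i \<and> p i' = p i) \<or> (\<exists>\<theta>\<in>T. \<exists>\<theta>'\<in>T. \<theta> \<noteq> \<theta>' \<and> f \<theta> = i \<and> f \<theta>' = i)"
    and tie: "\<And>\<theta>. \<theta> < N \<Longrightarrow> \<theta> \<notin> T \<Longrightarrow> \<exists>\<theta>'<N. \<theta>' \<noteq> \<theta> \<and> f \<theta>' = f \<theta>"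
  shows "card jumps_new + 2 * card images \<le>
    card starts + card jumps_old + card merges + 2 * card sources"
proof -
  define Coll where "Coll = {i \<in> sources. \<exists>i'\<in>sources. i' \<noteq> i \<and> p i' = p i}"
  define Rv where "Rv = {i. \<exists>\<theta>\<in>jumps_new. i = Suc \<theta> \<and> (\<exists>\<phi><N. \<phi> > i \<and> f \<phi> = i)}"
  define Z where "Z = starts \<union> Suc ` jumps_old \<union> Suc ` merges"
  have "Suc ` jumps_new \<subseteq> Coll \<union> Rv"
  proof (rule image_subsetI)
    fix \<theta> assume \<theta>: "\<theta> \<in> jumps_new"
    hence fS: "f (Suc \<theta>) = Suc \<theta>" "\<theta> \<in> T" using J_sub by (auto simp: jumps_new_def)
    have lt: "Suc \<theta> < N" using fS T_Suc by auto
    have rv: "Suc \<theta> \<in> Rv" if "\<phi> < N" "\<phi> \<noteq> Suc \<theta>" "f \<phi> = Suc \<theta>" for \<phi>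
      using that f_le[of \<phi>] \<theta> by (auto simp: Rv_def intro!: bexI[of _ \<theta>] exI[of _ \<phi>])
    show "Suc \<theta> \<in> Coll \<union> Rv"
    proof (cases "Suc \<theta> \<in> T")
      case True
      hence "Suc \<theta> \<in> sources" using fS by (force simp: sources_def)
      from vis[OF this] show ?thesis
      proof
        assume "\<exists>i'\<in>sources. i' \<noteq> Suc \<theta> \<and> p i' = p (Suc \<theta>)"
        thus ?thesis using \<open>Suc \<theta> \<in> sources\<close> by (auto simp: Coll_def)
      next
        assume "\<exists>\<theta>1\<in>T. \<exists>\<theta>'\<in>T. \<theta>1 \<noteq> \<theta>' \<and> f \<theta>1 = Suc \<theta> \<and> f \<theta>' = Suc \<theta>"
        then obtain \<theta>1 \<theta>2 where "\<theta>1 \<in> T" "\<theta>2 \<in> T" "\<theta>1 \<noteq> \<theta>2" "f \<theta>1 = Suc \<theta>" "f \<theta>2 = Suc \<theta>" by blast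
        thus ?thesis using rv T_less by (cases "\<theta>1 = Suc \<theta>") auto
      qed
    next
      case False
      from tie[OF lt this] rv fS show ?thesis by auto
    qed
  qed
  hence "card (Suc ` jumps_new) \<le> card (Coll \<union> Rv)"
    by (intro card_mono) (auto simp: Coll_def Rv_def intro: finite_subset[of _ "Suc ` jumps_new"])
  also have "\<dots> \<le> card Coll + card Rv" by (rule card_Un_le)
  finally have 1: "card jumps_new \<le> card Coll + card Rv" by (simp add: card_image)
  have 2: "card Coll + 2 * card images \<le> 2 * card sources"
    using card_colliding_le[OF fin_sources, of p] by (simp add: Coll_def images_def sources_def)
  have "Rv \<subseteq> f ` Z"
  proof
    fix i assume "i \<in> Rv"
    then obtain \<theta> where \<theta>: "\<theta> \<in> jumps_new" "i = Suc \<theta>" and ex: "\<exists>\<phi>. \<phi> < N \<and> \<phi> > i \<and> f \<phi> = i"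
      by (auto simp: Rv_def)
    define \<phi> where "\<phi> = (LEAST \<phi>. \<phi> < N \<and> \<phi> > i \<and> f \<phi> = i)"
    have \<phi>: "\<phi> < N" "\<phi> > i" "f \<phi> = i" using LeastI_ex[OF ex] by (auto simp: \<phi>_def)
    have min: "f \<psi> \<noteq> i" if "\<psi> < \<phi>" "\<psi> > i" for \<psi>
      using not_less_Least[of \<psi> "\<lambda>\<phi>. \<phi> < N \<and> \<phi> > i \<and> f \<phi> = i"] that \<phi> by (auto simp: \<phi>_def)
    have "\<phi> \<in> Z"
    proof (cases "\<phi> \<in> starts")
      case False
      then obtain \<theta>' where \<theta>': "\<theta>' \<in> T" "\<phi> = Suc \<theta>'" using \<phi> by (auto simp: starts_def)
      show ?thesis
      proof (cases "\<theta>' \<in> J")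
        case True
        thus ?thesis using \<theta>' \<phi> by (auto simp: Z_def jumps_old_def)
      next
        case False
        have "edge_comp (hist (Suc \<theta>')) (px (Suc \<theta>')) = {px (Suc \<theta>')}"
        proof (rule edge_comp_isolated)
          fix x y assume "(x, y) \<in> hist (Suc \<theta>')"
          then obtain \<rho> where \<rho>: "\<rho> \<in> T - J" "Suc \<rho> < \<phi>" "x = py \<rho>" "y = px (Suc \<rho>)"
            using \<theta>' by (auto simp: hist_def)
          have "f (Suc \<rho>) \<noteq> i"
          proof
            assume a: "f (Suc \<rho>) = i"
            hence "i \<le> Suc \<rho>" using f_le[of "Suc \<rho>"] \<rho> \<phi> by auto
            hence "Suc \<rho> = i" using min[of "Suc \<rho>"] \<rho> a by force
            thus False using \<theta> \<rho> by (auto simp: jumps_new_def)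
          qed
          thus "x \<noteq> px (Suc \<theta>') \<and> y \<noteq> px (Suc \<theta>')" using \<rho> \<phi> \<theta>' by (auto simp: py_def px_def)
        qed
        moreover have "py \<theta>' \<in> edge_comp (hist (Suc \<theta>')) (py \<theta>')" "py \<theta>' \<noteq> px (Suc \<theta>')"
          by (auto simp: py_def px_def)
        ultimately have "\<not> linked \<theta>'" unfolding linked_def by (metis singletonD)
        thus ?thesis using False \<theta>' \<phi> by (auto simp: Z_def merges_def)
      qed
    qed (simp add: Z_def)
    thus "i \<in> f ` Z" using \<phi>(3) by auto
  qed
  hence "card Rv \<le> card (f ` Z)" by (intro card_mono) (auto simp: Z_def)
  also have "\<dots> \<le> card Z" by (intro card_image_le) (auto simp: Z_def)
  also have "\<dots> \<le> card starts + card jumps_old + card merges"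
    unfolding Z_def by (intro order_trans[OF card_Un_le] add_mono) (auto simp: card_image)
  finally show ?thesis using 1 2 by linarith
qed

text \<open>Each image serves at least two moves, because its source is glued to another one or left
  twice. This is where one power of \<open>r\<close> is gained for every two moves.\<close>

lemma card_images_le:
  assumes "\<And>i. i \<in> sources \<Longrightarrow>
      (\<exists>i'\<in>sources. i' \<noteq> i \<and> p i' = p i) \<or> (\<exists>\<theta>\<in>T. \<exists>\<theta>'\<in>T. \<theta> \<noteq> \<theta>' \<and> f \<theta> = i \<and> f \<theta>' = i)"
  shows "2 * card images \<le> card T"
proof -
  have "2 * card images = (\<Sum>k\<in>images. 2)" by simp
  also have "\<dots> \<le> (\<Sum>k\<in>images. card {\<theta> \<in> T. p (f \<theta>) = k})"
  proof (rule sum_mono)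
    fix k assume "k \<in> images"
    then obtain i where i: "i \<in> sources" "k = p i" by (auto simp: images_def sources_def)
    from assms[OF i(1)] obtain \<theta> \<theta>' where t: "\<theta> \<in> T" "\<theta>' \<in> T" "\<theta> \<noteq> \<theta>'" "p (f \<theta>) = k" "p (f \<theta>') = k"
    proof
      assume "\<exists>i'\<in>sources. i' \<noteq> i \<and> p i' = p i"
      then obtain i' where "i' \<in> sources" "i' \<noteq> i" "p i' = p i" by blast
      moreover obtain \<theta> \<theta>' where "\<theta> \<in> T" "\<theta>' \<in> T" "i = f \<theta>" "i' = f \<theta>'"
        using i \<open>i' \<in> sources\<close> by (auto simp: sources_def)
      ultimately show ?thesis using that[of \<theta> \<theta>'] i by auto
    next
      assume "\<exists>\<theta>\<in>T. \<exists>\<theta>'\<in>T. \<theta> \<noteq> \<theta>' \<and> f \<theta> = i \<and> f \<theta>' = i"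
      thus ?thesis using that i by auto
    qed
    hence "card {\<theta>, \<theta>'} \<le> card {\<theta> \<in> T. p (f \<theta>) = k}" by (intro card_mono) auto
    thus "2 \<le> card {\<theta> \<in> T. p (f \<theta>) = k}" using t by simp
  qed
  also have "\<dots> = card T"
  proof -
    have "(\<Sum>k\<in>(\<lambda>\<theta>. p (f \<theta>)) ` T. \<Sum>\<theta> | \<theta> \<in> T \<and> p (f \<theta>) = k. (1::nat)) = (\<Sum>\<theta>\<in>T. 1)"
      by (rule sum.image_gen[symmetric]) simp
    thus ?thesis by (simp add: images_def image_image)
  qed
  finally show ?thesis .
qed

end

text \<open>Once \<open>cc\<close> is expressed by the excess, the powers of \<open>n\<close>
  collapse to a single \<open>n\<close> and a factor \<open>r / n\<close> per unit of
  excess.\<close>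

lemma (in regular_graph) weight_eq:
  assumes "walk_pattern N T f p J"
  shows "weight N T f p J =
    real n * (real r / real n) ^ walk_pattern.excess N T f p J *
    real r ^ (card (f ` {..<N}) + card (p ` f ` T)) / real r ^ (card (f ` T) + 1 + card T)"
proof -
  interpret walk_pattern N T f p J by fact
  have a: "cc + excess = card (f ` T) + 1 + card J" using excess_eq by (simp add: sources_def)
  have c: "card (T - J) + card J = card T"
    using J_sub card_Diff_subset[OF finJ J_sub] card_mono[OF finT J_sub] by simp
  have d: "card nodes = card (f ` {..<N}) + card (p ` f ` T)"
    using card_nodes by (simp add: points_def images_def)
  have b: "cc \<le> card nodes" by (rule cc_le_nodes)
  have n0: "real n > 0" and r0: "real r > 0" using n_pos r_pos by auto
  have e1: "real n ^ cc * real n ^ excess = real n * real n ^ card (f ` T) * real n ^ card J"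
    unfolding power_add[symmetric] a by (simp add: power_add)
  have "(card nodes - cc) + (card (f ` T) + 1 + card T) + cc =
      excess + card nodes + (card (T - J)) + cc"
    using a b c by linarith
  hence "(card nodes - cc) + (card (f ` T) + 1 + card T) = excess + card nodes + card (T - J)"
    by linarith
  hence e2: "real r ^ (card nodes - cc) * real r ^ (card (f ` T) + 1 + card T) =
      real r ^ excess * real r ^ card nodes * real r ^ card (T - J)"
    unfolding power_add[symmetric] by simp
  \<comment> \<open>Named powers turn the claim into a rational identity free of truncated
    subtraction.\<close>
  define A B C D where "A = real n ^ cc" and "B = real n ^ excess"
    and "C = real n ^ card (f ` T)" and "D = real n ^ card J"
  define A' B' C' D' E' where "A' = real r ^ (card nodes - cc)" and "B' = real r ^ (card (f ` T) + 1 + card T)"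
    and "C' = real r ^ excess" and "D' = real r ^ card nodes" and "E' = real r ^ card (T - J)"
  have pos: "A > 0" "B > 0" "C > 0" "D > 0" "A' > 0" "B' > 0" "C' > 0" "D' > 0" "E' > 0"
    using n0 r0 by (auto simp: A_def B_def C_def D_def A'_def B'_def C'_def D'_def E'_def)
  have "A * B = real n * C * D" "A' * B' = C' * D' * E'"
    using e1 e2 by (simp_all add: A_def B_def C_def D_def A'_def B'_def C'_def D'_def E'_def)
  hence AB: "A = real n * C * D / B" "A' = C' * D' * E' / B'" using pos by (simp_all add: field_simps)
  have "A * A' / (C * E' * D) = real n * (C' / B) * D' / B'"
    unfolding AB using pos by (simp add: field_simps)
  thus ?thesis
    unfolding weight_def d[symmetric] A_def B_def C_def D_def A'_def B'_def C'_def D'_def E'_def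
    by (simp add: power_divide)
qed

section \<open>Counting patterns by codes\<close>

text \<open>Codes with default value 0: only the exceptions carry information. Values up to
  \<open>N\<close>, not below it, leave room for storing a time shifted by one.\<close>

definition sparse :: "nat \<Rightarrow> nat \<Rightarrow> (nat \<Rightarrow> nat) set" where
  "sparse N u = {c \<in> {..<N} \<rightarrow>\<^sub>E {..N}. card {\<theta>. \<theta> < N \<and> c \<theta> \<noteq> 0} \<le> u}"

lemma finite_sparse [simp]: "finite (sparse N u)"
  unfolding sparse_def by (rule finite_subset[OF _ finite_PiE[of "{..<N}" "\<lambda>_. {..N}"]]) auto

text \<open>The generating function of the number of exceptions: each time contributes 1 for the
  default and \<open>w\<close> for each of the \<open>N\<close> other values.\<close>

lemma sum_inverse_pow:
  fixes w :: real
  shows "(\<Sum>c\<in>{..<N} \<rightarrow>\<^sub>E {..N}. w ^ card {\<theta>. \<theta> < N \<and> c \<theta> \<noteq> 0}) = (1 + N * w) ^ N"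
proof -
  have "(\<Sum>c\<in>{..<N} \<rightarrow>\<^sub>E {..N}. w ^ card {\<theta>. \<theta> < N \<and> c \<theta> \<noteq> 0}) =
      (\<Sum>c\<in>{..<N} \<rightarrow>\<^sub>E {..N}. \<Prod>\<theta><N. if c \<theta> = 0 then 1 else w)"
  proof (rule sum.cong[OF refl])
    fix c :: "nat \<Rightarrow> nat"
    have "(\<Prod>\<theta><N. if c \<theta> = 0 then 1 else w) = (\<Prod>\<theta> | \<theta> < N \<and> c \<theta> \<noteq> 0. w)"
      by (simp add: prod.If_cases Int_def Collect_neg_eq[symmetric])
    thus "w ^ card {\<theta>. \<theta> < N \<and> c \<theta> \<noteq> 0} = (\<Prod>\<theta><N. if c \<theta> = 0 then 1 else w)" by simp
  qed
  also have "\<dots> = (\<Prod>\<theta><N. \<Sum>k\<le>N. if k = 0 then 1 else w)"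
    by (rule prod_sum_PiE[symmetric]) auto
  also have "(\<Sum>k\<le>N. if k = 0 then 1 else w) = 1 + N * w"
  proof -
    have "{..N} = insert 0 {1..N}" by auto
    thus ?thesis by simp
  qed
  finally show ?thesis by simp
qed

text \<open>With weight \<open>1 / N^2\<close> per exception the generating function is
  \<open>(1 + 1 / N)^N\<close>, at most 3, while every code in the set weighs at least
  \<open>N^(- 2 u)\<close>.\<close>

lemma card_sparse_le:
  assumes "N > 0"
  shows "real (card (sparse N u)) \<le> 3 * real N ^ (2 * u)"
proof -
  let ?w = "1 / real N ^ 2"
  have "real (card (sparse N u)) * ?w ^ u = (\<Sum>c\<in>sparse N u. ?w ^ u)" by simp
  also have "\<dots> \<le> (\<Sum>c\<in>sparse N u. ?w ^ card {\<theta>. \<theta> < N \<and> c \<theta> \<noteq> 0})"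
    using assms by (intro sum_mono power_decreasing) (auto simp: sparse_def)
  also have "\<dots> \<le> (\<Sum>c\<in>{..<N} \<rightarrow>\<^sub>E {..N}. ?w ^ card {\<theta>. \<theta> < N \<and> c \<theta> \<noteq> 0})"
    by (intro sum_mono2 finite_PiE) (auto simp: sparse_def)
  also have "\<dots> = (1 + N * ?w) ^ N" by (rule sum_inverse_pow)
  also have "\<dots> = (1 + 1 / real N) ^ N" using assms by (simp add: power2_eq_square)
  also have "\<dots> \<le> exp (1 / real N) ^ N"
    by (intro power_mono exp_ge_add_one_self) auto
  also have "\<dots> = exp 1" using assms by (simp add: exp_of_nat_mult[symmetric])
  also have "\<dots> \<le> 3" by (rule exp_le)
  finally have "real (card (sparse N u)) * ?w ^ u \<le> 3" .
  moreover have "?w ^ u = 1 / real N ^ (2 * u)" by (simp add: power_divide power_mult)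
  ultimately show ?thesis using assms by (simp add: divide_le_eq)
qed

text \<open>The values other than \<open>y\<close> all come from outside the fibre.\<close>

lemma card_fibre_le:
  assumes "finite X"
  shows "card {x \<in> X. c x = y} + card (c ` X) \<le> card X + 1"
proof -
  let ?F = "{x \<in> X. c x = y}"
  have "c ` X \<subseteq> insert y (c ` (X - ?F))" by auto
  hence "card (c ` X) \<le> card (insert y (c ` (X - ?F)))" using assms by (intro card_mono) auto
  also have "\<dots> \<le> Suc (card (c ` (X - ?F)))" by (rule card_insert_le_m1) auto
  also have "card (c ` (X - ?F)) \<le> card (X - ?F)" using assms by (intro card_image_le) auto
  also have "card (X - ?F) = card X - card ?F" using assms by (intro card_Diff_subset) auto
  finally show ?thesis using card_mono[of X ?F] assms by fastforce
qed

text \<open>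
  \<open>cand T f \<pi> J \<theta>\<close> is the set of earlier points which the walk may reach at time \<open>\<theta>\<close> without
  merging two components. It depends only on the past of \<open>\<theta>\<close>, so that a walk can be recovered
  step by step from a code.
\<close>

definition hist_edges where
  "hist_edges T f \<pi> J \<theta> =
     (\<lambda>\<theta>'. (Inr (\<pi> (f \<theta>')) :: nat + nat, Inl (f (Suc \<theta>')) :: nat + nat)) ` {\<theta>' \<in> T - J. Suc \<theta>' < \<theta>}"

definition cand :: "nat set \<Rightarrow> (nat \<Rightarrow> nat) \<Rightarrow> (nat \<Rightarrow> nat) \<Rightarrow> nat set \<Rightarrow> nat \<Rightarrow> nat set" where
  "cand T f \<pi> J \<theta> = {a \<in> f ` {..<\<theta>}.
     edge_comp (hist_edges T f \<pi> J \<theta>) (Inr (\<pi> (f (\<theta> - 1)))) = edge_comp (hist_edges T f \<pi> J \<theta>) (Inl a)}"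

lemma cand_cong:
  assumes "\<And>s. s < \<theta> \<Longrightarrow> f s = f' s" "\<theta> > 0"
  shows "cand T f \<pi> J \<theta> = cand T f' \<pi> J \<theta>"
proof -
  have "hist_edges T f \<pi> J \<theta> = hist_edges T f' \<pi> J \<theta>"
    unfolding hist_edges_def using assms by (intro image_cong) auto
  moreover have "f ` {..<\<theta>} = f' ` {..<\<theta>}" using assms by (intro image_cong) auto
  ultimately show ?thesis unfolding cand_def using assms by simp
qed

lemma finite_cand [simp]: "finite (cand T f \<pi> J \<theta>)"
  by (simp add: cand_def)

text \<open>A function on all times, not only on the sources, so that the merging can be decoded
  before \<open>f\<close> is known; 0 stands for a point that is not moved.\<close>

definition merge_code :: "nat \<Rightarrow> nat set \<Rightarrow> (nat \<Rightarrow> nat) \<Rightarrow> (nat \<Rightarrow> nat) \<Rightarrow> nat \<Rightarrow> nat" where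
  "merge_code N T f p = restrict (\<lambda>i. if i \<in> f ` T \<and> p i \<noteq> i then p i + 1 else 0) {..<N}"

definition merge_decode :: "(nat \<Rightarrow> nat) \<Rightarrow> nat \<Rightarrow> nat" where
  "merge_decode c i = (if c i = 0 then i else c i - 1)"

locale good_pattern = walk_pattern +
  assumes f_ext: "f \<in> {..<N} \<rightarrow>\<^sub>E {..<N}" and p_ext: "p \<in> f ` T \<rightarrow>\<^sub>E f ` T"
    and p_idem: "\<And>i. i \<in> f ` T \<Longrightarrow> p (p i) = p i"
begin

definition "mc = merge_code N T f p"

lemma source_less: "i \<in> f ` T \<Longrightarrow> i < N"
  using f_less T_less by auto

lemma merge_decode_mc: "i \<in> f ` T \<Longrightarrow> merge_decode mc i = p i"
  using source_less by (auto simp: merge_decode_def mc_def merge_code_def)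

lemma hist_edges_eq: "hist_edges T f (merge_decode mc) J \<theta> = hist \<theta>"
  unfolding hist_edges_def hist_def py_def px_def by (intro image_cong) (auto simp: merge_decode_mc)

abbreviation "cnd \<equiv> cand T f (merge_decode mc) J"

lemma cnd_iff: "\<theta> \<in> T \<Longrightarrow> a \<in> cnd (Suc \<theta>) \<longleftrightarrow>
    a \<in> f ` {..\<theta>} \<and> edge_comp (hist (Suc \<theta>)) (py \<theta>) = edge_comp (hist (Suc \<theta>)) (Inl a)"
  by (auto simp: cand_def hist_edges_eq merge_decode_mc py_def lessThan_Suc_atMost)

lemma linked_iff: "\<theta> \<in> T \<Longrightarrow> f (Suc \<theta>) \<noteq> Suc \<theta> \<Longrightarrow> linked \<theta> \<longleftrightarrow> f (Suc \<theta>) \<in> cnd (Suc \<theta>)"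
proof -
  assume a: "\<theta> \<in> T" "f (Suc \<theta>) \<noteq> Suc \<theta>"
  have "f (Suc \<theta>) \<le> \<theta>" using f_le[OF T_Suc[OF a(1)]] a by simp
  moreover have "f (Suc \<theta>) = f (f (Suc \<theta>))" using f_idem T_Suc a by simp
  ultimately have "f (Suc \<theta>) \<in> f ` {..\<theta>}" by (metis atMost_iff image_eqI)
  thus ?thesis using a by (auto simp: cnd_iff linked_def px_def)
qed

lemma images_sub: "images \<subseteq> sources"
  using p_mem by (auto simp: images_def sources_def)

lemma card_images_le_sources: "card images \<le> card sources"
  using images_sub by (intro card_mono) auto

text \<open>By idempotence a source that is moved is not an image.\<close>

lemma card_nonfixed: "card {\<theta>. \<theta> < N \<and> mc \<theta> \<noteq> 0} + card images \<le> card sources"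
proof -
  have "{\<theta>. \<theta> < N \<and> mc \<theta> \<noteq> 0} \<subseteq> sources - images"
    using p_idem by (auto simp: mc_def merge_code_def sources_def images_def split: if_splits)
  hence "card {\<theta>. \<theta> < N \<and> mc \<theta> \<noteq> 0} \<le> card (sources - images)" by (intro card_mono) auto
  also have "\<dots> = card sources - card images" using images_sub by (intro card_Diff_subset) auto
  finally show ?thesis using card_images_le_sources by linarith
qed

lemma card_starts_points: "card (starts \<inter> points) \<le> card starts"
  by (intro card_mono) auto

lemma mc_sparse: "mc \<in> sparse N (excess + card starts)"
proof -
  have "mc \<in> {..<N} \<rightarrow>\<^sub>E {..N}"
    using p_mem source_less by (auto simp: mc_def merge_code_def Suc_le_eq)
  moreover have "card {\<theta>. \<theta> < N \<and> mc \<theta> \<noteq> 0} \<le> excess + card starts"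
    using card_nonfixed events_le card_starts_points by linarith
  ultimately show ?thesis by (simp add: sparse_def)
qed

text \<open>All candidates lie in the final component of one image, and a large fibre leaves few
  classes: \<open>card_fibre_le\<close> against \<open>cc_le_points\<close>.\<close>

lemma card_cnd_le: "\<theta> \<in> T \<Longrightarrow> card (cnd (Suc \<theta>)) + card sources \<le> card points + excess"
proof -
  assume \<theta>: "\<theta> \<in> T"
  have "cnd (Suc \<theta>) \<subseteq> {a \<in> points. cl (Inl a) = cl (py \<theta>)}"
  proof
    fix a assume a: "a \<in> cnd (Suc \<theta>)"
    then obtain s where s: "s \<le> \<theta>" "a = f s" using \<theta> by (auto simp: cnd_iff)
    have "edge_comp (hist (Suc \<theta>)) (py \<theta>) = edge_comp (hist (Suc \<theta>)) (Inl a)"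
      using a \<theta> by (simp add: cnd_iff)
    hence "cl (py \<theta>) = cl (Inl a)" by (rule edge_comp_eq_mono[OF hist_subset])
    moreover have "s < N" using s T_less[OF \<theta>] by simp
    ultimately show "a \<in> {a \<in> points. cl (Inl a) = cl (py \<theta>)}" using s by (simp add: points_def)
  qed
  hence "card (cnd (Suc \<theta>)) \<le> card {a \<in> points. cl (Inl a) = cl (py \<theta>)}" by (intro card_mono) auto
  thus ?thesis
    using card_fibre_le[OF fin_points, of "\<lambda>a. cl (Inl a)" "cl (py \<theta>)"] cc_le_points excess_eq by linarith
qed

definition "follows \<theta> \<longleftrightarrow> (\<exists>\<theta>'\<in>T - J. \<theta> = Suc \<theta>' \<and> f \<theta> \<in> cnd \<theta>)"

text \<open>The crude code. At an old point reached by an edge that closes a cycle it stores the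
  rank among the candidates, a number bounded in terms of the excess; at the other old points
  \<open>ptr_code\<close> stores the first visit.\<close>

definition "rank_code = restrict (\<lambda>\<theta>. if f \<theta> \<noteq> \<theta> \<and> follows \<theta> then Suc (card {a \<in> cnd \<theta>. a < f \<theta>}) else 0) {..<N}"
definition "ptr_code = restrict (\<lambda>\<theta>. if f \<theta> \<noteq> \<theta> \<and> \<not> follows \<theta> then Suc (f \<theta>) else 0) {..<N}"

lemma rank_code_PiE:
  assumes "card points \<le> card sources + e"
  shows "rank_code \<in> {..<N} \<rightarrow>\<^sub>E {..excess + e}"
proof (rule PiE_I)
  fix \<theta> assume N: "\<theta> \<in> {..<N}"
  show "rank_code \<theta> \<in> {..excess + e}"
  proof (cases "\<theta> < N \<and> f \<theta> \<noteq> \<theta> \<and> follows \<theta>")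
    case True
    then obtain \<theta>' where \<theta>': "\<theta>' \<in> T - J" "\<theta> = Suc \<theta>'" "f \<theta> \<in> cnd \<theta>" by (auto simp: follows_def)
    have "{a \<in> cnd \<theta>. a < f \<theta>} \<subset> cnd \<theta>" using \<theta>' by auto
    hence "card {a \<in> cnd \<theta>. a < f \<theta>} < card (cnd \<theta>)" by (intro psubset_card_mono) auto
    moreover have "card (cnd \<theta>) \<le> excess + e" using card_cnd_le[of \<theta>'] \<theta>' assms by auto
    ultimately show ?thesis using True by (simp add: rank_code_def)
  qed (use N in \<open>auto simp: rank_code_def\<close>)
qed (simp add: rank_code_def)

text \<open>A pointer is needed only at a start, after a jump to an old point and after a
  merge.\<close>

lemma ptr_code_sparse: "ptr_code \<in> sparse N (excess + 2 * card starts)"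
proof -
  have PiE: "ptr_code \<in> {..<N} \<rightarrow>\<^sub>E {..N}"
    using f_less by (auto simp: ptr_code_def Suc_le_eq)
  have "{\<theta>. \<theta> < N \<and> ptr_code \<theta> \<noteq> 0} \<subseteq> starts \<union> Suc ` jumps_old \<union> Suc ` merges"
  proof
    fix \<theta> assume "\<theta> \<in> {\<theta>. \<theta> < N \<and> ptr_code \<theta> \<noteq> 0}"
    hence \<theta>: "\<theta> < N" "f \<theta> \<noteq> \<theta>" "\<not> follows \<theta>" by (auto simp: ptr_code_def split: if_splits)
    show "\<theta> \<in> starts \<union> Suc ` jumps_old \<union> Suc ` merges"
    proof (cases "\<theta> \<in> starts")
      case False
      then obtain \<theta>' where \<theta>': "\<theta>' \<in> T" "\<theta> = Suc \<theta>'" using \<theta> by (auto simp: starts_def)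
      thus ?thesis using \<theta> linked_iff[of \<theta>']
        by (cases "\<theta>' \<in> J") (auto simp: jumps_old_def merges_def follows_def)
    qed simp
  qed
  hence "card {\<theta>. \<theta> < N \<and> ptr_code \<theta> \<noteq> 0} \<le> card (starts \<union> Suc ` jumps_old \<union> Suc ` merges)"
    by (intro card_mono) auto
  also have "\<dots> \<le> card starts + card jumps_old + card merges"
    by (intro order_trans[OF card_Un_le] add_mono) (auto simp: card_image)
  also have "\<dots> \<le> excess + 2 * card starts"
    using events_le card_starts_points card_images_le_sources by linarith
  finally show ?thesis using PiE by (simp add: sparse_def)
qed

end

lemma merge_code_inj:
  assumes "good_pattern N T f p J" "good_pattern N T f p' J'"
    "merge_code N T f p = merge_code N T f p'"
  shows "p = p'"
proof -
  interpret A: good_pattern N T f p J by fact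
  interpret B: good_pattern N T f p' J' by fact
  have "p i = p' i" if "i \<in> f ` T" for i
    using that A.merge_decode_mc B.merge_decode_mc assms(3) by (simp add: A.mc_def B.mc_def)
  thus ?thesis by (intro PiE_ext[OF A.p_ext B.p_ext])
qed

text \<open>By induction on time: patterns that agree before \<open>\<theta>\<close> have the same
  candidates at \<open>\<theta>\<close>, and the rank determines one of them.\<close>

lemma crude_code_inj:
  assumes "good_pattern N T f p J" "good_pattern N T f' p' J"
    "merge_code N T f p = merge_code N T f' p'"
    "good_pattern.rank_code N T f p J = good_pattern.rank_code N T f' p' J"
    "good_pattern.ptr_code N T f p J = good_pattern.ptr_code N T f' p' J"
  shows "f = f' \<and> p = p'"
proof -
  interpret A: good_pattern N T f p J by fact
  interpret B: good_pattern N T f' p' J by fact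
  have mc: "A.mc = B.mc" using assms(3) by (simp add: A.mc_def B.mc_def)
  have "f \<theta> = f' \<theta>" if "\<theta> < N" for \<theta>
    using that
  proof (induction \<theta> rule: less_induct)
    case (less \<theta>)
    have IH: "\<And>s. s < \<theta> \<Longrightarrow> f s = f' s" using less by auto
    have p: "A.ptr_code \<theta> = B.ptr_code \<theta>" and r: "A.rank_code \<theta> = B.rank_code \<theta>" using assms by auto
    show ?case
    proof (cases "A.ptr_code \<theta> = 0 \<and> A.rank_code \<theta> \<noteq> 0")
      case True
      have fa: "f \<theta> \<noteq> \<theta>" "A.follows \<theta>" and ra: "A.rank_code \<theta> = Suc (card {a \<in> A.cnd \<theta>. a < f \<theta>})"
        using True less.prems by (auto simp: A.rank_code_def split: if_splits)
      have fb: "f' \<theta> \<noteq> \<theta>" "B.follows \<theta>" and rb: "B.rank_code \<theta> = Suc (card {a \<in> B.cnd \<theta>. a < f' \<theta>})"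
        using True less.prems r by (auto simp: B.rank_code_def split: if_splits)
      have "\<theta> > 0" using fa by (auto simp: A.follows_def)
      hence c: "A.cnd \<theta> = B.cnd \<theta>" using IH mc cand_cong by metis
      have m: "f \<theta> \<in> A.cnd \<theta>" "f' \<theta> \<in> A.cnd \<theta>" using fa fb c by (auto simp: A.follows_def B.follows_def)
      have eq: "card {a \<in> A.cnd \<theta>. a < f \<theta>} = card {a \<in> A.cnd \<theta>. a < f' \<theta>}" using ra rb r c by simp
      have "\<not> x < y" if xy: "x \<in> A.cnd \<theta>" "card {a \<in> A.cnd \<theta>. a < x} = card {a \<in> A.cnd \<theta>. a < y}" for x y
      proof
        assume "x < y"
        hence "{a \<in> A.cnd \<theta>. a < x} \<subset> {a \<in> A.cnd \<theta>. a < y}" using xy by auto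
        hence "card {a \<in> A.cnd \<theta>. a < x} < card {a \<in> A.cnd \<theta>. a < y}" by (intro psubset_card_mono) auto
        thus False using xy by simp
      qed
      from this[OF m(1) eq] this[OF m(2) eq[symmetric]] show ?thesis by linarith
    next
      case False
      thus ?thesis using p r less.prems
        by (auto simp: A.rank_code_def B.rank_code_def A.ptr_code_def B.ptr_code_def split: if_splits)
    qed
  qed
  hence "f = f'" by (intro PiE_ext[OF A.f_ext B.f_ext]) auto
  moreover from this have "p = p'" using merge_code_inj[of N T f p J p' J] assms by simp
  ultimately show ?thesis by simp
qed

text \<open>The factors are \<open>2^N\<close> for the jumps, a rank for each time, and two sparse
  codes with \<open>k + st\<close> and \<open>k + 2 * st\<close> exceptions. Since the ranks are
  exponential in \<open>N\<close>, this is affordable for one or two blocks only.\<close>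

lemma card_crude_le:
  fixes \<P> :: "((nat \<Rightarrow> nat) \<times> (nat \<Rightarrow> nat) \<times> nat set) set"
  assumes good: "\<And>f p J. (f, p, J) \<in> \<P> \<Longrightarrow> good_pattern N T f p J"
    and e: "\<And>f p J. (f, p, J) \<in> \<P> \<Longrightarrow> card (f ` {..<N}) \<le> card (f ` T) + e"
    and k: "\<And>f p J. (f, p, J) \<in> \<P> \<Longrightarrow> walk_pattern.excess N T f p J = k"
    and st: "card {\<theta>. \<theta> < N \<and> (\<forall>\<theta>'\<in>T. \<theta> \<noteq> Suc \<theta>')} \<le> st"
    and N: "N > 0" and T: "T \<subseteq> {..<N}"
  shows "real (card \<P>) \<le> 9 * 2 ^ N * real (k + e + 1) ^ N * real N ^ (4 * k + 6 * st)"
proof -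
  define code where "code = (\<lambda>(f, p, J). (J, merge_code N T f p, good_pattern.rank_code N T f p J,
      good_pattern.ptr_code N T f p J))"
  define C where "C = Pow {..<N} \<times> sparse N (k + st) \<times> ({..<N} \<rightarrow>\<^sub>E {..k + e}) \<times> sparse N (k + 2 * st)"
  have sparse_mono: "sparse N u \<subseteq> sparse N u'" if "u \<le> u'" for u u'
    unfolding sparse_def using that order_trans by blast
  have "card \<P> \<le> card C"
  proof (rule card_inj_on_le)
    show "inj_on code \<P>"
    proof (rule inj_onI)
      fix x x' assume x: "x \<in> \<P>" and x': "x' \<in> \<P>" and eq: "code x = code x'"
      obtain f p J where 1: "x = (f, p, J)" by (cases x)
      obtain f' p' J' where 2: "x' = (f', p', J')" by (cases x')
      have J: "J = J'" and c: "merge_code N T f p = merge_code N T f' p'"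
        "good_pattern.rank_code N T f p J = good_pattern.rank_code N T f' p' J"
        "good_pattern.ptr_code N T f p J = good_pattern.ptr_code N T f' p' J"
        using eq 1 2 by (auto simp: code_def)
      have m: "(f, p, J) \<in> \<P>" "(f', p', J) \<in> \<P>" using x x' unfolding 1 2 J by simp_all
      have "f = f' \<and> p = p'" by (rule crude_code_inj[OF good[OF m(1)] good[OF m(2)] c])
      thus "x = x'" using 1 2 J by simp
    qed
    show "code ` \<P> \<subseteq> C"
    proof (rule image_subsetI)
      fix x assume x: "x \<in> \<P>"
      obtain f p J where fpJ: "x = (f, p, J)" by (cases x)
      interpret good_pattern N T f p J using good x fpJ by auto
      have 1: "card starts \<le> st" using st by (simp add: starts_def)
      have ex: "excess = k" using k x fpJ by auto
      have "merge_code N T f p \<in> sparse N (k + st)"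
        using mc_sparse sparse_mono[of "excess + card starts" "k + st"] 1 ex by (auto simp: mc_def)
      moreover have "ptr_code \<in> sparse N (k + 2 * st)"
        using ptr_code_sparse sparse_mono[of "excess + 2 * card starts" "k + 2 * st"] 1 ex by auto
      moreover have "rank_code \<in> {..<N} \<rightarrow>\<^sub>E {..k + e}"
        using rank_code_PiE[of e] e x fpJ ex by (auto simp: points_def sources_def)
      moreover have "J \<in> Pow {..<N}" using J_sub T by auto
      ultimately show "code x \<in> C" by (simp add: code_def C_def fpJ)
    qed
    show "finite C" by (simp add: C_def finite_PiE)
  qed
  also have "card C = 2 ^ N * (card (sparse N (k + st)) * ((k + e + 1) ^ N * card (sparse N (k + 2 * st))))"
    by (simp add: C_def card_cartesian_product card_Pow card_funcsetE)
  finally have "real (card \<P>) \<le> real (2 ^ N * (card (sparse N (k + st)) *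
      ((k + e + 1) ^ N * card (sparse N (k + 2 * st)))))"
    by (simp only: of_nat_le_iff)
  also have "\<dots> = 2 ^ N * (real (card (sparse N (k + st))) *
      (real (k + e + 1) ^ N * real (card (sparse N (k + 2 * st)))))"
    by simp
  finally have "real (card \<P>) \<le> \<dots>" .
  also have "\<dots> \<le> 2 ^ N * ((3 * real N ^ (2 * (k + st))) *
      (real (k + e + 1) ^ N * (3 * real N ^ (2 * (k + 2 * st)))))"
    using N by (intro mult_left_mono mult_mono card_sparse_le) auto
  also have "\<dots> = 9 * 2 ^ N * real (k + e + 1) ^ N * (real N ^ (2 * (k + st)) * real N ^ (2 * (k + 2 * st)))"
    by (simp add: mult_ac)
  also have "real N ^ (2 * (k + st)) * real N ^ (2 * (k + 2 * st)) = real N ^ (4 * k + 6 * st)"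
    by (simp add: power_add[symmetric])
  finally show ?thesis .
qed

text \<open>A weight \<open>1 / N\<close> for each pointer to an earlier time makes the pointers
  cost \<open>(1 + 1)^N\<close> in total, once for \<open>f\<close> and once for \<open>p\<close>;
  the jumps add another \<open>2^N\<close>. The excess does not enter, as required when
  \<open>r\<close> is close to \<open>n\<close>.\<close>

lemma sum_pointer_patterns_le:
  fixes \<P> :: "((nat \<Rightarrow> nat) \<times> (nat \<Rightarrow> nat) \<times> nat set) set"
  assumes good: "\<And>f p J. (f, p, J) \<in> \<P> \<Longrightarrow> good_pattern N T f p J"
    and N: "N > 0" and T: "T \<subseteq> {..<N}"
  shows "(\<Sum>(f, p, J)\<in>\<P>. (1 / real N) ^ (N - card (f ` {..<N}) + (card (f ` T) - card (p ` f ` T)))) \<le> 8 ^ N"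
proof -
  let ?F = "{..<N} \<rightarrow>\<^sub>E {..N}"
  define z where "z c = card {\<theta>. \<theta> < N \<and> c \<theta> \<noteq> 0}" for c :: "nat \<Rightarrow> nat"
  define fc where "fc f = restrict (\<lambda>\<theta>. if f \<theta> = \<theta> then 0 else Suc (f \<theta>)) {..<N}" for f :: "nat \<Rightarrow> nat"
  define code where "code = (\<lambda>(f, p, J :: nat set). (J, fc f, merge_code N T f p))"
  let ?w = "1 / real N"
  have fin: "finite (Pow {..<N} \<times> ?F \<times> ?F)" by (auto intro!: finite_PiE)
  have inj: "inj_on code \<P>"
  proof (rule inj_onI)
    fix x x' assume x: "x \<in> \<P>" and x': "x' \<in> \<P>" and eq: "code x = code x'"
    obtain f p J where 1: "x = (f, p, J)" by (cases x)
    obtain f' p' J' where 2: "x' = (f', p', J')" by (cases x')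
    interpret A: good_pattern N T f p J using good x 1 by auto
    interpret B: good_pattern N T f' p' J' using good x' 2 by auto
    have "f \<theta> = f' \<theta>" if "\<theta> < N" for \<theta>
    proof -
      have "fc f \<theta> = fc f' \<theta>" using eq 1 2 by (simp add: code_def)
      thus ?thesis using that by (auto simp: fc_def split: if_splits)
    qed
    hence "f = f'" by (intro PiE_ext[OF A.f_ext B.f_ext]) auto
    moreover from this have "p = p'"
      using merge_code_inj[of N T f p J p' J'] A.good_pattern_axioms B.good_pattern_axioms eq 1 2
      by (simp add: code_def)
    ultimately show "x = x'" using eq 1 2 by (simp add: code_def)
  qed
  have "(\<Sum>(f, p, J)\<in>\<P>. ?w ^ (N - card (f ` {..<N}) + (card (f ` T) - card (p ` f ` T)))) \<le>
      (\<Sum>x\<in>\<P>. (\<lambda>(J, c, c'). ?w ^ z c * ?w ^ z c') (code x))"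
  proof (rule sum_mono)
    fix x assume x: "x \<in> \<P>"
    obtain f p J where 1: "x = (f, p, J)" by (cases x)
    interpret good_pattern N T f p J using good x 1 by auto
    have "{\<theta>. \<theta> < N \<and> fc f \<theta> \<noteq> 0} = {..<N} - points" by (auto simp: fc_def points_eq)
    moreover have "points \<subseteq> {..<N}" by (auto simp: points_eq)
    ultimately have "z (fc f) = N - card points"
      unfolding z_def by (simp add: card_Diff_subset)
    moreover have "z mc \<le> card sources - card images" unfolding z_def using card_nonfixed by linarith
    ultimately have "z (fc f) + z mc \<le> N - card (f ` {..<N}) + (card (f ` T) - card (p ` f ` T))"
      by (simp add: points_def sources_def images_def)
    hence "?w ^ (N - card (f ` {..<N}) + (card (f ` T) - card (p ` f ` T))) \<le> ?w ^ (z (fc f) + z mc)"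
      using N by (intro power_decreasing) auto
    thus "(case x of (f, p, J) \<Rightarrow> ?w ^ (N - card (f ` {..<N}) + (card (f ` T) - card (p ` f ` T)))) \<le>
        (\<lambda>(J, c, c'). ?w ^ z c * ?w ^ z c') (code x)"
      by (simp add: 1 code_def power_add mc_def)
  qed
  also have "\<dots> = (\<Sum>(J, c, c')\<in>code ` \<P>. ?w ^ z c * ?w ^ z c')"
    using inj by (simp add: sum.reindex)
  also have "\<dots> \<le> (\<Sum>(J, c, c')\<in>Pow {..<N} \<times> ?F \<times> ?F. ?w ^ z c * ?w ^ z c')"
  proof (rule sum_mono2[OF fin])
    show "code ` \<P> \<subseteq> Pow {..<N} \<times> ?F \<times> ?F"
    proof (rule image_subsetI)
      fix x assume x: "x \<in> \<P>"
      obtain f p J where 1: "x = (f, p, J)" by (cases x)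
      interpret good_pattern N T f p J using good x 1 by auto
      have "fc f \<in> ?F" using f_less by (auto simp: fc_def Suc_le_eq)
      moreover have "merge_code N T f p \<in> ?F" using mc_sparse by (auto simp: sparse_def mc_def)
      ultimately show "code x \<in> Pow {..<N} \<times> ?F \<times> ?F" using J_sub T by (auto simp: code_def 1)
    qed
  qed auto
  also have "\<dots> = 2 ^ N * ((\<Sum>c\<in>?F. ?w ^ z c) * (\<Sum>c\<in>?F. ?w ^ z c))"
    by (simp add: sum.cartesian_product[symmetric] sum_distrib_left sum_distrib_right card_Pow,
        rule sum.swap)
  also have "(\<Sum>c\<in>?F. ?w ^ z c) = 2 ^ N"
    unfolding z_def using sum_inverse_pow[of ?w N] N by simp
  also have "(2::real) ^ N * (2 ^ N * 2 ^ N) = 8 ^ N"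
    by (simp add: power_mult_distrib[symmetric])
  finally show ?thesis .
qed

section \<open>Tame walks\<close>

definition path_old :: "(nat \<Rightarrow> 'b) \<Rightarrow> nat \<Rightarrow> bool" where
  "path_old w t \<longleftrightarrow> (\<exists>s<t. w s = w t)"

definition path_default :: "(nat \<Rightarrow> 'b) \<Rightarrow> nat \<Rightarrow> 'b" where
  "path_default w t = w (Suc (LEAST s. w s = w t))"

text \<open>
  The step leading to time \<open>Suc t\<close> deviates if it leaves an already visited point along another
  way than after the first visit.
\<close>

definition path_deviates :: "(nat \<Rightarrow> 'b) \<Rightarrow> nat \<Rightarrow> bool" where
  "path_deviates w t \<longleftrightarrow> path_old w t \<and> w (Suc t) \<noteq> path_default w t"

text \<open>The step into time \<open>l\<close> is left out: the last time of a block is always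
  coded explicitly.\<close>

definition tame :: "nat \<Rightarrow> (nat \<Rightarrow> 'b) \<Rightarrow> bool" where
  "tame l w \<longleftrightarrow> card {t. Suc t < l \<and> path_deviates w t} \<le> 1"

text \<open>Only the coincidences of times matter, so tameness passes from a walk to its
  \<open>first_index\<close>.\<close>

lemma path_deviates_cong:
  assumes "\<And>i j. i \<le> Suc t \<Longrightarrow> j \<le> Suc t \<Longrightarrow> w i = w j \<longleftrightarrow> w' i = w' j"
  shows "path_deviates w t \<longleftrightarrow> path_deviates w' t"
proof -
  have old: "path_old w t \<longleftrightarrow> path_old w' t" using assms by (auto simp: path_old_def)
  have L: "(LEAST s. w s = w t) = (LEAST s. w' s = w' t)" (is "?a = ?b")
  proof -
    have a: "w ?a = w t" "?a \<le> t" by (rule LeastI, rule refl) (rule Least_le, rule refl)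
    have b: "w' ?b = w' t" "?b \<le> t" by (rule LeastI, rule refl) (rule Least_le, rule refl)
    have "?a \<le> ?b" using assms[of ?b t] b by (intro Least_le) simp
    moreover have "?b \<le> ?a" using assms[of ?a t] a by (intro Least_le) simp
    ultimately show ?thesis by simp
  qed
  have "(LEAST s. w s = w t) \<le> t" by (rule Least_le) simp
  thus ?thesis
    using assms[of "Suc t" "Suc (LEAST s. w s = w t)"] old
    by (auto simp: path_deviates_def path_default_def L)
qed

text \<open>Between two hits on its own past the path must leave it, and leaving is a deviation,
  because a default successor has been visited before. The summand \<open>of_bool\<close> records
  whether the path is inside at time \<open>k\<close>.\<close>

lemma card_hits_le:
  "card {t. Suc t \<le> k \<and> \<not> path_old w t \<and> path_old w (Suc t)} \<le>
   card {t. Suc t \<le> k \<and> path_deviates w t} + of_bool (path_old w k)"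
proof (induction k)
  case (Suc k)
  let ?H = "\<lambda>k. {t. Suc t \<le> k \<and> \<not> path_old w t \<and> path_old w (Suc t)}"
  let ?D = "\<lambda>k. {t. Suc t \<le> k \<and> path_deviates w t}"
  have fin: "finite (?H k)" "finite (?D k)" for k
    by (rule finite_subset[of _ "{..k}"]; auto)+
  have H: "?H (Suc k) = (if \<not> path_old w k \<and> path_old w (Suc k) then insert k (?H k) else ?H k)"
    by (auto simp: le_Suc_eq)
  have D: "?D (Suc k) = (if path_deviates w k then insert k (?D k) else ?D k)"
    by (auto simp: le_Suc_eq)
  have dev: "path_deviates w k" if k: "path_old w k" "\<not> path_old w (Suc k)"
  proof -
    obtain s where s: "s < k" "w s = w k" using k(1) by (auto simp: path_old_def)
    have "(LEAST s. w s = w k) \<le> s" using s by (intro Least_le)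
    hence "Suc (LEAST s. w s = w k) < Suc k" using s by simp
    hence "w (Suc k) \<noteq> path_default w k" using k(2) by (auto simp: path_old_def path_default_def)
    thus ?thesis using k by (simp add: path_deviates_def)
  qed
  show ?case
    unfolding H D using Suc fin dev
    by (cases "path_old w k"; cases "path_old w (Suc k)"; cases "path_deviates w k") (auto simp: card_insert_if)
qed (simp add: path_old_def)

text \<open>
  The prediction of \<open>f \<theta>\<close> from the past: a new point if no candidate exists, the default successor
  of a point already visited in the block, the only candidate, or the only candidate in the
  set \<open>X i\<close> which is stored for the block \<open>i\<close>. Only the times at which it fails enter the code.
\<close>

definition decode :: "nat \<Rightarrow> nat set \<Rightarrow> (nat \<Rightarrow> nat set) \<Rightarrow> (nat \<Rightarrow> nat) \<Rightarrow> nat \<Rightarrow> nat" where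
  "decode l C X f \<theta> = (let b = \<theta> - \<theta> mod Suc l; t = \<theta> mod Suc l - 1; w = \<lambda>t. f (b + t) in
     if C = {} then \<theta> else if path_old w t then path_default w t
     else if card C = 1 then the_elem C else the_elem (X (\<theta> div Suc l) \<inter> C))"

lemma decode_cong:
  assumes "\<And>s. s < \<theta> \<Longrightarrow> f s = f' s" "\<theta> mod Suc l > 0"
  shows "decode l C X f \<theta> = decode l C X f' \<theta>"
proof -
  define b t where "b = \<theta> - \<theta> mod Suc l" and "t = \<theta> mod Suc l - 1"
  have \<theta>: "\<theta> = b + Suc t" using assms(2) by (simp add: b_def t_def)
  let ?w = "\<lambda>t. f (b + t)" and ?w' = "\<lambda>t. f' (b + t)"
  have e: "?w s = ?w' s" if "s \<le> t" for s using assms(1) that \<theta> by simp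
  have old: "path_old ?w t \<longleftrightarrow> path_old ?w' t" using e by (auto simp: path_old_def)
  have "path_default ?w t = path_default ?w' t" if o: "path_old ?w t"
  proof -
    have lt: "(LEAST s. ?w s = ?w t) < t"
      using o by (auto simp: path_old_def intro: le_less_trans[OF Least_le])
    have lt': "(LEAST s. ?w' s = ?w' t) < t"
      using o old by (auto simp: path_old_def intro: le_less_trans[OF Least_le])
    have a: "?w (LEAST s. ?w s = ?w t) = ?w t" by (rule LeastI[of "\<lambda>s. ?w s = ?w t" t]) simp
    have b: "?w' (LEAST s. ?w' s = ?w' t) = ?w' t" by (rule LeastI[of "\<lambda>s. ?w' s = ?w' t" t]) simp
    \<comment> \<open>The minimum is sought over all times, but it lies below \<open>t\<close>,
      where both functions agree.\<close>
    have "(LEAST s. ?w s = ?w t) = (LEAST s. ?w' s = ?w' t)"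
    proof (rule order_antisym)
      show "(LEAST s. ?w s = ?w t) \<le> (LEAST s. ?w' s = ?w' t)"
        using b lt' e[of t] e[of "LEAST s. ?w' s = ?w' t"] by (intro Least_le) simp
      show "(LEAST s. ?w' s = ?w' t) \<le> (LEAST s. ?w s = ?w t)"
        using a lt e[of t] e[of "LEAST s. ?w s = ?w t"] by (intro Least_le) simp
    qed
    thus ?thesis using e[of "Suc (LEAST s. ?w s = ?w t)"] lt unfolding path_default_def by simp
  qed
  thus ?thesis
    using old unfolding decode_def Let_def b_def[symmetric] t_def[symmetric] by auto
qed

text \<open>
  \<open>N\<close> times are divided into \<open>B\<close> blocks of length \<open>Suc l\<close>; no move leaves the last time of a block.
\<close>

locale block_pattern = good_pattern +
  fixes l B :: nat
  assumes N_eq: "N = B * Suc l" and T_eq: "T = {\<theta>. \<theta> < N \<and> \<theta> mod Suc l \<noteq> l}" and l_pos: "l > 0"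
    and vis: "\<And>i. i \<in> f ` T \<Longrightarrow>
      (\<exists>i'\<in>f ` T. i' \<noteq> i \<and> p i' = p i) \<or> (\<exists>\<theta>\<in>T. \<exists>\<theta>'\<in>T. \<theta> \<noteq> \<theta>' \<and> f \<theta> = i \<and> f \<theta>' = i)"
    and tie: "\<And>\<theta>. \<theta> < N \<Longrightarrow> \<theta> \<notin> T \<Longrightarrow> \<exists>\<theta>'<N. \<theta>' \<noteq> \<theta> \<and> f \<theta>' = f \<theta>"
    and tame: "\<And>i. i < B \<Longrightarrow> tame l (\<lambda>t. f (i * Suc l + t))"
begin

lemma block_mod: "t \<le> l \<Longrightarrow> (i * Suc l + t) mod Suc l = t"
  by (simp del: mult_Suc_right)

lemma block_T: "i < B \<Longrightarrow> {i * Suc l..<i * Suc l + l} \<subseteq> T"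
proof
  fix \<theta> assume i: "i < B" and "\<theta> \<in> {i * Suc l..<i * Suc l + l}"
  then obtain t where t: "\<theta> = i * Suc l + t" "t < l" by (metis atLeastLessThan_iff le_Suc_ex nat_add_left_cancel_less)
  have "\<theta> mod Suc l = t" using t block_mod by simp
  moreover have "Suc i * Suc l \<le> N" using i N_eq by (metis Suc_leI mult_le_mono1)
  ultimately show "\<theta> \<in> T" using t by (simp add: T_eq)
qed

lemma block_end: "i < B \<Longrightarrow> i * Suc l + l < N \<and> i * Suc l + l \<notin> T"
proof -
  assume i: "i < B"
  have "(i * Suc l + l) mod Suc l = l" by (rule block_mod) simp
  moreover have "Suc i * Suc l \<le> N" using i N_eq by (metis Suc_leI mult_le_mono1)
  ultimately show ?thesis by (simp add: T_eq)
qed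

lemma block_cases:
  assumes "\<theta> < N"
  obtains i t where "i < B" "t \<le> l" "\<theta> = i * Suc l + t" "\<theta> mod Suc l = t" "\<theta> div Suc l = i"
    "\<theta> - \<theta> mod Suc l = i * Suc l"
proof -
  have 1: "\<theta> = \<theta> div Suc l * Suc l + \<theta> mod Suc l" by (rule div_mult_mod_eq[symmetric])
  have "\<theta> div Suc l < B" using assms N_eq by (simp add: less_mult_imp_div_less)
  moreover have "\<theta> mod Suc l \<le> l" by (metis less_Suc_eq_le mod_less_divisor zero_less_Suc)
  moreover have "\<theta> - \<theta> mod Suc l = \<theta> div Suc l * Suc l" using 1 by linarith
  ultimately show ?thesis using that 1 by blast
qed

lemma card_starts: "card starts \<le> B"
proof -
  have "starts \<subseteq> (\<lambda>i. i * Suc l) ` {..<B}"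
  proof
    fix \<theta> assume \<theta>: "\<theta> \<in> starts"
    hence "\<theta> < N" by (simp add: starts_def)
    then obtain i t where it: "i < B" "t \<le> l" "\<theta> = i * Suc l + t" by (rule block_cases) blast
    have "t = 0"
    proof (rule ccontr)
      assume "t \<noteq> 0"
      hence "i * Suc l + (t - 1) \<in> {i * Suc l..<i * Suc l + l}" using it by auto
      hence "i * Suc l + (t - 1) \<in> T" using block_T it by blast
      moreover have "\<theta> = Suc (i * Suc l + (t - 1))" using it \<open>t \<noteq> 0\<close> by simp
      ultimately show False using \<theta> by (auto simp: starts_def)
    qed
    thus "\<theta> \<in> (\<lambda>i. i * Suc l) ` {..<B}" using it by auto
  qed
  hence "card starts \<le> card ((\<lambda>i. i * Suc l) ` {..<B})" by (intro card_mono) auto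
  also have "\<dots> \<le> B" by (rule order_trans[OF card_image_le]) auto
  finally show ?thesis .
qed

lemma card_points: "card points \<le> card sources + B"
proof -
  have "points \<subseteq> sources \<union> (\<lambda>i. f (i * Suc l + l)) ` {..<B}"
  proof
    fix j assume "j \<in> points"
    then obtain \<theta> where \<theta>: "\<theta> < N" "j = f \<theta>" by (auto simp: points_def)
    from \<theta>(1) obtain i t where it: "i < B" "t \<le> l" "\<theta> = i * Suc l + t" "\<theta> mod Suc l = t"
      by (rule block_cases) blast
    show "j \<in> sources \<union> (\<lambda>i. f (i * Suc l + l)) ` {..<B}"
    proof (cases "t = l")
      case False
      hence "\<theta> \<in> T" using \<theta> it by (simp add: T_eq)
      thus ?thesis using \<theta> by (simp add: sources_def)
    qed (use \<theta> it in auto)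
  qed
  hence "card points \<le> card (sources \<union> (\<lambda>i. f (i * Suc l + l)) ` {..<B})" by (intro card_mono) auto
  also have "\<dots> \<le> card sources + card ((\<lambda>i. f (i * Suc l + l)) ` {..<B})" by (rule card_Un_le)
  also have "card ((\<lambda>i. f (i * Suc l + l)) ` {..<B}) \<le> B" by (rule order_trans[OF card_image_le]) auto
  finally show ?thesis by simp
qed

lemma events: "card jumps_old + card merges + (card sources - card images) \<le> excess + B"
  using events_le card_starts_points card_starts card_images_le_sources by linarith

text \<open>The cancellation, present through \<open>vis\<close>, limits even the jumps to new
  points. So \<open>J\<close> is stored as a small subset instead of at the price
  \<open>2^N\<close>.\<close>

lemma card_J_le: "card J \<le> 3 * excess + 4 * B"
proof -
  have "card jumps_new + 2 * card images \<le>
      card starts + card jumps_old + card merges + 2 * card sources"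
    by (rule jumps_new_le) (use vis tie in \<open>simp_all add: sources_def\<close>)
  thus ?thesis using events card_starts card_J card_images_le_sources by linarith
qed

lemma card_sharing: "card sharing \<le> 2 * excess + 2 * B"
  using card_sharing_le card_points by linarith

definition "w i = (\<lambda>t. f (i * Suc l + t))"

text \<open>A prediction is attempted only at times strictly inside a block that are reached along
  an edge.\<close>

definition "midway \<theta> \<longleftrightarrow> \<theta> < N \<and> \<theta> mod Suc l \<noteq> 0 \<and> \<theta> mod Suc l \<noteq> l \<and> \<theta> - 1 \<notin> J"

text \<open>From a point new to it, the block arrives at one of several candidates, none of which it
  has visited before. Such a choice cannot be predicted from the past; the arrivals of this kind are
  stored once per block, in \<open>exits\<close>.\<close>

definition "fresh \<theta> \<longleftrightarrow> midway \<theta> \<and> f \<theta> \<in> cnd \<theta> \<and> card (cnd \<theta>) \<noteq> 1 \<and>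
  \<not> path_old (w (\<theta> div Suc l)) (\<theta> mod Suc l - 1) \<and>
  (\<forall>s<\<theta> mod Suc l. w (\<theta> div Suc l) s \<notin> cnd \<theta>)"

definition "exits = restrict (\<lambda>i. f ` {\<theta>. \<theta> div Suc l = i \<and> fresh \<theta>}) {..<B}"

definition "special = {\<theta>. \<theta> < N \<and> (\<not> midway \<theta> \<or> decode l (cnd \<theta>) exits f \<theta> \<noteq> f \<theta>)}"

lemma midway_cases:
  assumes "midway \<theta>"
  obtains i t where "i < B" "Suc t < l" "\<theta> = i * Suc l + Suc t" "\<theta> mod Suc l = Suc t" "\<theta> div Suc l = i"
    "\<theta> - \<theta> mod Suc l = i * Suc l" "i * Suc l + t \<in> T - J" "\<theta> = Suc (i * Suc l + t)"
proof -
  have "\<theta> < N" using assms by (simp add: midway_def)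
  then obtain i t' where it: "i < B" "t' \<le> l" "\<theta> = i * Suc l + t'" "\<theta> mod Suc l = t'" "\<theta> div Suc l = i"
    "\<theta> - \<theta> mod Suc l = i * Suc l" by (rule block_cases)
  obtain t where t: "t' = Suc t" using assms it by (cases t') (auto simp: midway_def)
  have lt: "Suc t < l" using it t assms by (auto simp: midway_def)
  have "i * Suc l + t \<in> {i * Suc l..<i * Suc l + l}" using lt by auto
  hence "i * Suc l + t \<in> T" using block_T it by blast
  moreover have "i * Suc l + t \<notin> J" using assms it t by (auto simp: midway_def)
  ultimately show ?thesis using that[of i t] it t lt by simp
qed

lemma cnd_cl: "\<theta> \<in> T \<Longrightarrow> a \<in> cnd (Suc \<theta>) \<Longrightarrow> cl (Inl a) = cl (py \<theta>)"
  using edge_comp_eq_mono[OF hist_subset, of "Suc \<theta>" "py \<theta>" "Inl a"] by (simp add: cnd_iff)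

text \<open>Suppose two fresh times of one block had a common candidate that is an arrival.
  Components only grow, so the later time would find the earlier arrival among its candidates,
  against freshness. Hence the stored set needs no information about the time at which an element is
  used.\<close>

lemma fresh_unique:
  assumes "fresh \<theta>"
  shows "exits (\<theta> div Suc l) \<inter> cnd \<theta> = {f \<theta>}"
proof -
  have inn: "midway \<theta>" and fc: "f \<theta> \<in> cnd \<theta>" using assms by (auto simp: fresh_def)
  from inn obtain i t where it: "i < B" "Suc t < l" "\<theta> = i * Suc l + Suc t" "\<theta> mod Suc l = Suc t"
    "\<theta> div Suc l = i" "\<theta> - \<theta> mod Suc l = i * Suc l" "i * Suc l + t \<in> T - J" "\<theta> = Suc (i * Suc l + t)"
    by (rule midway_cases)
  have no: "f (i * Suc l + s) \<notin> cnd \<theta>" if "s < Suc t" for s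
    using assms that it by (auto simp: fresh_def w_def)
  have "a = f \<theta>" if a: "a \<in> exits i" "a \<in> cnd \<theta>" for a
  proof -
    obtain \<theta>' where \<theta>': "\<theta>' div Suc l = i" "fresh \<theta>'" "a = f \<theta>'" using a it by (auto simp: exits_def)
    have inn': "midway \<theta>'" using \<theta>' by (simp add: fresh_def)
    from inn' obtain i' t' where it': "i' < B" "Suc t' < l" "\<theta>' = i' * Suc l + Suc t'" "\<theta>' mod Suc l = Suc t'"
      "\<theta>' div Suc l = i'" "\<theta>' - \<theta>' mod Suc l = i' * Suc l" "i' * Suc l + t' \<in> T - J" "\<theta>' = Suc (i' * Suc l + t')"
      by (rule midway_cases)
    have ii: "i' = i" using it' \<theta>' by simp
    have no': "f (i * Suc l + s) \<notin> cnd \<theta>'" if "s < Suc t'" for s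
      using \<theta>'(2) that it' ii by (auto simp: fresh_def w_def)
    consider "t' < t" | "t' = t" | "t < t'" by linarith
    thus ?thesis
    proof cases
      case 1
      thus ?thesis using no[of "Suc t'"] a \<theta>' it' ii by simp
    next
      case 2
      thus ?thesis using it it' ii \<theta>' by simp
    next
      case 3
      have T: "i * Suc l + t \<in> T" "i * Suc l + t' \<in> T" using it it' ii by auto
      have H: "hist (Suc (i * Suc l + t)) \<subseteq> hist (Suc (i * Suc l + t'))" using 3 by (intro hist_mono) simp
      have A: "edge_comp (hist (Suc (i * Suc l + t))) (py (i * Suc l + t)) =
          edge_comp (hist (Suc (i * Suc l + t))) (Inl a)"
        using a(2) cnd_iff[OF T(1)] it(8) by simp
      have Bq: "edge_comp (hist (Suc (i * Suc l + t))) (py (i * Suc l + t)) =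
          edge_comp (hist (Suc (i * Suc l + t))) (Inl (f \<theta>))"
        using fc cnd_iff[OF T(1)] it(8) by simp
      have C: "edge_comp (hist (Suc (i * Suc l + t'))) (py (i * Suc l + t')) =
          edge_comp (hist (Suc (i * Suc l + t'))) (Inl a)"
        using \<theta>' cnd_iff[OF T(2)] it'(8) ii by (simp add: fresh_def)
      have "edge_comp (hist (Suc (i * Suc l + t'))) (Inl a) =
          edge_comp (hist (Suc (i * Suc l + t'))) (Inl (f \<theta>))"
        using edge_comp_eq_mono[OF H A] edge_comp_eq_mono[OF H Bq] by simp
      moreover have "f \<theta> \<in> f ` {..i * Suc l + t'}" using 3 it(3) by auto
      ultimately have "f \<theta> \<in> cnd \<theta>'" using C cnd_iff[OF T(2)] it'(8) ii by simp
      thus ?thesis using no'[of "Suc t"] 3 it(3) by simp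
    qed
  qed
  moreover have "f \<theta> \<in> exits i" using assms it(1,5) by (auto simp: exits_def)
  ultimately show ?thesis unfolding it(5) using fc by blast
qed

text \<open>The ways in which a prediction can fail: a block boundary, a jump, a merge, a new point
  although candidates exist, a deviation, a hit of the block on its own past, or an entry into a
  component already met in the block.\<close>

lemma special_subset:
  "special \<subseteq> (\<lambda>i. i * Suc l) ` {..<B} \<union> (\<lambda>i. i * Suc l + l) ` {..<B} \<union> Suc ` J \<union> Suc ` merges \<union> sharing \<union>
    (\<Union>i<B. ((\<lambda>t. i * Suc l + Suc t) ` {t. Suc t < l \<and> path_deviates (w i) t}) \<union>
       ((\<lambda>t. i * Suc l + Suc t) ` {t. Suc t \<le> l - 1 \<and> \<not> path_old (w i) t \<and> path_old (w i) (Suc t)}) \<union>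
       revisits (i * Suc l) (i * Suc l + l))" 
proof
  define A1 A2 A3 A4 where "A1 = (\<lambda>i. i * Suc l) ` {..<B}" and "A2 = (\<lambda>i. i * Suc l + l) ` {..<B}"
    and "A3 = Suc ` J" and "A4 = Suc ` merges"
  define A5 where "A5 = (\<Union>i<B. ((\<lambda>t. i * Suc l + Suc t) ` {t. Suc t < l \<and> path_deviates (w i) t}) \<union>
       ((\<lambda>t. i * Suc l + Suc t) ` {t. Suc t \<le> l - 1 \<and> \<not> path_old (w i) t \<and> path_old (w i) (Suc t)}) \<union>
       revisits (i * Suc l) (i * Suc l + l))"
  have devI: "i * Suc l + Suc t \<in> A5" if "i < B" "Suc t < l" "path_deviates (w i) t" for i t
    unfolding A5_def using that by blast
  have hitI: "i * Suc l + Suc t \<in> A5"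
    if "i < B" "Suc t < l" "\<not> path_old (w i) t" "path_old (w i) (Suc t)" for i t
  proof -
    have "t \<in> {t. Suc t \<le> l - 1 \<and> \<not> path_old (w i) t \<and> path_old (w i) (Suc t)}" using that by auto
    thus ?thesis unfolding A5_def using that(1) by blast
  qed
  have revI: "\<theta> \<in> A5" if "i < B" "\<theta> \<in> revisits (i * Suc l) (i * Suc l + l)" for i \<theta>
    unfolding A5_def using that by blast
  fix \<theta> assume sp: "\<theta> \<in> special"
  hence N: "\<theta> < N" by (simp add: special_def)
  have "\<theta> \<in> A1 \<union> A2 \<union> A3 \<union> A4 \<union> sharing \<union> A5"
  proof (cases "midway \<theta>")
    case False
    from N obtain i t where it: "i < B" "t \<le> l" "\<theta> = i * Suc l + t" "\<theta> mod Suc l = t" by (rule block_cases) blast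
    consider "t = 0" | "t = l" | "t \<noteq> 0" "\<theta> - 1 \<in> J"
      using False N it(4) unfolding midway_def by blast
    thus ?thesis
    proof cases
      case 1
      hence "\<theta> \<in> A1" unfolding A1_def using it(1,3) by auto
      thus ?thesis by blast
    next
      case 2
      hence "\<theta> \<in> A2" unfolding A2_def using it(1,3) by auto
      thus ?thesis by blast
    next
      case 3
      have "\<theta> = Suc (\<theta> - 1)" using it(3) 3(1) by simp
      hence "\<theta> \<in> A3" unfolding A3_def using 3(2) by (metis imageI)
      thus ?thesis by blast
    qed
  next
    case inn: True
    then obtain i t where it: "i < B" "Suc t < l" "\<theta> = i * Suc l + Suc t" "\<theta> mod Suc l = Suc t"
      "\<theta> div Suc l = i" "\<theta> - \<theta> mod Suc l = i * Suc l" "i * Suc l + t \<in> T - J" "\<theta> = Suc (i * Suc l + t)"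
      by (rule midway_cases)
    let ?\<rho> = "i * Suc l + t"
    have T: "?\<rho> \<in> T" "?\<rho> \<notin> J" using it by auto
    have bad: "decode l (cnd \<theta>) exits f \<theta> \<noteq> f \<theta>" using sp inn by (simp add: special_def)
    have dec: "decode l (cnd \<theta>) exits f \<theta> =
      (if cnd \<theta> = {} then \<theta> else if path_old (w i) t then path_default (w i) t
       else if card (cnd \<theta>) = 1 then the_elem (cnd \<theta>) else the_elem (exits i \<inter> cnd \<theta>))"
      unfolding decode_def Let_def it(6) unfolding it(4,5) w_def by simp
    have wS: "w i (Suc t) = f \<theta>" by (simp add: w_def it(3))
    show ?thesis
    proof (cases "f \<theta> = \<theta>")
      \<comment> \<open>A new point although the past offers a candidate \<open>a\<close>: the edge
        puts both into the same final component, so the new point is sharing.\<close>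
      case True
      hence ne: "cnd \<theta> \<noteq> {}" using bad dec by auto
      then obtain a where a: "a \<in> cnd \<theta>" by blast
      obtain s where s: "s \<le> ?\<rho>" "a = f s" using a cnd_iff[OF T(1)] it(8) by auto
      have "\<not> linked ?\<rho>" using new_not_linked[of ?\<rho>] True it(7,8) by auto
      show ?thesis
      proof (cases "\<theta> \<in> sharing")
        case False
        have "s < N" using s T_less[OF T(1)] by simp
        hence "a \<in> points" using s by (simp add: points_def)
        moreover have "\<theta> \<in> points" using True N by (simp add: points_eq)
        moreover have "a \<noteq> \<theta>" using f_le[OF \<open>s < N\<close>] s it(8) by simp
        moreover have "cl (Inl a) = cl (Inl \<theta>)"
          using cnd_cl[OF T(1), of a] a cl_move[OF T] it(8) True by (simp add: px_def)
        ultimately show ?thesis using False by (auto simp: sharing_def)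
      qed simp
    next
      case old: False
      show ?thesis
      proof (cases "f \<theta> \<in> cnd \<theta>")
        case False
        hence "\<not> linked ?\<rho>" using linked_iff[OF T(1)] old it(8) by simp
        hence "?\<rho> \<in> merges" using T old it(8) by (simp add: merges_def)
        hence "\<theta> \<in> A4" unfolding A4_def using it(8) by simp
        thus ?thesis by blast
      next
        case c: True
        hence ne: "cnd \<theta> \<noteq> {}" by auto
        show ?thesis
        proof (cases "path_old (w i) t")
          case True
          hence "path_deviates (w i) t" using bad dec ne wS by (simp add: path_deviates_def)
          hence "\<theta> \<in> A5" using devI it(1,2,3) by simp
          thus ?thesis by blast
        next
          case nold: False
          have c1: "card (cnd \<theta>) \<noteq> 1"
          proof
            assume "card (cnd \<theta>) = 1"
            then obtain a where "cnd \<theta> = {a}" by (auto simp: card_1_singleton_iff)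
            thus False using c bad dec nold by auto
          qed
          \<comment> \<open>A fresh time would be predicted by \<open>exits\<close>, so the block
            has met one of the candidates before.\<close>
          have "\<not> fresh \<theta>"
          proof
            assume "fresh \<theta>"
            hence "exits i \<inter> cnd \<theta> = {f \<theta>}" using fresh_unique it(5) by blast
            thus False using bad dec nold c1 ne by simp
          qed
          then obtain s where s: "s < Suc t" "w i s \<in> cnd \<theta>"
            using inn c c1 nold it by (auto simp: fresh_def)
          show ?thesis
          proof (cases "path_old (w i) (Suc t)")
            case True
            hence "\<theta> \<in> A5" using hitI nold it(1,2,3) by simp
            thus ?thesis by blast
          next
            case False
            have "\<theta> \<in> revisits (i * Suc l) (i * Suc l + l)"
              unfolding revisits_def
            proof (intro CollectI conjI ballI)
              show "\<theta> \<in> {i * Suc l..i * Suc l + l}" using it by auto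
              fix u assume u: "u \<in> {i * Suc l..<\<theta>}"
              define v where "v = u - i * Suc l"
              have "u = i * Suc l + v" "v < Suc t" using u it(3) by (auto simp: v_def)
              thus "f u \<noteq> f \<theta>" using False wS by (auto simp: path_old_def w_def)
            next
              have "cl (Inl (w i s)) = cl (Inl (f \<theta>))"
                using cnd_cl[OF T(1)] s c it(8) by simp
              thus "\<exists>s\<in>{i * Suc l..<\<theta>}. cl (px s) = cl (px \<theta>)"
                using s it(3) by (intro bexI[of _ "i * Suc l + s"]) (auto simp: px_def w_def)
            qed
            hence "\<theta> \<in> A5" using revI it(1) by blast
            thus ?thesis by blast
          qed
        qed
      qed
    qed
  qed
  thus "\<theta> \<in> (\<lambda>i. i * Suc l) ` {..<B} \<union> (\<lambda>i. i * Suc l + l) ` {..<B} \<union> Suc ` J \<union> Suc ` merges \<union> sharing \<union>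
    (\<Union>i<B. ((\<lambda>t. i * Suc l + Suc t) ` {t. Suc t < l \<and> path_deviates (w i) t}) \<union>
       ((\<lambda>t. i * Suc l + Suc t) ` {t. Suc t \<le> l - 1 \<and> \<not> path_old (w i) t \<and> path_old (w i) (Suc t)}) \<union>
       revisits (i * Suc l) (i * Suc l + l))"
    unfolding A1_def A2_def A3_def A4_def A5_def .
qed

text \<open>A block has at most one deviation, two hits and \<open>excess\<close> revisits. To these
  come \<open>2 * B\<close> boundaries, \<open>3 * excess + 4 * B\<close> jumps,
  \<open>excess + B\<close> merges and \<open>2 * excess + 2 * B\<close> sharing points.\<close>

lemma card_special_le: "card special \<le> B * (excess + 12) + 6 * excess"
proof -
  let ?dev = "\<lambda>i. {t. Suc t < l \<and> path_deviates (w i) t}"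
  let ?hit = "\<lambda>i. {t. Suc t \<le> l - 1 \<and> \<not> path_old (w i) t \<and> path_old (w i) (Suc t)}"
  let ?g = "\<lambda>i t. i * Suc l + Suc t"
  have fin: "finite (?dev i)" "finite (?hit i)" "finite (revisits (i * Suc l) (i * Suc l + l))" for i
  proof -
    show "finite (?dev i)" by (rule finite_subset[of _ "{..l}"]) auto
    show "finite (?hit i)" by (rule finite_subset[of _ "{..l}"]) auto
  qed (simp add: revisits_def)
  have blk: "card (?g i ` ?dev i \<union> ?g i ` ?hit i \<union> revisits (i * Suc l) (i * Suc l + l)) \<le> 3 + excess"
    if i: "i < B" for i
  proof -
    have d: "card (?dev i) \<le> 1" using tame[OF i] by (simp add: tame_def w_def)
    have e: "{t. Suc t \<le> l - 1 \<and> path_deviates (w i) t} = ?dev i" using l_pos by auto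
    have "card (?hit i) \<le> card (?dev i) + of_bool (path_old (w i) (l - 1))"
      using card_hits_le[of "l - 1" "w i"] unfolding e .
    moreover have "of_bool (path_old (w i) (l - 1)) \<le> (1 :: nat)" by simp
    ultimately have h: "card (?hit i) \<le> 2" using d by linarith
    have r: "card (revisits (i * Suc l) (i * Suc l + l)) \<le> excess"
      using block_T[OF i] block_end[OF i] by (intro card_revisits_le) auto
    have "card (?g i ` ?dev i \<union> ?g i ` ?hit i \<union> revisits (i * Suc l) (i * Suc l + l)) \<le>
        card (?g i ` ?dev i) + card (?g i ` ?hit i) + card (revisits (i * Suc l) (i * Suc l + l))"
      by (intro order_trans[OF card_Un_le] add_mono card_Un_le) auto
    also have "\<dots> \<le> card (?dev i) + card (?hit i) + card (revisits (i * Suc l) (i * Suc l + l))"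
      by (intro add_mono card_image_le fin) auto
    finally show ?thesis using d h r by linarith
  qed
  let ?U = "\<Union>i<B. ?g i ` ?dev i \<union> ?g i ` ?hit i \<union> revisits (i * Suc l) (i * Suc l + l)"
  have "card ?U \<le> (\<Sum>i<B. card (?g i ` ?dev i \<union> ?g i ` ?hit i \<union> revisits (i * Suc l) (i * Suc l + l)))"
    by (rule card_UN_le) simp
  also have "\<dots> \<le> (\<Sum>i<B. 3 + excess)" by (intro sum_mono blk) auto
  finally have U: "card ?U \<le> B * (3 + excess)" by simp
  have finU: "finite ?U" using fin by auto
  have fsh: "finite sharing" by (simp add: sharing_def)
  let ?A = "(\<lambda>i. i * Suc l) ` {..<B}" and ?E = "(\<lambda>i. i * Suc l + l) ` {..<B}"
  have "card special \<le> card (?A \<union> ?E \<union> Suc ` J \<union> Suc ` merges \<union> sharing \<union> ?U)"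
    using special_subset finU fsh by (intro card_mono) auto
  also have "\<dots> \<le> card ?A + card ?E + card (Suc ` J) + card (Suc ` merges) + card sharing + card ?U"
    by (intro order_trans[OF card_Un_le] add_mono order_refl)
  also have "\<dots> \<le> B + B + card J + card merges + card sharing + card ?U"
    by (intro add_mono order_refl) (auto simp: card_image intro: order_trans[OF card_image_le])
  finally show ?thesis using U card_J_le events card_sharing by (simp add: algebra_simps)
qed

text \<open>A fresh time has a second candidate in the component of its arrival. So it suffices to
  store the small set \<open>sharing\<close> and one subset of it per block.\<close>

lemma exits_sub: "exits \<in> {..<B} \<rightarrow>\<^sub>E Pow sharing"
proof (rule PiE_I)
  fix i assume i: "i \<in> {..<B}"
  have "f \<theta> \<in> sharing" if fr: "fresh \<theta>" for \<theta>
  proof -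
    have inn: "midway \<theta>" and fc: "f \<theta> \<in> cnd \<theta>" and c1: "card (cnd \<theta>) \<noteq> 1" using fr by (auto simp: fresh_def)
    from inn obtain i t where it: "i < B" "Suc t < l" "\<theta> = i * Suc l + Suc t" "\<theta> mod Suc l = Suc t"
      "\<theta> div Suc l = i" "\<theta> - \<theta> mod Suc l = i * Suc l" "i * Suc l + t \<in> T - J" "\<theta> = Suc (i * Suc l + t)"
      by (rule midway_cases)
    have T: "i * Suc l + t \<in> T" using it by simp
    have "cnd \<theta> \<noteq> {f \<theta>}" using c1 by auto
    then obtain a where a: "a \<in> cnd \<theta>" "a \<noteq> f \<theta>" using fc by blast
    have pt: "b \<in> points" if b: "b \<in> cnd \<theta>" for b
    proof -
      obtain s where "s \<le> i * Suc l + t" "b = f s" using b cnd_iff[OF T, of b] it(8) by auto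
      moreover from this have "s < N" using T_less[OF T] by simp
      ultimately show ?thesis by (simp add: points_def)
    qed
    have "cl (Inl a) = cl (Inl (f \<theta>))" using cnd_cl[OF T] a(1) fc it(8) by simp
    thus ?thesis using pt[OF a(1)] pt[OF fc] a(2) by (auto simp: sharing_def)
  qed
  thus "exits i \<in> Pow sharing" using i by (auto simp: exits_def)
qed (simp add: exits_def)

definition "spec_code = restrict (\<lambda>\<theta>. if \<theta> \<in> special then Suc (f \<theta>) else 0) {..<N}"

lemma spec_code_sparse: "spec_code \<in> sparse N (B * (excess + 12) + 6 * excess)"
proof -
  have "spec_code \<in> {..<N} \<rightarrow>\<^sub>E {..N}" using f_less by (auto simp: spec_code_def Suc_le_eq)
  moreover have "{\<theta>. \<theta> < N \<and> spec_code \<theta> \<noteq> 0} = special" by (auto simp: spec_code_def special_def)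
  ultimately show ?thesis using card_special_le by (simp add: sparse_def)
qed

end

text \<open>Induction on time: where the code is silent, both patterns follow the same prediction
  from the same past.\<close>

lemma block_code_inj:
  assumes "block_pattern N T f p J l B" "block_pattern N T f' p' J l B"
    "merge_code N T f p = merge_code N T f' p'"
    "block_pattern.spec_code N T f p J l B = block_pattern.spec_code N T f' p' J l B"
    "block_pattern.exits N T f p J l B = block_pattern.exits N T f' p' J l B"
  shows "f = f' \<and> p = p'"
proof -
  interpret A: block_pattern N T f p J l B by fact
  interpret B: block_pattern N T f' p' J l B by fact
  have mc: "A.mc = B.mc" using assms(3) by (simp add: A.mc_def B.mc_def)
  have "f \<theta> = f' \<theta>" if "\<theta> < N" for \<theta>
    using that
  proof (induction \<theta> rule: less_induct)
    case (less \<theta>)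
    have IH: "\<And>s. s < \<theta> \<Longrightarrow> f s = f' s" using less by auto
    have s: "A.spec_code \<theta> = B.spec_code \<theta>" using assms by simp
    show ?case
    proof (cases "\<theta> \<in> A.special")
      case True
      thus ?thesis using s less.prems by (auto simp: A.spec_code_def B.spec_code_def split: if_splits)
    next
      case False
      hence nB: "\<theta> \<notin> B.special" using s less.prems by (auto simp: A.spec_code_def B.spec_code_def split: if_splits)
      have iA: "A.midway \<theta>" and dA: "decode l (A.cnd \<theta>) A.exits f \<theta> = f \<theta>"
        using False less.prems by (auto simp: A.special_def)
      have dB: "decode l (B.cnd \<theta>) B.exits f' \<theta> = f' \<theta>"
        using nB less.prems by (auto simp: B.special_def)
      have pos: "\<theta> mod Suc l > 0" using iA by (simp add: A.midway_def)
      hence "\<theta> > 0" by (cases \<theta>) auto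
      hence "A.cnd \<theta> = B.cnd \<theta>" unfolding mc using IH by (intro cand_cong) auto
      hence "decode l (A.cnd \<theta>) A.exits f \<theta> = decode l (B.cnd \<theta>) B.exits f' \<theta>"
        using decode_cong[of \<theta> f f' l "B.cnd \<theta>" B.exits] IH pos assms(5) by simp
      thus ?thesis using dA dB by simp
    qed
  qed
  hence "f = f'" by (intro PiE_ext[OF A.f_ext B.f_ext]) auto
  moreover from this have "p = p'"
    using merge_code_inj[of N T f p J p' J] A.good_pattern_axioms B.good_pattern_axioms assms(3) by simp
  ultimately show ?thesis by simp
qed

lemma card_small_subsets_le:
  "card {D. D \<subseteq> {..<N} \<and> card D \<le> d} \<le> card (sparse N d)" if "N > 0"
proof (rule card_inj_on_le)
  let ?\<Phi> = "\<lambda>D. restrict (\<lambda>\<theta>. if \<theta> \<in> D then 1 else 0 :: nat) {..<N}"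
  show "inj_on ?\<Phi> {D. D \<subseteq> {..<N} \<and> card D \<le> d}"
  proof (rule inj_onI)
    fix D D' assume "D \<in> {D. D \<subseteq> {..<N} \<and> card D \<le> d}" "D' \<in> {D. D \<subseteq> {..<N} \<and> card D \<le> d}"
      and eq: "?\<Phi> D = ?\<Phi> D'"
    hence D: "D \<subseteq> {..<N}" "D' \<subseteq> {..<N}" by auto
    have "x \<in> D \<longleftrightarrow> x \<in> D'" for x
      using D fun_cong[OF eq, of x] by (cases "x < N") (auto split: if_splits)
    thus "D = D'" by blast
  qed
  show "?\<Phi> ` {D. D \<subseteq> {..<N} \<and> card D \<le> d} \<subseteq> sparse N d"
  proof (rule image_subsetI)
    fix D assume "D \<in> {D. D \<subseteq> {..<N} \<and> card D \<le> d}"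
    hence D: "D \<subseteq> {..<N}" "card D \<le> d" by auto
    have "{\<theta>. \<theta> < N \<and> ?\<Phi> D \<theta> \<noteq> 0} = D" using D by auto
    moreover have "?\<Phi> D \<in> {..<N} \<rightarrow>\<^sub>E {..N}" using that by auto
    ultimately show "?\<Phi> D \<in> sparse N d" using D by (simp add: sparse_def)
  qed
qed simp

text \<open>Four sparse choices (jumps, merging, special times, sharing points) give
  \<open>3^4 = 81\<close> and the power of \<open>N\<close>; a subset of at most
  \<open>2 * k + 2 * B\<close> points for each block gives the power of 2. Nothing is exponential in
  the block length, unlike in \<open>card_crude_le\<close>.\<close>

lemma card_block_patterns_le:
  fixes \<P> :: "((nat \<Rightarrow> nat) \<times> (nat \<Rightarrow> nat) \<times> nat set) set"
  assumes blk: "\<And>f p J. (f, p, J) \<in> \<P> \<Longrightarrow> block_pattern N T f p J l B"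
    and k: "\<And>f p J. (f, p, J) \<in> \<P> \<Longrightarrow> walk_pattern.excess N T f p J = k"
    and N: "N > 0" and T: "T \<subseteq> {..<N}" and B: "B \<ge> 2"
  shows "real (card \<P>) \<le> 81 * real N ^ (38 * B * (k + 1)) * 2 ^ (2 * B * (k + B))"
proof -
  define code where "code = (\<lambda>(f, p, J). (J, merge_code N T f p, block_pattern.spec_code N T f p J l B,
      block_pattern.exits N T f p J l B))"
  define Ds where "Ds d = {D. D \<subseteq> {..<N} \<and> card D \<le> d}" for d
  define Es where "Es = (\<Union>D\<in>Ds (2 * k + 2 * B). {..<B} \<rightarrow>\<^sub>E Pow D)"
  define C where "C = Ds (3 * k + 4 * B) \<times> sparse N (k + B) \<times> sparse N (B * (k + 12) + 6 * k) \<times> Es"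
  have finD: "finite (Ds d)" for d by (rule finite_subset[of _ "Pow {..<N}"]) (auto simp: Ds_def)
  have finD': "finite D" if "D \<in> Ds d" for D d using that by (auto simp: Ds_def intro: finite_subset)
  have finEs: "finite Es" using finD finD' by (auto simp: Es_def intro!: finite_PiE)
  have sparse_mono: "sparse N u \<subseteq> sparse N u'" if "u \<le> u'" for u u'
    unfolding sparse_def using that order_trans by blast
  have "card \<P> \<le> card C"
  proof (rule card_inj_on_le)
    show "inj_on code \<P>"
    proof (rule inj_onI)
      fix x x' assume x: "x \<in> \<P>" and x': "x' \<in> \<P>" and eq: "code x = code x'"
      obtain f p J where 1: "x = (f, p, J)" by (cases x)
      obtain f' p' J' where 2: "x' = (f', p', J')" by (cases x')
      have J: "J = J'" and c: "merge_code N T f p = merge_code N T f' p'"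
        "block_pattern.spec_code N T f p J l B = block_pattern.spec_code N T f' p' J l B"
        "block_pattern.exits N T f p J l B = block_pattern.exits N T f' p' J l B"
        using eq 1 2 by (auto simp: code_def)
      have m: "(f, p, J) \<in> \<P>" "(f', p', J) \<in> \<P>" using x x' unfolding 1 2 J by simp_all
      have "f = f' \<and> p = p'" by (rule block_code_inj[OF blk[OF m(1)] blk[OF m(2)] c])
      thus "x = x'" using 1 2 J by simp
    qed
    show "code ` \<P> \<subseteq> C"
    proof (rule image_subsetI)
      fix x assume x: "x \<in> \<P>"
      obtain f p J where fpJ: "x = (f, p, J)" by (cases x)
      interpret block_pattern N T f p J l B using blk x fpJ by auto
      have ex: "excess = k" using k x fpJ by auto
      have "merge_code N T f p \<in> sparse N (k + B)"
        using mc_sparse sparse_mono[of "excess + card starts" "k + B"] card_starts ex by (auto simp: mc_def)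
      moreover have "spec_code \<in> sparse N (B * (k + 12) + 6 * k)"
        using spec_code_sparse ex by simp
      moreover have "J \<in> Ds (3 * k + 4 * B)" using J_sub T card_J_le ex by (auto simp: Ds_def)
      moreover have "sharing \<in> Ds (2 * k + 2 * B)"
        using card_sharing ex by (auto simp: Ds_def sharing_def points_eq)
      hence "exits \<in> Es" using exits_sub by (auto simp: Es_def)
      ultimately show "code x \<in> C" by (simp add: code_def C_def fpJ)
    qed
    show "finite C" using finD finEs by (simp add: C_def)
  qed
  also have "card C = card (Ds (3 * k + 4 * B)) * (card (sparse N (k + B)) *
      (card (sparse N (B * (k + 12) + 6 * k)) * card Es))"
    by (simp add: C_def card_cartesian_product)
  finally have 1: "real (card \<P>) \<le> real (card (Ds (3 * k + 4 * B))) * (real (card (sparse N (k + B))) *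
      (real (card (sparse N (B * (k + 12) + 6 * k))) * real (card Es)))"
    by (metis (no_types, lifting) of_nat_le_iff of_nat_mult)
  have Ds: "real (card (Ds d)) \<le> 3 * real N ^ (2 * d)" for d
    using card_small_subsets_le[OF N, of d] card_sparse_le[OF N, of d] unfolding Ds_def by linarith
  have "card Es \<le> (\<Sum>D\<in>Ds (2 * k + 2 * B). card ({..<B} \<rightarrow>\<^sub>E Pow D))"
    unfolding Es_def by (rule card_UN_le[OF finD])
  also have "\<dots> \<le> (\<Sum>D\<in>Ds (2 * k + 2 * B). (2 ^ (2 * k + 2 * B)) ^ B)"
    using finD' by (intro sum_mono) (auto simp: card_funcsetE card_Pow Ds_def intro!: power_mono power_increasing)
  finally have "real (card Es) \<le> real (card (Ds (2 * k + 2 * B)) * (2 ^ (2 * k + 2 * B)) ^ B)"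
    by (simp only: of_nat_le_iff) simp
  also have "\<dots> = real (card (Ds (2 * k + 2 * B))) * 2 ^ (2 * B * (k + B))"
    by (simp add: power_mult[symmetric] algebra_simps)
  also have "\<dots> \<le> (3 * real N ^ (2 * (2 * k + 2 * B))) * 2 ^ (2 * B * (k + B))"
    by (intro mult_right_mono Ds) auto
  finally have Es: "real (card Es) \<le> (3 * real N ^ (2 * (2 * k + 2 * B))) * 2 ^ (2 * B * (k + B))" .
  note 1
  also have "real (card (Ds (3 * k + 4 * B))) * (real (card (sparse N (k + B))) *
      (real (card (sparse N (B * (k + 12) + 6 * k))) * real (card Es))) \<le>
      (3 * real N ^ (2 * (3 * k + 4 * B))) * ((3 * real N ^ (2 * (k + B))) *
      ((3 * real N ^ (2 * (B * (k + 12) + 6 * k))) * ((3 * real N ^ (2 * (2 * k + 2 * B))) * 2 ^ (2 * B * (k + B)))))"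
    using N by (intro mult_mono Ds Es card_sparse_le) auto
  also have "\<dots> = 81 * real N ^ (2 * (3 * k + 4 * B) + 2 * (k + B) + 2 * (B * (k + 12) + 6 * k) + 2 * (2 * k + 2 * B)) *
      2 ^ (2 * B * (k + B))"
  proof -
    have "(3 * x) * ((3 * y) * ((3 * z) * ((3 * w) * c))) = 81 * (x * y * z * w) * c" for x y z w c :: real
      by simp
    thus ?thesis unfolding power_add .
  qed
  also have "\<dots> \<le> 81 * real N ^ (38 * B * (k + 1)) * 2 ^ (2 * B * (k + B))"
  proof (intro mult_right_mono mult_left_mono power_increasing)
    \<comment> \<open>\<open>B \<ge> 2\<close> lets \<open>B * k\<close> absorb the terms in
      \<open>k\<close> alone.\<close>
    define z where "z = B * k"
    have z: "2 * k \<le> z" using B unfolding z_def by (rule mult_le_mono1)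
    have L: "2 * (3 * k + 4 * B) + 2 * (k + B) + 2 * (B * (k + 12) + 6 * k) + 2 * (2 * k + 2 * B) =
        24 * k + 38 * B + 2 * z" by (simp add: z_def algebra_simps)
    have R: "38 * B * (k + 1) = 38 * z + 38 * B" by (simp add: z_def algebra_simps)
    show "2 * (3 * k + 4 * B) + 2 * (k + B) + 2 * (B * (k + 12) + 6 * k) + 2 * (2 * k + 2 * B) \<le> 38 * B * (k + 1)"
      unfolding L R using z by linarith
  qed (use N in auto)
  finally show ?thesis .
qed

section \<open>Paths closing two independent cycles\<close>

lemma card_image_collide:
  assumes "finite A" "x \<in> A" "y \<in> A" "x \<noteq> y" "g x = g y"
  shows "card (g ` A) + 1 \<le> card A"
proof -
  have "\<not> inj_on g A" using assms by (meson inj_onD)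
  hence "card (g ` A) \<noteq> card A" using assms(1) eq_card_imp_inj_on by blast
  moreover have "card (g ` A) \<le> card A" using assms(1) by (rule card_image_le)
  ultimately show ?thesis by simp
qed

text \<open>The point at \<open>t2\<close> is old, so every image of a point in \<open>X\<close>
  lies in the component of a point in \<open>X\<close>: one cycle. The two successors at the first
  deviation lie in one component: another cycle. So even without jumps there are fewer components
  than sources, and each jump adds at most one component.\<close>

lemma (in walk_pattern) two_deviations_excess:
  assumes N: "N = Suc l" and T: "T = {..<l}" and p: "\<And>i. i \<in> f ` T \<Longrightarrow> p i = i"
    and dev: "path_deviates f t1" "path_deviates f t2" "t1 < t2" "Suc t2 < l"
  shows "excess \<ge> 2"
proof -
  define ec where "ec = edge_comp (pattern_edges T f p {})"
  have move: "ec (Inr (f u)) = ec (Inl (f (Suc u)))" if "u < l" for u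
  proof -
    have "(Inr (p (f u)), Inl (f (Suc u))) \<in> pattern_edges T f p {}"
      using that T by (auto simp: pattern_edges_def)
    moreover have "p (f u) = f u" using that T p by auto
    ultimately show ?thesis unfolding ec_def using edge_comp_edge by fastforce
  qed
  have first: "\<exists>s<t. f s = f t \<and> (LEAST s. f s = f t) = s" if pd: "path_deviates f t" for t
  proof -
    obtain s where s: "s < t" "f s = f t" using pd by (auto simp: path_deviates_def path_old_def)
    have "f (LEAST s. f s = f t) = f t" using s by (intro LeastI[of "\<lambda>s. f s = f t"])
    moreover have "(LEAST s. f s = f t) \<le> s" using s by (intro Least_le)
    ultimately show ?thesis using s by auto
  qed
  obtain s1 where s1: "s1 < t1" "f s1 = f t1" "(LEAST s. f s = f t1) = s1" using first[OF dev(1)] by auto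
  obtain s2 where s2: "s2 < t2" "f s2 = f t2" using first[OF dev(2)] by auto
  have ne: "f (Suc t1) \<noteq> f (Suc s1)" using dev(1) s1 by (simp add: path_deviates_def path_default_def)
  define X where "X = f ` {..t2}"
  have XT: "X \<subseteq> f ` T" using dev T by (auto simp: X_def)
  have Inr_case: "ec (Inr i) \<in> (\<lambda>a. ec (Inl a)) ` X \<union> (\<lambda>a. ec (Inr a)) ` (f ` T - X)" if i: "i \<in> f ` T" for i
  proof (cases "i \<in> X")
    case True
    then obtain u where u: "u \<le> t2" "i = f u" by (auto simp: X_def)
    have "\<exists>u'<t2. i = f u'"
    proof (cases "u = t2")
      case True
      thus ?thesis using s2 u by metis
    next
      case False
      thus ?thesis using u by (intro exI[of _ u]) simp
    qed
    then obtain u' where u': "u' < t2" "i = f u'" by blast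
    have "ec (Inr i) = ec (Inl (f (Suc u')))" using move[of u'] u' dev by simp
    moreover have "f (Suc u') \<in> X" using u' by (auto simp: X_def)
    ultimately show ?thesis by blast
  qed (use i in blast)
  have "ec ` nodes \<subseteq> (\<lambda>a. ec (Inl a)) ` X \<union> (\<lambda>a. ec (Inr a)) ` (f ` T - X)"
  proof (rule image_subsetI)
    fix u assume "u \<in> nodes"
    then consider t where "t < N" "u = Inl (f t)" | i where "i \<in> f ` T" "u = Inr i"
      using p by (auto simp: pattern_nodes_def)
    thus "ec u \<in> (\<lambda>a. ec (Inl a)) ` X \<union> (\<lambda>a. ec (Inr a)) ` (f ` T - X)"
    proof cases
      case 1
      show ?thesis
      proof (cases t)
        case 0
        thus ?thesis using 1 by (auto simp: X_def)
      next
        case (Suc t')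
        hence "t' < l" using 1 N by simp
        hence "ec u = ec (Inr (f t'))" "f t' \<in> f ` T" using move[of t'] 1 Suc T by auto
        thus ?thesis using Inr_case[of "f t'"] by simp
      qed
    next
      case 2
      thus ?thesis using Inr_case by simp
    qed
  qed
  hence "card (ec ` nodes) \<le> card ((\<lambda>a. ec (Inl a)) ` X \<union> (\<lambda>a. ec (Inr a)) ` (f ` T - X))"
    by (intro card_mono) (auto simp: X_def)
  also have "\<dots> \<le> card ((\<lambda>a. ec (Inl a)) ` X) + card (f ` T - X)"
    by (rule order_trans[OF card_Un_le]) (simp add: card_image_le)
  finally have 1: "card (ec ` nodes) \<le> card ((\<lambda>a. ec (Inl a)) ` X) + card (f ` T - X)" .
  have "ec (Inl (f (Suc t1))) = ec (Inl (f (Suc s1)))"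
    using move[of t1] move[of s1] s1 dev by simp
  hence 2: "card ((\<lambda>a. ec (Inl a)) ` X) + 1 \<le> card X"
    using s1 dev ne by (intro card_image_collide[of X "f (Suc t1)" "f (Suc s1)"]) (auto simp: X_def)
  have "card (f ` T - X) = card (f ` T) - card X"
    using XT by (intro card_Diff_subset) (auto simp: X_def)
  moreover have "card X \<le> card (f ` T)" using XT by (intro card_mono) auto
  ultimately have 3: "ncomp nodes (pattern_edges T f p {}) + 1 \<le> card sources"
    using 1 2 by (simp add: ncomp_def ec_def sources_def)
  have "pattern_edges T f p {} = edges \<union> (\<lambda>\<theta>. (Inr (p (f \<theta>)), Inl (f (Suc \<theta>)))) ` J"
    using J_sub by (auto simp: pattern_edges_def)
  moreover have "(\<lambda>\<theta>. (Inr (p (f \<theta>)), Inl (f (Suc \<theta>)))) ` J \<subseteq> nodes \<times> nodes"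
    using J_sub T_Suc by (auto simp: pattern_nodes_def)
  ultimately have "cc \<le> ncomp nodes (pattern_edges T f p {}) + card J"
    using ncomp_Un_le[of nodes "(\<lambda>\<theta>. (Inr (p (f \<theta>)), Inl (f (Suc \<theta>)))) ` J" edges]
      card_image_le[OF finJ, of "\<lambda>\<theta>. (Inr (p (f \<theta>)) :: nat + nat, Inl (f (Suc \<theta>)) :: nat + nat)"]
    by simp
  thus ?thesis using 3 excess_eq by linarith
qed

lemma not_tame_deviations:
  assumes "\<not> tame l w"
  obtains t1 t2 where "path_deviates w t1" "path_deviates w t2" "t1 < t2" "Suc t2 < l"
proof -
  let ?S = "{t. Suc t < l \<and> path_deviates w t}"
  have fin: "finite ?S" by (rule finite_subset[of _ "{..l}"]) auto
  have "card ?S > 1" using assms by (simp add: tame_def)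
  then obtain a b where ab: "a \<in> ?S" "b \<in> ?S" "a \<noteq> b"
    using fin by (metis card_le_Suc0_iff_eq One_nat_def not_less)
  show ?thesis
  proof (cases "a < b")
    case True thus ?thesis using that[of a b] ab by auto
  next
    case False thus ?thesis using that[of b a] ab by auto
  qed
qed

text \<open>This supplies \<open>connected\<close> both for closed walks and, with a single block,
  for paths.\<close>

lemma blocks_connected:
  assumes N: "N = B * Suc l" and T: "T = {\<theta>. \<theta> < N \<and> \<theta> mod Suc l \<noteq> l}"
    and tie: "\<And>j. Suc j < B \<Longrightarrow> f (j * Suc l) = f (Suc j * Suc l) \<or> f (j * Suc l + l) = f (Suc j * Suc l + l)"
    and C: "C \<subseteq> {..<N}" "C \<noteq> {}" and move: "\<And>\<theta>. \<theta> \<in> T \<Longrightarrow> \<theta> \<in> C \<longleftrightarrow> Suc \<theta> \<in> C"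
    and same: "\<And>\<theta> \<theta>'. \<theta> < N \<Longrightarrow> \<theta>' < N \<Longrightarrow> f \<theta> = f \<theta>' \<Longrightarrow> \<theta> \<in> C \<longleftrightarrow> \<theta>' \<in> C"
  shows "C = {..<N}"
proof -
  have lt: "j * Suc l + t < N" if "j < B" "t \<le> l" for j t
  proof -
    have "Suc j * Suc l \<le> N" unfolding N using that by (intro mult_le_mono1) simp
    thus ?thesis using that by simp
  qed
  have blk: "j * Suc l + t \<in> C \<longleftrightarrow> j * Suc l \<in> C" if "j < B" "t \<le> l" for j t
    using that(2)
  proof (induction t)
    case (Suc t)
    have "(j * Suc l + t) mod Suc l = t" using Suc by (simp del: mult_Suc_right)
    hence "j * Suc l + t \<in> T" using Suc lt[OF that(1), of t] T by simp
    thus ?case using move[of "j * Suc l + t"] Suc by simp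
  qed simp
  have next_blk: "Suc j * Suc l \<in> C \<longleftrightarrow> j * Suc l \<in> C" if j: "Suc j < B" for j
  proof -
    have l0: "j * Suc l < N" "Suc j * Suc l < N" "j * Suc l + l < N" "Suc j * Suc l + l < N"
      using lt[of j 0] lt[of "Suc j" 0] lt[of j l] lt[of "Suc j" l] j by auto
    from tie[OF j] show ?thesis
    proof
      assume "f (j * Suc l) = f (Suc j * Suc l)"
      thus ?thesis using same l0 by blast
    next
      assume "f (j * Suc l + l) = f (Suc j * Suc l + l)"
      hence "j * Suc l + l \<in> C \<longleftrightarrow> Suc j * Suc l + l \<in> C" using same l0 by blast
      thus ?thesis using blk[of j l] blk[of "Suc j" l] j by simp
    qed
  qed
  have all: "j * Suc l \<in> C \<longleftrightarrow> 0 \<in> C" if "j < B" for j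
    using that
  proof (induction j)
    case (Suc j)
    thus ?case using next_blk[of j] by simp
  qed simp
  have mem: "\<theta> \<in> C \<longleftrightarrow> 0 \<in> C" if "\<theta> < N" for \<theta>
  proof -
    have 1: "\<theta> = \<theta> div Suc l * Suc l + \<theta> mod Suc l" by (rule div_mult_mod_eq[symmetric])
    have 2: "\<theta> div Suc l < B" using that N by (simp add: less_mult_imp_div_less)
    have 3: "\<theta> mod Suc l \<le> l" by (metis less_Suc_eq_le mod_less_divisor zero_less_Suc)
    show ?thesis using blk[OF 2 3] all[OF 2] 1 by simp
  qed
  thus ?thesis using C by auto
qed

text \<open>At such a point the product over its moves is a single factor of mean zero; cancellation
  is claimed nowhere else.\<close>

definition once :: "nat set \<Rightarrow> (nat \<Rightarrow> nat) \<Rightarrow> nat set" where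
  "once T f = {i \<in> f ` T. \<exists>\<theta>\<in>T. \<forall>\<theta>'\<in>T. f \<theta>' = i \<longleftrightarrow> \<theta>' = \<theta>}"

lemma mergings_visits:
  assumes "p \<in> mergings (f ` T) (once T f)" "i \<in> f ` T"
  shows "(\<exists>i'\<in>f ` T. i' \<noteq> i \<and> p i' = p i) \<or> (\<exists>\<theta>\<in>T. \<exists>\<theta>'\<in>T. \<theta> \<noteq> \<theta>' \<and> f \<theta> = i \<and> f \<theta>' = i)"
proof (cases "i \<in> once T f")
  case True
  thus ?thesis using assms by (auto simp: mergings_def)
next
  case False
  obtain \<theta> where "\<theta> \<in> T" "f \<theta> = i" using assms(2) by auto
  moreover from this False assms(2) obtain \<theta>' where "\<theta>' \<in> T" "\<not> (f \<theta>' = i \<longleftrightarrow> \<theta>' = \<theta>)"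
    by (auto simp: once_def)
  ultimately show ?thesis by blast
qed

lemma good_pattern_first_index:
  assumes T: "T \<subseteq> {..<N}" "\<And>\<theta>. \<theta> \<in> T \<Longrightarrow> Suc \<theta> < N" and N: "N > 0"
    and f: "f = first_index N W" and p: "p \<in> mergings (f ` T) S" and J: "J \<subseteq> T"
    and conn: "\<And>C. C \<subseteq> {..<N} \<Longrightarrow> C \<noteq> {} \<Longrightarrow> (\<And>\<theta>. \<theta> \<in> T \<Longrightarrow> \<theta> \<in> C \<longleftrightarrow> Suc \<theta> \<in> C) \<Longrightarrow>
      (\<And>\<theta> \<theta>'. \<theta> < N \<Longrightarrow> \<theta>' < N \<Longrightarrow> f \<theta> = f \<theta>' \<Longrightarrow> \<theta> \<in> C \<longleftrightarrow> \<theta>' \<in> C) \<Longrightarrow> C = {..<N}"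
  shows "good_pattern N T f p J"
proof
  show "T \<subseteq> {..<N}" by fact
  show "\<And>\<theta>. \<theta> \<in> T \<Longrightarrow> Suc \<theta> < N" by fact
  show "N > 0" by fact
  show "f \<theta> \<le> \<theta>" if "\<theta> < N" for \<theta> unfolding f by (rule first_index_le[OF that])
  show "f (f \<theta>) = f \<theta>" if "\<theta> < N" for \<theta> unfolding f by (rule first_index_idem[OF that])
  show "p i \<in> f ` T" if "i \<in> f ` T" for i using p that by (auto simp: mergings_def)
  show "J \<subseteq> T" by fact
  show "f \<in> {..<N} \<rightarrow>\<^sub>E {..<N}" unfolding f by (rule first_index_PiE)
  show "p \<in> f ` T \<rightarrow>\<^sub>E f ` T" using p by (auto simp: mergings_def)
  show "p (p i) = p i" if "i \<in> f ` T" for i using p that by (auto simp: mergings_def)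
qed (rule conn; assumption)

lemma sum_by_level_le:
  fixes g :: "'b \<Rightarrow> real" and c M :: "nat \<Rightarrow> real"
  assumes "finite P" "finite K" "\<And>x. x \<in> P \<Longrightarrow> g x \<le> c (ex x)" "\<And>x. x \<in> P \<Longrightarrow> ex x \<in> K"
    "\<And>k. k \<in> K \<Longrightarrow> real (card {x \<in> P. ex x = k}) \<le> M k" "\<And>k. c k \<ge> 0"
  shows "(\<Sum>x\<in>P. g x) \<le> (\<Sum>k\<in>K. M k * c k)"
proof -
  have "(\<Sum>x\<in>P. g x) = (\<Sum>k\<in>K. \<Sum>x | x \<in> P \<and> ex x = k. g x)"
    using assms by (intro sum.group[symmetric]) auto
  also have "\<dots> \<le> (\<Sum>k\<in>K. \<Sum>x | x \<in> P \<and> ex x = k. c k)"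
    using assms by (intro sum_mono) auto
  also have "\<dots> = (\<Sum>k\<in>K. real (card {x \<in> P. ex x = k}) * c k)" by simp
  also have "\<dots> \<le> (\<Sum>k\<in>K. M k * c k)"
    using assms by (intro sum_mono mult_right_mono) auto
  finally show ?thesis .
qed

definition pattern_set :: "nat set \<Rightarrow> (nat \<Rightarrow> nat) set \<Rightarrow> ((nat \<Rightarrow> nat) \<Rightarrow> nat set) \<Rightarrow>
    ((nat \<Rightarrow> nat) \<times> (nat \<Rightarrow> nat) \<times> nat set) set" where
  "pattern_set T Fs S = (SIGMA f:Fs. mergings (f ` T) (S f) \<times> Pow T)"

lemma sum_pattern_set:
  assumes "finite Fs" "finite T"
  shows "(\<Sum>f\<in>Fs. \<Sum>p\<in>mergings (f ` T) (S f). \<Sum>J\<in>Pow T. (g f p J :: real)) =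
    (\<Sum>(f, p, J)\<in>pattern_set T Fs S. g f p J)"
  unfolding pattern_set_def using assms
  by (subst sum.Sigma[symmetric]) (auto simp: sum.cartesian_product)

lemma finite_pattern_set: "finite Fs \<Longrightarrow> finite T \<Longrightarrow> finite (pattern_set T Fs S)"
  unfolding pattern_set_def by (intro finite_SigmaI) auto

text \<open>Keeps the range of the levels in the sums below finite.\<close>

lemma (in walk_pattern) excess_le: "excess \<le> 2 * N"
proof -
  have "card sources \<le> card T" "card J \<le> card T"
    using J_sub by (auto simp: sources_def card_image_le intro: card_mono)
  moreover have "card T < N"
  proof -
    have "T \<subseteq> {..<N - 1}" using T_Suc by force
    hence "card T \<le> N - 1" using card_mono[of "{..<N - 1}" T] by simp
    thus ?thesis using N_pos by linarith
  qed
  ultimately show ?thesis using excess_eq by linarith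
qed

context regular_graph
begin

lemma ratio_le_1: "real r / real n \<le> 1"
  using r_le_n n_pos by simp

definition path_weight :: "nat \<Rightarrow> ('a \<Rightarrow> 'a) \<Rightarrow> (nat \<Rightarrow> 'a) \<Rightarrow> real" where
  "path_weight l \<sigma> w = (\<Prod>t<l. qc (\<sigma> (w t)) (w (Suc t)))"

definition wild_paths :: "nat \<Rightarrow> (nat \<Rightarrow> 'a) set" where
  "wild_paths l = {w \<in> {..<Suc l} \<rightarrow>\<^sub>E V. \<not> tame l w}"

lemma finite_paths [simp]: "finite ({..<k} \<rightarrow>\<^sub>E V)" for k :: nat
  using finV by (intro finite_PiE) auto

text \<open>Absolute values leave no cancellation, so \<open>S\<close> is empty and \<open>p\<close>
  the identity. The smallness comes from an excess of at least 2 against the single factor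
  \<open>n\<close>.\<close>

lemma avg_wild_le:
  assumes N: "2 * (Suc l) ^ 2 \<le> n"
  shows "avg (\<lambda>\<sigma>. \<Sum>w\<in>wild_paths l. \<bar>path_weight l \<sigma> w\<bar>) \<le>
    2 * (\<Sum>k\<in>{2..2 * Suc l}. (9 * 2 ^ Suc l * real (k + 2) ^ Suc l * real (Suc l) ^ (4 * k + 6)) *
      (real n * (real r / real n) ^ k))"
proof -
  define N' T where "N' = Suc l" and "T = {..<l}"
  let ?W = "wild_paths l" and ?S = "\<lambda>_ :: nat \<Rightarrow> nat. {} :: nat set"
  define P where "P = pattern_set T (first_index N' ` ?W) ?S"
  have T: "T \<subseteq> {..<N'}" "\<And>\<theta>. \<theta> \<in> T \<Longrightarrow> Suc \<theta> < N'" by (auto simp: T_def N'_def)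
  have W: "?W \<subseteq> {..<N'} \<rightarrow>\<^sub>E V" by (auto simp: wild_paths_def N'_def)
  have finW: "finite ?W" by (rule finite_subset[OF W]) simp
  have finP: "finite P" unfolding P_def using finW by (intro finite_pattern_set) (auto simp: T_def)
  have "avg (\<lambda>\<sigma>. \<Sum>w\<in>?W. \<bar>path_weight l \<sigma> w\<bar>) = (\<Sum>w\<in>?W. avg (\<lambda>\<sigma>. \<Prod>\<theta>\<in>T. \<bar>qc (\<sigma> (w \<theta>)) (w (Suc \<theta>))\<bar>))"
    by (simp add: avg_sum path_weight_def abs_prod T_def)
  also have "\<dots> \<le> (\<Sum>w\<in>?W. \<bar>avg (\<lambda>\<sigma>. \<Prod>\<theta>\<in>T. \<bar>qc (\<sigma> (w \<theta>)) (w (Suc \<theta>))\<bar>)\<bar>)"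
    by (intro sum_mono) simp
  also have "\<dots> \<le> 2 * (\<Sum>f\<in>first_index N' ` ?W. \<Sum>p\<in>mergings (f ` T) {}. \<Sum>J\<in>Pow T. weight N' T f p J)"
    by (rule sum_avg_walk_le[OF T W]) (use N abs_qc_le in \<open>auto simp: N'_def\<close>)
  also have "\<dots> = 2 * (\<Sum>(f, p, J)\<in>P. weight N' T f p J)"
    unfolding P_def using finW by (subst sum_pattern_set) (auto simp: T_def)
  also have "(\<Sum>(f, p, J)\<in>P. weight N' T f p J) \<le>
      (\<Sum>k\<in>{2..2 * N'}. (9 * 2 ^ N' * real (k + 2) ^ N' * real N' ^ (4 * k + 6)) *
      (real n * (real r / real n) ^ k))"
  proof (rule sum_by_level_le[where ex = "\<lambda>(f, p, J). walk_pattern.excess N' T f p J"])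
    have good: "good_pattern N' T f p J" and pid: "\<And>i. i \<in> f ` T \<Longrightarrow> p i = i"
      and wild: "\<not> tame l f" if mem: "(f, p, J) \<in> P" for f p J
    proof -
      obtain w where w: "w \<in> ?W" "f = first_index N' w" and p: "p \<in> mergings (f ` T) {}" and J: "J \<subseteq> T"
        using mem by (auto simp: P_def pattern_set_def)
      show "good_pattern N' T f p J"
      proof (rule good_pattern_first_index[OF T _ w(2) p J])
        show "N' > 0" by (simp add: N'_def)
        fix C assume C: "C \<subseteq> {..<N'}" "C \<noteq> {}" "\<And>\<theta>. \<theta> \<in> T \<Longrightarrow> \<theta> \<in> C \<longleftrightarrow> Suc \<theta> \<in> C"
          "\<And>\<theta> \<theta>'. \<theta> < N' \<Longrightarrow> \<theta>' < N' \<Longrightarrow> f \<theta> = f \<theta>' \<Longrightarrow> \<theta> \<in> C \<longleftrightarrow> \<theta>' \<in> C"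
        show "C = {..<N'}"
        proof (rule blocks_connected[OF _ _ _ C(1,2)])
          show "N' = 1 * Suc l" by (simp add: N'_def)
          show "T = {\<theta>. \<theta> < N' \<and> \<theta> mod Suc l \<noteq> l}" unfolding T_def N'_def
            by (auto simp: less_Suc_eq)
          show "\<theta> \<in> C \<longleftrightarrow> Suc \<theta> \<in> C" if "\<theta> \<in> T" for \<theta> by (rule C(3)[OF that])
          show "\<theta> \<in> C \<longleftrightarrow> \<theta>' \<in> C" if "\<theta> < N'" "\<theta>' < N'" "f \<theta> = f \<theta>'" for \<theta> \<theta>' by (rule C(4)[OF that])
        qed simp
      qed
      show "p i = i" if "i \<in> f ` T" for i using p that by (auto simp: mergings_def)
      have "path_deviates w t \<longleftrightarrow> path_deviates f t" if "Suc t < l" for t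
        using that w(2) by (intro path_deviates_cong) (auto simp: first_index_eq_iff N'_def)
      hence "{t. Suc t < l \<and> path_deviates w t} = {t. Suc t < l \<and> path_deviates f t}" by auto
      thus "\<not> tame l f" using w(1) by (simp add: wild_paths_def tame_def)
    qed
    fix x assume x: "x \<in> P"
    obtain f p J where 1: "x = (f, p, J)" by (cases x)
    interpret good_pattern N' T f p J using good x 1 by blast
    have pid: "\<And>i. i \<in> f ` T \<Longrightarrow> p i = i" using pid x 1 by blast
    obtain t1 t2 where "path_deviates f t1" "path_deviates f t2" "t1 < t2" "Suc t2 < l"
      using not_tame_deviations[of l f] wild x 1 by blast
    hence "excess \<ge> 2"
      using two_deviations_excess[of l t1 t2] pid by (simp add: N'_def T_def)
    thus "(case x of (f, p, J) \<Rightarrow> walk_pattern.excess N' T f p J) \<in> {2..2 * N'}"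
      using excess_le 1 by simp
    have "p ` f ` T = f ` T" using pid by force
    moreover have "card (f ` {..<N'}) \<le> card T + 1"
      using card_image_le[of "{..<N'}" f] by (simp add: N'_def T_def)
    ultimately have "real r ^ (card (f ` {..<N'}) + card (p ` f ` T)) \<le> real r ^ (card (f ` T) + 1 + card T)"
      using r_pos by (intro power_increasing) auto
    hence "real r ^ (card (f ` {..<N'}) + card (p ` f ` T)) / real r ^ (card (f ` T) + 1 + card T) \<le> 1"
      using r_pos by simp
    hence "real n * (real r / real n) ^ excess *
       (real r ^ (card (f ` {..<N'}) + card (p ` f ` T)) / real r ^ (card (f ` T) + 1 + card T)) \<le>
       real n * (real r / real n) ^ excess"
      using r_pos n_pos by (intro mult_left_le) auto
    thus "(case x of (f, p, J) \<Rightarrow> weight N' T f p J) \<le>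
        real n * (real r / real n) ^ (case x of (f, p, J) \<Rightarrow> walk_pattern.excess N' T f p J)"
      using weight_eq[OF walk_pattern_axioms] 1 by simp
  next
    fix k assume "k \<in> {2..2 * N'}"
    have good: "good_pattern N' T f p J" if mem: "(f, p, J) \<in> P" for f p J
    proof -
      obtain w where w: "w \<in> ?W" "f = first_index N' w" and p: "p \<in> mergings (f ` T) {}" and J: "J \<subseteq> T"
        using mem by (auto simp: P_def pattern_set_def)
      show "good_pattern N' T f p J"
      proof (rule good_pattern_first_index[OF T _ w(2) p J])
        show "N' > 0" by (simp add: N'_def)
        fix C assume C: "C \<subseteq> {..<N'}" "C \<noteq> {}" "\<And>\<theta>. \<theta> \<in> T \<Longrightarrow> \<theta> \<in> C \<longleftrightarrow> Suc \<theta> \<in> C"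
          "\<And>\<theta> \<theta>'. \<theta> < N' \<Longrightarrow> \<theta>' < N' \<Longrightarrow> f \<theta> = f \<theta>' \<Longrightarrow> \<theta> \<in> C \<longleftrightarrow> \<theta>' \<in> C"
        show "C = {..<N'}"
        proof (rule blocks_connected[OF _ _ _ C(1,2)])
          show "N' = 1 * Suc l" by (simp add: N'_def)
          show "T = {\<theta>. \<theta> < N' \<and> \<theta> mod Suc l \<noteq> l}" unfolding T_def N'_def
            by (auto simp: less_Suc_eq)
          show "\<theta> \<in> C \<longleftrightarrow> Suc \<theta> \<in> C" if "\<theta> \<in> T" for \<theta> by (rule C(3)[OF that])
          show "\<theta> \<in> C \<longleftrightarrow> \<theta>' \<in> C" if "\<theta> < N'" "\<theta>' < N'" "f \<theta> = f \<theta>'" for \<theta> \<theta>' by (rule C(4)[OF that])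
        qed simp
      qed
    qed
    let ?Pk = "{x \<in> P. (case x of (f, p, J) \<Rightarrow> walk_pattern.excess N' T f p J) = k}"
    have "real (card ?Pk) \<le> 9 * 2 ^ N' * real (k + 1 + 1) ^ N' * real N' ^ (4 * k + 6 * 1)"
    proof (rule card_crude_le)
      show "good_pattern N' T f p J" if "(f, p, J) \<in> ?Pk" for f p J using good that by auto
      show "card (f ` {..<N'}) \<le> card (f ` T) + 1" if "(f, p, J) \<in> ?Pk" for f p J
      proof -
        have "{..<N'} = insert l T" by (auto simp: N'_def T_def)
        thus ?thesis by (simp add: card_insert_if T_def)
      qed
      show "walk_pattern.excess N' T f p J = k" if "(f, p, J) \<in> ?Pk" for f p J using that by auto
      have "{\<theta>. \<theta> < N' \<and> (\<forall>\<theta>'\<in>T. \<theta> \<noteq> Suc \<theta>')} \<subseteq> {0}"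
      proof
        fix \<theta> assume "\<theta> \<in> {\<theta>. \<theta> < N' \<and> (\<forall>\<theta>'\<in>T. \<theta> \<noteq> Suc \<theta>')}"
        thus "\<theta> \<in> {0}" by (cases \<theta>) (auto simp: N'_def T_def)
      qed
      thus "card {\<theta>. \<theta> < N' \<and> (\<forall>\<theta>'\<in>T. \<theta> \<noteq> Suc \<theta>')} \<le> 1"
        using card_mono[of "{0}" "{\<theta>. \<theta> < N' \<and> (\<forall>\<theta>'\<in>T. \<theta> \<noteq> Suc \<theta>')}"] by simp
      show "N' > 0" by (simp add: N'_def)
      show "T \<subseteq> {..<N'}" by (rule T(1))
    qed
    thus "real (card ?Pk) \<le> 9 * 2 ^ N' * real (k + 2) ^ N' * real N' ^ (4 * k + 6)" by (simp add: add.commute)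
  qed (use finP n_pos in auto)
  finally show ?thesis by (simp add: N'_def)
qed

section \<open>Averages over closed walks\<close>

text \<open>Blocks \<open>2 i\<close> and \<open>2 i + 1\<close> share their start, blocks
  \<open>2 i + 1\<close> and \<open>2 i + 2\<close> their end, as do the last block and the first;
  all blocks run forwards. These are the indices in the trace of the \<open>m\<close>-th power of
  \<open>gram K\<close>, for \<open>K\<close> a kernel of paths.\<close>

definition closed_walks :: "((nat \<Rightarrow> 'a) \<Rightarrow> bool) \<Rightarrow> nat \<Rightarrow> nat \<Rightarrow> (nat \<Rightarrow> 'a) set" where
  "closed_walks F m l = {W \<in> {..<2 * m * Suc l} \<rightarrow>\<^sub>E V.
     (\<forall>i<m. W (2 * i * Suc l) = W ((2 * i + 1) * Suc l)) \<and>
     (\<forall>i. Suc i < m \<longrightarrow> W ((2 * i + 1) * Suc l + l) = W ((2 * i + 2) * Suc l + l)) \<and>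
     W ((2 * m - 1) * Suc l + l) = W l \<and>
     (\<forall>j<2 * m. F (restrict (\<lambda>t. W (j * Suc l + t)) {..<Suc l}))}"

definition moves :: "nat \<Rightarrow> nat \<Rightarrow> nat set" where
  "moves B l = {\<theta>. \<theta> < B * Suc l \<and> \<theta> mod Suc l \<noteq> l}"

lemma moves_sub: "moves B l \<subseteq> {..<B * Suc l}"
  by (auto simp: moves_def)

lemma block_less: "j < B \<Longrightarrow> t \<le> l \<Longrightarrow> j * Suc l + t < B * Suc l"
proof -
  assume "j < B" "t \<le> l"
  hence "Suc j * Suc l \<le> B * Suc l" by (intro mult_le_mono1) simp
  thus ?thesis using \<open>t \<le> l\<close> by simp
qed

lemma index_split:
  assumes "\<theta> < B * Suc l"
  obtains j t where "j < B" "t \<le> l" "\<theta> = j * Suc l + t" "\<theta> mod Suc l = t" "\<theta> div Suc l = j"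
proof -
  have "\<theta> = \<theta> div Suc l * Suc l + \<theta> mod Suc l" by (rule div_mult_mod_eq[symmetric])
  moreover have "\<theta> div Suc l < B" using assms by (simp add: less_mult_imp_div_less)
  moreover have "\<theta> mod Suc l \<le> l" by (metis less_Suc_eq_le mod_less_divisor zero_less_Suc)
  ultimately show ?thesis using that by blast
qed

lemma moves_Suc: "\<theta> \<in> moves B l \<Longrightarrow> Suc \<theta> < B * Suc l"
proof -
  assume "\<theta> \<in> moves B l"
  hence \<theta>: "\<theta> < B * Suc l" "\<theta> mod Suc l \<noteq> l" by (auto simp: moves_def)
  from \<theta>(1) obtain j t where jt: "j < B" "t \<le> l" "\<theta> = j * Suc l + t" "\<theta> mod Suc l = t"
    by (rule index_split) blast
  have "Suc t \<le> l" using jt \<theta> by simp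
  thus ?thesis using block_less[OF jt(1), of "Suc t"] jt(3) by simp
qed

lemma block_index_mod: "t \<le> l \<Longrightarrow> (j * Suc l + t) mod Suc l = t"
  by (simp del: mult_Suc_right)

lemma block_index_div: "t \<le> l \<Longrightarrow> (j * Suc l + t) div Suc l = j"
  by (simp del: mult_Suc_right)

lemma inj_on_block_index: "inj_on (\<lambda>(j, t). j * Suc l + t) ({..<B} \<times> {..<l})"
proof (rule inj_onI, clarify)
  fix j t j' t' assume "t < l" "t' < l" and eq: "j * Suc l + t = j' * Suc l + t'"
  have "j = (j * Suc l + t) div Suc l" "t = (j * Suc l + t) mod Suc l"
    using block_index_mod[of t l j] block_index_div[of t l j] \<open>t < l\<close> by (metis less_imp_le_nat)+
  moreover have "j' = (j' * Suc l + t') div Suc l" "t' = (j' * Suc l + t') mod Suc l"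
    using block_index_mod[of t' l j'] block_index_div[of t' l j'] \<open>t' < l\<close> by (metis less_imp_le_nat)+
  ultimately show "j = j' \<and> t = t'" using eq by metis
qed

lemma moves_eq: "moves B l = (\<lambda>(j, t). j * Suc l + t) ` ({..<B} \<times> {..<l})"
proof (intro equalityI subsetI)
  fix \<theta> assume "\<theta> \<in> moves B l"
  hence \<theta>: "\<theta> < B * Suc l" "\<theta> mod Suc l \<noteq> l" by (auto simp: moves_def)
  from \<theta>(1) obtain j t where jt: "j < B" "t \<le> l" "\<theta> = j * Suc l + t" "\<theta> mod Suc l = t"
    by (rule index_split) blast
  have "t < l" using jt \<theta> by simp
  thus "\<theta> \<in> (\<lambda>(j, t). j * Suc l + t) ` ({..<B} \<times> {..<l})" using jt by force
next
  fix \<theta> assume "\<theta> \<in> (\<lambda>(j, t). j * Suc l + t) ` ({..<B} \<times> {..<l})"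
  then obtain j t where jt: "j < B" "t < l" "\<theta> = j * Suc l + t" by auto
  thus "\<theta> \<in> moves B l" using block_less[of j B t l] block_index_mod[of t l j] by (simp add: moves_def)
qed

lemma card_moves: "card (moves B l) = B * l"
  unfolding moves_eq using inj_on_block_index by (simp add: card_image)

definition walk_patterns :: "((nat \<Rightarrow> 'a) \<Rightarrow> bool) \<Rightarrow> nat \<Rightarrow> nat \<Rightarrow> ((nat \<Rightarrow> nat) \<times> (nat \<Rightarrow> nat) \<times> nat set) set" where
  "walk_patterns F m l = pattern_set (moves (2 * m) l)
     (first_index (2 * m * Suc l) ` closed_walks F m l) (once (moves (2 * m) l))"

lemma finite_moves [simp]: "finite (moves B l)"
  using moves_sub finite_subset by blast

lemma finite_closed_walks [simp]: "finite (closed_walks F m l)"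
  by (rule finite_subset[of _ "{..<2 * m * Suc l} \<rightarrow>\<^sub>E V"]) (auto simp: closed_walks_def)

lemma finite_walk_patterns [simp]: "finite (walk_patterns F m l)"
  unfolding walk_patterns_def by (intro finite_pattern_set) auto

lemma avg_closed_walks_le:
  assumes N: "2 * (2 * m * Suc l) ^ 2 \<le> n"
  shows "avg (\<lambda>\<sigma>. \<Sum>W\<in>closed_walks F m l. \<Prod>\<theta>\<in>moves (2 * m) l. qc (\<sigma> (W \<theta>)) (W (Suc \<theta>))) \<le>
    2 * (\<Sum>(f, p, J)\<in>walk_patterns F m l. weight (2 * m * Suc l) (moves (2 * m) l) f p J)"
proof -
  let ?N = "2 * m * Suc l" and ?T = "moves (2 * m) l" and ?W = "closed_walks F m l"
  have T: "?T \<subseteq> {..<?N}" "\<And>\<theta>. \<theta> \<in> ?T \<Longrightarrow> Suc \<theta> < ?N"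
    using moves_sub moves_Suc by auto
  have W: "?W \<subseteq> {..<?N} \<rightarrow>\<^sub>E V" by (auto simp: closed_walks_def)
  have "avg (\<lambda>\<sigma>. \<Sum>W\<in>?W. \<Prod>\<theta>\<in>?T. qc (\<sigma> (W \<theta>)) (W (Suc \<theta>))) =
      (\<Sum>W\<in>?W. avg (\<lambda>\<sigma>. \<Prod>\<theta>\<in>?T. qc (\<sigma> (W \<theta>)) (W (Suc \<theta>))))"
    by (rule avg_sum)
  also have "\<dots> \<le> (\<Sum>W\<in>?W. \<bar>avg (\<lambda>\<sigma>. \<Prod>\<theta>\<in>?T. qc (\<sigma> (W \<theta>)) (W (Suc \<theta>)))\<bar>)"
    by (intro sum_mono) simp
  also have "\<dots> \<le> 2 * (\<Sum>f\<in>first_index ?N ` ?W. \<Sum>p\<in>mergings (f ` ?T) (once ?T f). \<Sum>J\<in>Pow ?T. weight ?N ?T f p J)"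
  proof (rule sum_avg_walk_le[OF T W])
    show "\<bar>qc y x\<bar> \<le> q y x + 1 / n" for y x by (rule abs_qc_le)
    show "once ?T f \<subseteq> f ` ?T" for f by (auto simp: once_def)
    show "2 * ?N ^ 2 \<le> n" by (rule N)
    fix W s assume W': "W \<in> ?W" and s: "s \<in> once ?T (first_index ?N W)"
    obtain \<theta>0 where \<theta>0: "\<theta>0 \<in> ?T" "\<forall>\<theta>'\<in>?T. first_index ?N W \<theta>' = s \<longleftrightarrow> \<theta>' = \<theta>0"
      using s by (auto simp: once_def)
    hence "{\<theta> \<in> ?T. first_index ?N W \<theta> = s} = {\<theta>0}" by auto
    hence "(\<Sum>y\<in>V. \<Prod>\<theta> | \<theta> \<in> ?T \<and> first_index ?N W \<theta> = s. qc y (W (Suc \<theta>))) = (\<Sum>y\<in>V. qc y (W (Suc \<theta>0)))"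
      by simp
    also have "\<dots> = 0"
    proof (rule sum_qc_col)
      show "W (Suc \<theta>0) \<in> V" using W' W T(2)[OF \<theta>0(1)] by (auto simp: PiE_def Pi_def)
    qed
    finally show "(\<Sum>y\<in>V. \<Prod>\<theta> | \<theta> \<in> ?T \<and> first_index ?N W \<theta> = s. qc y (W (Suc \<theta>))) = 0" .
  qed
  also have "\<dots> = 2 * (\<Sum>(f, p, J)\<in>walk_patterns F m l. weight ?N ?T f p J)"
    unfolding walk_patterns_def by (subst sum_pattern_set) auto
  finally show ?thesis .
qed

text \<open>Neighbouring blocks share a start or an end, whence connectedness. Each block end
  coincides with that of a neighbour, which ties the times without a move.\<close>

lemma walk_patternsD:
  assumes "(f, p, J) \<in> walk_patterns F m l" "m > 0"
  shows "(\<exists>W\<in>closed_walks F m l. f = first_index (2 * m * Suc l) W) \<and>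
    good_pattern (2 * m * Suc l) (moves (2 * m) l) f p J \<and>
    (\<forall>i\<in>f ` moves (2 * m) l. (\<exists>i'\<in>f ` moves (2 * m) l. i' \<noteq> i \<and> p i' = p i) \<or>
       (\<exists>\<theta>\<in>moves (2 * m) l. \<exists>\<theta>'\<in>moves (2 * m) l. \<theta> \<noteq> \<theta>' \<and> f \<theta> = i \<and> f \<theta>' = i)) \<and>
    (\<forall>\<theta>. \<theta> < 2 * m * Suc l \<longrightarrow> \<theta> \<notin> moves (2 * m) l \<longrightarrow> (\<exists>\<theta>'<2 * m * Suc l. \<theta>' \<noteq> \<theta> \<and> f \<theta>' = f \<theta>))"
proof -
  let ?N = "2 * m * Suc l" and ?T = "moves (2 * m) l"
  obtain W where W: "W \<in> closed_walks F m l" "f = first_index ?N W"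
    and p: "p \<in> mergings (f ` ?T) (once ?T f)" and J: "J \<subseteq> ?T"
    using assms by (auto simp: walk_patterns_def pattern_set_def)
  have T: "?T \<subseteq> {..<?N}" "\<And>\<theta>. \<theta> \<in> ?T \<Longrightarrow> Suc \<theta> < ?N"
    using moves_sub moves_Suc by auto
  have lt: "j * Suc l + t < ?N" if "j < 2 * m" "t \<le> l" for j t
    using block_less[OF that] .
  have starts: "W (2 * i * Suc l) = W ((2 * i + 1) * Suc l)" if "i < m" for i
    using W(1) that by (auto simp: closed_walks_def)
  have ends: "W ((2 * i + 1) * Suc l + l) = W ((2 * i + 2) * Suc l + l)" if "Suc i < m" for i
    using W(1) that by (auto simp: closed_walks_def)
  have last: "W ((2 * m - 1) * Suc l + l) = W l"
    using W(1) by (auto simp: closed_walks_def)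
  have feq: "f \<theta> = f \<theta>' \<longleftrightarrow> W \<theta> = W \<theta>'" if "\<theta> < ?N" "\<theta>' < ?N" for \<theta> \<theta>'
    unfolding W(2) by (rule first_index_eq_iff[OF that])
  have "good_pattern ?N ?T f p J"
  proof (rule good_pattern_first_index[OF T _ W(2) p J])
    show "?N > 0" using assms by simp
    fix C assume C: "C \<subseteq> {..<?N}" "C \<noteq> {}" "\<And>\<theta>. \<theta> \<in> ?T \<Longrightarrow> \<theta> \<in> C \<longleftrightarrow> Suc \<theta> \<in> C"
      "\<And>\<theta> \<theta>'. \<theta> < ?N \<Longrightarrow> \<theta>' < ?N \<Longrightarrow> f \<theta> = f \<theta>' \<Longrightarrow> \<theta> \<in> C \<longleftrightarrow> \<theta>' \<in> C"
    show "C = {..<?N}"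
    proof (rule blocks_connected[OF _ _ _ C(1,2)])
      show "?N = 2 * m * Suc l" ..
      show "?T = {\<theta>. \<theta> < ?N \<and> \<theta> mod Suc l \<noteq> l}" by (simp add: moves_def)
      show "\<theta> \<in> C \<longleftrightarrow> Suc \<theta> \<in> C" if "\<theta> \<in> ?T" for \<theta> by (rule C(3)[OF that])
      show "\<theta> \<in> C \<longleftrightarrow> \<theta>' \<in> C" if "\<theta> < ?N" "\<theta>' < ?N" "f \<theta> = f \<theta>'" for \<theta> \<theta>' by (rule C(4)[OF that])
      fix j assume j: "Suc j < 2 * m"
      show "f (j * Suc l) = f (Suc j * Suc l) \<or> f (j * Suc l + l) = f (Suc j * Suc l + l)"
      proof (cases "even j")
        case True
        then obtain i where i: "j = 2 * i" by (elim evenE)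
        have "W (j * Suc l) = W (Suc j * Suc l)" using starts[of i] i j by simp
        thus ?thesis using feq lt[of j 0] lt[of "Suc j" 0] j by simp
      next
        case False
        then obtain i where i: "j = 2 * i + 1" by (elim oddE)
        have "W (j * Suc l + l) = W (Suc j * Suc l + l)" using ends[of i] i j by simp
        thus ?thesis using feq[of "j * Suc l + l" "Suc j * Suc l + l"] lt[of j l] lt[of "Suc j" l] j by simp
      qed
    qed
  qed
  moreover have "\<exists>\<theta>'<?N. \<theta>' \<noteq> \<theta> \<and> f \<theta>' = f \<theta>" if \<theta>: "\<theta> < ?N" "\<theta> \<notin> ?T" for \<theta>
  proof -
    from \<theta>(1) obtain j t where jt: "j < 2 * m" "t \<le> l" "\<theta> = j * Suc l + t" "\<theta> mod Suc l = t"
      by (rule index_split) blast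
    hence t: "t = l" using \<theta> by (simp add: moves_def)
    \<comment> \<open>The neighbour with the same end: the preceding block for even
      \<open>j\<close>, the following one for odd \<open>j\<close>, cyclically.\<close>
    obtain j' where j': "j' < 2 * m" "j' \<noteq> j" "W (j' * Suc l + l) = W (j * Suc l + l)"
    proof (cases "even j")
      case True
      then obtain i where i: "j = 2 * i" by (elim evenE)
      show ?thesis
      proof (cases i)
        case 0
        thus ?thesis using that[of "2 * m - 1"] last i assms(2) by simp
      next
        case (Suc i')
        thus ?thesis using that[of "2 * i' + 1"] ends[of i'] i jt(1) by simp
      qed
    next
      case False
      then obtain i where i: "j = 2 * i + 1" by (elim oddE)
      show ?thesis
      proof (cases "Suc i < m")
        case True
        thus ?thesis using that[of "2 * i + 2"] ends[of i] i jt(1) by simp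
      next
        case False
        hence "j = 2 * m - 1" using i jt(1) by linarith
        thus ?thesis using that[of 0] last i assms(2) by simp
      qed
    qed
    have ne: "j' * Suc l + l \<noteq> \<theta>"
      using j' jt t block_index_div[of l l j'] block_index_div[of l l j] by auto
    show ?thesis
      using ne j' jt t lt[of j' l] lt[of j l] feq[of "j' * Suc l + l" \<theta>]
      by (intro exI[of _ "j' * Suc l + l"]) simp
  qed
  moreover have "(\<exists>i'\<in>f ` ?T. i' \<noteq> i \<and> p i' = p i) \<or>
      (\<exists>\<theta>\<in>?T. \<exists>\<theta>'\<in>?T. \<theta> \<noteq> \<theta>' \<and> f \<theta> = i \<and> f \<theta>' = i)" if "i \<in> f ` ?T" for i
    by (rule mergings_visits[OF p that])
  moreover have "\<exists>W\<in>closed_walks F m l. f = first_index ?N W" using W by blast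
  ultimately show ?thesis by (intro conjI ballI allI impI)
qed

lemmas walk_patterns_good = walk_patternsD[THEN conjunct2, THEN conjunct1]
lemmas walk_patterns_visits = walk_patternsD[THEN conjunct2, THEN conjunct2, THEN conjunct1, rule_format]
lemmas walk_patterns_tie = walk_patternsD[THEN conjunct2, THEN conjunct2, THEN conjunct2, rule_format]

end

context regular_graph
begin

lemma card_points_moves: "card (f ` {..<B * Suc l}) \<le> card (f ` moves B l) + B"
proof -
  have "f ` {..<B * Suc l} \<subseteq> f ` moves B l \<union> (\<lambda>j. f (j * Suc l + l)) ` {..<B}"
  proof (rule image_subsetI)
    fix \<theta> assume "\<theta> \<in> {..<B * Suc l}"
    hence \<theta>: "\<theta> < B * Suc l" by simp
    then obtain j t where jt: "j < B" "t \<le> l" "\<theta> = j * Suc l + t" "\<theta> mod Suc l = t"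
      by (rule index_split) blast
    show "f \<theta> \<in> f ` moves B l \<union> (\<lambda>j. f (j * Suc l + l)) ` {..<B}"
    proof (cases "t = l")
      case False
      hence "\<theta> \<in> moves B l" using \<theta> jt by (simp add: moves_def)
      thus ?thesis by blast
    qed (use jt in auto)
  qed
  hence "card (f ` {..<B * Suc l}) \<le> card (f ` moves B l \<union> (\<lambda>j. f (j * Suc l + l)) ` {..<B})"
    by (intro card_mono) auto
  also have "\<dots> \<le> card (f ` moves B l) + card ((\<lambda>j. f (j * Suc l + l)) ` {..<B})" by (rule card_Un_le)
  also have "card ((\<lambda>j. f (j * Suc l + l)) ` {..<B}) \<le> B" by (rule order_trans[OF card_image_le]) auto
  finally show ?thesis by simp
qed

lemma card_starts_moves: "card {\<theta>. \<theta> < B * Suc l \<and> (\<forall>\<theta>'\<in>moves B l. \<theta> \<noteq> Suc \<theta>')} \<le> B"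
proof -
  have "{\<theta>. \<theta> < B * Suc l \<and> (\<forall>\<theta>'\<in>moves B l. \<theta> \<noteq> Suc \<theta>')} \<subseteq> (\<lambda>j. j * Suc l) ` {..<B}"
  proof
    fix \<theta> assume "\<theta> \<in> {\<theta>. \<theta> < B * Suc l \<and> (\<forall>\<theta>'\<in>moves B l. \<theta> \<noteq> Suc \<theta>')}"
    hence \<theta>: "\<theta> < B * Suc l" "\<And>\<theta>'. \<theta>' \<in> moves B l \<Longrightarrow> \<theta> \<noteq> Suc \<theta>'" by auto
    from \<theta>(1) obtain j t where jt: "j < B" "t \<le> l" "\<theta> = j * Suc l + t" "\<theta> mod Suc l = t"
      by (rule index_split) blast
    have "t = 0"
    proof (rule ccontr)
      assume "t \<noteq> 0"
      then obtain u where u: "t = Suc u" by (cases t) auto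
      have "(j * Suc l + u) mod Suc l = u" using jt u by (intro block_index_mod) simp
      hence "j * Suc l + u \<in> moves B l" using block_less[OF jt(1), of u] jt u by (simp add: moves_def)
      thus False using \<theta>(2)[of "j * Suc l + u"] jt(3) u by simp
    qed
    thus "\<theta> \<in> (\<lambda>j. j * Suc l) ` {..<B}" using jt by auto
  qed
  hence "card {\<theta>. \<theta> < B * Suc l \<and> (\<forall>\<theta>'\<in>moves B l. \<theta> \<noteq> Suc \<theta>')} \<le> card ((\<lambda>j. j * Suc l) ` {..<B})"
    by (intro card_mono) auto
  also have "\<dots> \<le> B" by (rule order_trans[OF card_image_le]) auto
  finally show ?thesis .
qed

text \<open>At most \<open>m * l\<close> images for \<open>2 * m * l\<close> moves and at most
  \<open>2 * m\<close> points beyond the sources, inserted into \<open>weight_eq\<close>. The factor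
  \<open>r^(- m l)\<close> is \<open>\<rho>\<close> to the number of moves.\<close>

lemma walk_patterns_weight:
  assumes x: "(f, p, J) \<in> walk_patterns F m l" and m: "m > 0"
  shows "weight (2 * m * Suc l) (moves (2 * m) l) f p J \<le>
    (real n * real r ^ (2 * m) / real r ^ (m * l)) *
    (real r / real n) ^ walk_pattern.excess (2 * m * Suc l) (moves (2 * m) l) f p J"
proof -
  let ?N = "2 * m * Suc l" and ?T = "moves (2 * m) l"
  interpret good_pattern ?N ?T f p J by (rule walk_patterns_good[OF x m])
  have im: "2 * card (p ` f ` ?T) \<le> card ?T"
    using card_images_le walk_patterns_visits[OF x m] unfolding images_def sources_def by simp
  hence im': "card (p ` f ` ?T) \<le> m * l" by (simp add: card_moves)
  have pt: "card (f ` {..<?N}) \<le> card (f ` ?T) + 2 * m" by (rule card_points_moves)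
  have r1: "real r \<ge> 1" using r_pos by simp
  have K: "card ?T = 2 * (m * l)" by (simp add: card_moves)
  have "real r ^ (card (f ` {..<?N}) + card (p ` f ` ?T)) * real r ^ (m * l) \<le>
      real r ^ (2 * m) * real r ^ (card (f ` ?T) + 1 + card ?T)"
    unfolding power_add[symmetric] K by (intro power_increasing) (use pt im' r1 in linarith)+
  hence "real r ^ (card (f ` {..<?N}) + card (p ` f ` ?T)) / real r ^ (card (f ` ?T) + 1 + card ?T) \<le>
      real r ^ (2 * m) / real r ^ (m * l)"
    using r_pos by (simp add: field_simps)
  from mult_left_mono[OF this, of "real n * (real r / real n) ^ excess"]
  show ?thesis unfolding weight_eq[OF walk_pattern_axioms] by (simp add: mult_ac)
qed

lemma tame_cong:
  assumes "\<And>i j. i \<le> l \<Longrightarrow> j \<le> l \<Longrightarrow> w i = w j \<longleftrightarrow> w' i = w' j" "tame l w"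
  shows "tame l w'"
proof -
  have "{t. Suc t < l \<and> path_deviates w t} = {t. Suc t < l \<and> path_deviates w' t}"
    using path_deviates_cong[of _ w w'] assms(1) by force
  thus ?thesis using assms(2) by (simp add: tame_def)
qed

lemma tame_block_pattern:
  assumes x: "(f, p, J) \<in> walk_patterns (tame l) m l" and m: "m > 0" and l: "l > 0"
  shows "block_pattern (2 * m * Suc l) (moves (2 * m) l) f p J l (2 * m)"
proof -
  let ?N = "2 * m * Suc l" and ?T = "moves (2 * m) l"
  obtain W where W: "W \<in> closed_walks (tame l) m l" "f = first_index ?N W"
    using walk_patternsD[OF x m] by blast
  interpret good_pattern ?N ?T f p J by (rule walk_patterns_good[OF x m])
  show ?thesis
  proof
    show "?N = 2 * m * Suc l" ..
    show "?T = {\<theta>. \<theta> < ?N \<and> \<theta> mod Suc l \<noteq> l}" by (simp add: moves_def)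
    show "l > 0" by fact
    show "(\<exists>i'\<in>f ` ?T. i' \<noteq> i \<and> p i' = p i) \<or> (\<exists>\<theta>\<in>?T. \<exists>\<theta>'\<in>?T. \<theta> \<noteq> \<theta>' \<and> f \<theta> = i \<and> f \<theta>' = i)"
      if "i \<in> f ` ?T" for i by (rule walk_patterns_visits[OF x m that])
    show "\<exists>\<theta>'<?N. \<theta>' \<noteq> \<theta> \<and> f \<theta>' = f \<theta>" if "\<theta> < ?N" "\<theta> \<notin> ?T" for \<theta> by (rule walk_patterns_tie[OF x m that])
    fix i assume i: "i < 2 * m"
    have "tame l (restrict (\<lambda>t. W (i * Suc l + t)) {..<Suc l})"
      using W(1) i by (auto simp: closed_walks_def)
    thus "tame l (\<lambda>t. f (i * Suc l + t))"
    proof (rule tame_cong[rotated])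
      fix s t assume st: "s \<le> l" "t \<le> l"
      hence "f (i * Suc l + s) = f (i * Suc l + t) \<longleftrightarrow> W (i * Suc l + s) = W (i * Suc l + t)"
        unfolding W(2) using block_less[OF i] by (intro first_index_eq_iff)
      thus "restrict (\<lambda>t. W (i * Suc l + t)) {..<Suc l} s = restrict (\<lambda>t. W (i * Suc l + t)) {..<Suc l} t
          \<longleftrightarrow> f (i * Suc l + s) = f (i * Suc l + t)"
        using st by (simp del: mult_Suc_right)
    qed
  qed
qed

lemma avg_closed_walks_tame:
  assumes N: "2 * (2 * m * Suc l) ^ 2 \<le> n" and m: "m > 0" and l: "l > 0"
  shows "avg (\<lambda>\<sigma>. \<Sum>W\<in>closed_walks (tame l) m l. \<Prod>\<theta>\<in>moves (2 * m) l. qc (\<sigma> (W \<theta>)) (W (Suc \<theta>))) \<le>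
    2 * (\<Sum>k\<le>2 * (2 * m * Suc l). (81 * real (2 * m * Suc l) ^ (76 * m * (k + 1)) * 2 ^ (4 * m * (k + 2 * m))) *
      ((real n * real r ^ (2 * m) / real r ^ (m * l)) * (real r / real n) ^ k))"
proof -
  let ?N = "2 * m * Suc l" and ?T = "moves (2 * m) l" and ?P = "walk_patterns (tame l) m l"
  let ?ex = "\<lambda>(f, p, J). walk_pattern.excess ?N ?T f p J"
  have "(\<Sum>(f, p, J)\<in>?P. weight ?N ?T f p J) \<le>
    (\<Sum>k\<le>2 * ?N. (81 * real ?N ^ (76 * m * (k + 1)) * 2 ^ (4 * m * (k + 2 * m))) *
      ((real n * real r ^ (2 * m) / real r ^ (m * l)) * (real r / real n) ^ k))"
  proof (rule sum_by_level_le[where ex = ?ex])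
    fix x assume x: "x \<in> ?P"
    obtain f p J where 1: "x = (f, p, J)" by (cases x)
    interpret block_pattern ?N ?T f p J l "2 * m" using tame_block_pattern x 1 m l by blast
    show "(case x of (f, p, J) \<Rightarrow> weight ?N ?T f p J) \<le>
        (real n * real r ^ (2 * m) / real r ^ (m * l)) * (real r / real n) ^ ?ex x"
      using walk_patterns_weight[OF x[unfolded 1] m] by (simp add: 1)
    show "?ex x \<in> {..2 * ?N}" using excess_le by (simp add: 1)
  next
    fix k
    let ?Pk = "{x \<in> ?P. ?ex x = k}"
    have "real (card ?Pk) \<le> 81 * real ?N ^ (38 * (2 * m) * (k + 1)) * 2 ^ (2 * (2 * m) * (k + 2 * m))"
    proof (rule card_block_patterns_le)
      show "block_pattern ?N ?T f p J l (2 * m)" if "(f, p, J) \<in> ?Pk" for f p J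
        using tame_block_pattern that m l by simp
      show "walk_pattern.excess ?N ?T f p J = k" if "(f, p, J) \<in> ?Pk" for f p J using that by simp
      show "?N > 0" using m by simp
      show "?T \<subseteq> {..<?N}" by (rule moves_sub)
      show "2 * m \<ge> 2" using m by simp
    qed
    thus "real (card ?Pk) \<le> 81 * real ?N ^ (76 * m * (k + 1)) * 2 ^ (4 * m * (k + 2 * m))"
      by simp
  qed auto
  thus ?thesis using avg_closed_walks_le[OF N, of "tame l"] by linarith
qed

text \<open>With only two blocks the crude code is affordable, and it serves any class
  \<open>F\<close> of paths.\<close>

lemma avg_closed_walks_two:
  assumes N: "2 * (2 * Suc l) ^ 2 \<le> n"
  shows "avg (\<lambda>\<sigma>. \<Sum>W\<in>closed_walks F 1 l. \<Prod>\<theta>\<in>moves 2 l. qc (\<sigma> (W \<theta>)) (W (Suc \<theta>))) \<le>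
    2 * (\<Sum>k\<le>2 * (2 * Suc l). (9 * 2 ^ (2 * Suc l) * real (k + 3) ^ (2 * Suc l) * real (2 * Suc l) ^ (4 * k + 12)) *
      ((real n * real r ^ 2 / real r ^ l) * (real r / real n) ^ k))"
proof -
  let ?N = "2 * Suc l" and ?T = "moves 2 l" and ?P = "walk_patterns F 1 l"
  let ?ex = "\<lambda>(f, p, J). walk_pattern.excess ?N ?T f p J"
  have good: "good_pattern ?N ?T f p J" if "(f, p, J) \<in> ?P" for f p J
    using walk_patterns_good[OF that] by simp
  have "(\<Sum>(f, p, J)\<in>?P. weight ?N ?T f p J) \<le>
    (\<Sum>k\<le>2 * ?N. (9 * 2 ^ ?N * real (k + 3) ^ ?N * real ?N ^ (4 * k + 12)) *
      ((real n * real r ^ 2 / real r ^ l) * (real r / real n) ^ k))"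
  proof (rule sum_by_level_le[where ex = ?ex])
    fix x assume x: "x \<in> ?P"
    obtain f p J where 1: "x = (f, p, J)" by (cases x)
    interpret good_pattern ?N ?T f p J using good x 1 by blast
    show "(case x of (f, p, J) \<Rightarrow> weight ?N ?T f p J) \<le>
        (real n * real r ^ 2 / real r ^ l) * (real r / real n) ^ ?ex x"
      using walk_patterns_weight[OF x[unfolded 1]] by (simp add: 1)
    show "?ex x \<in> {..2 * ?N}" using excess_le by (simp add: 1)
  next
    fix k
    let ?Pk = "{x \<in> ?P. ?ex x = k}"
    have "real (card ?Pk) \<le> 9 * 2 ^ ?N * real (k + 2 + 1) ^ ?N * real ?N ^ (4 * k + 6 * 2)"
    proof (rule card_crude_le)
      show "good_pattern ?N ?T f p J" if "(f, p, J) \<in> ?Pk" for f p J using good that by simp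
      show "walk_pattern.excess ?N ?T f p J = k" if "(f, p, J) \<in> ?Pk" for f p J using that by simp
      show "card (f ` {..<?N}) \<le> card (f ` ?T) + 2" for f by (rule card_points_moves)
      show "card {\<theta>. \<theta> < ?N \<and> (\<forall>\<theta>'\<in>?T. \<theta> \<noteq> Suc \<theta>')} \<le> 2" by (rule card_starts_moves)
      show "?N > 0" by simp
      show "?T \<subseteq> {..<?N}" by (rule moves_sub)
    qed
    thus "real (card ?Pk) \<le> 9 * 2 ^ ?N * real (k + 3) ^ ?N * real ?N ^ (4 * k + 12)"
      by (simp add: eval_nat_numeral)
  qed (auto simp: finite_walk_patterns)
  moreover have "avg (\<lambda>\<sigma>. \<Sum>W\<in>closed_walks F 1 l. \<Prod>\<theta>\<in>?T. qc (\<sigma> (W \<theta>)) (W (Suc \<theta>))) \<le>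
      2 * (\<Sum>(f, p, J)\<in>?P. weight ?N ?T f p J)"
    using avg_closed_walks_le[of 1 l F, unfolded mult_1_right] N by blast
  ultimately show ?thesis by linarith
qed

text \<open>When \<open>r\<close> is comparable to \<open>n\<close>, the excess gains nothing and
  its factor is bounded by 1. Instead part of the negative power of \<open>r\<close> pays the
  pointers, at \<open>1 / N\<close> each with \<open>N = 2 * Suc l \<le> r\<close>.\<close>

lemma avg_closed_walks_dense:
  assumes N: "2 * (2 * Suc l) ^ 2 \<le> n" and r: "2 * Suc l \<le> r"
  shows "avg (\<lambda>\<sigma>. \<Sum>W\<in>closed_walks F 1 l. \<Prod>\<theta>\<in>moves 2 l. qc (\<sigma> (W \<theta>)) (W (Suc \<theta>))) \<le>
    2 * (real n * real r ^ 2 * (real (2 * Suc l) / real r) ^ l * real (2 * Suc l) ^ 2 * 8 ^ (2 * Suc l))"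
proof -
  let ?N = "2 * Suc l" and ?T = "moves 2 l" and ?P = "walk_patterns F 1 l"
  let ?K = "real n * real r ^ 2 * (real ?N / real r) ^ l * real ?N ^ 2"
  have good: "good_pattern ?N ?T f p J" if "(f, p, J) \<in> ?P" for f p J
    using walk_patterns_good[OF that] by simp
  have "(\<Sum>(f, p, J)\<in>?P. weight ?N ?T f p J) \<le>
     (\<Sum>(f, p, J)\<in>?P. ?K * (1 / real ?N) ^ (?N - card (f ` {..<?N}) + (card (f ` ?T) - card (p ` f ` ?T))))"
  proof (rule sum_mono, clarify)
    fix f p J assume x: "(f, p, J) \<in> ?P"
    interpret good_pattern ?N ?T f p J using good x by blast
    have vis: "(\<exists>i'\<in>f ` ?T. i' \<noteq> i \<and> p i' = p i) \<or>
       (\<exists>\<theta>\<in>?T. \<exists>\<theta>'\<in>?T. \<theta> \<noteq> \<theta>' \<and> f \<theta> = i \<and> f \<theta>' = i)" if "i \<in> f ` ?T" for i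
      using walk_patterns_visits[OF x, of i] that by simp
    define a v \<kappa> where "a = card (f ` {..<?N})" and "v = card (f ` ?T)" and "\<kappa> = card (p ` f ` ?T)"
    have "2 * \<kappa> \<le> card ?T"
      using card_images_le vis unfolding images_def sources_def \<kappa>_def by simp
    hence \<kappa>: "\<kappa> \<le> l" by (simp add: card_moves)
    have av: "a \<le> v + 2" unfolding a_def v_def by (rule card_points_moves)
    have va: "v \<le> a" unfolding a_def v_def
      by (rule card_mono[OF _ image_mono[OF moves_sub]]) simp
    have \<kappa>v: "\<kappa> \<le> v" unfolding \<kappa>_def v_def by (rule card_image_le) simp
    have aN: "a \<le> ?N" unfolding a_def using card_image_le[of "{..<?N}" f] by simp
    have r1: "real r \<ge> 1" and N1: "real ?N \<ge> 1" using r_pos by auto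
    have K: "card ?T = 2 * l" by (simp add: card_moves)
    have "weight ?N ?T f p J = real n * (real r / real n) ^ excess *
        (real r ^ (a + \<kappa>) / real r ^ (v + 1 + 2 * l))"
      unfolding weight_eq[OF walk_pattern_axioms] a_def v_def \<kappa>_def K by simp
    also have "\<dots> \<le> real n * 1 * (real r ^ 2 / real r ^ (2 * l - \<kappa>))"
    proof (intro mult_mono mult_left_mono)
      show "(real r / real n) ^ excess \<le> 1" using ratio_le_1 by (intro power_le_one) auto
      have "real r ^ (a + \<kappa>) * real r ^ (2 * l - \<kappa>) \<le> real r ^ 2 * real r ^ (v + 1 + 2 * l)"
        unfolding power_add[symmetric] using av \<kappa> r1 by (intro power_increasing) auto
      thus "real r ^ (a + \<kappa>) / real r ^ (v + 1 + 2 * l) \<le> real r ^ 2 / real r ^ (2 * l - \<kappa>)"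
        using r_pos by (simp add: field_simps)
    qed auto
    \<comment> \<open>Each \<open>1 / r\<close> is split into \<open>N / r\<close> and
      \<open>1 / N\<close>. Of the former \<open>l\<close> factors are kept; the latter go to the
      pointers, with \<open>N^2\<close> for the two times by which \<open>N\<close> exceeds
      \<open>2 * l\<close>.\<close>
    also have "real r ^ 2 / real r ^ (2 * l - \<kappa>) =
        real r ^ 2 * ((real ?N / real r) ^ (2 * l - \<kappa>) * (1 / real ?N) ^ (2 * l - \<kappa>))"
      by (simp add: power_divide)
    also have "\<dots> \<le> real r ^ 2 * ((real ?N / real r) ^ l *
        (real ?N ^ 2 * (1 / real ?N) ^ (?N - a + (v - \<kappa>))))"
    proof (intro mult_left_mono mult_mono)
      show "(real ?N / real r) ^ (2 * l - \<kappa>) \<le> (real ?N / real r) ^ l"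
        using r \<kappa> r_pos by (intro power_decreasing) auto
      have "(1 / real ?N) ^ (2 * l - \<kappa> + 2) \<le> (1 / real ?N) ^ (?N - a + (v - \<kappa>))"
        using va \<kappa>v aN \<kappa> by (intro power_decreasing) auto
      thus "(1 / real ?N) ^ (2 * l - \<kappa>) \<le> real ?N ^ 2 * (1 / real ?N) ^ (?N - a + (v - \<kappa>))"
      proof -
        have "(1 / M) ^ x = M ^ 2 * (1 / M) ^ (x + 2)" if "M > 0" for M :: real and x
          using that by (simp add: power_add power2_eq_square)
        hence "(1 / real ?N) ^ (2 * l - \<kappa>) = real ?N ^ 2 * (1 / real ?N) ^ (2 * l - \<kappa> + 2)"
          by (metis of_nat_0_less_iff nat_0_less_mult_iff pos2 zero_less_Suc)
        moreover assume "(1 / real ?N) ^ (2 * l - \<kappa> + 2) \<le> (1 / real ?N) ^ (?N - a + (v - \<kappa>))"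
        ultimately show ?thesis by (simp only: mult_left_mono zero_le_power2)
      qed
    qed auto
    finally show "weight ?N ?T f p J \<le> ?K * (1 / real ?N) ^ (?N - a + (v - \<kappa>))"
      unfolding mult.assoc mult_1_left mult_1_right by (simp add: mult_left_mono)
  qed
  also have "\<dots> = ?K * (\<Sum>(f, p, J)\<in>?P. (1 / real ?N) ^ (?N - card (f ` {..<?N}) + (card (f ` ?T) - card (p ` f ` ?T))))"
    unfolding sum_distrib_left by (intro sum.cong) auto
  also have "\<dots> \<le> ?K * 8 ^ ?N"
  proof (rule mult_left_mono)
    show "(\<Sum>(f, p, J)\<in>?P. (1 / real ?N) ^ (?N - card (f ` {..<?N}) + (card (f ` ?T) - card (p ` f ` ?T)))) \<le> 8 ^ ?N"
      by (rule sum_pointer_patterns_le[OF good _ moves_sub]) simp_all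
  qed simp
  finally have "(\<Sum>(f, p, J)\<in>?P. weight ?N ?T f p J) \<le> ?K * 8 ^ ?N" .
  moreover have "avg (\<lambda>\<sigma>. \<Sum>W\<in>closed_walks F 1 l. \<Prod>\<theta>\<in>?T. qc (\<sigma> (W \<theta>)) (W (Suc \<theta>))) \<le>
      2 * (\<Sum>(f, p, J)\<in>?P. weight ?N ?T f p J)"
    using avg_closed_walks_le[of 1 l F, unfolded mult_1_right] N by blast
  ultimately show ?thesis by linarith
qed

end

lemma sum_PiE_Suc:
  assumes "finite V"
  shows "(\<Sum>w\<in>{..<Suc k} \<rightarrow>\<^sub>E V. g w) = (\<Sum>w\<in>{..<k} \<rightarrow>\<^sub>E V. \<Sum>b\<in>V. g (w(k := b)) :: 'c :: comm_monoid_add)"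
proof -
  have eq: "{..<Suc k} \<rightarrow>\<^sub>E V = (\<lambda>(b, w). w(k := b)) ` (V \<times> ({..<k} \<rightarrow>\<^sub>E V))"
    using PiE_insert_eq[of k "{..<k}" "\<lambda>_. V"] by (simp add: lessThan_Suc)
  have inj: "inj_on (\<lambda>(b, w). w(k := b)) (V \<times> ({..<k} \<rightarrow>\<^sub>E V))"
    by (rule inj_combinator) simp
  have "(\<Sum>w\<in>{..<Suc k} \<rightarrow>\<^sub>E V. g w) = (\<Sum>(b, w)\<in>V \<times> ({..<k} \<rightarrow>\<^sub>E V). g (w(k := b)))"
    unfolding eq using inj by (simp add: sum.reindex case_prod_unfold)
  also have "\<dots> = (\<Sum>b\<in>V. \<Sum>w\<in>{..<k} \<rightarrow>\<^sub>E V. g (w(k := b)))"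
    by (rule sum.cartesian_product[symmetric])
  also have "\<dots> = (\<Sum>w\<in>{..<k} \<rightarrow>\<^sub>E V. \<Sum>b\<in>V. g (w(k := b)))" by (rule sum.swap)
  finally show ?thesis .
qed

lemma prod_lessThan_double: "(\<Prod>j<2 * (m :: nat). h j) = (\<Prod>i<m. h (2 * i) * h (2 * i + 1) :: real)"
proof (induction m)
  case (Suc m)
  have "{..<2 * Suc m} = insert (2 * m + 1) (insert (2 * m) {..<2 * m})" by auto
  thus ?case using Suc by (simp add: mult_ac)
qed simp

section \<open>Traces and the eigenvalue bound\<close>

locale kernels =
  fixes V :: "'a set"
  assumes finite_V: "finite V"
begin

definition sq :: "('a \<Rightarrow> real) \<Rightarrow> real" where "sq x = (\<Sum>a\<in>V. (x a)\<^sup>2)"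

definition ap :: "('a \<Rightarrow> 'a \<Rightarrow> real) \<Rightarrow> ('a \<Rightarrow> real) \<Rightarrow> 'a \<Rightarrow> real" where
  "ap K x a = (\<Sum>b\<in>V. K a b * x b)"

text \<open>The kernel of the transpose of \<open>K\<close> times \<open>K\<close>.\<close>

definition gram :: "('a \<Rightarrow> 'a \<Rightarrow> real) \<Rightarrow> 'a \<Rightarrow> 'a \<Rightarrow> real" where
  "gram K b b' = (\<Sum>a\<in>V. K a b * K a b')"

fun kpow :: "('a \<Rightarrow> 'a \<Rightarrow> real) \<Rightarrow> nat \<Rightarrow> 'a \<Rightarrow> 'a \<Rightarrow> real" where
  "kpow K 0 a b = of_bool (a = b)"
| "kpow K (Suc k) a b = (\<Sum>c\<in>V. kpow K k a c * K c b)"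

definition trace :: "('a \<Rightarrow> 'a \<Rightarrow> real) \<Rightarrow> real" where "trace K = (\<Sum>a\<in>V. K a a)"

lemma sq_nonneg [simp]: "sq x \<ge> 0" by (simp add: sq_def sum_nonneg)

lemma kpow_add: "b \<in> V \<Longrightarrow> kpow K (i + j) a b = (\<Sum>c\<in>V. kpow K i a c * kpow K j c b)"
proof (induction j arbitrary: b)
  case 0
  have "(\<Sum>c\<in>V. kpow K i a c * of_bool (c = b)) = (\<Sum>c\<in>V. if c = b then kpow K i a c else 0)"
    by (intro sum.cong) auto
  thus ?case using 0 finite_V by (simp add: sum.delta)
next
  case (Suc j)
  have "kpow K (i + Suc j) a b = (\<Sum>d\<in>V. (\<Sum>c\<in>V. kpow K i a c * kpow K j c d) * K d b)"
    using Suc.IH by simp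
  also have "\<dots> = (\<Sum>d\<in>V. \<Sum>c\<in>V. kpow K i a c * (kpow K j c d * K d b))"
    by (simp add: sum_distrib_left sum_distrib_right mult_ac)
  also have "\<dots> = (\<Sum>c\<in>V. \<Sum>d\<in>V. kpow K i a c * (kpow K j c d * K d b))" by (rule sum.swap)
  also have "\<dots> = (\<Sum>c\<in>V. kpow K i a c * kpow K (Suc j) c b)" by (simp add: sum_distrib_left)
  finally show ?case .
qed

lemma kpow_1: "a \<in> V \<Longrightarrow> kpow K (Suc 0) a b = K a b"
proof -
  assume a: "a \<in> V"
  have "(\<Sum>c\<in>V. of_bool (a = c) * K c b) = (\<Sum>c\<in>V. if a = c then K c b else 0)"
    by (intro sum.cong) auto
  thus ?thesis using a finite_V by (simp add: sum.delta)
qed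

lemma kpow_sym:
  assumes sym: "\<And>a b. K a b = K b a"
  shows "a \<in> V \<Longrightarrow> b \<in> V \<Longrightarrow> kpow K k a b = kpow K k b a"
proof (induction k arbitrary: a b)
  case 0 thus ?case by auto
next
  case (Suc k)
  have "kpow K (Suc k) a b = (\<Sum>c\<in>V. K b c * kpow K k c a)"
    using Suc by (auto intro!: sum.cong simp: sym mult.commute)
  also have "\<dots> = (\<Sum>c\<in>V. kpow K (Suc 0) b c * kpow K k c a)"
    using Suc.prems by (intro sum.cong) (simp_all add: kpow_1 del: kpow.simps)
  also have "\<dots> = kpow K (Suc 0 + k) b a" using Suc.prems by (intro kpow_add[symmetric])
  finally show ?case by simp
qed

lemma cauchy: "(\<Sum>b\<in>V. x b * y b)\<^sup>2 \<le> sq x * sq y"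
  unfolding sq_def by (rule Cauchy_Schwarz_ineq_sum)

lemma inner_gram: "sq (ap K x) = (\<Sum>b\<in>V. x b * ap (gram K) x b)"
proof -
  have "sq (ap K x) = (\<Sum>a\<in>V. \<Sum>b\<in>V. \<Sum>b'\<in>V. x b * (K a b * K a b' * x b'))"
    by (simp add: sq_def ap_def power2_eq_square sum_product mult_ac)
  also have "\<dots> = (\<Sum>b\<in>V. \<Sum>a\<in>V. \<Sum>b'\<in>V. x b * (K a b * K a b' * x b'))" by (rule sum.swap)
  also have "\<dots> = (\<Sum>b\<in>V. \<Sum>b'\<in>V. \<Sum>a\<in>V. x b * (K a b * K a b' * x b'))"
    by (intro sum.cong refl sum.swap)
  also have "\<dots> = (\<Sum>b\<in>V. x b * ap (gram K) x b)"
    by (simp add: ap_def gram_def sum_distrib_left sum_distrib_right mult_ac)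
  finally show ?thesis .
qed

lemma sq_ap_power2_le: "(sq (ap K x))\<^sup>2 \<le> sq x * sq (ap (gram K) x)"
  unfolding inner_gram[of K x] by (rule cauchy)

lemma ap_cong: "(\<And>a b. a \<in> V \<Longrightarrow> b \<in> V \<Longrightarrow> K a b = K' a b) \<Longrightarrow> sq (ap K x) = sq (ap K' x)"
  unfolding sq_def ap_def by (intro sum.cong refl arg_cong2[where f = power]) auto

lemma sq_ap_le_hs: "sq (ap K x) \<le> sq x * (\<Sum>a\<in>V. \<Sum>b\<in>V. (K a b)\<^sup>2)"
proof -
  have "sq (ap K x) \<le> (\<Sum>a\<in>V. (\<Sum>b\<in>V. (K a b)\<^sup>2) * sq x)"
    unfolding sq_def[of "ap K x"] ap_def using cauchy[of "K _" x]
    by (intro sum_mono) (simp add: sq_def)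
  thus ?thesis by (simp add: sum_distrib_left mult.commute)
qed

lemma gram_kpow:
  assumes sym: "\<And>a b. T a b = T b a" and "a \<in> V" "b \<in> V"
  shows "gram (kpow T k) a b = kpow T (k + k) a b"
proof -
  have "gram (kpow T k) a b = (\<Sum>c\<in>V. kpow T k a c * kpow T k c b)"
    unfolding gram_def using assms kpow_sym[OF sym] by (intro sum.cong) auto
  thus ?thesis using assms by (simp add: kpow_add)
qed

text \<open>Each application of Cauchy-Schwarz doubles the exponent. This stands in for the spectral
  theorem and is the reason for exponents \<open>2^j\<close>.\<close>

lemma sq_kpow_le:
  assumes sym: "\<And>a b. T a b = T b a"
  shows "sq (ap T x) ^ (2 ^ j) \<le> sq x ^ (2 ^ j - 1) * sq (ap (kpow T (2 ^ j)) x)"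
proof (induction j)
  case 0
  have "sq (ap (kpow T (Suc 0)) x) = sq (ap T x)" by (rule ap_cong) (rule kpow_1)
  thus ?case by (simp del: kpow.simps)
next
  case (Suc j)
  let ?k = "2 ^ j :: nat"
  have k: "?k + ?k = 2 ^ Suc j" "?k \<ge> 1" by auto
  have "(sq (ap T x) ^ ?k)\<^sup>2 \<le> (sq x ^ (?k - 1) * sq (ap (kpow T ?k) x))\<^sup>2"
    by (intro power_mono Suc) auto
  also have "\<dots> = (sq x ^ (?k - 1))\<^sup>2 * (sq (ap (kpow T ?k) x))\<^sup>2" by (simp add: power_mult_distrib)
  also have "\<dots> \<le> (sq x ^ (?k - 1))\<^sup>2 * (sq x * sq (ap (gram (kpow T ?k)) x))"
    by (intro mult_left_mono sq_ap_power2_le) auto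
  also have "sq (ap (gram (kpow T ?k)) x) = sq (ap (kpow T (2 ^ Suc j)) x)"
    unfolding k(1)[symmetric] by (intro ap_cong gram_kpow sym)
  also have "(sq x ^ (?k - 1))\<^sup>2 * (sq x * sq (ap (kpow T (2 ^ Suc j)) x)) =
      sq x ^ (2 * (?k - 1) + 1) * sq (ap (kpow T (2 ^ Suc j)) x)"
  proof -
    have "(y ^ p)\<^sup>2 * (y * S) = y ^ (2 * p + 1) * S" for y S :: real and p :: nat
      by (simp add: power_add power_mult[symmetric] mult.commute)
    thus ?thesis .
  qed
  also have "2 * (?k - 1) + 1 = 2 ^ Suc j - 1"
    unfolding k(1)[symmetric] using k(2) by arith
  also have "(sq (ap T x) ^ ?k)\<^sup>2 = sq (ap T x) ^ (2 ^ Suc j)" by (simp add: power_mult[symmetric] mult.commute)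
  finally show ?case .
qed

lemma gram_sym: "gram K a b = gram K b a"
  by (simp add: gram_def mult.commute)

lemma hs_kpow:
  assumes sym: "\<And>a b. T a b = T b a"
  shows "(\<Sum>a\<in>V. \<Sum>b\<in>V. (kpow T k a b)\<^sup>2) = trace (kpow T (k + k))"
  unfolding trace_def
proof (rule sum.cong[OF refl])
  fix a assume a: "a \<in> V"
  have "(\<Sum>b\<in>V. (kpow T k a b)\<^sup>2) = (\<Sum>b\<in>V. kpow T k a b * kpow T k b a)"
    using a kpow_sym[OF sym, of a] by (intro sum.cong) (auto simp: power2_eq_square)
  thus "(\<Sum>b\<in>V. (kpow T k a b)\<^sup>2) = kpow T (k + k) a a" using a by (simp add: kpow_add)
qed

text \<open>The operator norm is at most the root of order \<open>2 * 2^j\<close> of the trace. One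
  Cauchy-Schwarz step passes to \<open>gram K\<close>, \<open>sq_kpow_le\<close> raises the power,
  and the squared Hilbert-Schmidt norm of a power of a symmetric kernel is a trace.\<close>

lemma sq_ap_trace_le: "sq (ap K x) ^ (2 ^ j) \<le> sq x ^ (2 ^ j) * trace (kpow (gram K) (2 ^ j))"
proof (cases j)
  case 0
  have "(\<Sum>a\<in>V. \<Sum>b\<in>V. (K a b)\<^sup>2) = trace (kpow (gram K) (Suc 0))"
  proof -
    have "(\<Sum>a\<in>V. \<Sum>b\<in>V. (K a b)\<^sup>2) = (\<Sum>b\<in>V. \<Sum>a\<in>V. (K a b)\<^sup>2)" by (rule sum.swap)
    also have "\<dots> = (\<Sum>b\<in>V. gram K b b)" by (simp add: gram_def power2_eq_square)
    also have "\<dots> = trace (kpow (gram K) (Suc 0))"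
      unfolding trace_def by (intro sum.cong refl kpow_1[symmetric])
    finally show ?thesis .
  qed
  thus ?thesis using sq_ap_le_hs[of K x] 0 by (simp del: kpow.simps)
next
  case (Suc i)
  let ?k = "2 ^ i :: nat" and ?T = "gram K"
  have k: "?k + ?k = 2 ^ j" "?k \<ge> 1" using Suc by auto
  have "sq (ap K x) ^ (2 ^ j) = ((sq (ap K x))\<^sup>2) ^ ?k" using Suc by (simp add: power_mult[symmetric])
  also have "\<dots> \<le> (sq x * sq (ap ?T x)) ^ ?k" by (intro power_mono sq_ap_power2_le) auto
  also have "\<dots> = sq x ^ ?k * sq (ap ?T x) ^ ?k" by (simp add: power_mult_distrib)
  also have "\<dots> \<le> sq x ^ ?k * (sq x ^ (?k - 1) * sq (ap (kpow ?T ?k) x))"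
    by (intro mult_left_mono sq_kpow_le gram_sym) auto
  also have "\<dots> \<le> sq x ^ ?k * (sq x ^ (?k - 1) * (sq x * trace (kpow ?T (2 ^ j))))"
    unfolding k(1)[symmetric] hs_kpow[OF gram_sym, symmetric]
    by (intro mult_left_mono sq_ap_le_hs) auto
  also have "\<dots> = sq x ^ (?k + (?k - 1) + 1) * trace (kpow ?T (2 ^ j))"
    by (simp only: power_add power_one_right mult_ac)
  also have "?k + (?k - 1) + 1 = 2 ^ j" using k by simp
  finally show ?thesis .
qed

text \<open>The test function \<open>g\<close> at the endpoint carries the induction: the last step
  is absorbed into it. An indicator gives the single entries.\<close>

lemma sum_kpow_paths:
  "a \<in> V \<Longrightarrow> (\<Sum>c\<in>{..<Suc m} \<rightarrow>\<^sub>E V. of_bool (c 0 = a) * (\<Prod>i<m. T (c i) (c (Suc i))) * g (c m)) =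
     (\<Sum>b\<in>V. kpow T m a b * g b)"
proof (induction m arbitrary: g)
  case 0
  have "(\<Sum>c\<in>{..<Suc 0} \<rightarrow>\<^sub>E V. of_bool (c 0 = a) * g (c 0)) = (\<Sum>b\<in>V. of_bool (b = a) * g b)"
    by (subst sum_PiE_Suc[OF finite_V]) simp
  also have "\<dots> = (\<Sum>b\<in>V. of_bool (a = b) * g b)" by (intro sum.cong) auto
  finally show ?case by simp
next
  case (Suc m)
  have "(\<Sum>c\<in>{..<Suc (Suc m)} \<rightarrow>\<^sub>E V. of_bool (c 0 = a) * (\<Prod>i<Suc m. T (c i) (c (Suc i))) * g (c (Suc m))) =
      (\<Sum>c\<in>{..<Suc m} \<rightarrow>\<^sub>E V. \<Sum>b\<in>V. of_bool (c 0 = a) * ((\<Prod>i<m. T (c i) (c (Suc i))) * T (c m) b) * g b)"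
  proof -
    have p: "(\<Prod>i<m. T ((c(Suc m := b)) i) ((c(Suc m := b)) (Suc i))) = (\<Prod>i<m. T (c i) (c (Suc i)))" for c b
      by (intro prod.cong) auto
    show ?thesis by (subst sum_PiE_Suc[OF finite_V]) (simp add: p del: fun_upd_apply, simp)
  qed
  also have "\<dots> = (\<Sum>c\<in>{..<Suc m} \<rightarrow>\<^sub>E V. of_bool (c 0 = a) * (\<Prod>i<m. T (c i) (c (Suc i))) * (\<Sum>b\<in>V. T (c m) b * g b))"
    by (simp add: sum_distrib_left sum_distrib_right mult_ac)
  also have "\<dots> = (\<Sum>c\<in>V. kpow T m a c * (\<Sum>b\<in>V. T c b * g b))"
    using Suc.IH[OF Suc.prems, of "\<lambda>c. \<Sum>b\<in>V. T c b * g b"] .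
  also have "\<dots> = (\<Sum>c\<in>V. \<Sum>b\<in>V. kpow T m a c * T c b * g b)" by (simp add: sum_distrib_left mult_ac)
  also have "\<dots> = (\<Sum>b\<in>V. \<Sum>c\<in>V. kpow T m a c * T c b * g b)" by (rule sum.swap)
  also have "\<dots> = (\<Sum>b\<in>V. kpow T (Suc m) a b * g b)" by (simp add: sum_distrib_right)
  finally show ?case .
qed

lemma trace_kpow:
  "trace (kpow T m) = (\<Sum>c | c \<in> {..<Suc m} \<rightarrow>\<^sub>E V \<and> c 0 = c m. \<Prod>i<m. T (c i) (c (Suc i)))"
proof -
  let ?C = "{..<Suc m} \<rightarrow>\<^sub>E V"
  have fin: "finite ?C" using finite_V by (intro finite_PiE) auto
  have "trace (kpow T m) = (\<Sum>a\<in>V. \<Sum>c\<in>?C. of_bool (c 0 = a) * (\<Prod>i<m. T (c i) (c (Suc i))) * of_bool (c m = a))"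
    unfolding trace_def
  proof (rule sum.cong[OF refl])
    fix a assume a: "a \<in> V"
    have "(\<Sum>b\<in>V. kpow T m a b * of_bool (b = a)) = (\<Sum>b\<in>V. if b = a then kpow T m a b else 0)"
      by (intro sum.cong) auto
    hence "kpow T m a a = (\<Sum>b\<in>V. kpow T m a b * of_bool (b = a))" using a finite_V by (simp add: sum.delta)
    thus "kpow T m a a = (\<Sum>c\<in>?C. of_bool (c 0 = a) * (\<Prod>i<m. T (c i) (c (Suc i))) * of_bool (c m = a))"
      using sum_kpow_paths[OF a, where g = "\<lambda>b. of_bool (b = a)"] by simp
  qed
  also have "\<dots> = (\<Sum>c\<in>?C. \<Sum>a\<in>V. of_bool (c 0 = a) * (\<Prod>i<m. T (c i) (c (Suc i))) * of_bool (c m = a))"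
    by (rule sum.swap)
  also have "\<dots> = (\<Sum>c\<in>?C. if c 0 = c m then (\<Prod>i<m. T (c i) (c (Suc i))) else 0)"
  proof (rule sum.cong[OF refl])
    fix c assume c: "c \<in> ?C"
    hence "c 0 \<in> V" by auto
    have "(\<Sum>a\<in>V. of_bool (c 0 = a) * (\<Prod>i<m. T (c i) (c (Suc i))) * of_bool (c m = a)) =
        (\<Sum>a\<in>V. if a = c 0 then (\<Prod>i<m. T (c i) (c (Suc i))) * of_bool (c m = a) else 0)"
      by (intro sum.cong) auto
    also have "\<dots> = (\<Prod>i<m. T (c i) (c (Suc i))) * of_bool (c m = c 0)"
      using \<open>c 0 \<in> V\<close> finite_V by (simp add: sum.delta)
    finally show "(\<Sum>a\<in>V. of_bool (c 0 = a) * (\<Prod>i<m. T (c i) (c (Suc i))) * of_bool (c m = a)) =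
        (if c 0 = c m then (\<Prod>i<m. T (c i) (c (Suc i))) else 0)" by auto
  qed
  also have "\<dots> = (\<Sum>c | c \<in> ?C \<and> c 0 = c m. \<Prod>i<m. T (c i) (c (Suc i)))"
    using fin by (simp add: sum.If_cases Int_def)
  finally show ?thesis .
qed

text \<open>Factor \<open>j\<close> joins \<open>e (j div 2)\<close> to
  \<open>c (Suc j div 2)\<close>, so successive factors alternately share their first and their
  second index.\<close>

lemma trace_gram:
  "trace (kpow (gram K) m) = (\<Sum>c | c \<in> {..<Suc m} \<rightarrow>\<^sub>E V \<and> c 0 = c m. \<Sum>e\<in>{..<m} \<rightarrow>\<^sub>E V.
     \<Prod>j<2 * m. K (e (j div 2)) (c (Suc j div 2)))"
  unfolding trace_kpow
proof (rule sum.cong[OF refl])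
  fix c
  have "(\<Prod>i<m. gram K (c i) (c (Suc i))) = (\<Sum>e\<in>{..<m} \<rightarrow>\<^sub>E V. \<Prod>i<m. K (e i) (c i) * K (e i) (c (Suc i)))"
    unfolding gram_def using finite_V by (intro prod_sum_PiE) auto
  also have "\<dots> = (\<Sum>e\<in>{..<m} \<rightarrow>\<^sub>E V. \<Prod>j<2 * m. K (e (j div 2)) (c (Suc j div 2)))"
    unfolding prod_lessThan_double by simp
  finally show "(\<Prod>i<m. gram K (c i) (c (Suc i))) = \<dots>" .
qed

text \<open>The kernel is real, while eigenvectors are complex; real and imaginary parts are
  estimated separately.\<close>

lemma complex_bound:
  assumes C: "\<And>x. sq (ap K x) \<le> C * sq x"
  shows "(\<Sum>a\<in>V. (cmod (\<Sum>b\<in>V. of_real (K a b) * u b))\<^sup>2) \<le> C * (\<Sum>a\<in>V. (cmod (u a))\<^sup>2)"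
proof -
  have "(\<Sum>a\<in>V. (cmod (\<Sum>b\<in>V. of_real (K a b) * u b))\<^sup>2) = sq (ap K (\<lambda>b. Re (u b))) + sq (ap K (\<lambda>b. Im (u b)))"
    by (simp add: sq_def ap_def cmod_power2 sum.distrib)
  also have "\<dots> \<le> C * sq (\<lambda>b. Re (u b)) + C * sq (\<lambda>b. Im (u b))" by (intro add_mono C)
  also have "\<dots> = C * (\<Sum>a\<in>V. (cmod (u a))\<^sup>2)"
    by (simp add: sq_def cmod_power2 sum.distrib distrib_left)
  finally show ?thesis .
qed

end

section \<open>Kernels of paths and the bound for an eigenvalue\<close>

context regular_graph
begin

sublocale kernels V by unfold_locales (rule finV)

text \<open>With \<open>F\<close> always true this is an entry of the \<open>l\<close>-th power of
  \<open>B = P - J / n\<close>; other choices of \<open>F\<close> give its tame and its wild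
  part.\<close>

definition path_kernel :: "((nat \<Rightarrow> 'a) \<Rightarrow> bool) \<Rightarrow> nat \<Rightarrow> ('a \<Rightarrow> 'a) \<Rightarrow> 'a \<Rightarrow> 'a \<Rightarrow> real" where
  "path_kernel F l \<sigma> a b = (\<Sum>w | w \<in> {..<Suc l} \<rightarrow>\<^sub>E V \<and> w 0 = a \<and> w l = b \<and> F w. path_weight l \<sigma> w)"

lemma path_kernel_alt:
  "path_kernel F l \<sigma> a b = (\<Sum>w\<in>{..<Suc l} \<rightarrow>\<^sub>E V. of_bool (w 0 = a \<and> F w) * of_bool (w l = b) * path_weight l \<sigma> w)"
proof -
  have "path_kernel F l \<sigma> a b = (\<Sum>w\<in>{..<Suc l} \<rightarrow>\<^sub>E V. if w 0 = a \<and> w l = b \<and> F w then path_weight l \<sigma> w else 0)"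
    unfolding path_kernel_def by (simp add: sum.If_cases Int_def)
  also have "\<dots> = (\<Sum>w\<in>{..<Suc l} \<rightarrow>\<^sub>E V. of_bool (w 0 = a \<and> F w) * of_bool (w l = b) * path_weight l \<sigma> w)"
    by (intro sum.cong) auto
  finally show ?thesis .
qed

lemma path_kernel_eigen:
  fixes u :: "'a \<Rightarrow> complex"
  assumes eig: "\<And>a. a \<in> V \<Longrightarrow> (\<Sum>b\<in>V. of_real (qc (\<sigma> a) b) * u b) = \<mu> * u a" and a: "a \<in> V"
  shows "(\<Sum>w\<in>{..<Suc l} \<rightarrow>\<^sub>E V. of_bool (w 0 = a) * of_real (path_weight l \<sigma> w) * u (w l)) = \<mu> ^ l * u a"
proof (induction l)
  case 0
  have "(\<Sum>w\<in>{..<Suc 0} \<rightarrow>\<^sub>E V. of_bool (w 0 = a) * u (w 0)) = (\<Sum>b\<in>V. of_bool (b = a) * u b)"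
    by (subst sum_PiE_Suc[OF finV]) simp
  also have "\<dots> = (\<Sum>b\<in>V. if b = a then u b else 0)" by (intro sum.cong) auto
  also have "\<dots> = u a" using a finV by (simp add: sum.delta)
  finally show ?case by (simp add: path_weight_def)
next
  case (Suc l)
  have "(\<Sum>w\<in>{..<Suc (Suc l)} \<rightarrow>\<^sub>E V. of_bool (w 0 = a) * of_real (path_weight (Suc l) \<sigma> w) * u (w (Suc l))) =
     (\<Sum>w\<in>{..<Suc l} \<rightarrow>\<^sub>E V. \<Sum>b\<in>V. of_bool (w 0 = a) * of_real (path_weight l \<sigma> w * qc (\<sigma> (w l)) b) * u b)"
  proof -
    have p: "path_weight (Suc l) \<sigma> (w(Suc l := b)) = path_weight l \<sigma> w * qc (\<sigma> (w l)) b" for w b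
    proof -
      have "(\<Prod>t<l. qc (\<sigma> ((w(Suc l := b)) t)) ((w(Suc l := b)) (Suc t))) = (\<Prod>t<l. qc (\<sigma> (w t)) (w (Suc t)))"
        by (intro prod.cong) auto
      thus ?thesis unfolding path_weight_def by (simp only: prod.lessThan_Suc) simp
    qed
    show ?thesis by (subst sum_PiE_Suc[OF finV]) (simp add: p del: fun_upd_apply, simp)
  qed
  also have "\<dots> = (\<Sum>w\<in>{..<Suc l} \<rightarrow>\<^sub>E V. of_bool (w 0 = a) * of_real (path_weight l \<sigma> w) *
      (\<Sum>b\<in>V. of_real (qc (\<sigma> (w l)) b) * u b))"
    by (simp add: sum_distrib_left mult_ac)
  also have "\<dots> = (\<Sum>w\<in>{..<Suc l} \<rightarrow>\<^sub>E V. of_bool (w 0 = a) * of_real (path_weight l \<sigma> w) * (\<mu> * u (w l)))"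
    using eig by (intro sum.cong refl arg_cong2[where f = "(*)"]) auto
  also have "\<dots> = \<mu> * (\<Sum>w\<in>{..<Suc l} \<rightarrow>\<^sub>E V. of_bool (w 0 = a) * of_real (path_weight l \<sigma> w) * u (w l))"
    by (simp add: sum_distrib_left mult_ac)
  finally show ?case using Suc by simp
qed

lemma path_kernel_split:
  fixes u :: "'a \<Rightarrow> complex"
  assumes eig: "\<And>a. a \<in> V \<Longrightarrow> (\<Sum>b\<in>V. of_real (qc (\<sigma> a) b) * u b) = \<mu> * u a" and a: "a \<in> V"
  shows "\<mu> ^ l * u a = (\<Sum>b\<in>V. of_real (path_kernel F l \<sigma> a b) * u b) +
     (\<Sum>b\<in>V. of_real (path_kernel (\<lambda>w. \<not> F w) l \<sigma> a b) * u b)"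
proof -
  let ?P = "{..<Suc l} \<rightarrow>\<^sub>E V"
  have ker: "(\<Sum>b\<in>V. of_real (path_kernel F l \<sigma> a b) * u b) =
      (\<Sum>w\<in>?P. of_bool (w 0 = a \<and> F w) * of_real (path_weight l \<sigma> w) * u (w l))" for F
  proof -
    have "(\<Sum>b\<in>V. of_real (path_kernel F l \<sigma> a b) * u b) =
       (\<Sum>b\<in>V. \<Sum>w\<in>?P. of_bool (w 0 = a \<and> F w) * of_bool (w l = b) * of_real (path_weight l \<sigma> w) * u b)"
    proof -
      have "complex_of_real (of_bool P) = of_bool P" for P by (cases P) auto
      thus ?thesis unfolding path_kernel_alt by (simp add: sum_distrib_right)
    qed
    also have "\<dots> = (\<Sum>w\<in>?P. \<Sum>b\<in>V. of_bool (w 0 = a \<and> F w) * of_bool (w l = b) * of_real (path_weight l \<sigma> w) * u b)"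
      by (rule sum.swap)
    also have "\<dots> = (\<Sum>w\<in>?P. of_bool (w 0 = a \<and> F w) * of_real (path_weight l \<sigma> w) * u (w l))"
    proof (rule sum.cong[OF refl])
      fix w assume "w \<in> ?P"
      hence wl: "w l \<in> V" by auto
      have "(\<Sum>b\<in>V. of_bool (w 0 = a \<and> F w) * of_bool (w l = b) * of_real (path_weight l \<sigma> w) * u b) =
        (\<Sum>b\<in>V. if b = w l then of_bool (w 0 = a \<and> F w) * of_real (path_weight l \<sigma> w) * u b else 0)"
        by (intro sum.cong) auto
      thus "(\<Sum>b\<in>V. of_bool (w 0 = a \<and> F w) * of_bool (w l = b) * of_real (path_weight l \<sigma> w) * u b) =
        of_bool (w 0 = a \<and> F w) * of_real (path_weight l \<sigma> w) * u (w l)"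
        using wl finV by (simp add: sum.delta)
    qed
    finally show ?thesis .
  qed
  have "\<mu> ^ l * u a = (\<Sum>w\<in>?P. of_bool (w 0 = a) * of_real (path_weight l \<sigma> w) * u (w l))"
    using path_kernel_eigen[OF eig a] by simp
  also have "\<dots> = (\<Sum>w\<in>?P. of_bool (w 0 = a \<and> F w) * of_real (path_weight l \<sigma> w) * u (w l) +
      of_bool (w 0 = a \<and> \<not> F w) * of_real (path_weight l \<sigma> w) * u (w l))"
    by (intro sum.cong) auto
  finally show ?thesis by (simp add: ker sum.distrib)
qed

definition closed_sum :: "((nat \<Rightarrow> 'a) \<Rightarrow> bool) \<Rightarrow> nat \<Rightarrow> nat \<Rightarrow> ('a \<Rightarrow> 'a) \<Rightarrow> real" where
  "closed_sum F m l \<sigma> = (\<Sum>W\<in>closed_walks F m l. \<Prod>\<theta>\<in>moves (2 * m) l. qc (\<sigma> (W \<theta>)) (W (Suc \<theta>)))"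

lemma prod_moves: "(\<Prod>\<theta>\<in>moves B l. g \<theta>) = (\<Prod>j<B. \<Prod>t<l. g (j * Suc l + t) :: real)"
  unfolding moves_eq using inj_on_block_index[of l B]
  by (simp add: prod.reindex case_prod_unfold prod.cartesian_product del: mult_Suc_right)

text \<open>The paths chosen for the \<open>2 * m\<close> factors are concatenated to one walk;
  \<open>e i\<close> and \<open>c i\<close> become the common starts and common ends of neighbouring
  blocks.\<close>

lemma trace_path_kernel:
  assumes m: "m > 0"
  shows "trace (kpow (gram (path_kernel F l \<sigma>)) m) = closed_sum F m l \<sigma>"
proof -
  let ?N = "2 * m * Suc l" and ?P = "{..<Suc l} \<rightarrow>\<^sub>E V"
  let ?C = "{c. c \<in> {..<Suc m} \<rightarrow>\<^sub>E V \<and> c 0 = c m}" and ?E = "{..<m} \<rightarrow>\<^sub>E V"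
  define G where "G c e = PiE {..<2 * m}
     (\<lambda>j. {w. w \<in> ?P \<and> w 0 = e (j div 2) \<and> w l = c (Suc j div 2) \<and> F w})" for c e :: "nat \<Rightarrow> 'a"
  have finC: "finite ?C" by (rule finite_subset[of _ "{..<Suc m} \<rightarrow>\<^sub>E V"]) auto
  have finG: "finite (G c e)" for c e unfolding G_def by (intro finite_PiE) auto
  define S where "S = (SIGMA c:?C. SIGMA e:?E. G c e)"
  have "trace (kpow (gram (path_kernel F l \<sigma>)) m) =
      (\<Sum>c\<in>?C. \<Sum>e\<in>?E. \<Sum>\<gamma>\<in>G c e. \<Prod>j<2 * m. path_weight l \<sigma> (\<gamma> j))"
    unfolding trace_gram path_kernel_def G_def
    by (intro sum.cong refl prod_sum_PiE) auto
  also have "\<dots> = (\<Sum>(c, e, \<gamma>)\<in>S. \<Prod>j<2 * m. path_weight l \<sigma> (\<gamma> j))"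
    unfolding S_def using finC finG by (simp add: sum.Sigma)
  also have "\<dots> = (\<Sum>W\<in>closed_walks F m l. \<Prod>j<2 * m. \<Prod>t<l. qc (\<sigma> (W (j * Suc l + t))) (W (Suc (j * Suc l + t))))"
  \<comment> \<open>The index \<open>m\<close> of \<open>c\<close> has no block of its own:
    \<open>c m = c 0\<close> is the end of block 0, read off at \<open>W l\<close>.\<close>
  proof (rule sum.reindex_bij_witness[of S
      "\<lambda>W. (restrict (\<lambda>i. if i < m then W (2 * i * Suc l + l) else W l) {..<Suc m},
            restrict (\<lambda>i. W (2 * i * Suc l)) {..<m},
            restrict (\<lambda>j. restrict (\<lambda>t. W (j * Suc l + t)) {..<Suc l}) {..<2 * m})"
      "\<lambda>(c, e, \<gamma>). restrict (\<lambda>\<theta>. \<gamma> (\<theta> div Suc l) (\<theta> mod Suc l)) {..<?N}"])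
    fix x assume x: "x \<in> S"
    obtain c e \<gamma> where 1: "x = (c, e, \<gamma>)" by (cases x)
    have c: "c \<in> {..<Suc m} \<rightarrow>\<^sub>E V" "c 0 = c m" and e: "e \<in> ?E" and \<gamma>: "\<gamma> \<in> G c e"
      using x 1 by (auto simp: S_def)
    have g: "\<gamma> j \<in> ?P" "\<gamma> j 0 = e (j div 2)" "\<gamma> j l = c (Suc j div 2)" "F (\<gamma> j)" if "j < 2 * m" for j
      using \<gamma> that by (auto simp: G_def)
    define W where "W = restrict (\<lambda>\<theta>. \<gamma> (\<theta> div Suc l) (\<theta> mod Suc l)) {..<?N}"
    have W: "W (j * Suc l + t) = \<gamma> j t" if "j < 2 * m" "t \<le> l" for j t
      unfolding W_def using block_less[OF that] block_index_mod[OF that(2)] block_index_div[OF that(2)]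
      by (simp del: mult_Suc_right)
    have W0: "W (j * Suc l) = \<gamma> j 0" if "j < 2 * m" for j using W[OF that, of 0] by simp
    have Wx: "(\<lambda>(c, e, \<gamma>). restrict (\<lambda>\<theta>. \<gamma> (\<theta> div Suc l) (\<theta> mod Suc l)) {..<?N}) x = W"
      by (simp add: 1 W_def)
    have ge: "restrict (\<lambda>t. W (j * Suc l + t)) {..<Suc l} = \<gamma> j" if "j < 2 * m" for j
    proof
      fix t show "restrict (\<lambda>t. W (j * Suc l + t)) {..<Suc l} t = \<gamma> j t"
        using W[OF that, of t] g(1)[OF that] by (cases "t < Suc l") (auto simp: PiE_def extensional_def)
    qed
    have "restrict (\<lambda>i. if i < m then W (2 * i * Suc l + l) else W l) {..<Suc m} = c"
    proof
      fix i show "restrict (\<lambda>i. if i < m then W (2 * i * Suc l + l) else W l) {..<Suc m} i = c i"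
      proof (cases "i < Suc m")
        case True
        show ?thesis
        proof (cases "i < m")
          case True
          thus ?thesis using W[of "2 * i" l] g(3)[of "2 * i"] by simp
        next
          case False
          hence "i = m" using \<open>i < Suc m\<close> by simp
          thus ?thesis using W[of 0 l] g(3)[of 0] c(2) m by simp
        qed
      qed (use c in \<open>auto simp: PiE_def extensional_def\<close>)
    qed
    moreover have "restrict (\<lambda>i. W (2 * i * Suc l)) {..<m} = e"
    proof
      fix i show "restrict (\<lambda>i. W (2 * i * Suc l)) {..<m} i = e i"
        using W0[of "2 * i"] g(2)[of "2 * i"] e by (cases "i < m") (auto simp: PiE_def extensional_def)
    qed
    moreover have "restrict (\<lambda>j. restrict (\<lambda>t. W (j * Suc l + t)) {..<Suc l}) {..<2 * m} = \<gamma>"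
    proof
      fix j show "restrict (\<lambda>j. restrict (\<lambda>t. W (j * Suc l + t)) {..<Suc l}) {..<2 * m} j = \<gamma> j"
        using ge[of j] \<gamma> by (cases "j < 2 * m") (auto simp: G_def PiE_def extensional_def)
    qed
    ultimately show "(\<lambda>W. (restrict (\<lambda>i. if i < m then W (2 * i * Suc l + l) else W l) {..<Suc m},
            restrict (\<lambda>i. W (2 * i * Suc l)) {..<m},
            restrict (\<lambda>j. restrict (\<lambda>t. W (j * Suc l + t)) {..<Suc l}) {..<2 * m}))
        ((\<lambda>(c, e, \<gamma>). restrict (\<lambda>\<theta>. \<gamma> (\<theta> div Suc l) (\<theta> mod Suc l)) {..<?N}) x) = x"
      unfolding Wx unfolding 1 by (simp only: prod.inject simp_thms)
    show "(\<lambda>(c, e, \<gamma>). restrict (\<lambda>\<theta>. \<gamma> (\<theta> div Suc l) (\<theta> mod Suc l)) {..<?N}) x \<in> closed_walks F m l"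
      unfolding Wx closed_walks_def
    proof (intro CollectI conjI allI impI)
      show "W \<in> {..<?N} \<rightarrow>\<^sub>E V"
      proof (rule PiE_I)
        fix \<theta> assume "\<theta> \<in> {..<?N}"
        hence "\<theta> < 2 * m * Suc l" by simp
        then obtain j t where jt: "j < 2 * m" "t \<le> l" "\<theta> = j * Suc l + t" by (rule index_split) blast
        have "\<gamma> j t \<in> V" using PiE_mem[OF g(1)[OF jt(1)], of t] jt(2) by simp
        thus "W \<theta> \<in> V" unfolding jt(3) W[OF jt(1,2)] .
      qed (simp add: W_def)
      fix i assume i: "i < m"
      show "W (2 * i * Suc l) = W ((2 * i + 1) * Suc l)"
        using W0[of "2 * i"] W0[of "2 * i + 1"] g(2)[of "2 * i"] g(2)[of "2 * i + 1"] i by simp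
    next
      fix i assume i: "Suc i < m"
      show "W ((2 * i + 1) * Suc l + l) = W ((2 * i + 2) * Suc l + l)"
        using W[of "2 * i + 1" l] W[of "2 * i + 2" l] g(3)[of "2 * i + 1"] g(3)[of "2 * i + 2"] i by simp
    next
      obtain m' where m': "m = Suc m'" using m by (cases m) auto
      have "W ((2 * m - 1) * Suc l + l) = c m"
        using W[of "2 * m - 1" l] g(3)[of "2 * m - 1"] m' by simp
      moreover have "W l = c 0" using W[of 0 l] g(3)[of 0] m by simp
      ultimately show "W ((2 * m - 1) * Suc l + l) = W l" using c by simp
    next
      fix j assume "j < 2 * m"
      thus "F (restrict (\<lambda>t. W (j * Suc l + t)) {..<Suc l})" using ge g(4) by simp
    qed
    have "(\<Prod>t<l. qc (\<sigma> (W (j * Suc l + t))) (W (Suc (j * Suc l + t)))) = path_weight l \<sigma> (\<gamma> j)"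
      if "j < 2 * m" for j
      unfolding path_weight_def
    proof (rule prod.cong[OF refl])
      fix t assume "t \<in> {..<l}"
      thus "qc (\<sigma> (W (j * Suc l + t))) (W (Suc (j * Suc l + t))) = qc (\<sigma> (\<gamma> j t)) (\<gamma> j (Suc t))"
        using W[OF that, of t] W[OF that, of "Suc t"] by simp
    qed
    thus "(\<Prod>j<2 * m. \<Prod>t<l. qc (\<sigma> ((\<lambda>(c, e, \<gamma>). restrict (\<lambda>\<theta>. \<gamma> (\<theta> div Suc l) (\<theta> mod Suc l)) {..<?N}) x (j * Suc l + t)))
         ((\<lambda>(c, e, \<gamma>). restrict (\<lambda>\<theta>. \<gamma> (\<theta> div Suc l) (\<theta> mod Suc l)) {..<?N}) x (Suc (j * Suc l + t)))) =
       (case x of (c, e, \<gamma>) \<Rightarrow> \<Prod>j<2 * m. path_weight l \<sigma> (\<gamma> j))"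
      unfolding Wx by (simp add: 1)
  next
    fix W assume W: "W \<in> closed_walks F m l"
    have WV: "W \<in> {..<?N} \<rightarrow>\<^sub>E V" using W by (simp add: closed_walks_def)
    define c where "c = restrict (\<lambda>i. if i < m then W (2 * i * Suc l + l) else W l) {..<Suc m}"
    define e where "e = restrict (\<lambda>i. W (2 * i * Suc l)) {..<m}"
    define \<gamma> where "\<gamma> = restrict (\<lambda>j. restrict (\<lambda>t. W (j * Suc l + t)) {..<Suc l}) {..<2 * m}"
    have gj: "\<gamma> j t = W (j * Suc l + t)" if "j < 2 * m" "t \<le> l" for j t
      using that by (simp add: \<gamma>_def del: mult_Suc_right)
    have WinV: "W (j * Suc l + t) \<in> V" if "j < 2 * m" "t \<le> l" for j t
      using WV block_less[OF that] by auto
    show "(\<lambda>(c, e, \<gamma>). restrict (\<lambda>\<theta>. \<gamma> (\<theta> div Suc l) (\<theta> mod Suc l)) {..<?N})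
       (restrict (\<lambda>i. if i < m then W (2 * i * Suc l + l) else W l) {..<Suc m},
            restrict (\<lambda>i. W (2 * i * Suc l)) {..<m},
            restrict (\<lambda>j. restrict (\<lambda>t. W (j * Suc l + t)) {..<Suc l}) {..<2 * m}) = W"
      unfolding c_def[symmetric] e_def[symmetric] \<gamma>_def[symmetric] prod.case
    proof
      fix \<theta> show "restrict (\<lambda>\<theta>. \<gamma> (\<theta> div Suc l) (\<theta> mod Suc l)) {..<?N} \<theta> = W \<theta>"
      proof (cases "\<theta> < ?N")
        case True
        then obtain j t where jt: "j < 2 * m" "t \<le> l" "\<theta> = j * Suc l + t" "\<theta> mod Suc l = t" "\<theta> div Suc l = j"
          by (rule index_split)
        have "\<gamma> (\<theta> div Suc l) (\<theta> mod Suc l) = W \<theta>" 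
          unfolding jt(4,5) gj[OF jt(1,2)] unfolding jt(3) ..
        thus ?thesis using True by (simp del: mult_Suc_right)
      qed (use WV in \<open>simp add: PiE_def extensional_def del: mult_Suc_right\<close>)
    qed
    have ties: "W (2 * i * Suc l) = W ((2 * i + 1) * Suc l)" if "i < m" for i
      using W that by (simp add: closed_walks_def)
    have tie2: "W ((2 * i + 1) * Suc l + l) = W ((2 * i + 2) * Suc l + l)" if "Suc i < m" for i
      using W that unfolding closed_walks_def by blast
    have tie3: "W ((2 * m - 1) * Suc l + l) = W l" using W by (simp add: closed_walks_def)
    have c_in: "c \<in> {..<Suc m} \<rightarrow>\<^sub>E V"
      unfolding c_def using WinV[of "2 * _" l] WinV[of 0 l] m by (auto simp del: mult_Suc_right)
    have c0: "c 0 = c m" using m by (simp add: c_def)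
    have e_in: "e \<in> ?E" unfolding e_def using WinV[of "2 * _" 0] by (auto simp del: mult_Suc_right)
    have g_in: "\<gamma> \<in> G c e"
      unfolding G_def
    proof (rule PiE_I)
      fix j assume "j \<in> {..<2 * m}"
      hence j: "j < 2 * m" by simp
      have "\<gamma> j \<in> ?P" unfolding \<gamma>_def using j WinV[OF j] by (auto simp del: mult_Suc_right)
      moreover have "\<gamma> j 0 = e (j div 2)"
      proof (cases "even j")
        case True
        then obtain i where "j = 2 * i" by (elim evenE)
        thus ?thesis using gj[OF j, of 0] j by (simp add: e_def)
      next
        case False
        then obtain i where i: "j = 2 * i + 1" by (elim oddE)
        thus ?thesis using gj[OF j, of 0] j ties[of i] by (simp add: e_def)
      qed
      moreover have "\<gamma> j l = c (Suc j div 2)"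
      proof (cases "even j")
        case True
        then obtain i where "j = 2 * i" by (elim evenE)
        thus ?thesis using gj[OF j, of l] j by (simp add: c_def)
      next
        case False
        then obtain i where i: "j = 2 * i + 1" by (elim oddE)
        show ?thesis
        proof (cases "Suc i < m")
          case True
          thus ?thesis using gj[OF j, of l] j tie2[OF True] i by (simp add: c_def)
        next
          case False
          hence "Suc i = m" "j = 2 * m - 1" using i j by linarith+
          thus ?thesis using gj[OF j, of l] tie3 i by (simp add: c_def)
        qed
      qed
      moreover have "F (\<gamma> j)" using W j by (simp add: closed_walks_def \<gamma>_def)
      ultimately show "\<gamma> j \<in> {w. w \<in> ?P \<and> w 0 = e (j div 2) \<and> w l = c (Suc j div 2) \<and> F w}" by simp
    qed (simp add: \<gamma>_def)
    show "(restrict (\<lambda>i. if i < m then W (2 * i * Suc l + l) else W l) {..<Suc m},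
            restrict (\<lambda>i. W (2 * i * Suc l)) {..<m},
            restrict (\<lambda>j. restrict (\<lambda>t. W (j * Suc l + t)) {..<Suc l}) {..<2 * m}) \<in> S"
      unfolding c_def[symmetric] e_def[symmetric] \<gamma>_def[symmetric] S_def
      using c_in c0 e_in g_in by blast
  qed
  also have "\<dots> = closed_sum F m l \<sigma>"
    unfolding closed_sum_def prod_moves ..
  finally show ?thesis .
qed

definition wild_sum :: "nat \<Rightarrow> ('a \<Rightarrow> 'a) \<Rightarrow> real" where
  "wild_sum l \<sigma> = (\<Sum>w\<in>wild_paths l. \<bar>path_weight l \<sigma> w\<bar>)"

lemma wild_kernel_le: "(\<Sum>a\<in>V. \<Sum>b\<in>V. \<bar>path_kernel (\<lambda>w. \<not> tame l w) l \<sigma> a b\<bar>) \<le> wild_sum l \<sigma>"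
proof -
  let ?P = "{..<Suc l} \<rightarrow>\<^sub>E V"
  have "(\<Sum>a\<in>V. \<Sum>b\<in>V. \<bar>path_kernel (\<lambda>w. \<not> tame l w) l \<sigma> a b\<bar>) \<le>
     (\<Sum>a\<in>V. \<Sum>b\<in>V. \<Sum>w | w \<in> ?P \<and> w 0 = a \<and> w l = b \<and> \<not> tame l w. \<bar>path_weight l \<sigma> w\<bar>)"
    unfolding path_kernel_def by (intro sum_mono sum_abs)
  also have "\<dots> = (\<Sum>(a, b)\<in>V \<times> V. \<Sum>w | w \<in> wild_paths l \<and> (w 0, w l) = (a, b). \<bar>path_weight l \<sigma> w\<bar>)"
  proof -
    have "{w. w \<in> ?P \<and> w 0 = a \<and> w l = b \<and> \<not> tame l w} = {w. w \<in> wild_paths l \<and> (w 0, w l) = (a, b)}" for a b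
      by (auto simp: wild_paths_def)
    thus ?thesis by (simp only: sum.cartesian_product)
  qed
  also have "\<dots> = (\<Sum>z\<in>V \<times> V. \<Sum>w | w \<in> wild_paths l \<and> (w 0, w l) = z. \<bar>path_weight l \<sigma> w\<bar>)"
    by (simp only: case_prod_unfold prod.collapse)
  also have "\<dots> = wild_sum l \<sigma>"
    unfolding wild_sum_def
  proof (rule sum.group)
    show "finite (wild_paths l)" unfolding wild_paths_def by (rule finite_subset[of _ ?P]) auto
    show "finite (V \<times> V)" using finV by simp
    show "(\<lambda>w. (w 0, w l)) ` wild_paths l \<subseteq> V \<times> V" by (auto simp: wild_paths_def)
  qed
  finally show ?thesis .
qed

lemma sum_squares_le_square_sum:
  assumes "finite A"
  shows "(\<Sum>i\<in>A. (f i :: real)\<^sup>2) \<le> (\<Sum>i\<in>A. \<bar>f i\<bar>)\<^sup>2"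
proof -
  have "L2_set f A \<le> (\<Sum>i\<in>A. \<bar>f i\<bar>)" by (rule L2_set_le_sum_abs)
  hence "(L2_set f A)\<^sup>2 \<le> (\<Sum>i\<in>A. \<bar>f i\<bar>)\<^sup>2" by (intro power_mono) (auto simp: L2_set_nonneg)
  thus ?thesis by (simp add: L2_set_def sum_nonneg)
qed

text \<open>An eigenvector satisfies \<open>\<mu>^l u = Y u + Z u\<close>. The norm of
  \<open>Y\<close> is at most \<open>\<tau>\<close> by the trace, that of \<open>Z\<close> at most
  \<open>z\<close>, because the Hilbert-Schmidt norm is below the sum of the absolute
  entries.\<close>

lemma eigenvalue_bound:
  fixes u :: "'a \<Rightarrow> complex"
  assumes eig: "\<And>a. a \<in> V \<Longrightarrow> (\<Sum>b\<in>V. of_real (qc (\<sigma> a) b) * u b) = \<mu> * u a"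
    and nz: "\<exists>a\<in>V. u a \<noteq> 0"
    and tr: "closed_sum F (2 ^ j) l \<sigma> \<le> \<tau> ^ (2 * 2 ^ j)" "\<tau> \<ge> 0"
    and z: "(\<Sum>a\<in>V. \<Sum>b\<in>V. \<bar>path_kernel (\<lambda>w. \<not> F w) l \<sigma> a b\<bar>) \<le> z"
  shows "cmod \<mu> ^ l \<le> \<tau> + z"
proof -
  let ?Y = "path_kernel F l \<sigma>" and ?Z = "path_kernel (\<lambda>w. \<not> F w) l \<sigma>"
  define nu where "nu v = L2_set (\<lambda>a. cmod (v a)) V" for v :: "'a \<Rightarrow> complex"
  have nu2: "(nu v)\<^sup>2 = (\<Sum>a\<in>V. (cmod (v a))\<^sup>2)" for v by (simp add: nu_def L2_set_def sum_nonneg)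
  have nu0: "nu v \<ge> 0" for v by (simp add: nu_def L2_set_nonneg)
  have bnd: "nu (\<lambda>a. \<Sum>b\<in>V. of_real (K a b) * u b) \<le> s * nu u"
    if C: "\<And>x. sq (ap K x) \<le> s\<^sup>2 * sq x" and s: "s \<ge> 0" for K s
  proof -
    have "(nu (\<lambda>a. \<Sum>b\<in>V. of_real (K a b) * u b))\<^sup>2 \<le> s\<^sup>2 * (nu u)\<^sup>2"
      unfolding nu2 by (rule complex_bound[OF C])
    hence "(nu (\<lambda>a. \<Sum>b\<in>V. of_real (K a b) * u b))\<^sup>2 \<le> (s * nu u)\<^sup>2" by (simp add: power_mult_distrib)
    thus ?thesis by (rule power2_le_imp_le) (simp add: s nu0)
  qed
  have Y: "sq (ap ?Y x) \<le> \<tau>\<^sup>2 * sq x" for x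
  proof -
    have "sq (ap ?Y x) ^ (2 ^ j) \<le> sq x ^ (2 ^ j) * closed_sum F (2 ^ j) l \<sigma>"
      using sq_ap_trace_le[of ?Y x j] trace_path_kernel[of "2 ^ j" F l \<sigma>] by simp
    also have "\<dots> \<le> sq x ^ (2 ^ j) * \<tau> ^ (2 * 2 ^ j)" by (intro mult_left_mono tr) auto
    also have "\<dots> = (\<tau>\<^sup>2 * sq x) ^ (2 ^ j)" by (simp add: power_mult power_mult_distrib mult.commute)
    finally have "sq (ap ?Y x) ^ (2 ^ j) \<le> (\<tau>\<^sup>2 * sq x) ^ (2 ^ j)" .
    thus ?thesis by (rule power_mono_iff[THEN iffD1, rotated 3]) auto
  qed
  have "0 \<le> (\<Sum>a\<in>V. \<Sum>b\<in>V. \<bar>?Z a b\<bar>)" by (intro sum_nonneg) simp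
  hence zz: "z \<ge> 0" using z by linarith
  have Z: "sq (ap ?Z x) \<le> z\<^sup>2 * sq x" for x
  proof -
    have "(\<Sum>a\<in>V. \<Sum>b\<in>V. (?Z a b)\<^sup>2) = (\<Sum>(a, b)\<in>V \<times> V. (?Z a b)\<^sup>2)" by (rule sum.cartesian_product)
    also have "\<dots> = (\<Sum>ab\<in>V \<times> V. (case ab of (a, b) \<Rightarrow> ?Z a b)\<^sup>2)" by (simp add: case_prod_unfold)
    also have "\<dots> \<le> (\<Sum>ab\<in>V \<times> V. \<bar>case ab of (a, b) \<Rightarrow> ?Z a b\<bar>)\<^sup>2"
      using finV by (intro sum_squares_le_square_sum) auto
    also have "(\<Sum>ab\<in>V \<times> V. \<bar>case ab of (a, b) \<Rightarrow> ?Z a b\<bar>) = (\<Sum>a\<in>V. \<Sum>b\<in>V. \<bar>?Z a b\<bar>)"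
      by (simp add: sum.cartesian_product case_prod_unfold)
    also have "(\<Sum>a\<in>V. \<Sum>b\<in>V. \<bar>?Z a b\<bar>)\<^sup>2 \<le> z\<^sup>2" by (intro power_mono z sum_nonneg) auto
    finally have "(\<Sum>a\<in>V. \<Sum>b\<in>V. (?Z a b)\<^sup>2) \<le> z\<^sup>2" .
    from mult_left_mono[OF this sq_nonneg[of x]] sq_ap_le_hs[of ?Z x] show ?thesis
      by (simp add: mult.commute)
  qed
  have "cmod \<mu> ^ l * nu u = nu (\<lambda>a. \<mu> ^ l * u a)"
    unfolding nu_def by (simp add: norm_mult norm_power L2_set_right_distrib)
  also have "\<dots> \<le> L2_set (\<lambda>a. cmod (\<Sum>b\<in>V. of_real (?Y a b) * u b) + cmod (\<Sum>b\<in>V. of_real (?Z a b) * u b)) V"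
    unfolding nu_def using path_kernel_split[OF eig, where F = F and l = l]
    by (intro L2_set_mono) (auto simp: norm_triangle_ineq)
  also have "\<dots> \<le> nu (\<lambda>a. \<Sum>b\<in>V. of_real (?Y a b) * u b) + nu (\<lambda>a. \<Sum>b\<in>V. of_real (?Z a b) * u b)"
    unfolding nu_def by (rule L2_set_triangle_ineq)
  also have "\<dots> \<le> \<tau> * nu u + z * nu u" by (intro add_mono bnd Y Z tr zz)
  finally have "cmod \<mu> ^ l * nu u \<le> (\<tau> + z) * nu u" by (simp add: distrib_right)
  moreover have "nu u > 0"
  proof -
    obtain a where a: "a \<in> V" "u a \<noteq> 0" using nz by blast
    have "(nu u)\<^sup>2 > 0" unfolding nu2 using a finV by (intro sum_pos2[of V a]) auto
    thus ?thesis using nu0[of u] by (metis less_eq_real_def power_zero_numeral less_irrefl)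
  qed
  ultimately show ?thesis by simp
qed

end

section \<open>The second eigenvalue\<close>

text \<open>The Weinstein-Aronszajn identity: \<open>?L\<close> and \<open>?R\<close> are multiplied
  in both orders, and both products are block triangular.\<close>

lemma det_one_plus_rank_one:
  fixes u v :: "'b :: idom mat"
  assumes u: "u \<in> carrier_mat n m" and v: "v \<in> carrier_mat m n"
  shows "det (1\<^sub>m n + u * v) = det (1\<^sub>m m + v * u)"
proof -
  let ?R = "four_block_mat (1\<^sub>m n) u (0\<^sub>m m n) (1\<^sub>m m)"
  let ?L = "four_block_mat (1\<^sub>m n) (- u) v (1\<^sub>m m)"
  have R: "?R \<in> carrier_mat (n + m) (n + m)" and L: "?L \<in> carrier_mat (n + m) (n + m)"
    using u v by auto
  have uv: "u * v \<in> carrier_mat n n" "v * u \<in> carrier_mat m m" using u v by auto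
  have "det ?R * det ?L = det (?R * ?L)" by (rule det_mult[OF R L, symmetric])
  also have "?R * ?L = four_block_mat (1\<^sub>m n * 1\<^sub>m n + u * v) (1\<^sub>m n * (- u) + u * 1\<^sub>m m)
      (0\<^sub>m m n * 1\<^sub>m n + 1\<^sub>m m * v) (0\<^sub>m m n * (- u) + 1\<^sub>m m * 1\<^sub>m m)"
    by (rule mult_four_block_mat) (use u v in auto)
  also have "\<dots> = four_block_mat (1\<^sub>m n + u * v) (0\<^sub>m n m) v (1\<^sub>m m)"
    by (rule cong_four_block_mat) (use u v in auto)
  also have "det \<dots> = det (1\<^sub>m n + u * v) * det (1\<^sub>m m :: 'b mat)"
    by (rule det_four_block_mat_upper_right_zero) (use u v in auto)
  finally have 1: "det ?R * det ?L = det (1\<^sub>m n + u * v)" by simp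
  have "det ?L * det ?R = det (?L * ?R)" by (rule det_mult[OF L R, symmetric])
  also have "?L * ?R = four_block_mat (1\<^sub>m n * 1\<^sub>m n + (- u) * 0\<^sub>m m n) (1\<^sub>m n * u + (- u) * 1\<^sub>m m)
      (v * 1\<^sub>m n + 1\<^sub>m m * 0\<^sub>m m n) (v * u + 1\<^sub>m m * 1\<^sub>m m)"
    by (rule mult_four_block_mat) (use u v in auto)
  also have "\<dots> = four_block_mat (1\<^sub>m n) (0\<^sub>m n m) v (1\<^sub>m m + v * u)"
    by (rule cong_four_block_mat) (use u v in \<open>auto simp: comm_add_mat\<close>)
  also have "det \<dots> = det (1\<^sub>m n :: 'b mat) * det (1\<^sub>m m + v * u)"
    by (rule det_four_block_mat_upper_right_zero) (use u v in auto)
  finally have "det ?L * det ?R = det (1\<^sub>m m + v * u)" by simp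
  thus ?thesis using 1 by (simp add: mult.commute)
qed

lemma det_one_plus_const:
  fixes c :: "'b :: idom"
  shows "det (mat n n (\<lambda>(i, j). (if i = j then 1 else 0) + c)) = 1 + of_nat n * c"
proof -
  let ?u = "mat n 1 (\<lambda>_. c)" and ?v = "mat 1 n (\<lambda>_. 1 :: 'b)"
  have "mat n n (\<lambda>(i, j). (if i = j then 1 else 0) + c) = 1\<^sub>m n + ?u * ?v"
    by (rule eq_matI) (auto simp: scalar_prod_def)
  also have "det \<dots> = det (1\<^sub>m 1 + ?v * ?u)" by (rule det_one_plus_rank_one) auto
  also have "\<dots> = 1 + of_nat n * c"
    by (subst det_single) (auto simp: scalar_prod_def)
  finally show ?thesis .
qed

lemma index_mult_mat_sum:
  assumes "A \<in> carrier_mat n m" "B \<in> carrier_mat m l" "i < n" "j < l"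
  shows "(A * B) $$ (i, j) = (\<Sum>k<m. A $$ (i, k) * B $$ (k, j))"
  using assms by (auto simp: scalar_prod_def lessThan_atLeast0)

text \<open>Row sums 1 mean \<open>A J = J\<close>, so
  \<open>(x - A) (1 + c J) = x - A + c (x - 1) J\<close>. The choice
  \<open>c (x - 1) = 1 / n\<close> turns the right side into \<open>x - B\<close>, and the
  determinant of \<open>1 + c J\<close> is \<open>x / (x - 1)\<close>.\<close>

lemma char_poly_minus_uniform:
  fixes p :: "nat \<Rightarrow> nat \<Rightarrow> 'b :: field_char_0"
  assumes n: "n > 0" and p: "\<And>i. i < n \<Longrightarrow> (\<Sum>k<n. p i k) = 1"
  shows "[:0, 1:] * char_poly (mat n n (\<lambda>(i, j). p i j)) =
    [:- 1, 1:] * char_poly (mat n n (\<lambda>(i, j). p i j - 1 / of_nat n))"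
    (is "?x * char_poly ?A = ?y * char_poly ?B")
proof -
  have A: "?A \<in> carrier_mat n n" and B: "?B \<in> carrier_mat n n" by auto
  have eq: "poly (?x * char_poly ?A) x = poly (?y * char_poly ?B) x" if x: "x \<noteq> 1" for x
  proof -
    define c where "c = 1 / (of_nat n * (x - 1))"
    have c: "c * (x - 1) = 1 / of_nat n" using x n by (simp add: c_def)
    let ?C = "mat n n (\<lambda>(i, j). (if i = j then 1 else 0) + c)"
    have ent: "(- char_matrix ?A x) $$ (i, j) = (if i = j then x else 0) - p i j" if "i < n" "j < n" for i j
      using that by (simp add: char_matrix_def)
    have "- char_matrix ?A x * ?C = - char_matrix ?B x"
    proof (rule eq_matI)
      fix i j assume "i < dim_row (- char_matrix ?B x)" "j < dim_col (- char_matrix ?B x)"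
      hence ij: "i < n" "j < n" by (auto simp: char_matrix_def)
      have "(- char_matrix ?A x * ?C) $$ (i, j) =
        (\<Sum>k<n. ((if i = k then x else 0) - p i k) * ((if k = j then 1 else 0) + c))"
        by (subst index_mult_mat_sum[of _ n n _ n]) (use ij ent in \<open>auto simp del: index_uminus_mat intro!: sum.cong\<close>)
      also have "\<dots> = (\<Sum>k<n. (if k = j then (if i = k then x else 0) - p i k else 0)) +
          c * ((\<Sum>k<n. if i = k then x else 0) - (\<Sum>k<n. p i k))"
      proof -
        have "(\<Sum>k<n. ((if i = k then x else 0) - p i k) * ((if k = j then 1 else 0) + c)) =
          (\<Sum>k<n. (if k = j then (if i = k then x else 0) - p i k else 0) +
             c * ((if i = k then x else 0) - p i k))"
          by (intro sum.cong) (auto simp: algebra_simps)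
        thus ?thesis by (simp only: sum.distrib sum_distrib_left[symmetric] sum_subtractf)
      qed
      also have "\<dots> = (if i = j then x else 0) - p i j + c * (x - 1)"
        using ij p by (simp add: sum.delta sum.delta')
      also have "\<dots> = (- char_matrix ?B x) $$ (i, j)" using ij c by (simp add: char_matrix_def)
      finally show "(- char_matrix ?A x * ?C) $$ (i, j) = (- char_matrix ?B x) $$ (i, j)" .
    qed (auto simp: char_matrix_def)
    hence "det (- char_matrix ?A x) * det ?C = det (- char_matrix ?B x)"
      by (subst det_mult[symmetric, of _ n]) auto
    hence "poly (char_poly ?A) x * (1 + of_nat n * c) = poly (char_poly ?B) x"
      by (simp only: char_poly_matrix[OF A] char_poly_matrix[OF B] det_one_plus_const)
    moreover have "(1 + of_nat n * c) * (x - 1) = x" using x n by (simp add: c_def field_simps)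
    ultimately have "poly (char_poly ?B) x * (x - 1) = poly (char_poly ?A) x * x"
      by (metis mult.assoc)
    thus ?thesis by (simp add: algebra_simps)
  qed
  show ?thesis
  \<comment> \<open>Equality away from 1 suffices, since a nonzero polynomial has finitely many
    roots.\<close>
  proof (rule ccontr)
    assume "?x * char_poly ?A \<noteq> ?y * char_poly ?B"
    hence "finite {x. poly (?x * char_poly ?A - ?y * char_poly ?B) x = 0}"
      by (intro poly_roots_finite) simp
    moreover have "- {1} \<subseteq> {x. poly (?x * char_poly ?A - ?y * char_poly ?B) x = 0}"
      using eq by auto
    ultimately have "finite (- {1 :: 'b})" by (rule rev_finite_subset)
    hence "finite (UNIV :: 'b set)" by simp
    thus False using infinite_UNIV_char_0 by blast
  qed
qed

lemma nth_eigenvalue_root: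
  assumes A: "A \<in> carrier_mat n n" and k: "1 \<le> k" "k \<le> n"
  shows "poly (char_poly A) (nth_eigenvalue A k) = 0"
proof -
  have "length (ordered_eigenvalues A) = size (proots (char_poly A))"
    by (metis ordered_eigenvalues(1) size_mset)
  also have "\<dots> = n" using degree_monic_char_poly[OF A] by (simp add: size_proots_complex)
  finally have "nth_eigenvalue A k \<in> set (ordered_eigenvalues A)"
    unfolding nth_eigenvalue_def using k by (intro nth_mem) linarith
  hence "nth_eigenvalue A k \<in># proots (char_poly A)"
    by (metis ordered_eigenvalues(1) set_mset_mset)
  moreover have "char_poly A \<noteq> 0" using degree_monic_char_poly[OF A] by force
  ultimately show ?thesis by simp
qed

text \<open>As multisets, the eigenvalues of \<open>A\<close> with 0 added are those of
  \<open>B\<close> with 1 added. So at least one of the first two eigenvalues of \<open>A\<close>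
  belongs to \<open>B\<close>, and either dominates the second in modulus.\<close>

lemma second_eigenvalue_le:
  assumes A: "A \<in> carrier_mat n n" and B: "B \<in> carrier_mat n n" and n: "n \<ge> 2"
    and eq: "[:0, 1:] * char_poly A = [:- 1, 1:] * char_poly B"
  shows "\<exists>\<mu>. poly (char_poly B) \<mu> = 0 \<and> cmod (nth_eigenvalue A 2) \<le> cmod \<mu>"
proof -
  define zs where "zs = ordered_eigenvalues A"
  have nz: "char_poly A \<noteq> 0" "char_poly B \<noteq> 0"
    using degree_monic_char_poly[OF A] degree_monic_char_poly[OF B] by force+
  have "proots ([:0, 1:] * char_poly A) = proots ([:- 1, 1:] * char_poly B)" using eq by simp
  hence eq': "add_mset 0 (mset zs) = add_mset 1 (proots (char_poly B))"
    using nz by (simp add: proots_mult zs_def ordered_eigenvalues(1) del: mult_pCons_left)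
  have "length zs = n"
    using degree_monic_char_poly[OF A] ordered_eigenvalues(1)[of A]
    by (metis size_mset size_proots_complex zs_def)
  then obtain a b xs where zs: "zs = a # b # xs" using n
    by (cases zs; cases "tl zs") auto
  have ab: "cmod b \<le> cmod a" using ordered_eigenvalues(2)[of A] by (simp add: zs_def[symmetric] zs)
  have "a \<in># proots (char_poly B) \<or> b \<in># proots (char_poly B)"
  proof (rule ccontr)
    assume "\<not> ?thesis"
    hence 0: "count (proots (char_poly B)) a = 0" "count (proots (char_poly B)) b = 0"
      by (auto simp: not_in_iff)
    have "count (add_mset 0 (mset zs)) x = count (add_mset 1 (proots (char_poly B))) x" for x
      by (simp only: eq')
    from this[of a] this[of b] show False using 0
      by (auto simp: zs split: if_splits)
  qed
  thus ?thesis using nz ab by (auto simp: nth_eigenvalue_def zs_def[symmetric] zs)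
qed

lemma root_char_poly_vec:
  fixes p :: "nat \<Rightarrow> nat \<Rightarrow> 'b :: field"
  assumes "poly (char_poly (mat n n (\<lambda>(i, j). p i j))) \<mu> = 0"
  obtains u where "\<And>i. i < n \<Longrightarrow> (\<Sum>j<n. p i j * u j) = \<mu> * u i" "\<exists>i<n. u i \<noteq> 0"
proof -
  let ?A = "mat n n (\<lambda>(i, j). p i j)"
  have A: "?A \<in> carrier_mat n n" by simp
  obtain v where v: "v \<in> carrier_vec n" "v \<noteq> 0\<^sub>v n" "?A *\<^sub>v v = \<mu> \<cdot>\<^sub>v v"
    using assms A unfolding eigenvalue_root_char_poly[OF A, symmetric] eigenvalue_def eigenvector_def by auto
  show ?thesis
  proof (rule that[of "\<lambda>i. v $ i"])
    fix i assume i: "i < n"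
    have "(\<Sum>j<n. p i j * v $ j) = (?A *\<^sub>v v) $ i"
      using i v(1) by (simp add: scalar_prod_def lessThan_atLeast0)
    also have "\<dots> = \<mu> * v $ i" using i v by simp
    finally show "(\<Sum>j<n. p i j * v $ j) = \<mu> * v $ i" .
  next
    show "\<exists>i<n. v $ i \<noteq> 0" using v(1,2) by (metis carrier_vecD eq_vecI index_zero_vec(1) zero_carrier_vec)
  qed
qed

text \<open>Read the eigenvalue equation at a coordinate where the eigenvector has maximal
  modulus.\<close>

lemma stochastic_root_le:
  fixes p :: "nat \<Rightarrow> nat \<Rightarrow> complex"
  assumes p: "\<And>i. i < n \<Longrightarrow> (\<Sum>k<n. cmod (p i k)) \<le> 1"
    and root: "poly (char_poly (mat n n (\<lambda>(i, j). p i j))) \<mu> = 0"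
  shows "cmod \<mu> \<le> 1"
proof -
  obtain u where u: "\<And>i. i < n \<Longrightarrow> (\<Sum>j<n. p i j * u j) = \<mu> * u i" and nz: "\<exists>i<n. u i \<noteq> 0"
    using root_char_poly_vec[OF root] by blast
  define M where "M = Max ((\<lambda>i. cmod (u i)) ` {..<n})"
  have ne: "{..<n} \<noteq> {}" using nz by auto
  have M: "cmod (u i) \<le> M" if "i < n" for i unfolding M_def using that by (intro Max_ge) auto
  have "M \<in> (\<lambda>i. cmod (u i)) ` {..<n}" unfolding M_def using ne by (intro Max_in) auto
  then obtain i where i: "i < n" "cmod (u i) = M" by auto
  have "M > 0" using nz M by (metis less_le_trans zero_less_norm_iff)
  have "cmod \<mu> * M = cmod (\<Sum>j<n. p i j * u j)" using u[OF i(1)] i(2) by (simp add: norm_mult)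
  also have "\<dots> \<le> (\<Sum>j<n. cmod (p i j) * M)"
    by (intro sum_norm_le) (auto simp: norm_mult intro!: mult_left_mono M)
  also have "\<dots> \<le> 1 * M" unfolding sum_distrib_right[symmetric]
    using p[OF i(1)] \<open>M > 0\<close> by (intro mult_right_mono) auto
  finally show ?thesis using \<open>M > 0\<close> by simp
qed

lemma regular_digraph_regular_graph:
  assumes G: "regular_digraph r G" and V: "pverts G \<noteq> {}" and r: "r > 0"
  shows "regular_graph (pverts G) (parcs G) r"
proof -
  interpret pair_fin_digraph G using G by (simp add: regular_digraph_def)
  show ?thesis
  proof
    show "finite (pverts G)" by simp
    fix v assume v: "v \<in> pverts G"
    have "out_arcs G v = (\<lambda>x. (v, x)) ` {x \<in> pverts G. (v, x) \<in> parcs G}"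
      using in_arcsD2 by auto
    hence "card {x \<in> pverts G. (v, x) \<in> parcs G} = out_degree G v"
      unfolding out_degree_def by (simp add: card_image inj_on_def)
    thus "card {x \<in> pverts G. (v, x) \<in> parcs G} = r" using G v by (simp add: regular_digraph_def)
    have "in_arcs G v = (\<lambda>x. (x, v)) ` {x \<in> pverts G. (x, v) \<in> parcs G}"
      using in_arcsD1 by auto
    hence "card {x \<in> pverts G. (x, v) \<in> parcs G} = in_degree G v"
      unfolding in_degree_def by (simp add: card_image inj_on_def)
    thus "card {x \<in> pverts G. (x, v) \<in> parcs G} = r" using G v by (simp add: regular_digraph_def)
  qed (use V r in auto)
qed

lemma sum_atLeast1_atMost_shift: "(\<Sum>x\<in>{1..n}. f x) = (\<Sum>i<n. f (Suc i))"
  using sum.atLeast1_atMost_eq[of f n] by simp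

lemma permuted_walk_matrix:
  assumes \<sigma>: "\<sigma> permutes {1..n}"
  shows "permutation_mat n \<sigma> * transition_mat n r G =
    mat n n (\<lambda>(x, y). if (\<sigma> (Suc x), Suc y) \<in> parcs G then 1 / of_nat r else 0)"
proof (rule eq_matI)
  fix i j assume "i < dim_row (mat n n (\<lambda>(x, y). if (\<sigma> (Suc x), Suc y) \<in> parcs G then 1 / of_nat r else (0::complex)))"
    "j < dim_col (mat n n (\<lambda>(x, y). if (\<sigma> (Suc x), Suc y) \<in> parcs G then 1 / of_nat r else (0::complex)))"
  hence ij: "i < n" "j < n" by auto
  define f where "f k = (if (k, Suc j) \<in> parcs G then 1 / of_nat r else (0 :: complex))" for k
  have in': "\<sigma> (Suc i) \<in> {1..n}" using permutes_in_image[OF \<sigma>] ij by auto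
  have "(permutation_mat n \<sigma> * transition_mat n r G) $$ (i, j) =
    (\<Sum>k<n. (if \<sigma> (Suc i) = Suc k then 1 else 0) * f (Suc k))"
    by (subst index_mult_mat_sum[of _ n n _ n])
      (use ij in \<open>auto simp: permutation_mat_def transition_mat_def f_def intro!: sum.cong\<close>)
  also have "\<dots> = (\<Sum>x\<in>{1..n}. (if \<sigma> (Suc i) = x then 1 else 0) * f x)"
    by (rule sum_atLeast1_atMost_shift[symmetric])
  also have "\<dots> = (\<Sum>x\<in>{1..n}. if \<sigma> (Suc i) = x then f x else 0)" by (intro sum.cong) auto
  also have "\<dots> = f (\<sigma> (Suc i))" using in' by (subst sum.delta') auto
  finally show "(permutation_mat n \<sigma> * transition_mat n r G) $$ (i, j) =
     mat n n (\<lambda>(x, y). if (\<sigma> (Suc x), Suc y) \<in> parcs G then 1 / of_nat r else 0) $$ (i, j)"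
    using ij by (simp add: f_def)
qed (auto simp: permutation_mat_def transition_mat_def)

section \<open>From the matrix \<open>M Q\<close> to the kernel \<open>qc\<close>\<close>

context
  fixes n r :: nat and G :: "nat pair_pre_digraph" and \<sigma> :: "nat \<Rightarrow> nat"
  assumes reg: "regular_graph {1..n} (parcs G) r" and \<sigma>: "\<sigma> permutes {1..n}" and n2: "n \<ge> 2"
begin

interpretation regular_graph "{1..n}" "parcs G" r by (rule reg)

lemma second_eigenvalue_vector:
  "\<exists>\<mu> u. (\<forall>a\<in>{1..n}. (\<Sum>b\<in>{1..n}. of_real (qc (\<sigma> a) b) * u b) = \<mu> * u a) \<and>
    (\<exists>a\<in>{1..n}. u a \<noteq> 0) \<and> cmod (nth_eigenvalue (permutation_mat n \<sigma> * transition_mat n r G) 2) \<le> cmod \<mu>"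
proof -
  define p :: "nat \<Rightarrow> nat \<Rightarrow> complex" where "p i j = of_real (q (\<sigma> (Suc i)) (Suc j))" for i j
  define p' :: "nat \<Rightarrow> nat \<Rightarrow> complex" where "p' i j = p i j - 1 / of_nat n" for i j
  have p': "p' i j = of_real (qc (\<sigma> (Suc i)) (Suc j))" for i j unfolding p'_def p_def qc_def by simp
  have M: "permutation_mat n \<sigma> * transition_mat n r G = mat n n (\<lambda>(i, j). p i j)"
    unfolding permuted_walk_matrix[OF \<sigma>] p_def q_def by (rule eq_matI) auto
  have s: "(\<Sum>k<n. p i k) = 1" if "i < n" for i
  proof -
    have "(\<Sum>k<n. p i k) = of_real (\<Sum>k<n. q (\<sigma> (Suc i)) (Suc k))" by (simp add: p_def)
    also have "(\<Sum>k<n. q (\<sigma> (Suc i)) (Suc k)) = 1"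
      using sum_q_row[of "\<sigma> (Suc i)"] permutes_in_image[OF \<sigma>, of "Suc i"] that
      by (simp add: sum_atLeast1_atMost_shift[symmetric] del: sum.atLeast1_atMost_eq)
    finally show ?thesis by simp
  qed
  have "\<exists>\<mu>. poly (char_poly (mat n n (\<lambda>(i, j). p' i j))) \<mu> = 0 \<and>
      cmod (nth_eigenvalue (permutation_mat n \<sigma> * transition_mat n r G) 2) \<le> cmod \<mu>"
    unfolding M using char_poly_minus_uniform[OF _ s] n2
    by (intro second_eigenvalue_le) (auto simp: p'_def[symmetric])
  then obtain \<mu> where \<mu>: "poly (char_poly (mat n n (\<lambda>(i, j). p' i j))) \<mu> = 0"
      "cmod (nth_eigenvalue (permutation_mat n \<sigma> * transition_mat n r G) 2) \<le> cmod \<mu>" by blast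
  obtain u where u: "\<And>i. i < n \<Longrightarrow> (\<Sum>j<n. p' i j * u j) = \<mu> * u i" "\<exists>i<n. u i \<noteq> 0"
    using root_char_poly_vec[OF \<mu>(1)] by blast
  have "(\<Sum>b\<in>{1..n}. of_real (qc (\<sigma> a) b) * u (b - 1)) = \<mu> * u (a - 1)" if a: "a \<in> {1..n}" for a
  proof -
    have "(\<Sum>b\<in>{1..n}. of_real (qc (\<sigma> a) b) * u (b - 1)) = (\<Sum>j<n. p' (a - 1) j * u j)"
      using a by (subst sum_atLeast1_atMost_shift) (auto simp: p' intro!: sum.cong)
    also have "\<dots> = \<mu> * u (a - 1)" using a by (intro u(1)) auto
    finally show ?thesis .
  qed
  moreover have "\<exists>a\<in>{1..n}. u (a - 1) \<noteq> 0"
  proof -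
    obtain i where "i < n" "u i \<noteq> 0" using u(2) by blast
    thus ?thesis by (intro bexI[of _ "Suc i"]) auto
  qed
  ultimately show ?thesis using \<mu>(2)
    by (intro exI[of _ \<mu>] exI[of _ "\<lambda>a. u (a - 1)"]) blast
qed

lemma second_eigenvalue_le_1: "cmod (nth_eigenvalue (permutation_mat n \<sigma> * transition_mat n r G) 2) \<le> 1"
proof -
  define p :: "nat \<Rightarrow> nat \<Rightarrow> complex" where "p i j = of_real (q (\<sigma> (Suc i)) (Suc j))" for i j
  have M: "permutation_mat n \<sigma> * transition_mat n r G = mat n n (\<lambda>(i, j). p i j)"
    unfolding permuted_walk_matrix[OF \<sigma>] p_def q_def by (rule eq_matI) auto
  have s: "(\<Sum>k<n. cmod (p i k)) \<le> 1" if "i < n" for i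
  proof -
    have "(\<Sum>k<n. cmod (p i k)) = (\<Sum>k<n. q (\<sigma> (Suc i)) (Suc k))" by (simp add: p_def q_nonneg)
    also have "\<dots> = 1"
      using sum_q_row[of "\<sigma> (Suc i)"] permutes_in_image[OF \<sigma>, of "Suc i"] that
      by (simp add: sum_atLeast1_atMost_shift[symmetric] del: sum.atLeast1_atMost_eq)
    finally show ?thesis by simp
  qed
  show ?thesis unfolding M by (rule stochastic_root_le[OF s nth_eigenvalue_root]) (use n2 in auto)
qed

end

context regular_graph
begin

text \<open>Required for Markov's inequality; it follows from the trace bound applied to the
  indicator of one vertex.\<close>

lemma closed_sum_nonneg: "0 \<le> closed_sum F (2 ^ j) l \<sigma>"
proof -
  obtain v where v: "v \<in> V" using neV by blast
  let ?x = "\<lambda>a. if a = v then 1 else 0 :: real"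
  have x: "sq ?x = 1" using v finV by (simp add: sq_def if_distrib[of "\<lambda>t. t\<^sup>2"] cong: if_cong)
  have "0 \<le> sq (ap (path_kernel F l \<sigma>) ?x) ^ (2 ^ j)" by (simp add: sq_nonneg)
  also have "\<dots> \<le> sq ?x ^ (2 ^ j) * closed_sum F (2 ^ j) l \<sigma>"
    using sq_ap_trace_le[of "path_kernel F l \<sigma>" ?x j] trace_path_kernel[of "2 ^ j" F l \<sigma>] by simp
  finally show ?thesis by (simp add: x)
qed

end

section \<open>Choice of the parameters\<close>

lemma sum_le_geometric:
  fixes x T :: real
  assumes "\<And>k. k \<le> K \<Longrightarrow> f k \<le> T * x ^ k" "0 \<le> x" "x \<le> 1 / 2" "0 \<le> T"
  shows "(\<Sum>k\<le>K. f k) \<le> 2 * T"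
proof -
  have "(\<Sum>k\<le>K. f k) \<le> (\<Sum>k\<le>K. T * x ^ k)" using assms(1) by (intro sum_mono) auto
  also have "\<dots> = T * (\<Sum>k\<le>K. x ^ k)" by (simp add: sum_distrib_left)
  also have "\<dots> \<le> T * (\<Sum>k. x ^ k)"
    using assms by (intro mult_left_mono sum_le_suminf summable_geometric) auto
  also have "\<dots> \<le> T * 2"
    using assms by (intro mult_left_mono) (auto simp: suminf_geometric field_simps)
  finally show ?thesis by simp
qed

text \<open>The chord of the convex function between 0 and \<open>b\<close> lies above it.\<close>

lemma exp_le_linear:
  fixes b t :: real
  assumes "0 \<le> t" "t \<le> 1"
  shows "exp (b * t) \<le> 1 + t * exp b"
proof -
  have "convex_on UNIV (exp :: real \<Rightarrow> real)" by (rule exp_convex)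
  from convex_onD[OF this, of t 0 b] assms
  have "exp (t * b) \<le> (1 - t) * 1 + t * exp b" by simp
  thus ?thesis using assms by (simp add: mult.commute)
qed

text \<open>The trace bound asks for \<open>m\<close> to be a power of two, which costs a factor 2
  in its size.\<close>

lemma power_two_between:
  assumes "(s :: real) \<ge> 1"
  obtains j where "s \<le> 2 ^ j" "2 ^ j \<le> 2 * s"
proof -
  define k where "k = nat \<lfloor>s\<rfloor>"
  have k: "k \<ge> 1" "real k \<le> s" "s < real k + 1" using assms unfolding k_def by linarith+
  obtain j where j: "2 ^ j \<le> k" "k < 2 ^ (j + 1)" using ex_power_ivl1[of 2 k] k by auto
  have "real k + 1 \<le> 2 ^ Suc j" using j(2) by (metis Suc_eq_plus1 of_nat_Suc of_nat_le_numeral_power_cancel_iff Suc_leI add.commute)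
  moreover have "2 ^ Suc j \<le> 2 * real k" using j(1) by (simp add: of_nat_le_numeral_power_cancel_iff numeral_power_le_of_nat_cancel_iff)
  ultimately show ?thesis using k by (intro that[of "Suc j"]) linarith+
qed

lemma power_le_exp:
  assumes "0 \<le> x" "x \<le> exp y" "real k * y \<le> z"
  shows "x ^ k \<le> exp z"
proof -
  have "x ^ k \<le> exp y ^ k" using assms by (intro power_mono) auto
  also have "\<dots> = exp (real k * y)" by (simp add: exp_of_nat_mult)
  finally show ?thesis using assms(3) by (meson exp_le_cancel_iff order_trans)
qed

lemma two_le_exp: "2 \<le> exp (1 :: real)"
  using exp_ge_add_one_self[of 1] by simp

section \<open>Tail bounds in the three ranges of \<open>r\<close>\<close>

context regular_graph
begin

definition eigen :: "('a \<Rightarrow> 'a) \<Rightarrow> complex \<Rightarrow> bool" where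
  "eigen \<sigma> \<mu> \<longleftrightarrow> (\<exists>u. (\<forall>a\<in>V. (\<Sum>b\<in>V. of_real (qc (\<sigma> a) b) * u b) = \<mu> * u a) \<and> (\<exists>a\<in>V. u a \<noteq> 0))"

lemma finite_permuting: "finite {\<sigma>. \<sigma> permutes V \<and> R \<sigma>}"
  by (rule finite_subset[OF _ finite_permutations[OF finV]]) auto

text \<open>A union bound over the failure of either hypothesis of \<open>eigenvalue_bound\<close>,
  each estimated by Markov's inequality.\<close>

lemma tail_tame:
  assumes "\<tau> > 0" "z > 0"
  shows "card {\<sigma>. \<sigma> permutes V \<and> (\<exists>\<mu>. eigen \<sigma> \<mu> \<and> \<tau> + z \<le> cmod \<mu> ^ l)} / fact n \<le>
    avg (closed_sum (tame l) (2 ^ j) l) / \<tau> ^ (2 * 2 ^ j) + avg (wild_sum l) / z"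
proof -
  let ?A = "{\<sigma>. \<sigma> permutes V \<and> (\<exists>\<mu>. eigen \<sigma> \<mu> \<and> \<tau> + z \<le> cmod \<mu> ^ l)}"
  let ?B = "{\<sigma>. \<sigma> permutes V \<and> closed_sum (tame l) (2 ^ j) l \<sigma> \<ge> \<tau> ^ (2 * 2 ^ j)}"
  let ?C = "{\<sigma>. \<sigma> permutes V \<and> wild_sum l \<sigma> \<ge> z}"
  have "?A \<subseteq> ?B \<union> ?C"
  proof
    fix \<sigma> assume s: "\<sigma> \<in> ?A"
    then obtain \<mu> where \<mu>: "eigen \<sigma> \<mu>" "\<tau> + z \<le> cmod \<mu> ^ l" by auto
    show "\<sigma> \<in> ?B \<union> ?C"
    proof (rule ccontr)
      assume "\<sigma> \<notin> ?B \<union> ?C"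
      hence 1: "closed_sum (tame l) (2 ^ j) l \<sigma> < \<tau> ^ (2 * 2 ^ j)" "wild_sum l \<sigma> < z" using s by auto
      obtain u where u: "\<And>a. a \<in> V \<Longrightarrow> (\<Sum>b\<in>V. of_real (qc (\<sigma> a) b) * u b) = \<mu> * u a" "\<exists>a\<in>V. u a \<noteq> 0"
        using \<mu>(1) by (auto simp: eigen_def)
      have "cmod \<mu> ^ l \<le> \<tau> + wild_sum l \<sigma>"
        by (rule eigenvalue_bound[OF u less_imp_le[OF 1(1)] less_imp_le[OF assms(1)] wild_kernel_le])
      thus False using 1 \<mu>(2) by linarith
    qed
  qed
  hence "card ?A \<le> card (?B \<union> ?C)" by (intro card_mono finite_UnI finite_permuting)
  also have "\<dots> \<le> card ?B + card ?C" by (rule card_Un_le)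
  finally have "card ?A / fact n \<le> card ?B / fact n + card ?C / fact n"
    by (simp add: add_divide_distrib[symmetric] divide_right_mono)
  also have "\<dots> \<le> avg (closed_sum (tame l) (2 ^ j) l) / \<tau> ^ (2 * 2 ^ j) + avg (wild_sum l) / z"
    using assms by (intro add_mono markov closed_sum_nonneg) (auto simp: wild_sum_def sum_nonneg)
  finally show ?thesis .
qed

lemma tail_all:
  assumes "\<tau> > 0"
  shows "card {\<sigma>. \<sigma> permutes V \<and> (\<exists>\<mu>. eigen \<sigma> \<mu> \<and> \<tau> \<le> cmod \<mu> ^ l)} / fact n \<le>
    avg (closed_sum (\<lambda>_. True) 1 l) / \<tau>\<^sup>2"
proof -
  let ?A = "{\<sigma>. \<sigma> permutes V \<and> (\<exists>\<mu>. eigen \<sigma> \<mu> \<and> \<tau> \<le> cmod \<mu> ^ l)}"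
  let ?B = "{\<sigma>. \<sigma> permutes V \<and> closed_sum (\<lambda>_. True) 1 l \<sigma> \<ge> \<tau>\<^sup>2}"
  have nn: "0 \<le> closed_sum (\<lambda>_. True) 1 l \<sigma>" for \<sigma> using closed_sum_nonneg[of "\<lambda>_. True" 0 l \<sigma>] by simp
  have "?A \<subseteq> ?B"
  proof
    fix \<sigma> assume s: "\<sigma> \<in> ?A"
    then obtain \<mu> where \<mu>: "eigen \<sigma> \<mu>" "\<tau> \<le> cmod \<mu> ^ l" by auto
    obtain u where u: "\<And>a. a \<in> V \<Longrightarrow> (\<Sum>b\<in>V. of_real (qc (\<sigma> a) b) * u b) = \<mu> * u a" "\<exists>a\<in>V. u a \<noteq> 0"
      using \<mu>(1) by (auto simp: eigen_def)
    \<comment> \<open>Applied with the exact root of the trace and with \<open>z = 0\<close>, as no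
      path is excluded.\<close>
    have "cmod \<mu> ^ l \<le> sqrt (closed_sum (\<lambda>_. True) 1 l \<sigma>) + 0"
      by (rule eigenvalue_bound[OF u, where F = "\<lambda>_. True" and j = 0]) (use nn in \<open>auto simp: path_kernel_def\<close>)
    hence "\<tau> \<le> sqrt (closed_sum (\<lambda>_. True) 1 l \<sigma>)" using \<mu>(2) by linarith
    hence "\<tau>\<^sup>2 \<le> closed_sum (\<lambda>_. True) 1 l \<sigma>"
      using assms nn[of \<sigma>] by (metis less_imp_le power_mono real_sqrt_pow2)
    thus "\<sigma> \<in> ?B" using s by simp
  qed
  hence "card ?A \<le> card ?B" by (intro card_mono finite_permuting)
  hence "card ?A / fact n \<le> card ?B / fact n" by (simp add: divide_right_mono)
  also have "\<dots> \<le> avg (closed_sum (\<lambda>_. True) 1 l) / \<tau>\<^sup>2" using assms by (intro markov nn) auto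
  finally show ?thesis .
qed

lemma exp_ln_n: "real n = exp (ln (real n))" using n_pos by simp
lemma exp_ln_r: "real r = exp (ln (real r))" using r_pos by simp

text \<open>The mean is of order \<open>r^2 / n\<close> up to \<open>8^l\<close> and logarithms. The
  powers of 2 and the division by the \<open>l\<close>-th power of \<open>\<rho>\<close> cost at
  most \<open>n^(4 a)\<close>, the remaining factors another \<open>n^(4 a)\<close>, so
  \<open>8 * a = 1 - c\<close> is what the claim permits.\<close>

lemma avg_wild_small:
  assumes L: "L = ln (real n)" and l: "real (Suc l) \<le> L" "real l * ln (real r) \<le> a * L"
    and r: "r \<ge> 2" "ln (real r) \<le> sqrt L" and a: "a \<le> 1 / 8" "8 * a = 1 - c"
    and E: "2 * L\<^sup>2 \<le> exp L" "exp (sqrt L) * L ^ 4 * 2 * exp (L / 8) * exp (- L) \<le> 1 / 2"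
      "576 * L ^ 14 * exp (2 * sqrt L) \<le> exp (4 * a * L)"
  shows "avg (wild_sum l) / (1 / sqrt r) ^ l \<le> exp (- c * L) / 2"
proof -
  let ?s = "Suc l"
  have L0: "L > 0" using l(1) by linarith
  have rl: "real r ^ l \<le> exp (a * L)" by (rule power_le_exp[of _ "ln (real r)"]) (use l exp_ln_r in auto)
  have "(2 :: real) ^ l \<le> real r ^ l" using r by (intro power_mono) auto
  hence tl: "2 ^ l \<le> exp (a * L)" using rl by linarith
  have rn: "real r / n \<le> exp (sqrt L) * exp (- L)"
  proof -
    have "real r / n = exp (ln (real r)) * exp (- L)"
      using n_pos r_pos by (simp add: L exp_minus field_simps)
    thus ?thesis using r(2) by simp
  qed
  \<comment> \<open>\<open>T\<close> is the term of the least excess \<open>k = 2\<close>, and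
    \<open>x\<close> the ratio per further unit; \<open>i + 4 \<le> 4 * 2^i\<close> for
    \<open>k = i + 2\<close> makes the sum geometric.\<close>
  define x where "x = 2 ^ ?s * real ?s ^ 4 * (real r / n)"
  define T where "T = 9 * 2 ^ ?s * 4 ^ ?s * real ?s ^ 14 * (n * (real r / n)\<^sup>2)"
  have x0: "x \<ge> 0" and T0: "T \<ge> 0" by (auto simp: x_def T_def)
  have "x \<le> (2 * exp (L / 8)) * L ^ 4 * (exp (sqrt L) * exp (- L))"
    unfolding x_def
  proof (intro mult_mono rn power_mono l(1))
    have "exp (a * L) \<le> exp (L / 8)" using a(1) L0 by simp
    thus "2 ^ ?s \<le> 2 * exp (L / 8)" using tl unfolding power_Suc by (intro mult_left_mono) linarith+
  qed auto
  also have "\<dots> = exp (sqrt L) * L ^ 4 * 2 * exp (L / 8) * exp (- L)" by (simp only: mult_ac)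
  finally have x: "x \<le> 1 / 2" using E(2) by linarith
  have "2 * (real ?s)\<^sup>2 \<le> 2 * L\<^sup>2" using l(1) by (intro mult_left_mono power_mono) auto
  also have "\<dots> \<le> n" using E(1) exp_ln_n by (simp add: L)
  finally have "real (2 * ?s\<^sup>2) \<le> real n" by simp
  hence small: "2 * ?s\<^sup>2 \<le> n" by (simp only: of_nat_le_iff)
  have "avg (wild_sum l) \<le> 2 * (\<Sum>k\<in>{2..2*?s}. (9 * 2 ^ ?s * real (k + 2) ^ ?s * real ?s ^ (4 * k + 6)) * (real n * (real r / real n) ^ k))"
    unfolding wild_sum_def[abs_def] by (rule avg_wild_le[OF small])
  also have "(\<Sum>k\<in>{2..2*?s}. (9 * 2 ^ ?s * real (k + 2) ^ ?s * real ?s ^ (4 * k + 6)) * (real n * (real r / real n) ^ k))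
     = (\<Sum>i\<in>{0..2*l}. (9 * 2 ^ ?s * real (i + 2 + 2) ^ ?s * real ?s ^ (4 * (i + 2) + 6)) * (real n * (real r / real n) ^ (i + 2)))"
  proof -
    have "{2..2*?s} = {0 + 2..2 * l + 2}" by simp
    thus ?thesis by (simp only: sum.shift_bounds_cl_nat_ivl)
  qed
  also have "\<dots> \<le> 2 * T"
    unfolding atLeast0AtMost
  proof (rule sum_le_geometric[OF _ x0 x T0])
    fix i
    have i4: "real (i + 2 + 2) \<le> 4 * 2 ^ i"
    proof -
      have "Suc i \<le> 2 ^ i" by (simp add: Suc_le_eq)
      hence "real (Suc i) \<le> 2 ^ i" by (metis of_nat_le_iff of_nat_numeral of_nat_power)
      moreover have "(1 :: real) \<le> 2 ^ i" by simp
      ultimately show ?thesis by simp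
    qed
    have "(9 * 2 ^ ?s * real (i + 2 + 2) ^ ?s * real ?s ^ (4 * (i + 2) + 6)) * (real n * (real r / real n) ^ (i + 2)) \<le>
      (9 * 2 ^ ?s * (4 * 2 ^ i) ^ ?s * real ?s ^ (4 * (i + 2) + 6)) * (real n * (real r / real n) ^ (i + 2))"
      by (intro mult_right_mono mult_left_mono power_mono i4) auto
    also have "\<dots> = T * x ^ i"
    proof -
      have 1: "(4 * 2 ^ i) ^ ?s = 4 ^ ?s * ((2 :: real) ^ ?s) ^ i"
        by (simp only: power_mult_distrib power_mult[symmetric] mult.commute)
      have 2: "real ?s ^ (4 * (i + 2) + 6) = real ?s ^ 14 * (real ?s ^ 4) ^ i"
        by (simp only: power_mult[symmetric] power_add[symmetric]) simp
      have 3: "(real r / real n) ^ (i + 2) = (real r / real n) ^ i * (real r / real n)\<^sup>2" by (simp only: power_add)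
      show ?thesis unfolding 1 2 3 T_def x_def by (simp only: power_mult_distrib mult_ac)
    qed
    finally show "(9 * 2 ^ ?s * real (i + 2 + 2) ^ ?s * real ?s ^ (4 * (i + 2) + 6)) * (real n * (real r / real n) ^ (i + 2)) \<le> T * x ^ i" .
  qed
  finally have avg: "avg (wild_sum l) \<le> 4 * T" by simp
  have "avg (wild_sum l) / (1 / sqrt r) ^ l = avg (wild_sum l) * sqrt r ^ l"
    by (simp add: power_divide)
  also have "\<dots> \<le> (4 * T) * real r ^ l"
  proof (intro mult_mono avg power_mono)
    show "sqrt r \<le> real r" using r by (intro real_le_lsqrt self_le_power) auto
  qed (use T0 in auto)
  \<comment> \<open>\<open>288 = 4 * 9 * 8\<close>, the 8 coming from
    \<open>2 ^ Suc l * 4 ^ Suc l\<close>.\<close>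
  also have "\<dots> = (288 * (2 ^ l) ^ 3 * real ?s ^ 14 * real r ^ 2 * real r ^ l) / n"
  proof -
    have "(4 :: real) ^ l = (2 ^ l)\<^sup>2" by (metis power2_eq_square power_mult_distrib mult_2 numeral_Bit0 four_x_squared mult.right_neutral one_power2)
    thus ?thesis using n_pos by (simp add: T_def power2_eq_square power3_eq_cube field_simps del: of_nat_Suc)
  qed
  also have "\<dots> \<le> (288 * (exp (a * L)) ^ 3 * L ^ 14 * exp (sqrt L) ^ 2 * exp (a * L)) / n"
  proof (intro divide_right_mono mult_mono power_mono tl rl l(1))
    show "real r \<le> exp (sqrt L)" using r exp_ln_r by (metis exp_le_cancel_iff)
  qed (use L0 in auto)
  also have "\<dots> = (576 * L ^ 14 * exp (2 * sqrt L)) * exp (4 * a * L - L) / 2"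
    by (subst exp_ln_n) (simp add: L[symmetric] exp_diff exp_of_nat_mult[symmetric] exp_add[symmetric] mult_ac)
  also have "\<dots> \<le> exp (4 * a * L) * exp (4 * a * L - L) / 2"
    by (intro divide_right_mono mult_right_mono E(3)) auto
  also have "\<dots> = exp (- c * L) / 2"
  proof -
    have c: "c = 1 - 8 * a" using a(2) by simp
    show ?thesis unfolding c by (simp add: exp_add[symmetric] algebra_simps)
  qed
  finally show ?thesis .
qed

text \<open>Exponents of \<open>n\<close>: 32 for the subsets stored per block, 1 for the single
  factor \<open>n\<close>, 4 for \<open>r ^ (2 * m)\<close>, against 40 from the threshold
  \<open>exp (20 * sqrt L)\<close> raised to \<open>2 * m\<close>. The codes
  \<open>N ^ (76 * m)\<close> are only \<open>n^o(1)\<close>.\<close>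

lemma avg_tame_small:
  fixes m :: nat
  assumes L: "L = ln (real n)" and l: "real (Suc l) \<le> L" "l > 0" and r: "r \<ge> 2" "ln (real r) \<le> sqrt L"
    and m: "m > 0" "sqrt L \<le> m" "m \<le> 2 * sqrt L" and c: "c \<le> 1"
    and E: "L \<ge> 16" "2 * L ^ 4 \<le> exp L" "exp (304 * sqrt L * ln L) * exp (8 * sqrt L) * exp (sqrt L) * exp (- L) \<le> 1 / 2"
      "324 * exp (304 * sqrt L * ln L) * exp (- 3 * L) \<le> exp (- L) / 2"
  shows "avg (closed_sum (tame l) m l) / (exp (20 * sqrt L) * (1 / sqrt r) ^ l) ^ (2 * m) \<le> exp (- c * L) / 2"
proof -
  let ?N = "2 * m * Suc l"
  have L0: "L > 0" using E by linarith
  have sL: "sqrt L * sqrt L = L" "sqrt L \<ge> 4"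
    using L0 E(1) real_sqrt_le_mono[of 16 L] by auto
  \<comment> \<open>\<open>4 * L * sqrt L \<le> L^2\<close> amounts to
    \<open>sqrt L \<ge> 4\<close>, which explains \<open>L \<ge> 16\<close>.\<close>
  have N: "real ?N \<le> L\<^sup>2"
  proof -
    have "real ?N = 2 * real m * real (Suc l)" by (simp only: of_nat_mult of_nat_numeral)
    also have "\<dots> \<le> 2 * (2 * sqrt L) * L" using l m by (intro mult_mono) auto
    also have "\<dots> \<le> (sqrt L * sqrt L) * L"
      using mult_right_mono[of 4 "sqrt L" "sqrt L"] sL(2) L0 by (intro mult_right_mono) linarith+
    finally show ?thesis by (simp only: sL power2_eq_square)
  qed
  have "2 * (real ?N)\<^sup>2 \<le> 2 * (L\<^sup>2)\<^sup>2" by (intro mult_left_mono power_mono N) auto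
  also have "\<dots> \<le> n" using E(2) exp_ln_n by (simp add: L)
  finally have "real (2 * ?N\<^sup>2) \<le> real n" by (simp only: of_nat_mult of_nat_power of_nat_numeral)
  hence small: "2 * ?N\<^sup>2 \<le> n" by (simp only: of_nat_le_iff)
  \<comment> \<open>\<open>304 = 76 * 2 * 2\<close>, from \<open>m \<le> 2 * sqrt L\<close> and
    \<open>N \<le> L^2\<close>.\<close>
  have N76: "real ?N ^ (76 * m) \<le> exp (304 * sqrt L * ln L)"
  proof (rule power_le_exp)
    show "real ?N \<le> exp (2 * ln L)"
      using N L0 by (simp add: exp_of_nat_mult[of 2 "ln L", simplified])
    have "ln L \<ge> 0" using E(1) by simp
    have "real (76 * m) * (2 * ln L) = real m * (152 * ln L)" by simp
    also have "\<dots> \<le> (2 * sqrt L) * (152 * ln L)" using m \<open>ln L \<ge> 0\<close> by (intro mult_right_mono) auto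
    finally show "real (76 * m) * (2 * ln L) \<le> 304 * sqrt L * ln L" by simp
  qed simp
  have p4: "(2 :: real) ^ (4 * m) \<le> exp (8 * sqrt L)"
    by (rule power_le_exp[OF _ two_le_exp]) (use m in auto)
  have mm: "real m * real m \<le> 4 * L"
  proof -
    have "real m * real m \<le> (2 * sqrt L) * (2 * sqrt L)" using m L0 by (intro mult_mono) auto
    thus ?thesis using sL by simp
  qed
  have p8: "(2 :: real) ^ (8 * m * m) \<le> exp (32 * L)"
    by (rule power_le_exp[OF _ two_le_exp]) (use mm in auto)
  have rm: "real r ^ (2 * m) \<le> exp (4 * L)"
  proof (rule power_le_exp[of _ "ln (real r)"])
    have "real (2 * m) * ln (real r) \<le> (2 * (2 * sqrt L)) * sqrt L"
      using m r L0 by (intro mult_mono) auto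
    thus "real (2 * m) * ln (real r) \<le> 4 * L" using sL by simp
  qed (use exp_ln_r in auto)
  have rn: "real r / n \<le> exp (sqrt L) * exp (- L)"
  proof -
    have "real r / n = exp (ln (real r)) * exp (- L)"
      using n_pos r_pos by (simp add: L exp_minus field_simps)
    thus ?thesis using r(2) by simp
  qed
  define x where "x = real ?N ^ (76 * m) * 2 ^ (4 * m) * (real r / n)"
  define T where "T = 81 * real ?N ^ (76 * m) * 2 ^ (8 * m * m) * ((real n * real r ^ (2 * m)) / real r ^ (m * l))"
  have x0: "x \<ge> 0" and T0: "T \<ge> 0" by (auto simp: x_def T_def)
  have "x \<le> exp (304 * sqrt L * ln L) * exp (8 * sqrt L) * (exp (sqrt L) * exp (- L))"
    unfolding x_def by (intro mult_mono rn N76 p4) auto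
  hence x: "x \<le> 1 / 2" using E(3) by (simp add: mult_ac)
  have "avg (closed_sum (tame l) m l) \<le> 2 * (\<Sum>k\<le>2*?N. (81 * real ?N ^ (76 * m * (k + 1)) * 2 ^ (4 * m * (k + 2 * m))) *
      ((real n * real r ^ (2 * m) / real r ^ (m * l)) * (real r / real n) ^ k))"
    unfolding closed_sum_def[abs_def] by (rule avg_closed_walks_tame[OF small m(1) l(2)])
  also have "(\<Sum>k\<le>2*?N. (81 * real ?N ^ (76 * m * (k + 1)) * 2 ^ (4 * m * (k + 2 * m))) *
      ((real n * real r ^ (2 * m) / real r ^ (m * l)) * (real r / real n) ^ k)) \<le> 2 * T"
  proof (rule sum_le_geometric[OF _ x0 x T0])
    fix k
    have 1: "real ?N ^ (76 * m * (k + 1)) = real ?N ^ (76 * m) * (real ?N ^ (76 * m)) ^ k"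
      by (simp only: power_mult power_add) simp
    have 2: "(2 :: real) ^ (4 * m * (k + 2 * m)) = 2 ^ (8 * m * m) * (2 ^ (4 * m)) ^ k"
      by (simp only: power_mult[symmetric] power_add[symmetric]) (simp add: algebra_simps)
    show "(81 * real ?N ^ (76 * m * (k + 1)) * 2 ^ (4 * m * (k + 2 * m))) *
      ((real n * real r ^ (2 * m) / real r ^ (m * l)) * (real r / real n) ^ k) \<le> T * x ^ k"
      unfolding 1 2 T_def x_def by (simp only: power_mult_distrib mult_ac order_refl)
  qed
  finally have avg: "avg (closed_sum (tame l) m l) \<le> 4 * T" by simp
  define A where "A = (exp (20 * sqrt L) * (1 / sqrt r) ^ l) ^ (2 * m)"
  have A: "A = exp (40 * real m * sqrt L) / real r ^ (m * l)"
  proof -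
    have "((1 / sqrt r) ^ l) ^ (2 * m) = (((1 / sqrt r)\<^sup>2) ^ (m * l))"
      by (simp only: power_mult[symmetric] mult_ac)
    also have "\<dots> = 1 / real r ^ (m * l)" by (simp add: power_divide)
    finally have 1: "((1 / sqrt r) ^ l) ^ (2 * m) = 1 / real r ^ (m * l)" .
    have "exp (20 * sqrt L) ^ (2 * m) = exp (40 * real m * sqrt L)"
      by (simp add: exp_of_nat_mult[symmetric])
    thus ?thesis unfolding A_def power_mult_distrib 1 by simp
  qed
  have A0: "A > 0" unfolding A using r_pos by simp
  have "avg (closed_sum (tame l) m l) / A \<le> 4 * T / A" using avg A0 by (simp add: divide_right_mono)
  also have "\<dots> = 324 * real ?N ^ (76 * m) * 2 ^ (8 * m * m) * (real n * real r ^ (2 * m)) * exp (- (40 * real m * sqrt L))"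
    using r_pos by (simp add: A T_def exp_minus divide_inverse del: of_nat_mult mult_Suc_right of_nat_Suc)
  also have "\<dots> \<le> 324 * exp (304 * sqrt L * ln L) * exp (32 * L) * (exp L * exp (4 * L)) * exp (- (40 * L))"
  proof (intro mult_mono N76 p8 rm)
    show "real n \<le> exp L" using n_pos by (simp add: L)
    have "sqrt L * sqrt L \<le> real m * sqrt L" using m by (intro mult_right_mono) (use L0 in auto)
    thus "exp (- (40 * real m * sqrt L)) \<le> exp (- (40 * L))" using sL by simp
  qed auto
  also have "\<dots> = 324 * exp (304 * sqrt L * ln L) * exp (- 3 * L)"
  proof -
    have "exp (32 * L) * (exp L * exp (4 * L)) * exp (- (40 * L)) = exp (- 3 * L)"
      by (simp only: exp_add[symmetric]) simp
    thus ?thesis by (simp only: mult.assoc)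
  qed
  also have "\<dots> \<le> exp (- L) / 2" by (rule E(4))
  also have "\<dots> \<le> exp (- c * L) / 2" using c L0 by simp
  finally show ?thesis by (simp only: A_def)
qed

text \<open>
  Here \<open>(1 + \<epsilon>) ^ l\<close> beats \<open>exp (20 * sqrt L) + 1\<close> because, with \<open>t = ln r / sqrt L \<le> 1\<close>, convexity gives
  \<open>exp (b * t) \<le> 1 + t * exp b\<close>, and \<open>\<epsilon> = 2 * C * t\<close>.
\<close>

lemma tail_sparse:
  assumes L: "L = ln (real n)" and r: "r \<ge> 2" "ln (real r) \<le> sqrt L" and c: "c \<le> 1"
    and a: "0 < a" "a \<le> 1 / 8" "8 * a = 1 - c" and C: "2 * C \<ge> exp (42 / a)"
    and E: "L \<ge> 16" "a * sqrt L \<ge> 2" "2 * L\<^sup>2 \<le> exp L" "2 * L ^ 4 \<le> exp L"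
      "exp (sqrt L) * L ^ 4 * 2 * exp (L / 8) * exp (- L) \<le> 1 / 2"
      "576 * L ^ 14 * exp (2 * sqrt L) \<le> exp (4 * a * L)"
      "exp (304 * sqrt L * ln L) * exp (8 * sqrt L) * exp (sqrt L) * exp (- L) \<le> 1 / 2"
      "324 * exp (304 * sqrt L * ln L) * exp (- 3 * L) \<le> exp (- L) / 2"
  shows "card {\<sigma>. \<sigma> permutes V \<and> (\<exists>\<mu>. eigen \<sigma> \<mu> \<and> (1 + 2 * C * ln r / sqrt L) * (1 / sqrt r) \<le> cmod \<mu>)} / fact n
    \<le> exp (- c * L)"
proof -
  have L0: "L > 0" using E by linarith
  have sL: "sqrt L * sqrt L = L" "sqrt L \<ge> 4"
    using L0 E(1) real_sqrt_le_mono[of 16 L] by auto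
  have lr: "ln (real r) \<ge> 1 / 2"
  proof -
    have "ln (real r) \<ge> ln 2" using r by simp
    thus ?thesis using ln2_ge_two_thirds by linarith
  qed
  define t where "t = ln (real r) / sqrt L"
  have t: "0 < t" "t \<le> 1" "ln (real r) = t * sqrt L" using lr r(2) L0 by (auto simp: t_def)
  \<comment> \<open>The largest real length with \<open>r^l \<le> n^a\<close>. It equals
    \<open>a * sqrt L / t\<close>, so that \<open>l\<close> steps with an exponent proportional to
    \<open>t\<close> add up to a multiple of \<open>sqrt L\<close>.\<close>
  define y where "y = a * L / ln (real r)"
  have yt: "y * t = a * sqrt L"
  proof -
    have "y * t = a * (L / sqrt L)" using lr by (simp add: y_def t_def)
    thus ?thesis using L0 by (simp add: real_div_sqrt)
  qed
  have y: "y \<ge> 2"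
  proof -
    have "y * t \<le> y * 1" using t a L0 lr by (intro mult_left_mono) (auto simp: y_def)
    thus ?thesis using yt E(2) by linarith
  qed
  define l where "l = nat \<lfloor>y\<rfloor>"
  have ly: "real l \<le> y" "y < real l + 1" using y unfolding l_def by linarith+
  have l0: "l > 0" using y ly by linarith
  have lrl: "real l * ln (real r) \<le> a * L"
  proof -
    have "real l * ln (real r) \<le> y * ln (real r)" using ly lr by (intro mult_right_mono) auto
    thus ?thesis using lr by (simp add: y_def)
  qed
  have lL: "real (Suc l) \<le> L"
  proof -
    have "real l * (1 / 2) \<le> real l * ln (real r)" using lr by (intro mult_left_mono) auto
    also have "\<dots> \<le> 1 / 8 * L" using lrl a(2) L0 by (meson less_imp_le mult_right_mono order_trans)
    finally show ?thesis using E(1) by simp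
  qed
  obtain j where j: "sqrt L \<le> 2 ^ j" "2 ^ j \<le> 2 * sqrt L" 
    using power_two_between[OF order_trans[OF _ sL(2)]] by auto
  define \<rho> where "\<rho> = 1 / sqrt r"
  have \<rho>: "\<rho> > 0" using r_pos by (simp add: \<rho>_def)
  define \<epsilon> where "\<epsilon> = 2 * C * ln r / sqrt L"
  \<comment> \<open>\<open>l \<ge> y / 2\<close> turns \<open>42 / a\<close> into 21. The surplus of
    21 over 20 makes room for the summand 1, the share of the wild paths.\<close>
  have big: "exp (20 * sqrt L) + 1 \<le> (1 + \<epsilon>) ^ l"
  proof -
    have "exp (42 / a * t) \<le> 1 + t * exp (42 / a)" using t by (intro exp_le_linear) auto
    also have "\<dots> \<le> 1 + t * (2 * C)" using C t by (intro add_left_mono mult_left_mono) auto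
    also have "\<dots> = 1 + \<epsilon>" by (simp add: \<epsilon>_def t_def)
    finally have "exp (42 / a * t) ^ l \<le> (1 + \<epsilon>) ^ l" by (intro power_mono) auto
    moreover have "exp (21 * sqrt L) \<le> exp (42 / a * t) ^ l"
    proof -
      have "21 * sqrt L = 21 / a * (y * t)" using a by (simp add: yt)
      also have "\<dots> \<le> 21 / a * ((2 * real l) * t)" using t a y ly by (intro mult_left_mono mult_right_mono) auto
      also have "\<dots> = real l * (42 / a * t)" by simp
      finally show ?thesis by (simp add: exp_of_nat_mult[symmetric])
    qed
    moreover have "exp (20 * sqrt L) + 1 \<le> exp (21 * sqrt L)"
    proof -
      have "exp (21 * sqrt L) = exp (20 * sqrt L) * exp (sqrt L)" by (simp add: exp_add[symmetric])
      moreover have "exp (sqrt L) \<ge> 2" using exp_ge_add_one_self[of "sqrt L"] sL by linarith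
      moreover have "exp (20 * sqrt L) \<ge> 1" using sL by simp
      moreover have "exp (20 * sqrt L) * 2 \<le> exp (20 * sqrt L) * exp (sqrt L)"
        using calculation by (intro mult_left_mono) auto
      ultimately show ?thesis by linarith
    qed
    ultimately show ?thesis by linarith
  qed
  have "{\<sigma>. \<sigma> permutes V \<and> (\<exists>\<mu>. eigen \<sigma> \<mu> \<and> (1 + \<epsilon>) * \<rho> \<le> cmod \<mu>)} \<subseteq>
     {\<sigma>. \<sigma> permutes V \<and> (\<exists>\<mu>. eigen \<sigma> \<mu> \<and> exp (20 * sqrt L) * \<rho> ^ l + \<rho> ^ l \<le> cmod \<mu> ^ l)}"
  proof (clarify, intro conjI exI)
    fix \<sigma> \<mu> assume "(1 + \<epsilon>) * \<rho> \<le> cmod \<mu>"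
    have e0: "\<epsilon> \<ge> 0"
    proof -
      have "C \<ge> 0" using C exp_ge_zero[of "42 / a"] by linarith
      thus ?thesis using lr L0 by (simp add: \<epsilon>_def)
    qed
    have "exp (20 * sqrt L) * \<rho> ^ l + \<rho> ^ l = (exp (20 * sqrt L) + 1) * \<rho> ^ l" by (simp add: distrib_right)
    also have "\<dots> \<le> (1 + \<epsilon>) ^ l * \<rho> ^ l" using big \<rho> by (intro mult_right_mono) auto
    also have "\<dots> = ((1 + \<epsilon>) * \<rho>) ^ l" by (simp add: power_mult_distrib)
    also have "\<dots> \<le> cmod \<mu> ^ l"
      using \<open>(1 + \<epsilon>) * \<rho> \<le> cmod \<mu>\<close> e0 \<rho> by (intro power_mono) auto
    finally show "exp (20 * sqrt L) * \<rho> ^ l + \<rho> ^ l \<le> cmod \<mu> ^ l" .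
  qed
  hence "card {\<sigma>. \<sigma> permutes V \<and> (\<exists>\<mu>. eigen \<sigma> \<mu> \<and> (1 + \<epsilon>) * \<rho> \<le> cmod \<mu>)} \<le>
     card {\<sigma>. \<sigma> permutes V \<and> (\<exists>\<mu>. eigen \<sigma> \<mu> \<and> exp (20 * sqrt L) * \<rho> ^ l + \<rho> ^ l \<le> cmod \<mu> ^ l)}"
    by (intro card_mono finite_permuting)
  hence "card {\<sigma>. \<sigma> permutes V \<and> (\<exists>\<mu>. eigen \<sigma> \<mu> \<and> (1 + \<epsilon>) * \<rho> \<le> cmod \<mu>)} / fact n \<le>
     card {\<sigma>. \<sigma> permutes V \<and> (\<exists>\<mu>. eigen \<sigma> \<mu> \<and> exp (20 * sqrt L) * \<rho> ^ l + \<rho> ^ l \<le> cmod \<mu> ^ l)} / fact n"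
    by (simp add: divide_right_mono)
  also have "\<dots> \<le> avg (closed_sum (tame l) (2 ^ j) l) / (exp (20 * sqrt L) * \<rho> ^ l) ^ (2 * 2 ^ j) + avg (wild_sum l) / \<rho> ^ l"
    by (rule tail_tame) (use \<rho> in auto)
  also have "\<dots> \<le> exp (- c * L) / 2 + exp (- c * L) / 2"
    unfolding \<rho>_def
  proof (rule add_mono)
    show "avg (closed_sum (tame l) (2 ^ j) l) / (exp (20 * sqrt L) * (1 / sqrt r) ^ l) ^ (2 * 2 ^ j) \<le> exp (- c * L) / 2"
      by (rule avg_tame_small[OF L lL l0 r _ _ _ c E(1,4,7,8)]) (use j in auto)
    show "avg (wild_sum l) / (1 / sqrt r) ^ l \<le> exp (- c * L) / 2"
      by (rule avg_wild_small[OF L lL lrl r a(2,3) E(3,5,6)])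
  qed
  finally show ?thesis by (simp add: \<epsilon>_def \<rho>_def)
qed

lemma tail_power:
  assumes "\<delta> > 0"
  shows "card {\<sigma>. \<sigma> permutes V \<and> (\<exists>\<mu>. eigen \<sigma> \<mu> \<and> \<delta> * (1 / sqrt r) \<le> cmod \<mu>)} / fact n
    \<le> avg (closed_sum (\<lambda>_. True) 1 l) * real r ^ l / (\<delta>\<^sup>2) ^ l"
proof -
  define \<rho> where "\<rho> = 1 / sqrt r"
  have \<rho>: "\<rho> > 0" using r_pos by (simp add: \<rho>_def)
  have "{\<sigma>. \<sigma> permutes V \<and> (\<exists>\<mu>. eigen \<sigma> \<mu> \<and> \<delta> * \<rho> \<le> cmod \<mu>)} \<subseteq>
     {\<sigma>. \<sigma> permutes V \<and> (\<exists>\<mu>. eigen \<sigma> \<mu> \<and> (\<delta> * \<rho>) ^ l \<le> cmod \<mu> ^ l)}"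
  proof (clarify, intro conjI exI)
    fix \<mu> assume "\<delta> * \<rho> \<le> cmod \<mu>"
    thus "(\<delta> * \<rho>) ^ l \<le> cmod \<mu> ^ l" using assms \<rho> by (intro power_mono) auto
  qed
  hence "card {\<sigma>. \<sigma> permutes V \<and> (\<exists>\<mu>. eigen \<sigma> \<mu> \<and> \<delta> * \<rho> \<le> cmod \<mu>)} \<le>
     card {\<sigma>. \<sigma> permutes V \<and> (\<exists>\<mu>. eigen \<sigma> \<mu> \<and> (\<delta> * \<rho>) ^ l \<le> cmod \<mu> ^ l)}"
    by (intro card_mono finite_permuting)
  hence "card {\<sigma>. \<sigma> permutes V \<and> (\<exists>\<mu>. eigen \<sigma> \<mu> \<and> \<delta> * \<rho> \<le> cmod \<mu>)} / fact n \<le>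
     card {\<sigma>. \<sigma> permutes V \<and> (\<exists>\<mu>. eigen \<sigma> \<mu> \<and> (\<delta> * \<rho>) ^ l \<le> cmod \<mu> ^ l)} / fact n"
    by (simp add: divide_right_mono)
  also have "\<dots> \<le> avg (closed_sum (\<lambda>_. True) 1 l) / ((\<delta> * \<rho>) ^ l)\<^sup>2"
    by (rule tail_all) (use \<rho> assms in auto)
  also have "((\<delta> * \<rho>) ^ l)\<^sup>2 = (\<delta>\<^sup>2) ^ l / real r ^ l"
  proof -
    have "((\<delta> * \<rho>) ^ l)\<^sup>2 = ((\<delta> * \<rho>)\<^sup>2) ^ l" by (simp only: power_mult[symmetric] mult.commute)
    also have "(\<delta> * \<rho>)\<^sup>2 = \<delta>\<^sup>2 / real r" by (simp add: \<rho>_def power_mult_distrib power_divide)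
    finally show ?thesis by (simp only: power_divide)
  qed
  finally show ?thesis by (simp add: \<rho>_def)
qed

text \<open>Here \<open>1 + \<epsilon>\<close> is at least \<open>20 * exp 2\<close>, and the square
  of its \<open>l\<close>-th power at least \<open>400 ^ l * exp (4 * L)\<close>. The first factor
  absorbs \<open>2^N * 10^N\<close> from the code, up to a constant; the second beats
  \<open>n * r^2 \<le> n^2\<close> and the powers of \<open>L\<close>.\<close>

lemma tail_medium:
  assumes L: "L = ln (real n)" and r: "sqrt L \<le> ln (real r)" "(real r)\<^sup>2 \<le> real n" and c: "c \<le> 1"
    and C: "2 * C \<ge> 20 * exp 2"
    and E: "L \<ge> 16" "2 * (4 * L)\<^sup>2 \<le> exp L" "(4 * L) ^ 4 * exp ((L + 2) / 5) * exp (- L / 2) \<le> 1 / 2"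
      "14400 * (4 * L) ^ 12 \<le> exp L"
  shows "card {\<sigma>. \<sigma> permutes V \<and> (\<exists>\<mu>. eigen \<sigma> \<mu> \<and> (1 + 2 * C * ln r / sqrt L) * (1 / sqrt r) \<le> cmod \<mu>)} / fact n
    \<le> exp (- c * L)"
proof -
  have L0: "L > 0" using E by linarith
  define \<delta> where "\<delta> = 1 + 2 * C * ln r / sqrt L"
  define l where "l = nat \<lceil>L\<rceil>"
  have l: "L \<le> real l" "real l \<le> L + 1" using L0 unfolding l_def by linarith+
  let ?s = "2 * Suc l"
  have s: "real ?s \<le> 4 * L" using l E(1) by simp
  have \<delta>: "\<delta> \<ge> 20 * exp 2"
  proof -
    have C0: "C \<ge> 0" using C exp_ge_zero[of 2] by linarith
    have "1 \<le> ln r / sqrt L" using r(1) L0 by simp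
    hence "20 * exp 2 * 1 \<le> (2 * C) * (ln r / sqrt L)" using C C0 by (intro mult_mono[OF C]) auto
    thus ?thesis by (simp add: \<delta>_def)
  qed
  have "2 * (real ?s)\<^sup>2 \<le> 2 * (4 * L)\<^sup>2" by (intro mult_left_mono power_mono s) auto
  also have "\<dots> \<le> n" using E(2) exp_ln_n by (simp add: L)
  finally have "real (2 * ?s\<^sup>2) \<le> real n" by (simp only: of_nat_mult of_nat_power of_nat_numeral)
  hence small: "2 * ?s\<^sup>2 \<le> n" by (simp only: of_nat_le_iff)
  have lnr: "2 * ln (real r) \<le> L"
  proof -
    have "ln ((real r)\<^sup>2) \<le> ln (real n)" using r(2) r_pos by (subst ln_le_cancel_iff) (use n_pos in auto)
    thus ?thesis using r_pos by (simp add: L ln_realpow)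
  qed
  have rn: "real r / n \<le> exp (- L / 2)"
  proof -
    have "real r / n = exp (ln (real r) - L)"
      using n_pos r_pos by (simp add: L exp_diff)
    thus ?thesis using lnr by simp
  qed
  \<comment> \<open>\<open>k + 3 \<le> 10 * exp (k / 10)\<close> makes the ranks geometric in the
    excess. Their ratio is about \<open>n^(1/5)\<close> and stays below the gain
    \<open>n^(1/2)\<close> from \<open>r^2 \<le> n\<close>.\<close>
  define x where "x = real ?s ^ 4 * exp (Suc l / 5) * (real r / n)"
  define T where "T = 9 * 2 ^ ?s * 10 ^ ?s * real ?s ^ 12 * ((real n * (real r)\<^sup>2) / real r ^ l)"
  have x0: "x \<ge> 0" and T0: "T \<ge> 0" by (auto simp: x_def T_def)
  have "x \<le> (4 * L) ^ 4 * exp ((L + 2) / 5) * exp (- L / 2)"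
    unfolding x_def using l by (intro mult_mono rn power_mono s) auto
  hence x: "x \<le> 1 / 2" using E(3) by linarith
  have "avg (closed_sum (\<lambda>_. True) 1 l) \<le> 2 * (\<Sum>k\<le>2*?s. (9 * 2 ^ ?s * real (k + 3) ^ ?s * real ?s ^ (4 * k + 12)) *
      ((real n * (real r)\<^sup>2 / real r ^ l) * (real r / real n) ^ k))"
    using avg_closed_walks_two[OF small, of "\<lambda>_. True"] unfolding closed_sum_def[abs_def] mult_1_right .
  also have "(\<Sum>k\<le>2*?s. (9 * 2 ^ ?s * real (k + 3) ^ ?s * real ?s ^ (4 * k + 12)) *
      ((real n * (real r)\<^sup>2 / real r ^ l) * (real r / real n) ^ k)) \<le> 2 * T"
  proof (rule sum_le_geometric[OF _ x0 x T0])
    fix k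
    have k3: "real (k + 3) \<le> 10 * exp (k / 10)"
      using exp_ge_add_one_self[of "k / 10"] unfolding of_nat_add of_nat_numeral by linarith
    have "(9 * 2 ^ ?s * real (k + 3) ^ ?s * real ?s ^ (4 * k + 12)) * ((real n * (real r)\<^sup>2 / real r ^ l) * (real r / real n) ^ k) \<le>
      (9 * 2 ^ ?s * (10 * exp (k / 10)) ^ ?s * real ?s ^ (4 * k + 12)) * ((real n * (real r)\<^sup>2 / real r ^ l) * (real r / real n) ^ k)"
      by (intro mult_right_mono mult_left_mono power_mono k3) auto
    also have "\<dots> = T * x ^ k"
    proof -
      have 1: "(10 * exp (k / 10)) ^ ?s = 10 ^ ?s * exp (Suc l / 5) ^ k"
        by (simp add: power_mult_distrib exp_of_nat_mult[symmetric] field_simps del: power_Suc mult_Suc_right)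
      have 2: "real ?s ^ (4 * k + 12) = real ?s ^ 12 * (real ?s ^ 4) ^ k"
        by (simp only: power_mult[symmetric] power_add[symmetric] add.commute)
      show ?thesis unfolding 1 2 T_def x_def by (simp only: power_mult_distrib mult_ac)
    qed
    finally show "(9 * 2 ^ ?s * real (k + 3) ^ ?s * real ?s ^ (4 * k + 12)) * ((real n * (real r)\<^sup>2 / real r ^ l) * (real r / real n) ^ k) \<le> T * x ^ k" .
  qed
  finally have avg: "avg (closed_sum (\<lambda>_. True) 1 l) \<le> 4 * T" by simp
  have "card {\<sigma>. \<sigma> permutes V \<and> (\<exists>\<mu>. eigen \<sigma> \<mu> \<and> \<delta> * (1 / sqrt r) \<le> cmod \<mu>)} / fact n
    \<le> avg (closed_sum (\<lambda>_. True) 1 l) * real r ^ l / (\<delta>\<^sup>2) ^ l"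
    by (rule tail_power) (use \<delta> exp_gt_zero[of 2] in \<open>auto intro: less_le_trans[rotated]\<close>)
  also have "\<dots> \<le> (4 * T) * real r ^ l / (400 ^ l * exp (4 * L))"
  proof (intro frac_le mult_right_mono avg)
    have "(20 * exp 2)\<^sup>2 \<le> \<delta>\<^sup>2" using \<delta> by (intro power_mono) auto
    hence "(400 * exp 4) ^ l \<le> (\<delta>\<^sup>2) ^ l"
      by (intro power_mono) (auto simp: power_mult_distrib exp_of_nat_mult[symmetric, of 2 2, simplified] power2_eq_square exp_add[symmetric])
    moreover have "exp (4 * L) \<le> exp 4 ^ l" using l(1) by (simp add: exp_of_nat_mult[symmetric])
    ultimately show "400 ^ l * exp (4 * L) \<le> (\<delta>\<^sup>2) ^ l"
      unfolding power_mult_distrib by (meson mult_left_mono order_trans zero_le_numeral zero_le_power)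
  qed (use T0 in auto)
  also have "\<dots> = 14400 * real ?s ^ 12 * (real n * (real r)\<^sup>2) / exp (4 * L)"
  proof -
    have "(2 :: real) ^ ?s * 10 ^ ?s = 400 * 400 ^ l"
      by (simp add: power_mult power_mult_distrib[symmetric] power_add)
    hence "T = 9 * (400 * 400 ^ l) * real ?s ^ 12 * ((real n * (real r)\<^sup>2) / real r ^ l)"
      by (simp only: T_def mult.assoc)
    thus ?thesis using r_pos by (simp add: field_simps del: of_nat_Suc of_nat_mult mult_Suc_right)
  qed
  also have "\<dots> \<le> 14400 * (4 * L) ^ 12 * (exp L * exp L) / exp (4 * L)"
  proof (intro divide_right_mono mult_mono power_mono s)
    show "real n \<le> exp L" using n_pos by (simp add: L)
    thus "(real r)\<^sup>2 \<le> exp L" using r by linarith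
  qed (use L0 in auto)
  also have "\<dots> \<le> exp L * (exp L * exp L) / exp (4 * L)"
    by (intro divide_right_mono mult_right_mono E(4)) auto
  also have "\<dots> = exp (- L)" by (simp add: exp_add[symmetric] exp_diff[symmetric])
  also have "\<dots> \<le> exp (- c * L)" using c L0 by simp
  finally show ?thesis by (simp add: \<delta>_def)
qed

text \<open>Now \<open>ln r \<ge> L / 2\<close>, so \<open>1 + \<epsilon>\<close> is at least
  \<open>C * sqrt L\<close>. Its square supplies per step \<open>4 * L \<ge> N\<close> for a
  pointer, 64 for the constant \<open>8^N\<close>, and \<open>exp 6\<close>, which beats
  \<open>n * r^2 \<le> n^3\<close> and the powers of \<open>L\<close>.\<close>

lemma tail_dense:
  assumes L: "L = ln (real n)" and r: "real n \<le> (real r)\<^sup>2" and c: "c \<le> 1"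
    and C: "C \<ge> 16 * exp 3"
    and E: "L \<ge> 16" "2 * (4 * L)\<^sup>2 \<le> exp L" "4 * L \<le> exp (L / 2)" "128 * (4 * L)\<^sup>2 \<le> exp (2 * L)"
  shows "card {\<sigma>. \<sigma> permutes V \<and> (\<exists>\<mu>. eigen \<sigma> \<mu> \<and> (1 + 2 * C * ln r / sqrt L) * (1 / sqrt r) \<le> cmod \<mu>)} / fact n
    \<le> exp (- c * L)"
proof -
  have L0: "L > 0" using E by linarith
  define \<delta> where "\<delta> = 1 + 2 * C * ln r / sqrt L"
  define l where "l = nat \<lceil>L\<rceil>"
  have l: "L \<le> real l" "real l \<le> L + 1" using L0 unfolding l_def by linarith+
  let ?s = "2 * Suc l"
  have s: "real ?s \<le> 4 * L" using l E(1) by simp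
  have lnr: "L \<le> 2 * ln (real r)"
  proof -
    have "ln (real n) \<le> ln ((real r)\<^sup>2)" using r r_pos by (subst ln_le_cancel_iff) (use n_pos in auto)
    thus ?thesis using r_pos by (simp add: L ln_realpow)
  qed
  have C0: "C > 0" using C exp_gt_zero[of 3] by linarith
  have \<delta>: "\<delta> \<ge> C * sqrt L"
  proof -
    have "sqrt L = L / sqrt L" using L0 by (simp add: real_div_sqrt)
    also have "\<dots> \<le> 2 * ln r / sqrt L" using lnr L0 by (intro divide_right_mono) auto
    finally have "C * sqrt L \<le> C * (2 * ln r / sqrt L)" using C0 by (intro mult_left_mono) auto
    hence "C * sqrt L \<le> 2 * C * ln r / sqrt L" by (simp add: mult_ac)
    thus ?thesis unfolding \<delta>_def by linarith
  qed
  have \<delta>0: "\<delta> > 0" using \<delta> C0 L0 by (meson less_le_trans mult_pos_pos real_sqrt_gt_zero)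
  have "2 * (real ?s)\<^sup>2 \<le> 2 * (4 * L)\<^sup>2" by (intro mult_left_mono power_mono s) auto
  also have "\<dots> \<le> n" using E(2) exp_ln_n by (simp add: L)
  finally have "real (2 * ?s\<^sup>2) \<le> real n" by (simp only: of_nat_mult of_nat_power of_nat_numeral)
  hence small: "2 * ?s\<^sup>2 \<le> n" by (simp only: of_nat_le_iff)
  have "real ?s \<le> exp (L / 2)" using s E(3) by linarith
  also have "\<dots> \<le> exp (ln (real r))" using lnr by simp
  also have "\<dots> = real r" using r_pos by simp
  finally have sr: "?s \<le> r" by (simp only: of_nat_le_iff)
  have avg: "avg (closed_sum (\<lambda>_. True) 1 l) \<le> 2 * (real n * (real r)\<^sup>2 * (real ?s / real r) ^ l * (real ?s)\<^sup>2 * 8 ^ ?s)"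
    using avg_closed_walks_dense[OF small sr, of "\<lambda>_. True"] unfolding closed_sum_def[abs_def] mult_1_right .
  have "card {\<sigma>. \<sigma> permutes V \<and> (\<exists>\<mu>. eigen \<sigma> \<mu> \<and> \<delta> * (1 / sqrt r) \<le> cmod \<mu>)} / fact n
    \<le> avg (closed_sum (\<lambda>_. True) 1 l) * real r ^ l / (\<delta>\<^sup>2) ^ l"
    by (rule tail_power) (use \<delta>0 in auto)
  also have "\<dots> \<le> (2 * (real n * (real r)\<^sup>2 * (real ?s / real r) ^ l * (real ?s)\<^sup>2 * 8 ^ ?s)) * real r ^ l / (256 ^ l * exp (6 * L) * L ^ l)"
  proof (intro frac_le mult_right_mono avg)
    have "(16 * exp 3 * sqrt L)\<^sup>2 \<le> \<delta>\<^sup>2"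
    proof (intro power_mono)
      have "16 * exp 3 * sqrt L \<le> C * sqrt L" using C L0 by (intro mult_right_mono) auto
      thus "16 * exp 3 * sqrt L \<le> \<delta>" using \<delta> by linarith
    qed (use L0 in auto)
    moreover have "(exp 3)\<^sup>2 = exp (6 :: real)" by (simp add: power2_eq_square exp_add[symmetric])
    ultimately have "256 * exp 6 * L \<le> \<delta>\<^sup>2"
      using L0 by (simp add: power_mult_distrib)
    hence "(256 * exp 6 * L) ^ l \<le> (\<delta>\<^sup>2) ^ l" using L0 by (intro power_mono) auto
    moreover have "256 ^ l * exp (6 * L) * L ^ l \<le> 256 ^ l * exp 6 ^ l * L ^ l"
      using l(1) L0 by (intro mult_right_mono mult_left_mono) (auto simp: exp_of_nat_mult[symmetric])
    ultimately show "256 ^ l * exp (6 * L) * L ^ l \<le> (\<delta>\<^sup>2) ^ l"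
      unfolding power_mult_distrib by linarith
  qed (use L0 in auto)
  also have "\<dots> = 128 * (real n * (real r)\<^sup>2 * (real ?s)\<^sup>2) * (real ?s) ^ l / (4 ^ l * L ^ l * exp (6 * L))"
  proof -
    have "(8 :: real) ^ ?s = 64 * 64 ^ l" by (simp add: power_mult power_add)
    moreover have "(256 :: real) ^ l = 64 ^ l * 4 ^ l" by (simp add: power_mult_distrib[symmetric])
    ultimately show ?thesis using r_pos L0
      by (simp add: power_divide field_simps del: of_nat_Suc of_nat_mult mult_Suc_right)
  qed
  also have "\<dots> \<le> 128 * (exp L * (exp L * exp L) * (4 * L)\<^sup>2) * (4 * L) ^ l / (4 ^ l * L ^ l * exp (6 * L))"
  proof (intro divide_right_mono mult_mono power_mono s)
    show n: "real n \<le> exp L" using n_pos by (simp add: L)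
    have "(real r)\<^sup>2 \<le> (real n)\<^sup>2" using r_le_n by (intro power_mono) auto
    also have "\<dots> \<le> (exp L)\<^sup>2" using n by (intro power_mono) auto
    finally show "(real r)\<^sup>2 \<le> exp L * exp L" by (simp add: power2_eq_square)
  qed (use L0 in auto)
  also have "\<dots> = (128 * (4 * L)\<^sup>2) * (exp L * (exp L * exp L)) / exp (6 * L)"
    using L0 by (simp add: power_mult_distrib)
  also have "\<dots> \<le> exp (2 * L) * (exp L * (exp L * exp L)) / exp (6 * L)"
    by (intro divide_right_mono mult_right_mono E(4)) auto
  also have "\<dots> = exp (- L)" by (simp add: exp_add[symmetric] exp_diff[symmetric])
  also have "\<dots> \<le> exp (- c * L)" using c L0 by simp
  finally show ?thesis by (simp add: \<delta>_def)
qed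

text \<open>All asymptotic inequalities of the three ranges in one predicate. It does not mention
  \<open>r\<close>, so the threshold for \<open>n\<close> is uniform in \<open>r\<close>.\<close>

definition (in -) large_log :: "real \<Rightarrow> real \<Rightarrow> bool" where
  "large_log a L \<longleftrightarrow> L \<ge> 16 \<and> a * sqrt L \<ge> 2 \<and> 2 * L\<^sup>2 \<le> exp L \<and> 2 * L ^ 4 \<le> exp L \<and>
    exp (sqrt L) * L ^ 4 * 2 * exp (L / 8) * exp (- L) \<le> 1 / 2 \<and>
    576 * L ^ 14 * exp (2 * sqrt L) \<le> exp (4 * a * L) \<and>
    exp (304 * sqrt L * ln L) * exp (8 * sqrt L) * exp (sqrt L) * exp (- L) \<le> 1 / 2 \<and>
    324 * exp (304 * sqrt L * ln L) * exp (- 3 * L) \<le> exp (- L) / 2 \<and>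
    2 * (4 * L)\<^sup>2 \<le> exp L \<and> (4 * L) ^ 4 * exp ((L + 2) / 5) * exp (- L / 2) \<le> 1 / 2 \<and>
    14400 * (4 * L) ^ 12 \<le> exp L \<and> 4 * L \<le> exp (L / 2) \<and> 128 * (4 * L)\<^sup>2 \<le> exp (2 * L)"

lemma (in -) eventually_large_log:
  assumes "a > 0"
  shows "eventually (large_log a) at_top"
  unfolding large_log_def[abs_def] using assms
  by (intro eventually_conj; real_asymp)

lemma tail_large:
  assumes L: "L = ln (real n)" and r: "r \<ge> 2" and c: "c \<le> 1" and a: "0 < a" "a \<le> 1 / 8" "8 * a = 1 - c"
    and C: "C \<ge> exp (42 / a)" and E: "large_log a L"
  shows "card {\<sigma>. \<sigma> permutes V \<and> (\<exists>\<mu>. eigen \<sigma> \<mu> \<and> (1 + 2 * C * ln r / sqrt L) * (1 / sqrt r) \<le> cmod \<mu>)} / fact n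
    \<le> exp (- c * L)"
proof -
  \<comment> \<open>\<open>a \<le> 1 / 8\<close> gives \<open>42 / a \<ge> 336\<close>, ample for
    the constants of the other two ranges.\<close>
  have "exp 3 * exp (16 :: real) \<le> C"
  proof -
    have "42 / a \<ge> 42 / (1 / 8)" using a by (intro divide_left_mono) auto
    hence "3 + 16 \<le> 42 / a" by simp
    hence "exp (3 + 16) \<le> exp (42 / a)" by (simp only: exp_le_cancel_iff)
    thus ?thesis using C by (simp only: exp_add)
  qed
  moreover have "exp 3 * 16 \<le> exp 3 * exp (16 :: real)"
    using exp_ge_add_one_self[of 16] by (intro mult_left_mono) auto
  ultimately have C3: "C \<ge> 16 * exp 3" by linarith
  have C2: "2 * C \<ge> 20 * exp 2"
  proof -
    have "exp 2 \<le> exp (3 :: real)" by simp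
    thus ?thesis using C3 exp_gt_zero[of "2 :: real"] by linarith
  qed
  have C1: "2 * C \<ge> exp (42 / a)" using C exp_gt_zero[of "42 / a"] by linarith
  consider "ln (real r) \<le> sqrt L" | "sqrt L \<le> ln (real r)" "(real r)\<^sup>2 \<le> real n" | "real n \<le> (real r)\<^sup>2"
    by linarith
  thus ?thesis
  proof cases
    case 1
    show ?thesis by (rule tail_sparse[OF L r 1 c a C1]) (use E in \<open>auto simp: large_log_def\<close>)
  next
    case 2
    show ?thesis by (rule tail_medium[OF L 2 c C2]) (use E in \<open>auto simp: large_log_def\<close>)
  next
    case 3
    show ?thesis by (rule tail_dense[OF L 3 c C3]) (use E in \<open>auto simp: large_log_def\<close>)
  qed
qed

end

text \<open>For bounded \<open>n\<close> a large constant puts the threshold above 1, the largest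
  possible modulus: \<open>sqrt r * sqrt (ln n) \<le> M^2 < C\<close>, and
  \<open>2 * ln r \<ge> 1\<close>.\<close>

lemma threshold_gt_1_small:
  fixes n r :: nat
  assumes "2 \<le> r" "r \<le> n" "real n \<le> M" "C > M\<^sup>2"
  shows "(1 + 2 * C * ln r / sqrt (ln n)) * (1 / sqrt r) > 1"
proof -
  have M: "M \<ge> 2" using assms by linarith
  have s: "0 < sqrt (ln n)" "sqrt (ln n) \<le> M"
  proof -
    show "0 < sqrt (ln n)" using assms by simp
    have "ln n \<le> real n" using assms by (intro ln_bound) auto
    also have "\<dots> \<le> M" by fact
    also have "\<dots> \<le> M\<^sup>2" using M by (intro self_le_power) auto
    finally show "sqrt (ln n) \<le> M" using M by (intro real_le_lsqrt) auto
  qed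
  have "1 \<le> 2 * ln (real r)"
  proof -
    have "ln 2 \<le> ln (real r)" using assms by simp
    thus ?thesis using ln2_ge_two_thirds by linarith
  qed
  hence C: "C \<le> C * (2 * ln (real r))" using assms M mult_left_mono[of 1 "2 * ln (real r)" C]
    by (smt (verit) mult.right_neutral zero_le_power2)
  have "sqrt r \<le> M"
  proof -
    have "real r \<le> M" using assms by linarith
    also have "\<dots> \<le> M\<^sup>2" using M by (intro self_le_power) auto
    finally show ?thesis using M by (intro real_le_lsqrt) auto
  qed
  hence "sqrt r * sqrt (ln n) \<le> M * M" using s M by (intro mult_mono) auto
  also have "\<dots> \<le> 2 * C * ln r" using C assms(4) by (simp add: power2_eq_square mult_ac)
  finally have "sqrt r \<le> 2 * C * ln r / sqrt (ln n)" using s by (simp add: pos_le_divide_eq)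
  hence "1 + 2 * C * ln r / sqrt (ln n) > sqrt r" by linarith
  thus ?thesis using assms(1) by (simp add: field_simps)
qed

theorem theorem2:
  fixes c\<^sub>0 :: real
  assumes "0 < c\<^sub>0" and "c\<^sub>0 < 1"
  shows "\<exists>c\<^sub>1 > 0. \<forall>(n :: nat) (r :: nat) (G :: nat pair_pre_digraph).
    n \<ge> 1 \<longrightarrow> r \<ge> 2 \<longrightarrow> regular_digraph r G \<longrightarrow> pverts G = {1..n} \<longrightarrow>
    (let Q = transition_mat n r G;
         P = (\<lambda>\<sigma>. permutation_mat n \<sigma> * Q);
         \<rho> = 1 / sqrt (real r);
         d = r ^ 2;
         \<epsilon> = c\<^sub>1 * ln (real d) / sqrt (ln (real n))
     in measure_pmf.prob (pmf_of_set {\<sigma>. \<sigma> permutes {1..n}})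
          {\<sigma>. cmod (nth_eigenvalue (P \<sigma>) 2) \<ge> (1 + \<epsilon>) * \<rho>} \<le> real n powr (- c\<^sub>0))"
proof -
  define a where "a = (1 - c\<^sub>0) / 8"
  have a: "0 < a" "a \<le> 1 / 8" "8 * a = 1 - c\<^sub>0" using assms by (auto simp: a_def)
  obtain L\<^sub>0 where L\<^sub>0: "\<And>L. L \<ge> L\<^sub>0 \<Longrightarrow> large_log a L"
    using eventually_large_log[OF a(1)] by (auto simp: eventually_at_top_linorder)
  \<comment> \<open>The first summand serves large \<open>n\<close>; the second puts the threshold
    above 1 when \<open>ln n < L\<^sub>0\<close>, for every \<open>r\<close>.\<close>
  define C where "C = exp (42 / a) + (exp L\<^sub>0)\<^sup>2"
  have C: "C \<ge> exp (42 / a)" "C > (exp L\<^sub>0)\<^sup>2" by (auto simp: C_def)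
  have C0: "C > 0" using C(1) exp_gt_zero[of "42 / a"] by linarith
  have main: "measure_pmf.prob (pmf_of_set {\<sigma>. \<sigma> permutes {1..n}})
      {\<sigma>. (1 + C * ln (real (r ^ 2)) / sqrt (ln (real n))) * (1 / sqrt (real r)) \<le>
        cmod (nth_eigenvalue (permutation_mat n \<sigma> * transition_mat n r G) 2)} \<le> real n powr (- c\<^sub>0)"
    (is "measure_pmf.prob _ ?A \<le> _")
    if n: "n \<ge> 1" and r: "r \<ge> 2" and G: "regular_digraph r G" "pverts G = {1..n}" for n r :: nat and G
  proof -
    let ?S = "{\<sigma>. \<sigma> permutes {1..n}}"
    have reg: "regular_graph {1..n} (parcs G) r"
      using regular_digraph_regular_graph[OF G(1)] G(2) n r by simp
    interpret regular_graph "{1..n}" "parcs G" r by (rule reg)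
    \<comment> \<open>A vertex has \<open>r\<close> distinct successors, so \<open>r \<ge> 2\<close>
      excludes \<open>n = 1\<close>, where there is no second eigenvalue.\<close>
    have rn: "r \<le> n" using r_le_n by simp
    hence n2: "n \<ge> 2" using r by linarith
    define \<theta> where "\<theta> = (1 + 2 * C * ln r / sqrt (ln n)) * (1 / sqrt r)"
    have \<theta>: "(1 + C * ln (real (r ^ 2)) / sqrt (ln (real n))) * (1 / sqrt (real r)) = \<theta>"
      using r by (simp add: \<theta>_def ln_realpow)
    have prob: "measure_pmf.prob (pmf_of_set ?S) ?A = card (?S \<inter> ?A) / fact n"
    proof -
      have "?S \<noteq> {}" "finite ?S" using permutes_id[of "{1..n}"] by (blast, simp add: finite_permutations)
      moreover have "card ?S = fact n" by (rule card_permutations) auto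
      ultimately show ?thesis using measure_pmf_of_set[of ?S ?A] by (simp only: of_nat_fact simp_thms not_False_eq_True)
    qed
    show ?thesis
    proof (cases "ln (real n) \<ge> L\<^sub>0")
      case True
      have "?S \<inter> ?A \<subseteq> {\<sigma>. \<sigma> permutes {1..n} \<and> (\<exists>\<mu>. eigen \<sigma> \<mu> \<and> \<theta> \<le> cmod \<mu>)}"
      proof
        fix \<sigma> assume "\<sigma> \<in> ?S \<inter> ?A"
        hence \<sigma>: "\<sigma> permutes {1..n}"
          and le: "\<theta> \<le> cmod (nth_eigenvalue (permutation_mat n \<sigma> * transition_mat n r G) 2)"
          unfolding \<theta> by auto
        show "\<sigma> \<in> {\<sigma>. \<sigma> permutes {1..n} \<and> (\<exists>\<mu>. eigen \<sigma> \<mu> \<and> \<theta> \<le> cmod \<mu>)}"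
          using second_eigenvalue_vector[OF reg \<sigma> n2] \<sigma> le unfolding eigen_def
          by (blast intro: order_trans)
      qed
      hence "card (?S \<inter> ?A) \<le> card {\<sigma>. \<sigma> permutes {1..n} \<and> (\<exists>\<mu>. eigen \<sigma> \<mu> \<and> \<theta> \<le> cmod \<mu>)}"
        by (intro card_mono finite_permuting)
      hence "card (?S \<inter> ?A) / fact n \<le>
          card {\<sigma>. \<sigma> permutes {1..n} \<and> (\<exists>\<mu>. eigen \<sigma> \<mu> \<and> \<theta> \<le> cmod \<mu>)} / fact n"
        by (simp add: divide_right_mono)
      also have "\<dots> \<le> exp (- c\<^sub>0 * ln (real n))"
        using tail_large[OF _ r _ a C(1) L\<^sub>0[OF True]] assms by (simp add: \<theta>_def)
      also have "\<dots> = real n powr (- c\<^sub>0)" using n by (simp add: powr_def)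
      finally show ?thesis unfolding prob .
    next
      case False
      hence "exp (ln (real n)) \<le> exp L\<^sub>0" by simp
      hence "real n \<le> exp L\<^sub>0" using n by simp
      hence "\<theta> > 1" unfolding \<theta>_def by (rule threshold_gt_1_small[OF r rn _ C(2)])
      have "?S \<inter> ?A = {}"
      proof -
        have "False" if "\<sigma> permutes {1..n}" "\<theta> \<le> cmod (nth_eigenvalue (permutation_mat n \<sigma> * transition_mat n r G) 2)" for \<sigma>
          using second_eigenvalue_le_1[OF reg that(1) n2] that(2) \<open>\<theta> > 1\<close> by linarith
        thus ?thesis unfolding \<theta> by blast
      qed
      thus ?thesis unfolding prob by simp
    qed
  qed
  show ?thesis
    unfolding Let_def by (intro exI[of _ C] conjI allI impI C0 main)
qed

end
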